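(* Let $(X_\sigma,f_\sigma)_{\sigma\in A}$ be a combinatorial Seshadri stratification on $X_P$, with associated triangulation $\mathcal T$ and, for a fixed linearization $>^t$ of the partial order on $A$, associated quasi-valuation $\nu$. Denote by $\Gamma=\{\nu(f)\mid f\in\mathbb K[\hat X_P]\setminus\{0\}\}\subseteq\mathbb Q^A$ the image of $\nu$. (i) $\Gamma$ is a fan of monoids, isomorphic to $S_{\mathcal T}$. In particular, $\Gamma$ depends, up to isomorphism, only on the triangulation $\mathcal T$ and is independent of the choice of the linearization $>^t$ of $A$. (ii) The associated graded algebra $\mathrm{gr}_\nu\mathbb K[\hat X_P]$ is isomorphic to the fan algebra $\mathbb K[\Gamma]$. In particular, the algebra $\mathrm{gr}_\nu\mathbb K[\hat X_P]$ depends only on the triangulation $\mathcal T$. (iii) The variety $X_0=\mathrm{Proj}(\mathrm{gr}_\nu\mathbb K[\hat X_P])$ is reduced. It is the irredundant union of the toric varieties $\mathrm{Proj}(\mathbb K[S_{\mathfrak C}])$, where $\mathfrak C$ runs over all maximal chains in $A$. The variety $X_0$ is equidimensional, i.e. all irreducible components of $X_0$ have the same dimension as $X_P$.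
   Context: Toric variety. $\mathbb K$ is an algebraically closed field of characteristic zero, $T\simeq(\mathbb K^* )^n$ is a torus with character lattice $M$, $M_{\mathbb R}=M\otimes_{\mathbb Z}\mathbb R$. $P\subseteq M_{\mathbb R}$ is a full dimensional normal lattice polytope, $\Lambda=P\cap M$, $V=\mathbb K^\Lambda$ with standard basis $\{e_\chi\}_{\chi\in\Lambda}$ and dual coordinates $x_\chi$. $X_P\subseteq\mathbb P(V)$ is the Zariski closure of the image of $T\to\mathbb P(V)$, $t\mapsto[\sum_{\chi\in\Lambda}\chi(t)e_\chi]$; $\hat X_P\subseteq V$ is its affine cone and $\mathbb K[\hat X_P]$ the coordinate ring of the cone (the homogeneous coordinate ring of $X_P$), graded by degree. $\hat T=\mathbb K^*\times T$, with character lattice $\hat M=\mathbb Z\oplus M$, acts on $V$ by $(c,t)\cdot e_\chi=c\chi(t)e_\chi$ and on functions by $(\hat t\cdot g)(x)=g(\hat t^{-1}x)$; so $x_\chi|_{\hat X_P}$ has weight $(-1,-\chi)$. A (nonzero) $\hat T$-eigenfunction $g$ is homogeneous and its weight $\lambda_g$ has first entry $-\deg g$. $M_{\mathbb R}$ is identified with $\{1\}\times M_{\mathbb R}\subset\mathbb R\oplus M_{\mathbb R}$. Stratification and triangulation. $A$ is the set of (nonempty) faces of $P$, including $P$, ordered by inclusion; $\sigma^o$ is the relative interior of $\sigma$; $X_\sigma$ is the Zariski closure of the $T$-orbit $\{[\sum_{\chi\in\Lambda\cap\sigma}\chi(t)e_\chi]\mid t\in T\}$. A combinatorial Seshadri stratification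 on $X_P$ is a collection $(X_\sigma,f_\sigma)_{\sigma\in A}$ where each $f_\sigma\in\mathbb K[\hat X_P]\setminus\{0\}$ is a $\hat T$-eigenfunction with $\deg f_\sigma\ge1$ whose $\hat T$-weight $\mu_\sigma$ satisfies $\frac{-\mu_\sigma}{\deg f_\sigma}\in\sigma^o$. A flag is a totally ordered subset $C\subseteq A$; $\mathcal F(A)$ is the set of flags. The associated triangulation of $P$ is $\mathcal T=(\Delta_C)_{C\in\mathcal F(A)}$, $\Delta_C$ the convex hull of the points $\frac{-\mu_\sigma}{\deg f_\sigma}$, $\sigma\in C$. Quasi-valuation. For a maximal chain $\mathfrak C=\{\sigma_r>\dots>\sigma_0\}$ in $A$ the weights $\mu_{\sigma_r},\dots,\mu_{\sigma_0}$ form a $\mathbb Q$-basis of $\hat M_{\mathbb Q}$. $\mathbb Q^{\mathfrak C}$ is the subspace of $\mathbb Q^A$ (standard basis $e_\sigma$, $\sigma\in A$) spanned by $e_\sigma$, $\sigma\in\mathfrak C$. For a $\hat T$-eigenfunction $g$ of weight $\lambda_g=\sum_i a_i\mu_{\sigma_i}$ put $\nu_{\mathfrak C}(g)=\sum_i a_ie_{\sigma_i}$; for general $g\ne0$ take the minimum of the values on the $\hat T$-weight components of $g$. The minimum is with respect to the lexicographic order on $\mathbb Q^A$ induced by a fixed total order $>^t$ on $A$ refining the partial order (the coordinate at the $>^t$-largest element is compared first). The quasi-valuation is $\nu(g)=\min\{\nu_{\mathfrak C}(g)\mid\mathfrak C\text{ a maximal chain in }A\}$. It filters $\mathbb K[\hat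 X_P]$ by the ideals $\mathbb K[\hat X_P]_{\ge\underline a}=\{g\mid g=0\text{ or }\nu(g)\ge^t\underline a\}$ (similarly $>\underline a$), and $\mathrm{gr}_\nu\mathbb K[\hat X_P]=\bigoplus_{\underline a\in\Gamma}\mathbb K[\hat X_P]_{\ge\underline a}/\mathbb K[\hat X_P]_{>\underline a}$ is the associated graded algebra, where the summand for $\underline a$ has degree $\sum_\sigma a_\sigma\deg f_\sigma$. Fans of monoids. For a polytope $Q\subseteq M_{\mathbb R}$ let $K(Q)=\{(c,cp)\mid c\in\mathbb R_{\ge0},p\in Q\}$ (and $\{0\}$ for the empty flag). $S\subseteq\hat M$ is the submonoid generated by $(1,\chi)$, $\chi\in\Lambda$; equivalently $S=K(P)\cap\hat M$. For a flag $C$ put $S_C=S\cap K(\Delta_C)$; $S_{\mathcal T}$ is the fan of monoids $\bigcup_CS_C$, where addition of two elements is defined only if they lie in a common $S_C$. $\Gamma_C=\{\underline a\in\Gamma\mid\mathrm{supp}\,\underline a\subseteq C\}$, where $\mathrm{supp}\,\underline a=\{\sigma\mid a_\sigma\ne0\}$; $\Gamma$ being a fan of monoids means that $\Gamma=\bigcup_C\Gamma_C$ where each $\Gamma_C$ is a monoid under the addition of $\mathbb Q^A$, $\Gamma_C\subseteq\Gamma_{C'}$ iff $C\subseteq C'$, and $\Gamma_C\cap\Gamma_{C'}=\Gamma_{C\cap C'}$. An isomorphism $\Gamma\simeq S_{\mathcal T}$ is a bijection restricting to monoid isomorphisms $\Gamma_C\simeq S_C$ for all flags $C$. Fan algebra.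 $\mathbb K[\Gamma]=\mathbb K[y_{\underline a}\mid\underline a\in\Gamma]/I(\Gamma)$, $I(\Gamma)$ being generated by $y_{\underline a}y_{\underline b}-y_{\underline a+\underline b}$ if there is a chain $C\subseteq A$ containing $\mathrm{supp}\,\underline a$ and $\mathrm{supp}\,\underline b$ (with $\underline a,\underline b\in\Gamma\subseteq\mathbb Q_{\ge0}^A$), and by $y_{\underline a}y_{\underline b}$ if there is no such chain. It is graded by $\deg y_{\underline a}=\sum_\sigma a_\sigma\deg f_\sigma$. $\mathbb K[S_{\mathfrak C}]$ is the semigroup algebra, graded by the first coordinate of $\hat M=\mathbb Z\oplus M$.
   Formalization: The fan algebra K[Γ] is taken with the additional relation y_0 = 1; with the listed generators of I(Γ) alone it would have an extra direct factor K (y_0 a nontrivial idempotent), and the isomorphism with the associated graded algebra in (ii) would fail. *)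

theory Defs
  imports
    "HOL-Analysis.Analysis"
    "HOL-Computational_Algebra.Polynomial"
    "HOL-Library.Poly_Mapping"
    "HOL-Library.Extended_Nat"
    "HOL-Algebra.QuotRing"
    "HOL-Algebra.Module"
begin

section \<open>Graded algebras and Proj\<close>

record ('k, 'a) graded_algebra = "('k, 'a) module" +
  homog :: "nat \<Rightarrow> 'a set"

definition graded_iso ::
    "('k, 'a) graded_algebra \<Rightarrow> ('k, 'b) graded_algebra \<Rightarrow> ('a \<Rightarrow> 'b) \<Rightarrow> bool" where
  "graded_iso R R' h \<longleftrightarrow> h \<in> ring_iso R R' \<and>
     (\<forall>c. \<forall>x\<in>carrier R. h (c \<odot>\<^bsub>R\<^esub> x) = c \<odot>\<^bsub>R'\<^esub> h x) \<and>
     (\<forall>d. h ` homog R d = homog R' d)"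

definition graded_isomorphic ::
    "('k, 'a) graded_algebra \<Rightarrow> ('k, 'b) graded_algebra \<Rightarrow> bool" where
  "graded_isomorphic R R' \<longleftrightarrow> (\<exists>h. graded_iso R R' h)"

definition homog_elems :: "('k, 'a) graded_algebra \<Rightarrow> 'a set" where
  "homog_elems R = (\<Union>d. homog R d)"

definition proj_points :: "('k, 'a) graded_algebra \<Rightarrow> 'a set set" where
  "proj_points R = {p. primeideal p R \<and> p = Idl\<^bsub>R\<^esub> (p \<inter> homog_elems R) \<and>
     \<not> (\<Union>d\<in>{0<..}. homog R d) \<subseteq> p}"

text \<open>The base of the Zariski topology contains the whole space, as the case \<open>a = 1\<close>.\<close>

definition proj_top :: "('k, 'a) graded_algebra \<Rightarrow> 'a set topology" where
  "proj_top R = topology_generated_by {{p \<in> proj_points R. a \<notin> p} | a. a \<in> homog_elems R}"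

text \<open>The fraction \<open>a/f\<close> in the degree zero part of the homogeneous localization at \<open>p\<close>,
  as an equivalence class of pairs; \<open>a\<close> and \<open>f\<close> are meant to be homogeneous of the same degree
  with \<open>f \<notin> p\<close>.\<close>

definition hfrac ::
    "('k, 'a) graded_algebra \<Rightarrow> 'a set \<Rightarrow> 'a \<Rightarrow> 'a \<Rightarrow> ('a \<times> 'a) set" where
  "hfrac R p a f = {(b, g). (\<exists>d. b \<in> homog R d \<and> g \<in> homog R d) \<and> g \<notin> p \<and>
     (\<exists>h \<in> homog_elems R - p. h \<otimes>\<^bsub>R\<^esub> (a \<otimes>\<^bsub>R\<^esub> g) = h \<otimes>\<^bsub>R\<^esub> (b \<otimes>\<^bsub>R\<^esub> f))}"

definition stalk_add ::
    "('k, 'a) graded_algebra \<Rightarrow> 'a set \<Rightarrow> ('a \<times> 'a) set \<Rightarrow> ('a \<times> 'a) set \<Rightarrow> ('a \<times> 'a) set" where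
  "stalk_add R p x y =
     (\<Union>(a, f)\<in>x. \<Union>(b, g)\<in>y. hfrac R p (a \<otimes>\<^bsub>R\<^esub> g \<oplus>\<^bsub>R\<^esub> b \<otimes>\<^bsub>R\<^esub> f) (f \<otimes>\<^bsub>R\<^esub> g))"

definition stalk_mult ::
    "('k, 'a) graded_algebra \<Rightarrow> 'a set \<Rightarrow> ('a \<times> 'a) set \<Rightarrow> ('a \<times> 'a) set \<Rightarrow> ('a \<times> 'a) set" where
  "stalk_mult R p x y = (\<Union>(a, f)\<in>x. \<Union>(b, g)\<in>y. hfrac R p (a \<otimes>\<^bsub>R\<^esub> b) (f \<otimes>\<^bsub>R\<^esub> g))"

definition stalk_smult ::
    "('k, 'a) graded_algebra \<Rightarrow> 'a set \<Rightarrow> 'k \<Rightarrow> ('a \<times> 'a) set \<Rightarrow> ('a \<times> 'a) set" where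
  "stalk_smult R p c x = (\<Union>(a, f)\<in>x. hfrac R p (c \<odot>\<^bsub>R\<^esub> a) f)"

text \<open>Sections of the structure sheaf over \<open>U\<close>: functions into the disjoint union of the stalks
  that are locally given by a single fraction.\<close>

definition proj_sections ::
    "('k, 'a) graded_algebra \<Rightarrow> 'a set set \<Rightarrow> ('k, 'a set \<Rightarrow> ('a \<times> 'a) set) module" where
  "proj_sections R U =
    \<lparr> carrier = {s \<in> extensional U. \<forall>p\<in>U. \<exists>W. openin (proj_top R) W \<and> p \<in> W \<and> W \<subseteq> U \<and>
        (\<exists>d. \<exists>a\<in>homog R d. \<exists>f\<in>homog R d. \<forall>q\<in>W. f \<notin> q \<and> s q = hfrac R q a f)},
      mult = (\<lambda>s t. \<lambda>p\<in>U. stalk_mult R p (s p) (t p)),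
      one = (\<lambda>p\<in>U. hfrac R p \<one>\<^bsub>R\<^esub> \<one>\<^bsub>R\<^esub>),
      zero = (\<lambda>p\<in>U. hfrac R p \<zero>\<^bsub>R\<^esub> \<one>\<^bsub>R\<^esub>),
      add = (\<lambda>s t. \<lambda>p\<in>U. stalk_add R p (s p) (t p)),
      smult = (\<lambda>c s. \<lambda>p\<in>U. stalk_smult R p c (s p)) \<rparr>"

text \<open>A space with a sheaf of \<open>k\<close>-algebras of functions, so that restriction of sections is
  \<^term>\<open>restrict\<close>.\<close>

record ('k, 'p, 's) kspace =
  space_top :: "'p topology"
  sections :: "'p set \<Rightarrow> ('k, 'p \<Rightarrow> 's) module"

definition Proj :: "('k, 'a) graded_algebra \<Rightarrow> ('k, 'a set, ('a \<times> 'a) set) kspace" where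
  "Proj R = \<lparr> space_top = proj_top R, sections = proj_sections R \<rparr>"

abbreviation points :: "('k, 'p, 's) kspace \<Rightarrow> 'p set" where
  "points X \<equiv> topspace (space_top X)"

definition reduced_space :: "('k, 'p, 's) kspace \<Rightarrow> bool" where
  "reduced_space X \<longleftrightarrow> (\<forall>U. openin (space_top X) U \<longrightarrow>
     (\<forall>s \<in> carrier (sections X U). \<forall>m::nat.
        s [^]\<^bsub>sections X U\<^esub> m = \<zero>\<^bsub>sections X U\<^esub> \<longrightarrow> s = \<zero>\<^bsub>sections X U\<^esub>))"

definition integral_space :: "('k, 'p, 's) kspace \<Rightarrow> bool" where
  "integral_space X \<longleftrightarrow> points X \<noteq> {} \<and>
     (\<forall>U. openin (space_top X) U \<and> U \<noteq> {} \<longrightarrow> domain (sections X U))"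

text \<open>The homomorphisms induced on stalks are surjective at points of a closed immersion of
  locally ringed spaces, hence automatically local.\<close>

definition closed_immersion ::
    "('k, 'p, 's) kspace \<Rightarrow> ('k, 'q, 't) kspace \<Rightarrow> ('p \<Rightarrow> 'q) \<Rightarrow> bool" where
  "closed_immersion Z X j \<longleftrightarrow>
     embedding_map (space_top Z) (space_top X) j \<and> closedin (space_top X) (j ` points Z) \<and>
     (\<exists>\<theta>. let pre = (\<lambda>U. {z \<in> points Z. j z \<in> U}) in
        (\<forall>U. openin (space_top X) U \<longrightarrow>
           \<theta> U \<in> ring_hom (sections X U) (sections Z (pre U)) \<and>
           (\<forall>c. \<forall>s\<in>carrier (sections X U).
              \<theta> U (c \<odot>\<^bsub>sections X U\<^esub> s) = c \<odot>\<^bsub>sections Z (pre U)\<^esub> \<theta> U s) \<and>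
           (\<forall>W. openin (space_top X) W \<and> W \<subseteq> U \<longrightarrow>
              (\<forall>s\<in>carrier (sections X U). \<theta> W (restrict s W) = restrict (\<theta> U s) (pre W))) \<and>
           (\<forall>t\<in>carrier (sections Z (pre U)). \<forall>z\<in>pre U. \<exists>W. openin (space_top X) W \<and>
              j z \<in> W \<and> W \<subseteq> U \<and>
              (\<exists>s\<in>carrier (sections X W). \<theta> W s = restrict t (pre W)))))"

section \<open>Krull dimension\<close>

definition irreducible_in :: "'p topology \<Rightarrow> 'p set \<Rightarrow> bool" where
  "irreducible_in X Z \<longleftrightarrow> Z \<subseteq> topspace X \<and> Z \<noteq> {} \<and>
     (\<forall>F G. closedin X F \<and> closedin X G \<and> Z \<subseteq> F \<union> G \<longrightarrow> Z \<subseteq> F \<or> Z \<subseteq> G)"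

definition irreducible_components :: "'p topology \<Rightarrow> 'p set set" where
  "irreducible_components X =
     {Z. irreducible_in X Z \<and> (\<forall>Z'. irreducible_in X Z' \<and> Z \<subseteq> Z' \<longrightarrow> Z' = Z)}"

definition krull_dim :: "'p topology \<Rightarrow> enat" where
  "krull_dim X = Sup {enat m | m. \<exists>Z :: nat \<Rightarrow> 'p set.
     (\<forall>i\<le>m. closedin X (Z i) \<and> irreducible_in X (Z i)) \<and> (\<forall>i<m. Z i \<subset> Z (Suc i))}"

section \<open>Polynomials\<close>

text \<open>A polynomial in variables \<open>'i\<close> is a finitely supported function on the monomials
  \<open>'i \<Rightarrow>\<^sub>0 nat\<close>; multiplication is convolution.\<close>

type_synonym ('i, 'k) mpoly = "('i \<Rightarrow>\<^sub>0 nat) \<Rightarrow>\<^sub>0 'k"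

definition polys_in :: "'i set \<Rightarrow> ('i, 'k::field) mpoly set" where
  "polys_in I = {p. \<forall>m\<in>Poly_Mapping.keys p. Poly_Mapping.keys m \<subseteq> I}"

definition poly_ring :: "'i set \<Rightarrow> ('i, 'k::field) mpoly ring" where
  "poly_ring I = \<lparr> carrier = polys_in I, mult = (*), one = 1, zero = 0, add = (+) \<rparr>"

definition homog_polys :: "'i set \<Rightarrow> nat \<Rightarrow> ('i, 'k::field) mpoly set" where
  "homog_polys I d = {p \<in> polys_in I. \<forall>m\<in>Poly_Mapping.keys p.
     (\<Sum>i\<in>Poly_Mapping.keys m. Poly_Mapping.lookup m i) = d}"

definition poly_eval :: "('i, 'k::field) mpoly \<Rightarrow> ('i \<Rightarrow> 'k) \<Rightarrow> 'k" where
  "poly_eval p v = (\<Sum>m\<in>Poly_Mapping.keys p. Poly_Mapping.lookup p m *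
     (\<Prod>i\<in>Poly_Mapping.keys m. v i ^ Poly_Mapping.lookup m i))"

section \<open>Lattice polytopes\<close>

type_synonym 'n lat = "int ^ 'n"
type_synonym 'n hlat = "int \<times> (int ^ 'n)"
type_synonym 'n face = "(real ^ 'n) set"

definition real_vec :: "'n::finite lat \<Rightarrow> real ^ 'n" where
  "real_vec \<xi> = (\<chi> i. real_of_int (\<xi> $ i))"

definition real_hvec :: "'n::finite hlat \<Rightarrow> real \<times> (real ^ 'n)" where
  "real_hvec s = (real_of_int (fst s), real_vec (snd s))"

definition lattice_points :: "(real ^ 'n::finite) set \<Rightarrow> 'n lat set" where
  "lattice_points Q = {\<xi>. real_vec \<xi> \<in> Q}"

definition dilate :: "nat \<Rightarrow> (real ^ 'n::finite) set \<Rightarrow> (real ^ 'n) set" where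
  "dilate k Q = (\<lambda>p. real k *\<^sub>R p) ` Q"

definition lattice_polytope :: "(real ^ 'n::finite) set \<Rightarrow> bool" where
  "lattice_polytope P \<longleftrightarrow> (\<exists>F :: 'n lat set. finite F \<and> P = convex hull (real_vec ` F))"

definition normal_lattice_polytope :: "(real ^ 'n::finite) set \<Rightarrow> bool" where
  "normal_lattice_polytope P \<longleftrightarrow> lattice_polytope P \<and>
     (\<forall>k l. {a + b | a b. a \<in> lattice_points (dilate k P) \<and> b \<in> lattice_points (dilate l P)} =
        lattice_points (dilate (k + l) P))"

definition faces :: "(real ^ 'n::finite) set \<Rightarrow> 'n face set" where
  "faces P = {\<sigma>. \<sigma> face_of P \<and> \<sigma> \<noteq> {}}"

abbreviation flag :: "(real ^ 'n::finite) set \<Rightarrow> 'n face set \<Rightarrow> bool" where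
  "flag P C \<equiv> subset.chain (faces P) C"

abbreviation max_chain :: "(real ^ 'n::finite) set \<Rightarrow> 'n face set \<Rightarrow> bool" where
  "max_chain P C \<equiv> subset.maxchain (faces P) C"

section \<open>The toric variety and its homogeneous coordinate ring\<close>

text \<open>A vector of \<open>V\<close> is its family of coordinates, extended by zero outside \<open>\<Lambda>\<close>.\<close>

type_synonym ('n, 'k) lvec = "int ^ 'n \<Rightarrow> 'k"
type_synonym ('n, 'k) lfun = "(int ^ 'n \<Rightarrow> 'k) \<Rightarrow> 'k"

definition vspace :: "(real ^ 'n::finite) set \<Rightarrow> ('n, 'k::field) lvec set" where
  "vspace P = {v. \<forall>\<xi>. \<xi> \<notin> lattice_points P \<longrightarrow> v \<xi> = 0}"

definition torus :: "('k::field ^ 'n::finite) set" where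
  "torus = {t. \<forall>i. t $ i \<noteq> 0}"

definition char_val :: "'n::finite lat \<Rightarrow> 'k::field ^ 'n \<Rightarrow> 'k" where
  "char_val \<xi> t = (\<Prod>i\<in>UNIV. (t $ i) powi (\<xi> $ i))"

definition proj_point :: "('n::finite, 'k::field) lvec \<Rightarrow> ('n, 'k) lvec set" where
  "proj_point v = {\<lambda>\<xi>. c * v \<xi> | c. c \<noteq> 0}"

definition proj_space :: "(real ^ 'n::finite) set \<Rightarrow> ('n, 'k::field) lvec set set" where
  "proj_space P = proj_point ` {v \<in> vspace P. v \<noteq> (\<lambda>_. 0)}"

definition proj_space_top :: "(real ^ 'n::finite) set \<Rightarrow> ('n, 'k::field) lvec set topology" where
  "proj_space_top P = topology_generated_by
     {{x \<in> proj_space P. \<exists>v\<in>x. poly_eval p v \<noteq> 0} | p d. p \<in> homog_polys (lattice_points P) d}"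

definition torus_orbit ::
    "(real ^ 'n::finite) set \<Rightarrow> 'n face \<Rightarrow> ('n, 'k::field) lvec set set" where
  "torus_orbit P \<sigma> =
     {proj_point (\<lambda>\<xi>. if \<xi> \<in> lattice_points P \<inter> lattice_points \<sigma> then char_val \<xi> t else 0)
       | t. t \<in> torus}"

definition stratum ::
    "(real ^ 'n::finite) set \<Rightarrow> 'n face \<Rightarrow> ('n, 'k::field) lvec set set" where
  "stratum P \<sigma> = proj_space_top P closure_of torus_orbit P \<sigma>"

definition toric_variety :: "(real ^ 'n::finite) set \<Rightarrow> ('n, 'k::field) lvec set set" where
  "toric_variety P = stratum P P"

definition affine_cone :: "(real ^ 'n::finite) set \<Rightarrow> ('n, 'k::field) lvec set" where
  "affine_cone P = insert (\<lambda>_. 0) (\<Union>(toric_variety P))"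

text \<open>Elements of the coordinate ring are polynomial functions on the cone, extended by zero to
  all vectors; \<open>1\<close> is therefore the indicator function of the cone.\<close>

definition poly_fun ::
    "(real ^ 'n::finite) set \<Rightarrow> ('n lat, 'k::field) mpoly \<Rightarrow> ('n, 'k) lfun" where
  "poly_fun P p = (\<lambda>v. if v \<in> affine_cone P then poly_eval p v else 0)"

definition coord_ring ::
    "(real ^ 'n::finite) set \<Rightarrow> ('k::field, ('n, 'k) lfun) graded_algebra" where
  "coord_ring P =
    \<lparr> carrier = poly_fun P ` polys_in (lattice_points P),
      mult = (\<lambda>g h v. g v * h v),
      one = poly_fun P 1,
      zero = (\<lambda>_. 0),
      add = (\<lambda>g h v. g v + h v),
      smult = (\<lambda>c g v. c * g v),
      homog = (\<lambda>d. poly_fun P ` homog_polys (lattice_points P) d) \<rparr>"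

definition fun_degree :: "(real ^ 'n::finite) set \<Rightarrow> ('n, 'k::field) lfun \<Rightarrow> nat" where
  "fun_degree P g = (THE d. g \<in> homog (coord_ring P) d)"

definition torus_act :: "'k::field \<times> ('k ^ 'n::finite) \<Rightarrow> ('n, 'k) lvec \<Rightarrow> ('n, 'k) lvec" where
  "torus_act = (\<lambda>(c, t) v \<xi>. c * char_val \<xi> t * v \<xi>)"

definition torus_inv :: "'k::field \<times> ('k ^ 'n::finite) \<Rightarrow> 'k \<times> ('k ^ 'n)" where
  "torus_inv = (\<lambda>(c, t). (inverse c, \<chi> i. inverse (t $ i)))"

definition hchar_val :: "'n::finite hlat \<Rightarrow> 'k::field \<times> ('k ^ 'n) \<Rightarrow> 'k" where
  "hchar_val s = (\<lambda>(c, t). c powi fst s * char_val (snd s) t)"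

definition is_eigenfunction ::
    "(real ^ 'n::finite) set \<Rightarrow> ('n, 'k::field) lfun \<Rightarrow> 'n hlat \<Rightarrow> bool" where
  "is_eigenfunction P g s \<longleftrightarrow> g \<in> carrier (coord_ring P) \<and> g \<noteq> \<zero>\<^bsub>coord_ring P\<^esub> \<and>
     (\<forall>u \<in> (UNIV - {0}) \<times> torus. \<forall>v \<in> affine_cone P.
        g (torus_act (torus_inv u) v) = hchar_val s u * g v)"

definition weight :: "(real ^ 'n::finite) set \<Rightarrow> ('n, 'k::field) lfun \<Rightarrow> 'n hlat" where
  "weight P g = (THE s. is_eigenfunction P g s)"

text \<open>\<open>D s\<close> is the component of \<open>g\<close> of weight \<open>s\<close>.\<close>

definition weight_decomposition ::
    "(real ^ 'n::finite) set \<Rightarrow> ('n, 'k::field) lfun \<Rightarrow> ('n hlat \<Rightarrow> ('n, 'k) lfun) \<Rightarrow> bool" where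
  "weight_decomposition P g D \<longleftrightarrow> finite {s. D s \<noteq> (\<lambda>_. 0)} \<and>
     (\<forall>s. D s \<noteq> (\<lambda>_. 0) \<longrightarrow> is_eigenfunction P (D s) s) \<and>
     g = (\<lambda>v. \<Sum>s | D s \<noteq> (\<lambda>_. 0). D s v)"

definition weight_components ::
    "(real ^ 'n::finite) set \<Rightarrow> ('n, 'k::field) lfun \<Rightarrow> ('n, 'k) lfun set" where
  "weight_components P g =
     {D s | D s. weight_decomposition P g D \<and> D s \<noteq> (\<lambda>_. 0)}"

section \<open>Combinatorial Seshadri stratifications\<close>

text \<open>The point \<open>- \<mu> / deg f\<close> of \<open>\<real> \<oplus> M\<^sub>\<real>\<close>.\<close>

definition weight_point ::
    "(real ^ 'n::finite) set \<Rightarrow> ('n, 'k::field) lfun \<Rightarrow> real \<times> (real ^ 'n)" where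
  "weight_point P g = (1 / real (fun_degree P g)) *\<^sub>R (- real_hvec (weight P g))"

definition seshadri_stratification ::
    "(real ^ 'n::finite) set \<Rightarrow> ('n face \<Rightarrow> ('n, 'k::field) lvec set set) \<Rightarrow>
      ('n face \<Rightarrow> ('n, 'k) lfun) \<Rightarrow> bool" where
  "seshadri_stratification P X f \<longleftrightarrow> (\<forall>\<sigma>\<in>faces P. X \<sigma> = stratum P \<sigma> \<and>
     (\<exists>s. is_eigenfunction P (f \<sigma>) s) \<and> fun_degree P (f \<sigma>) \<ge> 1 \<and>
     weight_point P (f \<sigma>) \<in> {1} \<times> rel_interior \<sigma>)"

definition linearization :: "(real ^ 'n::finite) set \<Rightarrow> ('n face \<times> 'n face) set \<Rightarrow> bool" where
  "linearization P r \<longleftrightarrow> linear_order_on (faces P) r \<and>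
     (\<forall>\<sigma>\<in>faces P. \<forall>\<tau>\<in>faces P. \<sigma> \<subseteq> \<tau> \<longrightarrow> (\<sigma>, \<tau>) \<in> r)"

text \<open>\<open>M\<^sub>\<real>\<close> is identified with \<open>{1} \<times> M\<^sub>\<real>\<close> by the second projection.\<close>

definition flag_simplex ::
    "(real ^ 'n::finite) set \<Rightarrow> ('n face \<Rightarrow> ('n, 'k::field) lfun) \<Rightarrow> 'n face set \<Rightarrow>
      (real ^ 'n) set" where
  "flag_simplex P f C = convex hull ((\<lambda>\<sigma>. snd (weight_point P (f \<sigma>))) ` C)"

definition same_triangulation ::
    "(real ^ 'n::finite) set \<Rightarrow> ('n face \<Rightarrow> ('n, 'k::field) lfun) \<Rightarrow>
      ('n face \<Rightarrow> ('n, 'k) lfun) \<Rightarrow> bool" where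
  "same_triangulation P f f' \<longleftrightarrow> (\<forall>C. flag P C \<longrightarrow> flag_simplex P f C = flag_simplex P f' C)"

section \<open>The quasi-valuation\<close>

text \<open>Vectors of \<open>\<rat>\<^sup>A\<close> are rational functions on all sets that vanish outside \<open>A\<close>.\<close>

type_synonym 'n qvec = "(real ^ 'n) set \<Rightarrow> rat"

definition qsupp :: "'n::finite qvec \<Rightarrow> 'n face set" where
  "qsupp a = {\<sigma>. a \<sigma> \<noteq> 0}"

definition qadd :: "'n::finite qvec \<Rightarrow> 'n qvec \<Rightarrow> 'n qvec" where
  "qadd a b = (\<lambda>\<sigma>. a \<sigma> + b \<sigma>)"

definition lex_less ::
    "(real ^ 'n::finite) set \<Rightarrow> ('n face \<times> 'n face) set \<Rightarrow> 'n qvec \<Rightarrow> 'n qvec \<Rightarrow> bool" where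
  "lex_less P r a b \<longleftrightarrow> (\<exists>\<sigma>\<in>faces P. a \<sigma> < b \<sigma> \<and>
     (\<forall>\<tau>\<in>faces P. (\<sigma>, \<tau>) \<in> r \<and> \<tau> \<noteq> \<sigma> \<longrightarrow> a \<tau> = b \<tau>))"

definition lex_le ::
    "(real ^ 'n::finite) set \<Rightarrow> ('n face \<times> 'n face) set \<Rightarrow> 'n qvec \<Rightarrow> 'n qvec \<Rightarrow> bool" where
  "lex_le P r a b \<longleftrightarrow> lex_less P r a b \<or> a = b"

definition lex_min ::
    "(real ^ 'n::finite) set \<Rightarrow> ('n face \<times> 'n face) set \<Rightarrow> 'n qvec set \<Rightarrow> 'n qvec" where
  "lex_min P r B = (THE a. a \<in> B \<and> (\<forall>b\<in>B. lex_le P r a b))"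

text \<open>The coefficients of the weight of \<open>g\<close> with respect to the weights of the \<open>f \<sigma>\<close>,
  \<open>\<sigma> \<in> C\<close>.\<close>

definition nu_eigen ::
    "(real ^ 'n::finite) set \<Rightarrow> ('n face \<Rightarrow> ('n, 'k::field) lfun) \<Rightarrow> 'n face set \<Rightarrow>
      ('n, 'k) lfun \<Rightarrow> 'n qvec" where
  "nu_eigen P f C g = (THE a. qsupp a \<subseteq> C \<and>
     of_int (fst (weight P g)) = (\<Sum>\<sigma>\<in>C. a \<sigma> * of_int (fst (weight P (f \<sigma>)))) \<and>
     (\<forall>i. of_int (snd (weight P g) $ i) = (\<Sum>\<sigma>\<in>C. a \<sigma> * of_int (snd (weight P (f \<sigma>)) $ i))))"

definition nu_chain ::
    "(real ^ 'n::finite) set \<Rightarrow> ('n face \<Rightarrow> ('n, 'k::field) lfun) \<Rightarrow> ('n face \<times> 'n face) set \<Rightarrow>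
      'n face set \<Rightarrow> ('n, 'k) lfun \<Rightarrow> 'n qvec" where
  "nu_chain P f r C g = lex_min P r (nu_eigen P f C ` weight_components P g)"

definition nu ::
    "(real ^ 'n::finite) set \<Rightarrow> ('n face \<Rightarrow> ('n, 'k::field) lfun) \<Rightarrow> ('n face \<times> 'n face) set \<Rightarrow>
      ('n, 'k) lfun \<Rightarrow> 'n qvec" where
  "nu P f r g = lex_min P r {nu_chain P f r C g | C. max_chain P C}"

definition Gam ::
    "(real ^ 'n::finite) set \<Rightarrow> ('n face \<Rightarrow> ('n, 'k::field) lfun) \<Rightarrow> ('n face \<times> 'n face) set \<Rightarrow>
      'n qvec set" where
  "Gam P f r = nu P f r ` (carrier (coord_ring P) - {\<zero>\<^bsub>coord_ring P\<^esub>})"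

definition filt_ge ::
    "(real ^ 'n::finite) set \<Rightarrow> ('n face \<Rightarrow> ('n, 'k::field) lfun) \<Rightarrow> ('n face \<times> 'n face) set \<Rightarrow>
      'n qvec \<Rightarrow> ('n, 'k) lfun set" where
  "filt_ge P f r a =
     {g \<in> carrier (coord_ring P). g = \<zero>\<^bsub>coord_ring P\<^esub> \<or> lex_le P r a (nu P f r g)}"

definition filt_gt ::
    "(real ^ 'n::finite) set \<Rightarrow> ('n face \<Rightarrow> ('n, 'k::field) lfun) \<Rightarrow> ('n face \<times> 'n face) set \<Rightarrow>
      'n qvec \<Rightarrow> ('n, 'k) lfun set" where
  "filt_gt P f r a =
     {g \<in> carrier (coord_ring P). g = \<zero>\<^bsub>coord_ring P\<^esub> \<or> lex_less P r a (nu P f r g)}"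

definition qdegree ::
    "(real ^ 'n::finite) set \<Rightarrow> ('n face \<Rightarrow> ('n, 'k::field) lfun) \<Rightarrow> 'n qvec \<Rightarrow> rat" where
  "qdegree P f a = (\<Sum>\<sigma>\<in>faces P. a \<sigma> * of_nat (fun_degree P (f \<sigma>)))"

text \<open>An element of the associated graded algebra is a finitely supported family of cosets
  \<open>u a \<in> R\<^sub>\<ge>\<^sub>a / R\<^sub>>\<^sub>a\<close>, indexed by \<open>a \<in> \<Gamma>\<close>. The operations are computed on representatives.
  The summand with index \<open>a + b \<notin> \<Gamma>\<close> is zero.\<close>

definition gr_algebra ::
    "(real ^ 'n::finite) set \<Rightarrow> ('n face \<Rightarrow> ('n, 'k::field) lfun) \<Rightarrow> ('n face \<times> 'n face) set \<Rightarrow>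
      ('k, 'n qvec \<Rightarrow> ('n, 'k) lfun set) graded_algebra" where
  "gr_algebra P f r =
    (let R = coord_ring P; G = Gam P f r; I = filt_gt P f r;
         rep = (\<lambda>u a. SOME g. g \<in> u a);
         supp = (\<lambda>u. {a \<in> G. u a \<noteq> I a});
         car = {u \<in> (\<Pi>\<^sub>E a\<in>G. {I a +>\<^bsub>R\<^esub> g | g. g \<in> filt_ge P f r a}). finite (supp u)}
     in \<lparr> carrier = car,
          mult = (\<lambda>u v. \<lambda>c\<in>G. I c +>\<^bsub>R\<^esub>
            (\<Oplus>\<^bsub>R\<^esub>ab\<in>{ab \<in> supp u \<times> supp v. qadd (fst ab) (snd ab) = c}.
               rep u (fst ab) \<otimes>\<^bsub>R\<^esub> rep v (snd ab))),
          one = (\<lambda>c\<in>G. if c = (\<lambda>_. 0) then I c +>\<^bsub>R\<^esub> \<one>\<^bsub>R\<^esub> else I c),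
          zero = (\<lambda>c\<in>G. I c),
          add = (\<lambda>u v. \<lambda>c\<in>G. I c +>\<^bsub>R\<^esub> (rep u c \<oplus>\<^bsub>R\<^esub> rep v c)),
          smult = (\<lambda>k u. \<lambda>c\<in>G. I c +>\<^bsub>R\<^esub> (k \<odot>\<^bsub>R\<^esub> rep u c)),
          homog = (\<lambda>d. {u \<in> car. \<forall>a\<in>supp u. qdegree P f a = of_nat d}) \<rparr>)"

section \<open>Fans of monoids and their algebras\<close>

definition sub_fan :: "'n::finite qvec set \<Rightarrow> 'n face set \<Rightarrow> 'n qvec set" where
  "sub_fan G C = {a \<in> G. qsupp a \<subseteq> C}"

definition fan_of_monoids :: "(real ^ 'n::finite) set \<Rightarrow> 'n qvec set \<Rightarrow> bool" where
  "fan_of_monoids P G \<longleftrightarrow> G = (\<Union>C\<in>{C. flag P C}. sub_fan G C) \<and>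
     (\<forall>C. flag P C \<longrightarrow> (\<lambda>_. 0) \<in> sub_fan G C \<and>
        (\<forall>a\<in>sub_fan G C. \<forall>b\<in>sub_fan G C. qadd a b \<in> sub_fan G C)) \<and>
     (\<forall>C C'. flag P C \<and> flag P C' \<longrightarrow>
        (sub_fan G C \<subseteq> sub_fan G C' \<longleftrightarrow> C \<subseteq> C') \<and>
        sub_fan G C \<inter> sub_fan G C' = sub_fan G (C \<inter> C'))"

text \<open>The cone \<open>K(Q)\<close>; inserting \<open>0\<close> only matters for empty \<open>Q\<close>.\<close>

definition cone_over :: "(real ^ 'n::finite) set \<Rightarrow> (real \<times> (real ^ 'n)) set" where
  "cone_over Q = insert 0 {(c, c *\<^sub>R p) | c p. c \<ge> 0 \<and> p \<in> Q}"

inductive_set submonoid_gen :: "'m::monoid_add set \<Rightarrow> 'm set" for B where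
  zero: "0 \<in> submonoid_gen B"
| gen: "b \<in> B \<Longrightarrow> b \<in> submonoid_gen B"
| add: "a \<in> submonoid_gen B \<Longrightarrow> b \<in> submonoid_gen B \<Longrightarrow> a + b \<in> submonoid_gen B"

definition S_mon :: "(real ^ 'n::finite) set \<Rightarrow> 'n hlat set" where
  "S_mon P = submonoid_gen {(1, \<xi>) | \<xi>. \<xi> \<in> lattice_points P}"

definition S_flag ::
    "(real ^ 'n::finite) set \<Rightarrow> ('n face \<Rightarrow> ('n, 'k::field) lfun) \<Rightarrow> 'n face set \<Rightarrow>
      'n hlat set" where
  "S_flag P f C = {s \<in> S_mon P. real_hvec s \<in> cone_over (flag_simplex P f C)}"

definition S_fan ::
    "(real ^ 'n::finite) set \<Rightarrow> ('n face \<Rightarrow> ('n, 'k::field) lfun) \<Rightarrow> 'n hlat set" where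
  "S_fan P f = (\<Union>C\<in>{C. flag P C}. S_flag P f C)"

definition fan_iso_S ::
    "(real ^ 'n::finite) set \<Rightarrow> 'n qvec set \<Rightarrow> ('n face \<Rightarrow> ('n, 'k::field) lfun) \<Rightarrow> bool" where
  "fan_iso_S P G f \<longleftrightarrow> (\<exists>h. bij_betw h G (S_fan P f) \<and>
     (\<forall>C. flag P C \<longrightarrow> bij_betw h (sub_fan G C) (S_flag P f C) \<and> h (\<lambda>_. 0) = 0 \<and>
        (\<forall>a\<in>sub_fan G C. \<forall>b\<in>sub_fan G C. h (qadd a b) = h a + h b)))"

definition fan_iso ::
    "(real ^ 'n::finite) set \<Rightarrow> 'n qvec set \<Rightarrow> 'n qvec set \<Rightarrow> bool" where
  "fan_iso P G G' \<longleftrightarrow> (\<exists>h. bij_betw h G G' \<and>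
     (\<forall>C. flag P C \<longrightarrow> bij_betw h (sub_fan G C) (sub_fan G' C) \<and> h (\<lambda>_. 0) = (\<lambda>_. 0) \<and>
        (\<forall>a\<in>sub_fan G C. \<forall>b\<in>sub_fan G C. h (qadd a b) = qadd (h a) (h b))))"

definition yvar :: "'i \<Rightarrow> ('i, 'k::field) mpoly" where
  "yvar a = Poly_Mapping.single (Poly_Mapping.single a 1) 1"

text \<open>The relation \<open>y\<^sub>0 = 1\<close> is not implied by the other generators: they all vanish when every
  variable is set to zero. Without it the fan algebra would have a spurious direct factor \<open>k\<close>.\<close>

definition fan_ideal_gens ::
    "(real ^ 'n::finite) set \<Rightarrow> 'n qvec set \<Rightarrow> ('n qvec, 'k::field) mpoly set" where
  "fan_ideal_gens P G =
     {yvar a * yvar b - yvar (qadd a b) | a b.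
        a \<in> G \<and> b \<in> G \<and> (\<exists>C. flag P C \<and> qsupp a \<subseteq> C \<and> qsupp b \<subseteq> C)} \<union>
     {yvar a * yvar b | a b.
        a \<in> G \<and> b \<in> G \<and> \<not> (\<exists>C. flag P C \<and> qsupp a \<subseteq> C \<and> qsupp b \<subseteq> C)} \<union>
     {yvar (\<lambda>_. 0) - 1}"

definition fan_algebra ::
    "(real ^ 'n::finite) set \<Rightarrow> ('n face \<Rightarrow> ('n, 'k::field) lfun) \<Rightarrow> 'n qvec set \<Rightarrow>
      ('k, ('n qvec, 'k) mpoly set) graded_algebra" where
  "fan_algebra P f G =
    (let R = poly_ring G; I = Idl\<^bsub>R\<^esub> (fan_ideal_gens P G)
     in \<lparr> carrier = carrier (R Quot I),
          mult = mult (R Quot I),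
          one = one (R Quot I),
          zero = zero (R Quot I),
          add = add (R Quot I),
          smult = (\<lambda>c x. \<Union>p\<in>x. I +>\<^bsub>R\<^esub> (Poly_Mapping.single 0 c * p)),
          homog = (\<lambda>d. {I +>\<^bsub>R\<^esub> p | p. p \<in> carrier R \<and> (\<forall>m\<in>Poly_Mapping.keys p.
            (\<Sum>a\<in>Poly_Mapping.keys m. of_nat (Poly_Mapping.lookup m a) * qdegree P f a)
              = of_nat d)}) \<rparr>)"

definition semigroup_algebra ::
    "'n::finite hlat set \<Rightarrow> ('k::field, 'n hlat \<Rightarrow>\<^sub>0 'k) graded_algebra" where
  "semigroup_algebra S =
    \<lparr> carrier = {p. Poly_Mapping.keys p \<subseteq> S},
      mult = (*), one = 1, zero = 0, add = (+),
      smult = (\<lambda>c p. Poly_Mapping.single 0 c * p),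
      homog = (\<lambda>d. {p. Poly_Mapping.keys p \<subseteq> S \<and> (\<forall>s\<in>Poly_Mapping.keys p. fst s = int d)}) \<rparr>"

text \<open>For a finitely generated submonoid \<open>S\<close> of the lattice, the torus action on the toric variety
  \<open>Proj k[S]\<close> is given by the grading of \<open>k[S]\<close> by that lattice.\<close>

definition affine_semigroup :: "'n::finite hlat set \<Rightarrow> bool" where
  "affine_semigroup S \<longleftrightarrow> (\<exists>B. finite B \<and> S = submonoid_gen B)"

text \<open>\<open>X\<close> is the union of the closed subspaces \<open>Z i\<close>, none of which can be omitted.\<close>

definition irredundant_union ::
    "('k, 'q, 't) kspace \<Rightarrow> 'i set \<Rightarrow> ('i \<Rightarrow> ('k, 'p, 's) kspace) \<Rightarrow> bool" where
  "irredundant_union X I Z \<longleftrightarrow> (\<exists>j.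
     (\<forall>i\<in>I. closed_immersion (Z i) X (j i)) \<and>
     points X = (\<Union>i\<in>I. j i ` points (Z i)) \<and>
     (\<forall>i\<in>I. points X \<noteq> (\<Union>i'\<in>I - {i}. j i' ` points (Z i'))))"

end

theory Submission imports Defs begin

text \<open>The coordinate ring of the cone is the semigroup algebra of \<open>S\<close>: a monomial in the coordinates is, as a
  function on the cone, determined by its weight, and distinct characters of the torus are linearly
  independent. Hence the eigenfunctions are the multiples of the elements \<open>s\<close> of \<open>S\<close>, and the
  quasi-valuation of a function is the minimum of its values on the \<open>s\<close> that occur in it
  (\<open>cone_fun\<close>, \<open>eigenfunction_iff\<close>).

  The simplices of the flags cover \<open>P\<close>, so \<open>s\<close> has nonnegative coordinates with respect to the weights of
  some flag. The convex geometry behind everything is \<open>lex_comparison\<close>: among all ways to write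
  \<open>s\<close> as a nonnegative combination of weights, the one supported on a flag is the lexicographically
  largest; and the coordinates with respect to a maximal chain whose simplex does not contain \<open>s\<close>
  do not fall below it. So \<open>\<nu>(s)\<close> is the vector of these coordinates, \<open>coords s\<close>. It is additive
  precisely on pairs of elements with supports in a common flag, and superadditive otherwise. This
  identifies \<open>\<Gamma>\<close> with the fan of the \<open>S\<^sub>C\<close>; normality enters because every lattice point of the cone
  over a simplex has to belong to \<open>S\<close>.

  All leaves of \<open>\<nu>\<close> are one-dimensional. In the associated graded ring the product of the classes of
  \<open>s\<close> and \<open>t\<close> is the class of \<open>s + t\<close> if \<open>s\<close> and \<open>t\<close> lie in a common \<open>S\<^sub>C\<close>, and zero otherwise.
  Both this ring and the fan algebra are therefore isomorphic to the algebra with basis \<open>S\<close> and this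
  product (\<open>graded_iso_gr\<close>, \<open>graded_iso_fan\<close>), which involves only the triangulation.

  Discarding the monomials outside \<open>S\<^sub>C\<close> maps this algebra onto the domain \<open>k[S\<^sub>C]\<close>. Jointly these
  maps are injective, so \<open>X\<^sub>0\<close> is reduced, and each gives a closed immersion of \<open>Proj k[S\<^sub>C]\<close>. The monomials
  outside a prime have pairwise compatible supports, hence supports in one maximal chain, so the images
  cover \<open>X\<^sub>0\<close> (\<open>prime_contains_kernel\<close>). They are the irreducible components.

  The dimension of \<open>Proj k[S\<^sub>C]\<close> and of the toric variety is \<open>n\<close>. A strictly decreasing chain of
  primes produces algebraically independent elements, and counting exponents in a box bounds their number
  by \<open>n + 1\<close> (\<open>prime_chain\<close>); the faces of a maximal chain give a chain of length \<open>n\<close>.\<close>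

section \<open>Finitely supported functions as linear combinations\<close>

type_synonym ('n, 'k) lpoly = "'n hlat \<Rightarrow>\<^sub>0 'k"

abbreviation "hpolys P == homog_polys (lattice_points P)"

abbreviation "KX == coord_ring"

abbreviation "lpts == lattice_points"

abbreviation "Pts == proj_points"

abbreviation "keys == Poly_Mapping.keys"

abbreviation "lookup == Poly_Mapping.lookup"

abbreviation "single == Poly_Mapping.single"

definition pm_eval :: "('a \<Rightarrow>\<^sub>0 'k::field) => ('a => 'k) => 'k" where
 "pm_eval F phi = (SUM s:keys F. lookup F s * phi s)"

definition pm_map :: "('a => 'b) => ('a \<Rightarrow>\<^sub>0 'k::field) => ('b \<Rightarrow>\<^sub>0 'k)" where
 "pm_map h F = (SUM s:keys F. single (h s) (lookup F s))"

lemma pm_eval_superset: assumes "finite A" "keys F <= A" shows "pm_eval F phi = (SUM s:A. lookup F s * phi s)" unfolding pm_eval_def using assms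
 by (intro sum.mono_neutral_left) (auto simp: in_keys_iff)

lemma pm_eval_0 [simp]: "pm_eval 0 phi = 0" by (simp add: pm_eval_def)

lemma pm_eval_single [simp]: "pm_eval (single s c) phi = c * phi s" by (simp add: pm_eval_def)

lemma pm_eval_add: "pm_eval (F + G) phi = pm_eval F phi + pm_eval G phi"
proof -
 let ?A = "keys F Un keys G"
 have "pm_eval (F + G) phi = (SUM s:?A. lookup (F + G) s * phi s)"
  by (intro pm_eval_superset) (auto dest: Poly_Mapping.keys_add[THEN subsetD])
 also have "... = (SUM s:?A. lookup F s * phi s) + (SUM s:?A. lookup G s * phi s)" by (simp add: lookup_add distrib_right sum.distrib)
 also have "... = pm_eval F phi + pm_eval G phi" by (simp add: pm_eval_superset[of ?A])
 finally show ?thesis .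
qed

lemma pm_eval_sum: "pm_eval (sum F A) phi = (SUM i:A. pm_eval (F i) phi)"
 by (induction A rule: infinite_finite_induct) (simp_all add: pm_eval_add)

lemma pm_expand: "F = (SUM s:keys F. single s (lookup F s))"
proof (rule poly_mapping_eqI)
 fix k
 have "lookup (SUM s:keys F. single s (lookup F s)) k = (SUM s:keys F. if s = k then lookup F s else 0)"
  by (simp add: lookup_sum lookup_single when_def cong: if_cong)
 also have "... = lookup F k" by (simp add: in_keys_iff)
 finally show "lookup F k = lookup (SUM s:keys F. single s (lookup F s)) k" ..
qed

lemma pm_mult_expand: fixes F G :: "'a::monoid_add \<Rightarrow>\<^sub>0 'k::field" shows "F * G = (SUM s:keys F. SUM t:keys G.
  single (s + t) (lookup F s * lookup G t))"
proof -
 have "F * G = (SUM s:keys F. single s (lookup F s)) * (SUM t:keys G. single t (lookup G t))"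
  by (simp flip: pm_expand)
 thus ?thesis by (simp add: sum_product mult_single)
qed

lemma pm_eval_mult: fixes F G :: "'a::monoid_add \<Rightarrow>\<^sub>0 'k::field"
 assumes "!!s t. s : keys F ==> t : keys G ==> phi (s + t) = phi s * phi t" shows "pm_eval (F * G) phi = pm_eval F phi * pm_eval G phi"
 by (subst pm_mult_expand)
  (simp add: pm_eval_sum sum_product assms pm_eval_def[of F] pm_eval_def[of G] mult_ac cong: sum.cong)

lemma pm_eval_cong:
 "(!!s. s : keys F ==> phi s = psi s) ==> pm_eval F phi = pm_eval F psi" by (simp add: pm_eval_def)

lemma pm_eval_map: "pm_eval (pm_map h F) phi = pm_eval F (%m. phi (h m))" by (simp add: pm_map_def pm_eval_sum pm_eval_def[of F])

lemma lookup_pm_map: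
 "lookup (pm_map h F) t = (SUM s:{s : keys F. h s = t}. lookup F s)"
 by (simp add: pm_map_def lookup_sum lookup_single when_def sum.If_cases Int_def)

lemma keys_pm_map: "keys (pm_map h F) <= h ` keys F"
proof
 fix t assume "t : keys (pm_map h F)"
 hence "(SUM s:{s : keys F. h s = t}. lookup F s) ~= 0" by (simp add: in_keys_iff lookup_pm_map)
 then obtain s where "s : keys F" "h s = t" by (metis (mono_tags, lifting) mem_Collect_eq sum.neutral)
 thus "t : h ` keys F" by auto
qed

lemma pm_map_superset: assumes "finite A" "keys F <= A" shows "pm_map h F = (SUM s:A. single (h s) (lookup F s))" unfolding pm_map_def using assms
 by (intro sum.mono_neutral_left) (auto simp: in_keys_iff)

lemma pm_map_add: "pm_map h (F + G) = pm_map h F + pm_map h G"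
proof -
 let ?A = "keys F Un keys G"
 have "pm_map h (F + G) = (SUM s:?A. single (h s) (lookup (F + G) s))"
  by (intro pm_map_superset) (auto dest: Poly_Mapping.keys_add[THEN subsetD])
 also have "... = pm_map h F + pm_map h G" by (simp add: lookup_add single_add sum.distrib pm_map_superset[of ?A])
 finally show ?thesis .
qed

lemma pm_map_single [simp]: "pm_map h (single s c) = single (h s) c" by (simp add: pm_map_def)

lemma pm_map_0 [simp]: "pm_map h 0 = 0" by (simp add: pm_map_def)

lemma pm_map_sum: "pm_map h (sum F A) = (SUM i:A. pm_map h (F i))" by (induction A rule: infinite_finite_induct) (simp_all add: pm_map_add)

lemma lookup_smult [simp]: fixes F :: "'a::comm_monoid_add \<Rightarrow>\<^sub>0 'k::field" shows "lookup (single 0 c * F) s = c * lookup F s"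
 by (simp flip: mult_map_scale_conv_mult add: Poly_Mapping.map.rep_eq when_def)

section \<open>Laurent polynomials on the lattice\<close>

lemma le_abs_mult: "0 < N ==> z ~= 0 ==> N <= \<bar>N * z\<bar>" for N z :: int
 using mult_left_mono[of 1 "\<bar>z\<bar>" N] by (simp add: abs_mult)

text \<open>Expansion to a large base: for large \<open>N\<close> the functional with coefficients
  \<open>1, N, N\<^sup>2, \<dots>\<close> separates finitely many lattice points.\<close>

lemma separating_functional_vec: fixes A :: "(int ^ 'n::finite) set"
 assumes "finite A" shows "EX w :: int ^ 'n => int. Modules.additive w & inj_on w A"
proof -
 have "EX w :: int ^ 'n => int. Modules.additive w & (ALL d:D. (EX i:I. d $ i ~= 0) --> w d ~= 0) & (ALL d. (ALL i:I. d $ i = 0) --> w d = 0)"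
  if "finite D" "finite I" for D :: "(int ^ 'n) set" and I :: "'n set" using \<open>finite I\<close>
 proof (induction I)
  case empty
  show ?case by (rule exI[of _ "%_. 0"]) (auto simp: Modules.additive_def)
 next
  case (insert j I)
  then obtain w :: "int ^ 'n => int" where w: "Modules.additive w"
   "ALL d:D. (EX i:I. d $ i ~= 0) --> w d ~= 0" "ALL d. (ALL i:I. d $ i = 0) --> w d = 0" by blast
  define N where "N = (SUM d:D. \<bar>d $ j\<bar>) + 1"
  have N: "\<bar>d $ j\<bar> < N" if "d : D" for d
   unfolding N_def using member_le_sum[of d D "%d. \<bar>d $ j\<bar>"] that \<open>finite D\<close> by simp
  have nz: "N * w d + d $ j ~= 0" if d: "d : D" "EX i:insert j I. d $ i ~= 0" for d
  proof (cases "w d = 0")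
   case True
   hence "d $ j ~= 0" using w(2) d by blast
   thus ?thesis using True by simp
  next
   case False
   hence "N <= \<bar>N * w d\<bar>" using N[OF d(1)] by (intro le_abs_mult) auto
   thus ?thesis using N[OF d(1)] by linarith
  qed
  show ?case by (rule exI[of _ "%d. N * w d + d $ j"])
    (use nz w(3) in "auto simp: Modules.additive_def algebra_simps Modules.additive.add[OF w(1)]")
 qed
 from this[OF finite_imageI[OF finite_cartesian_product[OF assms assms]] finite, of "%(x, y). x - y"]
 obtain w :: "int ^ 'n => int"
  where w: "Modules.additive w"
   "ALL d : (%(x, y). x - y) ` (A \<times> A). (EX i:UNIV. d $ i ~= 0) --> w d ~= 0" by blast
 have "inj_on w A"
 proof (rule inj_onI, rule ccontr)
  fix x y assume xy: "x : A" "y : A" "w x = w y" "x ~= y"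
  have "w x = w (x - y) + w y" using Modules.additive.add[OF w(1), of "x - y" y] by simp
  hence "w (x - y) = 0" using xy by simp
  moreover have "x - y : (%(x, y). x - y) ` (A \<times> A)" using xy(1,2) by auto
  moreover have "EX i. (x - y) $ i ~= 0" using xy(4) by (simp add: vec_eq_iff)
  ultimately show False using w(2) by blast
 qed
 thus ?thesis using w(1) by blast
qed

lemma separating_functional: fixes A :: "'n::finite hlat set" assumes "finite A" shows "EX w :: 'n hlat => int. Modules.additive w & inj_on w A"
proof -
 obtain w :: "int ^ 'n => int" where w: "Modules.additive w" "inj_on w (snd ` A)"
  using separating_functional_vec[OF finite_imageI[OF assms], of snd] by blast
 let ?D = "(%(x, y). w (snd x) - w (snd y)) ` (A \<times> A)"
 define N where "N = (SUM d:?D. \<bar>d\<bar>) + 1"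
 have N: "\<bar>w (snd x) - w (snd y)\<bar> < N" if "x : A" "y : A" for x y
 proof -
  have "w (snd x) - w (snd y) : ?D" using that by auto
  thus ?thesis unfolding N_def using member_le_sum[of "w (snd x) - w (snd y)" ?D "%d. \<bar>d\<bar>"] assms by simp
 qed
 have "inj_on (%x. N * fst x + w (snd x)) A"
 proof (rule inj_onI)
  fix x y assume xy: "x : A" "y : A" "N * fst x + w (snd x) = N * fst y + w (snd y)"
  have e: "w (snd x) - w (snd y) = N * (fst y - fst x)" using xy(3) by (simp add: algebra_simps)
  have "fst y - fst x = 0"
  proof (rule ccontr)
   assume "fst y - fst x ~= 0"
   hence "N <= \<bar>N * (fst y - fst x)\<bar>" using N[OF xy(1,2)] by (intro le_abs_mult) auto
   thus False using e N[OF xy(1,2)] by linarith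
  qed
  moreover from this have "snd x = snd y" using e xy(1,2) w(2) by (auto dest: inj_onD)
  ultimately show "x = y" by (simp add: prod_eq_iff)
 qed
 thus ?thesis by (intro exI[of _ "%x. N * fst x + w (snd x)"]) (auto simp: Modules.additive_def Modules.additive.add[OF w(1)] algebra_simps)
qed

text \<open>A functional separating all exponents singles out a leading term on each factor, and the
  product of the leading terms cannot cancel.\<close>

lemma laurent_mult_nonzero: fixes F G :: "('n::finite, 'k::field) lpoly" assumes "F ~= 0" "G ~= 0" shows "F * G ~= 0"
proof -
 obtain w :: "'n hlat => int" where w: "Modules.additive w"
   "inj_on w (keys F Un keys G)" using separating_functional[of "keys F Un keys G"] finite_keys by blast
 have lead: "EX s:keys H. ALL t:keys H. t ~= s --> w t < w s"
  if "H ~= 0" "inj_on w (keys H)" for H :: "('n, 'k) lpoly"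
 proof -
  have "Max (w ` keys H) : w ` keys H" using that by (intro Max_in) auto
  then obtain s where s: "s : keys H" "w s = Max (w ` keys H)" by auto
  have "w t < w s" if t: "t : keys H" "t ~= s" for t
  proof -
   have "w t <= w s" using s t by simp
   moreover have "w t ~= w s" using t s(1) \<open>inj_on w (keys H)\<close> by (auto dest: inj_onD)
   ultimately show ?thesis by simp
  qed
  with s show ?thesis by blast
 qed
 obtain s where s: "s : keys F" "!!t. t : keys F ==> t ~= s ==> w t < w s" using lead[OF assms(1)] w(2) by (auto simp: inj_on_Un)
 obtain t where t: "t : keys G" "!!s. s : keys G ==> s ~= t ==> w s < w t" using lead[OF assms(2)] w(2) by (auto simp: inj_on_Un)
 have eq: "a = s & b = t" if "a : keys F" "b : keys G" "a + b = s + t" for a b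
 proof (rule ccontr)
  assume "~ (a = s & b = t)"
  moreover have "w a + w b = w s + w t" using that(3) Modules.additive.add[OF w(1)] by metis
  moreover have "w a <= w s" "w b <= w t" using s(2) t(2) that by (metis less_imp_le order_refl)+
  ultimately show False using s(2)[OF that(1)] t(2)[OF that(2)] by force
 qed
 have "lookup (F * G) (s + t) = (SUM a:keys F. SUM b:keys G. (if a + b = s + t then lookup F a * lookup G b else 0))"
  by (subst pm_mult_expand) (simp add: lookup_sum lookup_single when_def cong: if_cong)
 also have "... = (SUM a:keys F. SUM b:keys G. (if b = t then (if a = s then lookup F a * lookup G b else 0) else 0))"
  by (intro sum.cong refl) (auto dest: eq)
 also have "... = lookup F s * lookup G t" using s(1) t(1) by simp
 also have "... ~= 0" using s(1) t(1) by (simp add: in_keys_iff)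
 finally show ?thesis by auto
qed

lemma char_val_add:
 "t : torus ==> char_val (xi + \<eta>) t = char_val xi t * char_val \<eta> t"
 by (simp add: char_val_def torus_def power_int_add prod.distrib)

lemma char_val_0 [simp]: "char_val 0 t = 1" by (simp add: char_val_def)

lemma char_val_nonzero: "t : torus ==> char_val xi t ~= 0" by (simp add: char_val_def torus_def)

abbreviation big_torus :: "('k::field \<times> ('k ^ 'n::finite)) set" where
 "big_torus \<equiv> (UNIV - {0}) \<times> torus"

lemma hchar_val_add:
 "u : big_torus ==> hchar_val (s + s') u = hchar_val s u * hchar_val s' u" by (cases u) (simp add: hchar_val_def char_val_add power_int_add)

lemma hchar_val_0 [simp]: "hchar_val 0 u = 1" by (cases u) (simp add: hchar_val_def)

lemma hchar_val_nonzero: "u : big_torus ==> hchar_val s u ~= 0" by (cases u) (simp add: hchar_val_def char_val_nonzero)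

lemma hchar_val_uminus: "u : big_torus ==> hchar_val (- s) u = inverse (hchar_val s u)"
 using hchar_val_add[of u s "- s"] hchar_val_nonzero[of u s] by (simp add: field_simps)

definition torus_mult :: "'k::field \<times> ('k ^ 'n::finite) => 'k \<times> ('k ^ 'n) => 'k \<times> ('k ^ 'n)" where
 "torus_mult u v = (fst u * fst v, \<chi> i. snd u $ i * snd v $ i)"

lemma torus_mult_in: "u : big_torus ==> v : big_torus ==> torus_mult u v : big_torus" by (auto simp: torus_mult_def torus_def)

lemma hchar_val_torus_mult: "hchar_val s (torus_mult u v) = hchar_val s u * hchar_val s v" by (cases u; cases v)
  (simp add: hchar_val_def torus_mult_def char_val_def power_int_mult_distrib prod.distrib)

lemma torus_inv_in: "u : big_torus ==> torus_inv u : big_torus" by (cases u) (auto simp: torus_inv_def torus_def)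

lemma hchar_val_torus_inv: "hchar_val s (torus_inv u) = inverse (hchar_val s u)"
 by (cases u) (simp add: hchar_val_def torus_inv_def char_val_def power_int_inverse flip: prod_inversef)

text \<open>Two different characters already differ at a point with one coordinate \<open>2\<close> and all others
  \<open>1\<close>, as \<open>2\<close> is not a root of unity in characteristic zero.\<close>

lemma two_powi_inj: assumes "(2::'k::field_char_0) powi a = 2 powi b" shows "a = b"
proof -
 have *: "a = b" if "a <= b" "(2::'k) powi a = 2 powi b" for a b :: int
 proof -
  have "(2::'k) powi (b - a) = 1" using that by (simp add: power_int_diff)
  hence "(2::'k) ^ nat (b - a) = 1" using that(1) by (simp add: power_int_def)
  hence "of_nat (2 ^ nat (b - a)) = (of_nat 1 :: 'k)" by simp
  hence "(2::nat) ^ nat (b - a) = 1" unfolding of_nat_eq_iff .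
  thus ?thesis using that(1) by simp
 qed
 show ?thesis using *[of a b] *[of b a] assms by (cases "a <= b") auto
qed

lemma hchar_val_separates: fixes s s' :: "'n::finite hlat"
 assumes "s ~= s'" shows "EX u::'k::field_char_0 \<times> ('k ^ 'n). u : big_torus & hchar_val s u ~= hchar_val s' u"
proof (cases "fst s = fst s'")
 case False
 have "hchar_val s (2, \<chi> i. 1) ~= (hchar_val s' (2, \<chi> i. 1) :: 'k)"
  using False two_powi_inj by (auto simp: hchar_val_def char_val_def)
 thus ?thesis by (intro exI[of _ "(2, \<chi> i. 1)"]) (auto simp: torus_def)
next
 case True
 with assms obtain j where j: "snd s $ j ~= snd s' $ j" by (auto simp: prod_eq_iff vec_eq_iff)
 let ?u = "(1, \<chi> i. if i = j then 2 else 1) :: 'k \<times> ('k ^ 'n)"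
 have v: "hchar_val z ?u = 2 powi (snd z $ j)" for z
 proof -
  have "(if i = j then 2 else (1::'k)) powi (snd z $ i) = (if i = j then 2 powi (snd z $ j) else 1)" for i by simp
  thus ?thesis by (simp add: hchar_val_def char_val_def)
 qed
 have "?u : big_torus" by (auto simp: torus_def)
 moreover have "hchar_val s ?u ~= hchar_val s' ?u" unfolding v using two_powi_inj j by blast
 ultimately show ?thesis by blast
qed

text \<open>Artin's independence of characters: translating a minimal relation by a point that
  separates two of its characters and subtracting gives a shorter one.\<close>

lemma characters_independent: fixes F :: "('n::finite, 'k::field_char_0) lpoly"
 assumes "!!u. u : big_torus ==> pm_eval F (%s. hchar_val s u) = 0" shows "F = 0"
proof -
 have "ALL s:A. c s = 0"
  if "finite A" "!!u::'k \<times> ('k ^ 'n). u : big_torus ==> (SUM s:A. c s * hchar_val s u) = 0"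
  for A :: "'n hlat set" and c :: "'n hlat => 'k" using that
 proof (induction A arbitrary: c rule: finite_induct)
  case empty
  thus ?case by simp
 next
  case (insert a A)
  have z: "c s = 0" if s: "s : A" for s
  proof -
   have "s ~= a" using s insert by auto
   then obtain u :: "'k \<times> ('k ^ 'n)" where u: "u : big_torus" "hchar_val s u ~= hchar_val a u" using hchar_val_separates by blast
   have "(SUM t:A. c t * (hchar_val t u - hchar_val a u) * hchar_val t v) = 0"
    if v: "v : big_torus" for v
   proof -
    have "(SUM t:insert a A. c t * hchar_val t (torus_mult u v)) = 0" by (rule insert.prems) (use u(1) v torus_mult_in in auto)
    moreover have "hchar_val a u * (SUM t:insert a A. c t * hchar_val t v) = 0" using insert.prems[OF v] by simp
    ultimately have "(SUM t:insert a A. c t * (hchar_val t u - hchar_val a u) * hchar_val t v) = 0"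
     unfolding hchar_val_torus_mult sum_distrib_left by (simp add: left_diff_distrib right_diff_distrib sum_subtractf mult_ac)
    thus ?thesis using insert.hyps by simp
   qed
   from insert.IH[OF this] s u(2) show ?thesis by auto
  qed
  have "c a * hchar_val a ((1, \<chi> i. 1) :: 'k \<times> ('k ^ 'n)) = 0"
   using insert.prems[of "(1, \<chi> i. 1)"] insert.hyps z by (auto simp: torus_def)
  moreover have "hchar_val a ((1, \<chi> i. 1) :: 'k \<times> ('k ^ 'n)) ~= 0" by (rule hchar_val_nonzero) (auto simp: torus_def)
  ultimately show ?case using z by simp
 qed
 from this[of "keys F" "lookup F"] assms
 have "ALL s:keys F. lookup F s = 0" by (simp add: pm_eval_def)
 thus ?thesis by (intro poly_mapping_eqI) (metis in_keys_iff lookup_zero)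
qed

section \<open>Topologies generated by a base\<close>

lemma openin_generated_base: assumes "!!A B. A : \<B> ==> B : \<B> ==> A Int B : \<B>"
 shows "openin (topology_generated_by \<B>) U \<longleftrightarrow> (ALL x:U. EX A:\<B>. x : A & A <= U)"
proof
 assume "openin (topology_generated_by \<B>) U"
 hence "generate_topology_on \<B> U" by (simp add: openin_topology_generated_by_iff)
 thus "ALL x:U. EX A:\<B>. x : A & A <= U"
 proof induction
  case (Int a b)
  thus ?case by (metis (no_types, lifting) Int_iff Int_mono assms)
 next
  case (UN K)
  thus ?case by (meson Union_iff Union_upper subset_trans)
 qed auto
next
 assume *: "ALL x:U. EX A:\<B>. x : A & A <= U"
 hence "U = \<Union>{A : \<B>. A <= U}" by blast
 moreover have "openin (topology_generated_by \<B>) (\<Union>{A : \<B>. A <= U})"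
  by (intro openin_Union) (auto intro: topology_generated_by_Basis)
 ultimately show "openin (topology_generated_by \<B>) U" by simp
qed

lemma in_closure_generated_base:
 assumes "!!A B. A : \<B> ==> B : \<B> ==> A Int B : \<B>" shows "x : topology_generated_by \<B> closure_of Q \<longleftrightarrow>
  x : \<Union>\<B> & (ALL A:\<B>. x : A --> A Int Q ~= {})"
proof -
 have "(ALL T. x : T & openin (topology_generated_by \<B>) T --> (EX y. y : Q & y : T)) \<longleftrightarrow> (ALL A:\<B>. x : A --> A Int Q ~= {})"
 proof (intro iffI ballI impI allI)
  fix A assume "ALL T. x : T & openin (topology_generated_by \<B>) T --> (EX y. y : Q & y : T)"
   "A : \<B>" "x : A"
  thus "A Int Q ~= {}" using topology_generated_by_Basis[of A \<B>] by auto
 next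
  fix T assume *: "ALL A:\<B>. x : A --> A Int Q ~= {}"
   and T: "x : T & openin (topology_generated_by \<B>) T"
  then obtain A where "A : \<B>" "x : A" "A <= T" using openin_generated_base[OF assms, of T] by blast
  thus "EX y. y : Q & y : T" using * by blast
 qed
 thus ?thesis by (auto simp: in_closure_of topology_generated_by_topspace)
qed

section \<open>The coordinate ring of the cone is a semigroup algebra\<close>

definition mono_deg :: "('i \<Rightarrow>\<^sub>0 nat) => nat" where
 "mono_deg m = (SUM i:keys m. lookup m i)"

definition mono_val :: "('i => 'k::comm_semiring_1) => ('i \<Rightarrow>\<^sub>0 nat) => 'k" where
 "mono_val v m = (PROD i:keys m. v i ^ lookup m i)"

text \<open>The weight by which the torus of \<open>\<int> \<times> M\<close> scales a monomial on the points of the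
  open orbit.\<close>

definition nscale :: "nat => 'n::finite lat => 'n hlat" where
 "nscale k xi = (int k, \<chi> i. int k * xi $ i)"

definition mono_wt :: "('n::finite lat \<Rightarrow>\<^sub>0 nat) => 'n hlat" where
 "mono_wt m = (SUM xi:keys m. nscale (lookup m xi) xi)"

lemma nscale_simps [simp]: "nscale 0 xi = 0" "nscale 1 xi = (1, xi)" "nscale (Suc 0) xi = (1, xi)"
 by (simp_all add: nscale_def prod_eq_iff vec_eq_iff)

lemma nscale_add: "nscale (k + l) xi = nscale k xi + nscale l xi" by (simp add: nscale_def prod_eq_iff vec_eq_iff algebra_simps)

lemma keys_add_nat:
 "keys ((m::'i \<Rightarrow>\<^sub>0 nat) + m') = keys m Un keys m'" by (auto simp: in_keys_iff lookup_add)

lemma mono_deg_superset: "finite A ==> keys m <= A ==> mono_deg m = (SUM i:A. lookup m i)"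
 unfolding mono_deg_def by (intro sum.mono_neutral_left) (auto simp: in_keys_iff)

lemma mono_val_superset:
 "finite A ==> keys m <= A ==> mono_val v m = (PROD i:A. v i ^ lookup m i)"
 unfolding mono_val_def by (intro prod.mono_neutral_left) (auto simp: in_keys_iff)

lemma mono_wt_superset:
 "finite A ==> keys m <= A ==> mono_wt m = (SUM xi:A. nscale (lookup m xi) xi)"
 unfolding mono_wt_def by (intro sum.mono_neutral_left) (auto simp: in_keys_iff)

lemma mono_add:
 "mono_deg (m + m') = mono_deg m + mono_deg m'"
 "mono_val v (m + m') = mono_val v m * mono_val v m'"
 "mono_wt (l + l') = mono_wt l + mono_wt l'"
proof -
 let ?A = "keys m Un keys m'" and ?B = "keys l Un keys l'"
 show "mono_deg (m + m') = mono_deg m + mono_deg m'" by (simp add: mono_deg_superset[of ?A] keys_add_nat lookup_add sum.distrib)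
 show "mono_val v (m + m') = mono_val v m * mono_val v m'"
  by (simp add: mono_val_superset[of ?A] keys_add_nat lookup_add power_add prod.distrib)
 show "mono_wt (l + l') = mono_wt l + mono_wt l'" by (simp add: mono_wt_superset[of ?B] keys_add_nat lookup_add nscale_add sum.distrib)
qed

lemma mono_0 [simp]: "mono_deg 0 = 0" "mono_val v 0 = 1" "mono_wt 0 = 0" by (simp_all add: mono_deg_def mono_val_def mono_wt_def)

lemma mono_single_1 [simp]:
 "mono_val v (single i (Suc 0)) = v i" "mono_wt (single xi (Suc 0)) = (1, xi)"
 "mono_deg (single j (Suc 0)) = 1" by (simp_all add: mono_val_def mono_wt_def mono_deg_def)

lemma fst_mono_wt: "fst (mono_wt m) = int (mono_deg m)" by (simp add: mono_wt_def mono_deg_def fst_sum nscale_def)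

lemma mono_deg_eq_0: "mono_deg m = 0 \<longleftrightarrow> m = 0" by (auto simp: mono_deg_def in_keys_iff intro: poly_mapping_eqI)

lemma mono_val_scale: "mono_val (%i. c * v i) m = c ^ mono_deg m * mono_val v m"
 by (simp add: mono_val_def mono_deg_def power_mult_distrib prod.distrib power_sum)

lemma poly_eval_pm_eval: "poly_eval p v = pm_eval p (mono_val v)" by (simp add: poly_eval_def pm_eval_def mono_val_def)

lemma poly_eval_mult: "poly_eval (p * q) v = poly_eval p v * poly_eval q v" by (simp add: poly_eval_pm_eval pm_eval_mult mono_add)

lemma homog_polys_iff:
 "p : homog_polys I d \<longleftrightarrow> (ALL m:keys p. keys m <= I & mono_deg m = d)"
 by (auto simp: homog_polys_def polys_in_def mono_deg_def)

lemma poly_eval_scale: assumes "p : homog_polys I d" shows "poly_eval p (%i. c * v i) = c ^ d * poly_eval p v"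
proof -
 have "(SUM m:keys p. lookup p m * (c ^ mono_deg m * mono_val v m)) = (SUM m:keys p. c ^ d * (lookup p m * mono_val v m))"
  by (intro sum.cong refl) (use assms in "simp add: homog_polys_iff mult_ac")
 thus ?thesis by (simp add: poly_eval_pm_eval pm_eval_def mono_val_scale sum_distrib_left)
qed

lemma homog_polys_mult:
 "p : homog_polys I d ==> q : homog_polys I e ==> p * q : homog_polys I (d + e)" unfolding homog_polys_iff
proof (intro ballI)
 assume p: "ALL m:keys p. keys m <= I & mono_deg m = d"
  and q: "ALL m:keys q. keys m <= I & mono_deg m = e"
 fix m assume "m : keys (p * q)"
 then obtain a b where ab: "m = a + b" "a : keys p" "b : keys q" using Poly_Mapping.keys_mult[of p q] by blast
 show "keys m <= I & mono_deg m = d + e" using p[rule_format, OF ab(2)] q[rule_format, OF ab(3)] by (simp add: ab(1) keys_add_nat mono_add)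
qed

lemma one_in_homog_polys: "1 : homog_polys I 0" by (simp add: homog_polys_iff)

lemma S_mon_eq: "S_mon P = mono_wt ` {m. keys m <= lpts P}"
proof (intro equalityI subsetI)
 fix s assume "s : S_mon P"
 thus "s : mono_wt ` {m. keys m <= lpts P}" unfolding S_mon_def
 proof induction
  case zero
  show ?case by (rule image_eqI[of _ _ 0]) auto
 next
  case (gen b)
  then obtain xi where "b = (1, xi)" "xi : lpts P" by blast
  thus ?case by (intro image_eqI[of _ _ "single xi 1"]) auto
 next
  case (add a b)
  thus ?case by (auto simp: mono_add(3)[symmetric] keys_add_nat intro!: imageI)
 qed
next
 have ns: "nscale k xi : S_mon P" if "xi : lpts P" for k xi unfolding S_mon_def
  by (induction k) (use that in "auto simp: nscale_add[of 1, simplified] intro: submonoid_gen.intros")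
 have su: "(SUM i:A. g i) : S_mon P" if "finite A" "ALL i:A. g i : S_mon P" for A :: "'i set" and g
  using that unfolding S_mon_def by (induction A) (auto intro: submonoid_gen.intros)
 fix s assume "s : mono_wt ` {m. keys m <= lpts P}"
 thus "s : S_mon P" by (auto simp: mono_wt_def intro!: su ns)
qed

lemma S_mon_add: "s : S_mon P ==> t : S_mon P ==> s + t : S_mon P" unfolding S_mon_def by (rule submonoid_gen.add)

lemma S_mon_0: "0 : S_mon P" unfolding S_mon_def by (rule submonoid_gen.zero)

lemma S_mon_fst_nonneg: "s : S_mon P ==> 0 <= fst s" by (auto simp: S_mon_eq fst_mono_wt)

text \<open>The point of the torus orbit of the face \<open>sig\<close>, scaled by the first coordinate of \<open>u\<close>.\<close>

definition torus_pt ::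
  "(real ^ 'n::finite) set => 'n face => 'k::field \<times> ('k ^ 'n) => ('n, 'k) lvec" where
 "torus_pt P sig u = (%xi. if xi : lpts P Int lpts sig then fst u * char_val xi (snd u) else 0)"

lemma torus_pt_scale: "torus_pt P sig (c, t) = (%xi. c * torus_pt P sig (1, t) xi)" by (auto simp: torus_pt_def)

lemma torus_orbit_eq: "torus_orbit P sig = (%t. proj_point (torus_pt P sig (1, t))) ` torus"
proof -
 have "proj_point (%xi. if xi : lpts P Int lpts sig then char_val xi t else 0) = proj_point (torus_pt P sig (1, t))" for t :: "'b ^ 'a"
  by (rule arg_cong[of _ _ proj_point]) (auto simp: torus_pt_def)
 thus ?thesis unfolding torus_orbit_def by auto
qed

lemma hchar_val_nscale: assumes "u : big_torus" shows "hchar_val (nscale k xi) u = (fst u * char_val xi (snd u)) ^ k"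
proof (induction k)
 case 0
 thus ?case by simp
next
 case (Suc k)
 have "hchar_val (nscale (Suc k) xi) u = hchar_val (1, xi) u * hchar_val (nscale k xi) u"
  using nscale_add[of 1 k xi] hchar_val_add[OF assms] by simp
 thus ?case using Suc by (cases u) (simp add: hchar_val_def)
qed

lemma hchar_val_sum: assumes "u : big_torus" shows "hchar_val (SUM i:A. g i) u = (PROD i:A. hchar_val (g i) u)"
 by (induction A rule: infinite_finite_induct) (simp_all add: hchar_val_add[OF assms])

lemma mono_val_torus_pt: assumes "u : big_torus" "keys m <= lpts P" shows "mono_val (torus_pt P sig u) m =
  (if keys m <= lpts sig then hchar_val (mono_wt m) u else 0)"
proof (cases "keys m <= lpts sig")
 case True
 have "mono_val (torus_pt P sig u) m = (PROD xi:keys m. (fst u * char_val xi (snd u)) ^ lookup m xi)"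
  unfolding mono_val_def torus_pt_def using True assms(2) by (intro prod.cong refl) auto
 thus ?thesis using True by (simp add: mono_wt_def hchar_val_sum[OF assms(1)] hchar_val_nscale[OF assms(1)])
next
 case False
 then obtain xi where "xi : keys m" "xi ~: lpts sig" by auto
 hence "(PROD i:keys m. torus_pt P sig u i ^ lookup m i) = 0"
  by (intro prod_zero) (auto simp: torus_pt_def in_keys_iff intro!: bexI[of _ xi])
 thus ?thesis using False by (simp add: mono_val_def)
qed

lemma torus_act_eq: "torus_act u v = (%xi. fst u * char_val xi (snd u) * v xi)" by (cases u) (simp add: torus_act_def)

lemma mono_val_torus_act: assumes "u : big_torus" shows "mono_val (torus_act u v) m = hchar_val (mono_wt m) u * mono_val v m"
 by (simp add: mono_val_def torus_act_eq mono_wt_def hchar_val_sum[OF assms]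
   hchar_val_nscale[OF assms] power_mult_distrib prod.distrib)

subsection \<open>Points of projective space\<close>

lemma in_proj_point: "v : proj_point v" unfolding proj_point_def by (auto intro!: exI[of _ 1])

lemma proj_point_eq: "v' : proj_point v ==> proj_point v' = proj_point v"
proof -
 assume "v' : proj_point v"
 then obtain c where c: "c ~= 0" "v' = (%xi. c * v xi)" by (auto simp: proj_point_def)
 have "EX b. (%xi. a * v xi) = (%xi. b * v' xi) & b ~= 0" if "a ~= 0" for a using c that by (intro exI[of _ "a / c"]) auto
 moreover have "EX b. (%xi. a * v' xi) = (%xi. b * v xi) & b ~= 0" if "a ~= 0" for a
  using c that by (intro exI[of _ "a * c"]) (auto simp: mult_ac)
 ultimately show ?thesis unfolding proj_point_def by blast
qed

definition proj_basic ::
  "(real ^ 'n::finite) set => ('n lat, 'k::field) mpoly => ('n, 'k) lvec set set" where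
 "proj_basic P p = {x : proj_space P. EX v:x. poly_eval p v ~= 0}"

lemma proj_point_in_basic:
 assumes "p : homog_polys I d" shows "proj_point v : proj_basic P p \<longleftrightarrow> proj_point v : proj_space P & poly_eval p v ~= 0"
proof -
 have "(EX v':proj_point v. poly_eval p v' ~= 0) \<longleftrightarrow> poly_eval p v ~= 0"
  using in_proj_point[of v] by (auto simp: proj_point_def poly_eval_scale[OF assms])
 thus ?thesis by (simp add: proj_basic_def)
qed

lemma proj_basic_Int: assumes "p : homog_polys I d" "q : homog_polys I e" shows "proj_basic P p Int proj_basic P q = proj_basic P (p * q)"
proof (rule Set.set_eqI)
 fix x
 show "x : proj_basic P p Int proj_basic P q \<longleftrightarrow> x : proj_basic P (p * q)"
 proof (cases "x : proj_space P")
  case True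
  then obtain v where "x = proj_point v" by (auto simp: proj_space_def)
  thus ?thesis by (auto simp: proj_point_in_basic[OF assms(1)] proj_point_in_basic[OF assms(2)]
     proj_point_in_basic[OF homog_polys_mult[OF assms]] poly_eval_mult)
 qed (auto simp: proj_basic_def)
qed

lemma proj_basic_1: "proj_basic P 1 = proj_space P" by (auto simp: proj_basic_def poly_eval_pm_eval proj_space_def intro: in_proj_point
   simp flip: single_one)

definition proj_base ::
  "(real ^ 'n::finite) set => ('n, 'k::field) lvec set set set" where
 "proj_base P = {proj_basic P p | p d. p : hpolys P d}"

lemma proj_space_top_eq: "proj_space_top P = topology_generated_by (proj_base P)"
 by (simp add: proj_space_top_def proj_base_def proj_basic_def)

lemma proj_base_Int_closed: assumes "A : proj_base P" "B : proj_base P" shows "A Int B : proj_base P"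
proof -
 obtain p d q e where "A = proj_basic P p" "p : hpolys P d"
  "B = proj_basic P q" "q : hpolys P e" using assms by (auto simp: proj_base_def)
 thus ?thesis unfolding proj_base_def using proj_basic_Int homog_polys_mult by blast
qed

lemma Union_proj_base [simp]: "\<Union>(proj_base P) = proj_space P"
proof
 show "\<Union>(proj_base P) <= proj_space P" by (auto simp: proj_base_def proj_basic_def)
 show "proj_space P <= \<Union>(proj_base P)"
 proof (rule subsetI)
  fix x assume "x : proj_space P"
  hence "x : proj_basic P 1" by (simp add: proj_basic_1)
  thus "x : \<Union>(proj_base P)" by (rule UnionI[rotated]) (use one_in_homog_polys in "auto simp: proj_base_def")
 qed
qed

lemma topspace_proj_space_top [simp]: "topspace (proj_space_top P) = proj_space P"
 by (simp add: proj_space_top_eq topology_generated_by_topspace)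

lemma openin_proj_space_top:
 "openin (proj_space_top P) U \<longleftrightarrow> (ALL x:U. EX p d. p : hpolys P d & x : proj_basic P p & proj_basic P p <= U)"
proof -
 have "(EX A:proj_base P. x : A & A <= U) \<longleftrightarrow> (EX p d. p : hpolys P d & x : proj_basic P p & proj_basic P p <= U)" for x
  unfolding proj_base_def by auto
 thus ?thesis by (simp add: proj_space_top_eq openin_generated_base[OF proj_base_Int_closed])
qed

lemma in_closure_proj_space_top:
 "x : proj_space_top P closure_of Q \<longleftrightarrow> x : proj_space P &
  (ALL p d. p : hpolys P d --> x : proj_basic P p --> proj_basic P p Int Q ~= {})"
proof -
 have "(ALL A:proj_base P. x : A --> A Int Q ~= {}) \<longleftrightarrow>
  (ALL p d. p : hpolys P d --> x : proj_basic P p --> proj_basic P p Int Q ~= {})"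
  unfolding proj_base_def by auto
 thus ?thesis by (simp add: proj_space_top_eq in_closure_generated_base[OF proj_base_Int_closed])
qed

lemma proj_point_in_closure:
 assumes "proj_point v : proj_space P" shows "proj_point v : proj_space_top P closure_of (proj_point ` Q) \<longleftrightarrow>
  (ALL p d. p : hpolys P d --> (ALL w:Q. proj_point w : proj_space P --> poly_eval p w = 0) --> poly_eval p v = 0)"
 (is "_ = ?R")
proof -
 have "proj_basic P p Int proj_point ` Q ~= {} \<longleftrightarrow> ~ (ALL w:Q. proj_point w : proj_space P --> poly_eval p w = 0)"
  if "p : hpolys P d" for p d using proj_point_in_basic[OF that, of _ P] by blast
 moreover have "proj_point v : proj_basic P p \<longleftrightarrow> poly_eval p v ~= 0"
  if "p : hpolys P d" for p d using proj_point_in_basic[OF that, of v P] assms by simp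
 ultimately have *: "(proj_point v : proj_basic P p --> proj_basic P p Int proj_point ` Q ~= {}) \<longleftrightarrow>
   ((ALL w:Q. proj_point w : proj_space P --> poly_eval p w = 0) --> poly_eval p v = 0)"
  if "p : hpolys P d" for p d using that by (simp, blast)
 show ?thesis unfolding in_closure_proj_space_top using assms * by simp
qed

subsection \<open>The cone\<close>

text \<open>A point of \<open>V\<close> lies on the cone iff it is a monoid homomorphism on \<open>S\<close>: the closure of the
  torus is cut out by the binomials \<open>x\<^sup>m - x\<^sup>m\<^sup>'\<close> with \<open>m\<close>, \<open>m'\<close> of equal weight, since
  the characters of the torus are linearly independent.\<close>

lemma poly_eval_torus_pt:
 assumes "p : polys_in (lpts P)" "u : big_torus" shows "poly_eval p (torus_pt P P u) = pm_eval (pm_map mono_wt p) (%s. hchar_val s u)"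
 unfolding poly_eval_pm_eval pm_eval_map by (rule pm_eval_cong) (use assms in "auto simp: mono_val_torus_pt polys_in_def")

lemma homog_polys_polys_in: "p : homog_polys I d ==> p : polys_in I" by (simp add: homog_polys_def)

lemma vanish_on_torus: fixes p :: "('n::finite lat, 'k::field_char_0) mpoly" assumes "p : hpolys P d"
  "!!t. t : torus ==> poly_eval p (torus_pt P P (1, t)) = 0" shows "pm_map mono_wt p = 0"
proof (rule characters_independent)
 fix u :: "'k \<times> ('k ^ 'n)" assume u: "u : big_torus"
 hence "poly_eval p (torus_pt P P u) = 0" using assms(2)[of "snd u"] torus_pt_scale[of P P "fst u" "snd u"] poly_eval_scale[OF assms(1)]
  by auto
 thus "pm_eval (pm_map mono_wt p) (%s. hchar_val s u) = 0" using poly_eval_torus_pt[OF homog_polys_polys_in[OF assms(1)] u] by simp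
qed

lemma torus_pt_in_vspace: "torus_pt P sig u : vspace P" by (auto simp: vspace_def torus_pt_def)

lemma proj_point_in_space: "proj_point v : proj_space P \<longleftrightarrow> v : vspace P & v ~= (%_. 0)"
proof
 assume "proj_point v : proj_space P"
 then obtain w where w: "w : vspace P" "w ~= (%_. 0)" "proj_point v = proj_point w" by (auto simp: proj_space_def)
 hence "v : proj_point w" using in_proj_point by metis
 then obtain c where "c ~= 0" "v = (%xi. c * w xi)" by (auto simp: proj_point_def)
 thus "v : vspace P & v ~= (%_. 0)" using w(1,2) by (auto simp: vspace_def fun_eq_iff)
qed (auto simp: proj_space_def)

lemma affine_cone_iff: fixes v :: "('n::finite, 'k::field_char_0) lvec" shows "v : affine_cone P \<longleftrightarrow> v : vspace P &
  (ALL m m'. keys m <= lpts P --> keys m' <= lpts P -->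
    mono_wt m = mono_wt m' --> mono_val v m = mono_val v m')" (is "_ \<longleftrightarrow> _ & ?B v")
proof -
 have tv: "toric_variety P = proj_space_top P closure_of (proj_point ` torus_pt P P ` ({1} \<times> torus))"
  unfolding toric_variety_def stratum_def torus_orbit_eq by (rule arg_cong[of _ _ "(closure_of) _"]) auto
 have zero: "(%_. 0) : vspace P & ?B (%_. 0 :: 'k)"
 proof -
  have val: "mono_val (%_. 0 :: 'k) m = (if m = 0 then 1 else 0)" for m :: "'n lat \<Rightarrow>\<^sub>0 nat"
  proof (cases "m = 0")
   case False
   then obtain i where "i : keys m" by (metis keys_eq_empty all_not_in_conv)
   hence "mono_val (%_. 0 :: 'k) m = 0" unfolding mono_val_def by (intro prod_zero) (auto simp: in_keys_iff intro!: bexI[of _ i])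
   thus ?thesis using False by simp
  qed simp
  have eq: "m = 0 \<longleftrightarrow> m' = 0" if "mono_wt m = mono_wt m'" for m m' :: "'n lat \<Rightarrow>\<^sub>0 nat"
   using fst_mono_wt[of m] fst_mono_wt[of m'] that mono_deg_eq_0[of m] mono_deg_eq_0[of m'] by simp
  have "?B (%_. 0 :: 'k)"
  proof (intro allI impI)
   fix m m' :: "'n lat \<Rightarrow>\<^sub>0 nat" assume "mono_wt m = mono_wt m'"
   thus "mono_val (%_. 0 :: 'k) m = mono_val (%_. 0) m'" using eq[of m m'] by (simp add: val)
  qed
  moreover have "(%_. 0) : vspace P" by (simp add: vspace_def)
  ultimately show ?thesis by (intro conjI)
 qed
 show ?thesis
 proof (cases "v = (%_. 0)")
  case True
  hence "v : affine_cone P" by (simp add: affine_cone_def)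
  thus ?thesis using zero True by blast
 next
  case nz: False
  have mem: "v : affine_cone P \<longleftrightarrow> proj_point v : toric_variety P"
  proof
   assume "v : affine_cone P"
   then obtain x where x: "v : x" "x : toric_variety P" using nz by (auto simp: affine_cone_def)
   hence "x : proj_space P" by (simp add: tv in_closure_proj_space_top)
   then obtain w where "x = proj_point w" by (auto simp: proj_space_def)
   thus "proj_point v : toric_variety P" using x proj_point_eq by metis
  qed (use in_proj_point in "auto simp: affine_cone_def")
  show ?thesis
  proof (cases "v : vspace P")
   case False
   hence "proj_point v ~: toric_variety P" by (simp add: tv in_closure_proj_space_top proj_point_in_space)
   thus ?thesis using mem False by simp
  next
   case True
   hence sp: "proj_point v : proj_space P" using nz by (simp add: proj_point_in_space)
   have "proj_point v : toric_variety P \<longleftrightarrow> ?B v" unfolding tv proj_point_in_closure[OF sp]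
   proof (intro iffI allI impI)
    fix m m' assume vanish: "ALL p d. p : hpolys P d -->
      (ALL w:torus_pt P P ` ({1} \<times> torus). proj_point w : proj_space P --> poly_eval p w = 0) --> poly_eval p v = 0"
     and m: "keys m <= lpts P" "keys m' <= lpts P"
      "mono_wt m = mono_wt m'"
    let ?p = "single m 1 + single m' (- 1) :: ('n lat, 'k) mpoly"
    have ev: "poly_eval ?p w = mono_val w m - mono_val w m'" for w by (simp add: poly_eval_pm_eval pm_eval_add)
    have "mono_deg m' = mono_deg m" using fst_mono_wt[of m] fst_mono_wt[of m'] m(3) by simp
    hence "?p : hpolys P (mono_deg m)" using m(1,2) Poly_Mapping.keys_add[of "single m 1" "single m' (- 1 :: 'k)"]
     by (auto simp: homog_polys_iff)
    moreover have "poly_eval ?p (torus_pt P P (1, t)) = 0" if "t : torus" for t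
    proof -
     have "(1, t) : big_torus" using that by auto
     thus ?thesis by (simp add: ev mono_val_torus_pt m)
    qed
    ultimately have "poly_eval ?p v = 0" using vanish by auto
    thus "mono_val v m = mono_val v m'" by (simp add: ev)
   next
    fix p :: "('n lat, 'k) mpoly" and d assume B: "?B v" and p: "p : hpolys P d"
     and van: "ALL w:torus_pt P P ` ({1} \<times> torus). proj_point w : proj_space P --> poly_eval p w = 0"
    have z: "pm_map mono_wt p = 0"
    proof (rule vanish_on_torus[OF p])
     fix t :: "'k ^ 'n" assume t: "t : torus"
     have "torus_pt P P (1, t) ~= (%_. 0)"
     proof -
      obtain xi where "v xi ~= 0" using nz by auto
      hence "xi : lpts P" using True by (auto simp: vspace_def)
      hence "torus_pt P P (1, t) xi ~= 0" using t by (simp add: torus_pt_def char_val_nonzero)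
      thus ?thesis by auto
     qed
     hence "proj_point (torus_pt P P (1, t)) : proj_space P" by (simp add: proj_point_in_space torus_pt_in_vspace)
     thus "poly_eval p (torus_pt P P (1, t)) = 0" using van t by auto
    qed
    define phi where "phi s = mono_val v (SOME m. keys m <= lpts P & mono_wt m = s)" for s
    have phi: "mono_val v m = phi (mono_wt m)" if "keys m <= lpts P" for m
    proof -
     let ?m = "SOME m'. keys m' <= lpts P & mono_wt m' = mono_wt m"
     have "keys ?m <= lpts P & mono_wt ?m = mono_wt m" by (rule someI[of _ m]) (use that in auto)
     thus ?thesis unfolding phi_def by (intro B[rule_format]) (use that in auto)
    qed
    have "poly_eval p v = pm_eval p (%m. phi (mono_wt m))"
     unfolding poly_eval_pm_eval using p by (intro pm_eval_cong) (auto simp: homog_polys_iff phi)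
    also have "... = pm_eval (pm_map mono_wt p) phi" by (simp add: pm_eval_map)
    finally show "poly_eval p v = 0" using z by simp
   qed
   thus ?thesis using mem True by simp
  qed
 qed
qed

lemma affine_coneD: fixes v :: "('n::finite, 'k::field_char_0) lvec" assumes "v : affine_cone P" "keys m <= lpts P"
  "keys m' <= lpts P" "mono_wt m = mono_wt m'" shows "mono_val v m = mono_val v m'" using assms unfolding affine_cone_iff by blast

lemma torus_act_cone: fixes v :: "('n::finite, 'k::field_char_0) lvec"
 assumes "u : big_torus" "v : affine_cone P" shows "torus_act u v : affine_cone P"
proof -
 have "torus_act u v : vspace P" using assms(2) by (auto simp: affine_cone_iff vspace_def torus_act_eq)
 moreover have "mono_val (torus_act u v) m = mono_val (torus_act u v) m'"
  if "keys m <= lpts P" "keys m' <= lpts P"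
   "mono_wt m = mono_wt m'" for m m' using affine_coneD[OF assms(2) that] that(3) by (simp add: mono_val_torus_act[OF assms(1)])
 ultimately show ?thesis unfolding affine_cone_iff by blast
qed

lemma torus_pt_cone: fixes u :: "'k::field_char_0 \<times> ('k ^ 'n::finite)" assumes "u : big_torus" shows "torus_pt P P u : affine_cone P"
 unfolding affine_cone_iff using assms by (auto simp: torus_pt_in_vspace mono_val_torus_pt)

text \<open>The value of the character \<open>s\<close> at a point of the cone.\<close>

definition cone_val :: "(real ^ 'n::finite) set => ('n, 'k::field) lvec => 'n hlat => 'k" where
 "cone_val P v s = mono_val v (SOME m. keys m <= lpts P & mono_wt m = s)"

lemma cone_val_mono_wt: fixes v :: "('n::finite, 'k::field_char_0) lvec"
 assumes "v : affine_cone P" "keys m <= lpts P" shows "cone_val P v (mono_wt m) = mono_val v m"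
proof -
 let ?m = "SOME m'. keys m' <= lpts P & mono_wt m' = mono_wt m"
 have "keys ?m <= lpts P & mono_wt ?m = mono_wt m" by (rule someI[of _ m]) (use assms(2) in auto)
 thus ?thesis unfolding cone_val_def by (intro affine_coneD[OF assms(1)]) (use assms(2) in auto)
qed

lemma cone_val_add: fixes v :: "('n::finite, 'k::field_char_0) lvec"
 assumes "v : affine_cone P" "s : S_mon P" "t : S_mon P" shows "cone_val P v (s + t) = cone_val P v s * cone_val P v t"
proof -
 obtain m l where ml: "keys m <= lpts P" "s = mono_wt m"
  "keys l <= lpts P" "t = mono_wt l" using assms(2,3) by (auto simp: S_mon_eq)
 have "cone_val P v (mono_wt (m + l)) = mono_val v (m + l)" by (rule cone_val_mono_wt[OF assms(1)]) (use ml in "simp add: keys_add_nat")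
 thus ?thesis using ml by (simp add: mono_add cone_val_mono_wt[OF assms(1)])
qed

lemma cone_val_torus_act: fixes v :: "('n::finite, 'k::field_char_0) lvec"
 assumes "v : affine_cone P" "s : S_mon P" "u : big_torus" shows "cone_val P (torus_act u v) s = hchar_val s u * cone_val P v s"
proof -
 obtain m where m: "keys m <= lpts P" "s = mono_wt m" using assms(2) by (auto simp: S_mon_eq)
 show ?thesis using cone_val_mono_wt[OF assms(1) m(1)] cone_val_mono_wt[OF torus_act_cone[OF assms(3,1)] m(1)]
  by (simp add: m(2) mono_val_torus_act[OF assms(3)])
qed

lemma cone_val_torus_pt: fixes u :: "'k::field_char_0 \<times> ('k ^ 'n::finite)"
 assumes "u : big_torus" "s : S_mon P" shows "cone_val P (torus_pt P P u) s = hchar_val s u"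
proof -
 obtain m where m: "keys m <= lpts P" "s = mono_wt m" using assms(2) by (auto simp: S_mon_eq)
 show ?thesis using m by (simp add: cone_val_mono_wt[OF torus_pt_cone[OF assms(1)]] mono_val_torus_pt[OF assms(1)])
qed

subsection \<open>The coordinate ring\<close>

definition span_on :: "'m set => ('m \<Rightarrow>\<^sub>0 'k::field) set" where
 "span_on S = {F. keys F <= S}"

lemma span_onD: "F : span_on S ==> s : keys F ==> s : S" by (auto simp: span_on_def)

definition cone_fun ::
  "(real ^ 'n::finite) set => (('n, 'k::field) lpoly) => ('n, 'k) lfun" where
 "cone_fun P F = (%v. if v : affine_cone P then pm_eval F (cone_val P v) else 0)"

lemma poly_fun_eq_cone_fun: fixes p :: "('n::finite lat, 'k::field_char_0) mpoly"
 assumes "p : polys_in (lpts P)" shows "poly_fun P p = cone_fun P (pm_map mono_wt p)"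
proof
 fix v
 have "pm_eval p (mono_val v) = pm_eval p (%m. cone_val P v (mono_wt m))" if "v : affine_cone P"
  by (rule pm_eval_cong) (use assms that in "auto simp: polys_in_def cone_val_mono_wt")
 thus "poly_fun P p v = cone_fun P (pm_map mono_wt p) v" by (simp add: poly_fun_def cone_fun_def poly_eval_pm_eval pm_eval_map)
qed

lemma pm_map_mono_wt_surj: fixes F :: "('n::finite, 'k::field) lpoly" assumes "F : span_on (S_mon P)"
 obtains p :: "('n lat, 'k) mpoly" where "p : polys_in (lpts P)" "pm_map mono_wt p = F"
  "mono_wt ` keys p <= keys F"
proof -
 have "ALL s:keys F. EX m. keys m <= lpts P & mono_wt m = s" using span_onD[OF assms] unfolding S_mon_eq by blast
 then obtain g where g: "ALL s:keys F. keys (g s) <= lpts P & mono_wt (g s) = s" by metis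
 let ?p = "pm_map g F"
 have k: "keys ?p <= g ` keys F" by (rule keys_pm_map)
 have "pm_map mono_wt ?p = (SUM s:keys F. single (mono_wt (g s)) (lookup F s))" by (simp add: pm_map_def[of g] pm_map_sum)
 also have "... = F" using g by (subst (3) pm_expand) simp
 finally have "pm_map mono_wt ?p = F" .
 thus thesis using k g by (intro that[of ?p]) (auto simp: polys_in_def)
qed

lemma pm_map_supported:
 "p : polys_in (lpts P) ==> pm_map mono_wt p : span_on (S_mon P)"
 using keys_pm_map[of mono_wt p] by (auto simp: span_on_def S_mon_eq polys_in_def)

lemma carrier_coord_ring:
 "carrier (KX P :: ('k::field_char_0, ('n::finite, 'k) lfun) graded_algebra) = cone_fun P ` span_on (S_mon P)"
proof (intro equalityI subsetI)
 fix g assume "g : carrier (KX P :: ('k, ('n, 'k) lfun) graded_algebra)"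
 thus "g : cone_fun P ` span_on (S_mon P)" by (auto simp: coord_ring_def poly_fun_eq_cone_fun pm_map_supported)
next
 fix g :: "('n, 'k) lfun" assume "g : cone_fun P ` span_on (S_mon P)"
 then obtain F where F: "F : span_on (S_mon P)" "g = cone_fun P F" by blast
 obtain p :: "('n lat, 'k) mpoly" where "p : polys_in (lpts P)" "pm_map mono_wt p = F" by (rule pm_map_mono_wt_surj[OF F(1)])
 thus "g : carrier (KX P)" using F by (auto simp: coord_ring_def poly_fun_eq_cone_fun intro!: image_eqI[of _ _ p])
qed

lemma homog_coord_ring:
 "homog (KX P :: ('k::field_char_0, ('n::finite, 'k) lfun) graded_algebra) d = cone_fun P ` {F : span_on (S_mon P). ALL s:keys F. fst s = int d}"
proof (intro equalityI subsetI)
 fix g assume "g : homog (KX P :: ('k, ('n, 'k) lfun) graded_algebra) d"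
 then obtain p where p: "p : hpolys P d" "g = poly_fun P p" by (auto simp: coord_ring_def)
 have "fst s = int d" if "s : keys (pm_map mono_wt p)" for s
 proof -
  have "s : mono_wt ` keys p" by (rule subsetD[OF keys_pm_map that])
  thus ?thesis using p(1) by (auto simp: fst_mono_wt homog_polys_iff)
 qed
 thus "g : cone_fun P ` {F : span_on (S_mon P). ALL s:keys F. fst s = int d}"
  using p homog_polys_polys_in[OF p(1)] by (auto simp: poly_fun_eq_cone_fun pm_map_supported)
next
 fix g :: "('n, 'k) lfun"
 assume "g : cone_fun P ` {F : span_on (S_mon P). ALL s:keys F. fst s = int d}"
 then obtain F where F: "F : span_on (S_mon P)" "g = cone_fun P F"
  "ALL s:keys F. fst s = int d" by blast
 obtain p :: "('n lat, 'k) mpoly" where p: "p : polys_in (lpts P)" "pm_map mono_wt p = F"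
  "mono_wt ` keys p <= keys F" by (rule pm_map_mono_wt_surj[OF F(1)])
 have "mono_deg m = d" if "m : keys p" for m
 proof -
  have "mono_wt m : keys F" using p(3) that by blast
  thus ?thesis using F(3) fst_mono_wt[of m] by auto
 qed
 hence "p : hpolys P d" using p(1) by (auto simp: homog_polys_iff polys_in_def)
 thus "g : homog (KX P) d" using F p by (auto simp: coord_ring_def poly_fun_eq_cone_fun intro!: image_eqI[of _ _ p])
qed

lemma span_on_add: "F : span_on S ==> G : span_on S ==> F + G : span_on S" using Poly_Mapping.keys_add[of F G] by (auto simp: span_on_def)

lemma span_on_uminus:
 "F : span_on S ==> - F : span_on S" by (auto simp: span_on_def in_keys_iff)

lemma span_on_diff:
 "F : span_on S ==> G : span_on S ==> F - G : span_on S" using span_on_add[of F S "- G"] span_on_uminus[of G S] by simp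

lemma span_on_single: "s : S ==> single s c : span_on S" by (simp add: span_on_def)

lemma span_on_0: "0 : span_on S" by (simp add: span_on_def)

lemma span_on_sum: "(!!i. i : A ==> F i : span_on S) ==> sum F A : span_on S"
 by (induction A rule: infinite_finite_induct) (auto simp: span_on_0 span_on_add)

lemma span_on_smult: fixes F :: "'a::comm_monoid_add \<Rightarrow>\<^sub>0 'k::field" shows "F : span_on S ==> single 0 c * F : span_on S"
 by (auto simp: span_on_def in_keys_iff)

lemma span_on_mult: fixes F G :: "'a::monoid_add \<Rightarrow>\<^sub>0 'k::field"
 assumes "F : span_on S" "G : span_on S" "!!s t. s : S ==> t : S ==> s + t : S" shows "F * G : span_on S"
 using assms Poly_Mapping.keys_mult[of F G] unfolding span_on_def by blast

lemma pm_eval_diff: "pm_eval (F - G) phi = pm_eval F phi - pm_eval G phi" using pm_eval_add[of "F - G" G phi] by simp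

lemma pm_eval_smult: fixes F :: "'a::comm_monoid_add \<Rightarrow>\<^sub>0 'k::field" shows "pm_eval (single 0 c * F) phi = c * pm_eval F phi"
proof -
 have "pm_eval (single 0 c * F) phi = (SUM s:keys F. lookup (single 0 c * F) s * phi s)"
  by (rule pm_eval_superset) (auto simp: in_keys_iff)
 thus ?thesis unfolding lookup_smult by (simp add: pm_eval_def[of F] sum_distrib_left mult.assoc)
qed

lemma cone_fun_add: "cone_fun P (F + G) = (%v. cone_fun P F v + cone_fun P G v)" by (auto simp: cone_fun_def pm_eval_add)

lemma cone_fun_0 [simp]: "cone_fun P 0 = (%_. 0)" by (rule ext) (simp add: cone_fun_def)

lemma cone_fun_sum: "cone_fun P (sum F A) = (%v. SUM i:A. cone_fun P (F i) v)" by (auto simp: cone_fun_def pm_eval_sum)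

lemma cone_fun_smult: "cone_fun P (single 0 c * F) = (%v. c * cone_fun P F v)" by (auto simp: cone_fun_def pm_eval_smult)

lemma cone_fun_mult: fixes F G :: "('n::finite, 'k::field_char_0) lpoly"
 assumes "F : span_on (S_mon P)" "G : span_on (S_mon P)" shows "cone_fun P (F * G) = (%v. cone_fun P F v * cone_fun P G v)"
proof
 fix v
 have "pm_eval (F * G) (cone_val P v) = pm_eval F (cone_val P v) * pm_eval G (cone_val P v)"
  if "v : affine_cone P" by (rule pm_eval_mult) (intro cone_val_add that span_onD[OF assms(1)] span_onD[OF assms(2)])
 thus "cone_fun P (F * G) v = cone_fun P F v * cone_fun P G v" by (simp add: cone_fun_def)
qed

lemma cone_fun_1: "poly_fun P (1 :: ('n::finite lat, 'k::field_char_0) mpoly) = cone_fun P 1"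
proof -
 have "pm_map mono_wt (1 :: ('n lat, 'k) mpoly) = 1" using pm_map_single[of mono_wt 0 1] by simp
 thus ?thesis by (subst poly_fun_eq_cone_fun) (auto simp: polys_in_def)
qed

lemma coord_ring_simps:
 "\<zero>\<^bsub>KX P\<^esub> = (%_. 0)" "\<one>\<^bsub>KX P\<^esub> = poly_fun P 1"
 "g \<oplus>\<^bsub>KX P\<^esub> h = (%v. g v + h v)" "g \<otimes>\<^bsub>KX P\<^esub> h = (%v. g v * h v)"
 "c \<odot>\<^bsub>KX P\<^esub> g = (%v. c * g v)" by (simp_all add: coord_ring_def)

lemma cone_fun_inj: fixes F G :: "('n::finite, 'k::field_char_0) lpoly"
 assumes "F : span_on (S_mon P)" "G : span_on (S_mon P)" shows "cone_fun P F = cone_fun P G \<longleftrightarrow> F = G"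
proof
 assume eq: "cone_fun P F = cone_fun P G"
 have "F - G = 0"
 proof (rule characters_independent)
  fix u :: "'k \<times> ('k ^ 'n)" assume u: "u : big_torus"
  have "pm_eval H (cone_val P (torus_pt P P u)) = pm_eval H (%s. hchar_val s u)"
   if "H : span_on (S_mon P)" for H :: "('n, 'k) lpoly" by (rule pm_eval_cong) (intro cone_val_torus_pt u span_onD[OF that])
  from this[OF assms(1)] this[OF assms(2)] fun_cong[OF eq, of "torus_pt P P u"] torus_pt_cone[OF u, of P]
  show "pm_eval (F - G) (%s. hchar_val s u) = 0" by (simp add: pm_eval_diff cone_fun_def)
 qed
 thus "F = G" by simp
qed simp

lemma cone_fun_eq_0: fixes F :: "('n::finite, 'k::field_char_0) lpoly"
 assumes "F : span_on (S_mon P)" shows "cone_fun P F = (%_. 0) \<longleftrightarrow> F = 0" using cone_fun_inj[OF assms span_on_0] by simp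

subsection \<open>Eigenfunctions and weights\<close>

text \<open>The weight spaces of the coordinate ring are lines, spanned by the characters in \<open>S\<close>.\<close>

lemma eigenfunction_cone_fun: fixes F :: "('n::finite, 'k::field_char_0) lpoly"
 assumes F: "F : span_on (S_mon P)" shows "is_eigenfunction P (cone_fun P F) w \<longleftrightarrow> (EX c. c ~= 0 & F = single (- w) c)"
proof
 assume e: "is_eigenfunction P (cone_fun P F) w"
 define u1 :: "'k \<times> ('k ^ 'n)" where "u1 = (1, \<chi> i. 1)"
 have u1: "u1 : big_torus" by (auto simp: u1_def torus_def)
 define C where "C = cone_fun P F (torus_pt P P u1)"
 have act: "torus_act u (torus_pt P P u1) = torus_pt P P u" for u :: "'k \<times> ('k ^ 'n)"
  by (auto simp: torus_act_eq torus_pt_def u1_def char_val_def)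
 have ev: "pm_eval F (%s. hchar_val s u) = hchar_val (- w) u * C" if u: "u : big_torus"
  for u :: "'k \<times> ('k ^ 'n)"
 proof -
  have "torus_inv (torus_inv u) = u" by (cases u) (simp add: torus_inv_def vec_eq_iff)
  moreover have "cone_fun P F (torus_act (torus_inv (torus_inv u)) (torus_pt P P u1)) = hchar_val w (torus_inv u) * C"
   using e torus_inv_in[OF u] torus_pt_cone[OF u1, of P] by (auto simp: is_eigenfunction_def C_def)
  ultimately have "cone_fun P F (torus_pt P P u) = hchar_val (- w) u * C" by (simp add: act hchar_val_torus_inv hchar_val_uminus[OF u])
  moreover have "pm_eval F (cone_val P (torus_pt P P u)) = pm_eval F (%s. hchar_val s u)"
   by (rule pm_eval_cong) (intro cone_val_torus_pt u span_onD[OF F])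
  ultimately show ?thesis using torus_pt_cone[OF u, of P] by (simp add: cone_fun_def)
 qed
 have "F - single (- w) C = 0" by (rule characters_independent) (simp add: pm_eval_diff ev mult.commute)
 hence "F = single (- w) C" by simp
 moreover have "F ~= 0" using e by (auto simp: is_eigenfunction_def coord_ring_simps)
 ultimately show "EX c. c ~= 0 & F = single (- w) c" by (cases "C = 0") auto
next
 assume "EX c. c ~= 0 & F = single (- w) c"
 then obtain c where c: "c ~= 0" "F = single (- w) c" by blast
 hence w: "- w : S_mon P" using F by (simp add: span_on_def)
 have "cone_fun P F (torus_act (torus_inv u) v) = hchar_val w u * cone_fun P F v"
  if u: "u : big_torus" and v: "v : affine_cone P" for u v using torus_act_cone[OF torus_inv_in[OF u] v] v
  by (simp add: cone_fun_def c cone_val_torus_act[OF v w torus_inv_in[OF u]] hchar_val_torus_inv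
    hchar_val_uminus[OF u] mult_ac)
 moreover have "cone_fun P F ~= (%_. 0)" using c cone_fun_eq_0[OF F] by (metis lookup_single_eq lookup_zero)
 ultimately show "is_eigenfunction P (cone_fun P F) w" using F by (auto simp: is_eigenfunction_def carrier_coord_ring coord_ring_simps)
qed

lemma eigenfunction_iff: fixes g :: "('n::finite, 'k::field_char_0) lfun" shows "is_eigenfunction P g w \<longleftrightarrow>
  - w : S_mon P & (EX c. c ~= 0 & g = cone_fun P (single (- w) c))"
proof
 assume e: "is_eigenfunction P g w"
 then obtain F where F: "F : span_on (S_mon P)" "g = cone_fun P F" by (auto simp: is_eigenfunction_def carrier_coord_ring)
 then obtain c where "c ~= 0" "F = single (- w) c" using e eigenfunction_cone_fun[OF F(1)] by auto
 thus "- w : S_mon P & (EX c. c ~= 0 & g = cone_fun P (single (- w) c))" using F by (auto simp: span_on_def)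
next
 assume "- w : S_mon P & (EX c. c ~= 0 & g = cone_fun P (single (- w) c))"
 then obtain c where c: "- w : S_mon P" "c ~= 0" "g = cone_fun P (single (- w) c)" by blast
 thus "is_eigenfunction P g w" using eigenfunction_cone_fun[OF span_on_single[OF c(1)], of c w] by blast
qed

lemma weight_single: assumes "s : S_mon P" "(c::'k::field_char_0) ~= 0" shows "weight P (cone_fun P (single s c)) = - s" unfolding weight_def
proof (rule the_equality)
 show "is_eigenfunction P (cone_fun P (single s c)) (- s)" using assms by (auto simp: eigenfunction_iff)
next
 fix w assume "is_eigenfunction P (cone_fun P (single s c)) w"
 then obtain b where "b ~= 0" "single s c = single (- w) b" using eigenfunction_cone_fun[OF span_on_single[OF assms(1)]] by blast
 hence "s = - w" using assms(2) by (metis lookup_single_eq lookup_single_not_eq)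
 thus "w = - s" by simp
qed

lemma weight_components_cone_fun: fixes F :: "('n::finite, 'k::field_char_0) lpoly"
 assumes F: "F : span_on (S_mon P)" shows "weight_components P (cone_fun P F) = (%s. cone_fun P (single s (lookup F s))) ` keys F"
  (is "_ = ?c ` _")
proof (intro equalityI subsetI)
 fix g assume "g : weight_components P (cone_fun P F)"
 then obtain D s where D: "finite {s. D s ~= (%_. 0)}"
  "!!s. D s ~= (%_. 0) ==> is_eigenfunction P (D s) s"
  "cone_fun P F = (%v. \<Sum>s | D s ~= (%_. 0). D s v)" and s: "g = D s" "D s ~= (%_. 0)"
  by (auto simp: weight_components_def weight_decomposition_def)
 have "ALL s. EX c. D s ~= (%_. 0) --> - s : S_mon P & c ~= 0 & D s = cone_fun P (single (- s) c)"
  using D(2) unfolding eigenfunction_iff by blast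
 then obtain c where c: "!!s. D s ~= (%_. 0) ==> - s : S_mon P & c s ~= 0 & D s = cone_fun P (single (- s) (c s))" by metis
 have "cone_fun P F = cone_fun P (\<Sum>s | D s ~= (%_. 0). single (- s) (c s))"
  unfolding D(3) cone_fun_sum by (intro ext sum.cong refl) (use c in "metis (mono_tags) mem_Collect_eq")
 hence FF: "F = (\<Sum>s | D s ~= (%_. 0). single (- s) (c s))"
  by (subst (asm) cone_fun_inj[OF F span_on_sum]) (use c in "auto intro: span_on_single")
 have "lookup F (- s) = (\<Sum>t | D t ~= (%_. 0). if t = s then c t else 0)"
  by (subst FF) (simp add: lookup_sum lookup_single when_def cong: if_cong)
 also have "... = c s" using s(2) by (subst sum.delta[OF D(1)]) simp
 finally have l: "lookup F (- s) = c s" .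
 hence "- s : keys F" using c[OF s(2)] by (simp add: in_keys_iff)
 moreover have "g = ?c (- s)" using l c[OF s(2)] s(1) by simp
 ultimately show "g : ?c ` keys F" by blast
next
 fix g assume "g : ?c ` keys F"
 then obtain s where s: "s : keys F" "g = ?c s" by blast
 define D where "D = (%w. ?c (- w))"
 have nz: "?c t ~= (%_. 0) \<longleftrightarrow> t : keys F" for t
 proof (cases "t : keys F")
  case True
  hence "t : S_mon P" using F by (auto simp: span_on_def)
  thus ?thesis using True cone_fun_eq_0[OF span_on_single[OF \<open>t : S_mon P\<close>]]
   by (metis in_keys_iff lookup_single_eq lookup_zero)
 next
  case False
  thus ?thesis by (simp add: in_keys_iff)
 qed
 have set: "{w. D w ~= (%_. 0)} = uminus ` keys F" unfolding D_def nz by force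
 have "weight_decomposition P (cone_fun P F) D" unfolding weight_decomposition_def
 proof (intro conjI allI impI)
  show "finite {w. D w ~= (%_. 0)}" unfolding set by simp
  show "is_eigenfunction P (D w) w" if "D w ~= (%_. 0)" for w
  proof -
   have "- w : keys F" using that unfolding D_def nz .
   thus ?thesis unfolding eigenfunction_iff D_def using F by (auto simp: span_on_def in_keys_iff)
  qed
  have "cone_fun P F = cone_fun P (SUM s:keys F. single s (lookup F s))" by (simp flip: pm_expand)
  also have "... = (%v. SUM s:keys F. ?c s v)" by (simp add: cone_fun_sum)
  also have "... = (%v. SUM w:uminus ` keys F. D w v)" by (simp add: sum.reindex D_def)
  finally show "cone_fun P F = (%v. \<Sum>w | D w ~= (%_. 0). D w v)" by (simp add: set)
 qed
 moreover have "g = D (- s)" "D (- s) ~= (%_. 0)" using s nz by (auto simp: D_def)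
 ultimately show "g : weight_components P (cone_fun P F)" unfolding weight_components_def by blast
qed

lemma fun_degree_cone_fun: fixes F :: "('n::finite, 'k::field_char_0) lpoly"
 assumes "F : span_on (S_mon P)" "F ~= 0" "!!s. s : keys F ==> fst s = int d" shows "fun_degree P (cone_fun P F) = d"
 unfolding fun_degree_def
proof (rule the_equality)
 show "cone_fun P F : homog (KX P) d" unfolding homog_coord_ring using assms by blast
next
 fix e assume "cone_fun P F : homog (KX P) e"
 hence "ALL s:keys F. fst s = int e" using cone_fun_inj[OF assms(1)] unfolding homog_coord_ring by auto
 moreover obtain s where "s : keys F" using assms(2) by (metis keys_eq_empty all_not_in_conv)
 ultimately have "int e = int d" using assms(3) by metis
 thus "e = d" by simp
qed

section \<open>The triangulation by flags of faces\<close>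

lemma linear_order_max: assumes "linear_order_on A r" "finite D" "D ~= {}" "D <= A" shows "EX m:D. ALL x:D. (x, m) : r" using assms(2,3,4)
proof (induction D rule: finite_ne_induct)
 case (singleton x)
 thus ?case using assms(1) by (auto simp: linear_order_on_def partial_order_on_def preorder_on_def refl_on_def)
next
 case (insert x D)
 then obtain m where m: "m : D" "ALL y:D. (y, m) : r" by auto
 have refl: "(x, x) : r" using assms(1) insert.prems by (auto simp: linear_order_on_def partial_order_on_def preorder_on_def refl_on_def)
 have tr: "trans r" using assms(1) by (simp add: linear_order_on_def partial_order_on_def preorder_on_def)
 consider "x = m" | "(x, m) : r" | "(m, x) : r" using assms(1) insert.prems m(1) by (auto simp: linear_order_on_def total_on_def)
 thus ?case
 proof cases
  case 3
  hence "ALL y:insert x D. (y, x) : r" using m refl tr by (auto dest: transD)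
  thus ?thesis by blast
 qed (use m refl in auto)
qed

text \<open>Every face of a polytope, including the empty one, is the zero locus of a linear
  functional on the cone over the polytope that is nonnegative there.\<close>

lemma face_functional: fixes Q :: "(real ^ 'n::finite) set"
 assumes "polytope Q" "F face_of Q" shows "EX l :: real \<times> (real ^ 'n) => real. linear l & (ALL x:Q. 0 <= l (1, x)) &
  (ALL x:Q. l (1, x) = 0 \<longleftrightarrow> x : F)"
proof -
 have "F exposed_face_of Q" using assms exposed_face_of_polyhedron polytope_imp_polyhedron by blast
 then obtain a b where ab: "Q <= {x. a \<bullet> x <= b}" "F = Q Int {x. a \<bullet> x = b}" unfolding exposed_face_of_def by blast
 let ?l = "%z::real \<times> (real ^ 'n). fst z * b - a \<bullet> snd z"
 have "linear ?l" by (rule linearI) (simp_all add: algebra_simps inner_add_right)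
 moreover have "0 <= ?l (1, x)" if "x : Q" for x using ab(1) that by auto
 moreover have "?l (1, x) = 0 \<longleftrightarrow> x : F" if "x : Q" for x using ab(2) that by auto
 ultimately show ?thesis by blast
qed

lemma chain_Union_face: assumes "subset.chain \<A> B" "finite B" "!!F. F : B ==> F face_of Q" shows "\<Union>B face_of Q" "B ~= {} ==> \<Union>B : B"
proof -
 show in_B: "\<Union>B : B" if "B ~= {}" using Union_in_chain[OF assms(2) that assms(1)] .
 show "\<Union>B face_of Q" using in_B assms(3) by (cases "B = {}") auto
qed

lemma chain_subset: assumes "subset.chain \<A> C" "B <= C" shows "subset.chain \<A> B"
proof -
 have "x <= y | y <= x" if "x : B" "y : B" for x y using assms(1) subsetD[OF assms(2)] that by (simp add: subset_chain_def)
 moreover have "B <= \<A>" using assms by (auto simp: subset_chain_def)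
 ultimately show ?thesis by (simp add: subset_chain_def)
qed

lemma convex_hull_image_finite: fixes g :: "'i => 'a::real_vector" assumes "finite C" "inj_on g C"
 shows "x : convex hull (g ` C) \<longleftrightarrow> (EX u. (ALL i:C. 0 <= u i) & sum u C = 1 & x = (SUM i:C. u i *\<^sub>R g i))"
proof
 assume "x : convex hull (g ` C)"
 then obtain u where "ALL y:g ` C. 0 <= u y" "sum u (g ` C) = 1" "(SUM y:g ` C. u y *\<^sub>R y) = x"
  using assms(1) by (auto simp: convex_hull_finite)
 thus "EX u. (ALL i:C. 0 <= u i) & sum u C = 1 & x = (SUM i:C. u i *\<^sub>R g i)"
  using assms(2) by (intro exI[of _ "%i. u (g i)"]) (auto simp: sum.reindex)
next
 assume "EX u. (ALL i:C. 0 <= u i) & sum u C = 1 & x = (SUM i:C. u i *\<^sub>R g i)"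
 then obtain u where u: "ALL i:C. 0 <= u i" "sum u C = 1" "x = (SUM i:C. u i *\<^sub>R g i)" by blast
 show "x : convex hull (g ` C)" unfolding u(3) by (rule convex_sum) (use assms(1) u in "auto intro: hull_inc")
qed

text \<open>A polytope with a point chosen in the relative interior of each face. The choice of a linear
  extension \<open>r\<close> of the inclusion of faces belongs to the data.\<close>

locale face_points =
 fixes P :: "(real ^ 'n::finite) set" and p :: "'n face => real ^ 'n" and r :: "('n face \<times> 'n face) set" assumes polytope_P: "polytope P"
  and p_rel_interior: "!!sig. sig : faces P ==> p sig : rel_interior sig" and lin: "linearization P r"
begin

lemma finite_faces: "finite (faces P)" using finite_polytope_faces[OF polytope_P] by (auto simp: faces_def intro: finite_subset)

lemma faces_face_of: "sig : faces P ==> sig face_of P" by (simp add: faces_def)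

lemma faces_subset: "sig : faces P ==> sig <= P" using faces_face_of face_of_imp_subset by blast

lemma face_of_face: "sig : faces P ==> tau : faces P ==> tau <= sig ==> tau face_of sig"
 by (rule face_of_subset[OF faces_face_of _ faces_subset])

lemma polytope_face: "sig : faces P ==> polytope sig" using polytope_P faces_face_of face_of_polytope_polytope by blast

lemma convex_face: "sig : faces P ==> convex sig" using polytope_face polytope_imp_convex by blast

lemma p_in: "sig : faces P ==> p sig : sig" using p_rel_interior rel_interior_subset by blast

lemma p_in_P: "sig : faces P ==> p sig : P" using p_in faces_subset by blast

lemma p_in_face_iff: assumes "sig : faces P" "tau face_of P" shows "p sig : tau \<longleftrightarrow> sig <= tau"
proof
 assume "p sig : tau"
 hence "tau Int rel_interior sig ~= {}" using p_rel_interior[OF assms(1)] by blast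
 thus "sig <= tau" by (rule subset_of_face_of[OF assms(2) faces_subset[OF assms(1)]])
qed (use p_in[OF assms(1)] in blast)

lemma inj_p: "inj_on p (faces P)"
proof (rule inj_onI)
 fix sig tau assume *: "sig : faces P" "tau : faces P" "p sig = p tau"
 have "sig <= tau" using p_in_face_iff[OF *(1) faces_face_of[OF *(2)]] p_in[OF *(2)] *(3) by simp
 moreover have "tau <= sig" using p_in_face_iff[OF *(2) faces_face_of[OF *(1)]] p_in[OF *(1)] *(3) by simp
 ultimately show "sig = tau" by blast
qed

lemma flag_finite: "flag P C ==> finite C" using finite_faces finite_subset by (auto simp: subset.chain_def)

lemma flag_faces: "flag P C ==> sig : C ==> sig : faces P" by (auto simp: subset.chain_def)

lemma r_total: "sig : faces P ==> tau : faces P ==> (sig, tau) : r | (tau, sig) : r"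
proof -
 assume "sig : faces P" "tau : faces P"
 thus ?thesis using lin by (cases "sig = tau")
   (auto simp: linearization_def linear_order_on_def total_on_def partial_order_on_def
    preorder_on_def refl_on_def)
qed

lemma r_antisym: "(sig, tau) : r ==> (tau, sig) : r ==> sig = tau"
 using lin by (auto simp: linearization_def linear_order_on_def partial_order_on_def antisym_def)

lemma r_subset: "sig : faces P ==> tau : faces P ==> sig <= tau ==> (sig, tau) : r" using lin by (auto simp: linearization_def)

lemma r_max: assumes "D <= faces P" "D ~= {}" shows "EX m:D. ALL x:D. (x, m) : r"
 using linear_order_max[of "faces P" r D] assms finite_faces lin finite_subset by (auto simp: linearization_def)

definition pv :: "'n face => real \<times> (real ^ 'n)" where "pv sig = (1, p sig)"

text \<open>Comparison of two expressions of one vector: a nonnegative one with arbitrary support and one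
  supported on a flag. At the largest face \<open>sig\<close> where they differ, a functional vanishing on the
  smaller members of the flag and nonnegative on the cone over \<open>sig\<close> shows that the coefficient of
  the nonnegative expression is the smaller one. Uniqueness of coordinates, the minimality of the
  nonnegative expression among all chains and the superadditivity of the quasi-valuation all
  come from this one comparison.\<close>

lemma lex_comparison: fixes a b :: "'n face => real" assumes nonneg: "!!sig. sig : faces P ==> 0 <= a sig"
  and C: "flag P C" "!!sig. sig : faces P ==> sig ~: C ==> b sig = 0"
  and eq: "(SUM sig:faces P. a sig *\<^sub>R pv sig) = (SUM sig:faces P. b sig *\<^sub>R pv sig)" and ne: "EX sig:faces P. a sig ~= b sig"
 shows "EX sig:faces P. a sig < b sig & (ALL tau:faces P. (sig, tau) : r & tau ~= sig --> a tau = b tau)"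
proof -
 obtain sig where sig: "sig : faces P" "a sig ~= b sig"
  and max: "!!x. x : faces P ==> a x ~= b x ==> (x, sig) : r" using r_max[of "{sig : faces P. a sig ~= b sig}"] ne by auto
 have above: "a tau = b tau" if "tau : faces P" "(sig, tau) : r" "tau ~= sig" for tau
  using max[OF that(1)] r_antisym[OF that(2)] that(3) by blast
 have "a sig < b sig"
 proof (rule ccontr)
  assume "~ a sig < b sig"
  hence gt: "b sig < a sig" using sig(2) by linarith
  define D where "D = {tau : faces P. (tau, sig) : r}"
  have D: "finite D" "D <= faces P" "sig : D" using finite_faces r_subset[OF sig(1) sig(1)] sig(1) by (auto simp: D_def)
  have split: "(SUM tau:faces P. h tau) = (SUM tau:D. h tau) + (SUM tau:faces P - D. h tau)"
   for h :: "'n face => real \<times> (real ^ 'n)" using sum.subset_diff[OF D(2) finite_faces, of h] by (simp add: add.commute)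
  have "(SUM tau:faces P - D. a tau *\<^sub>R pv tau) = (SUM tau:faces P - D. b tau *\<^sub>R pv tau)"
  proof (rule sum.cong[OF refl])
   fix tau assume "tau : faces P - D"
   hence "a tau = b tau" using r_total[of tau sig] sig(1) D(3) by (intro above) (auto simp: D_def)
   thus "a tau *\<^sub>R pv tau = b tau *\<^sub>R pv tau" by simp
  qed
  hence w: "(SUM tau:D. a tau *\<^sub>R pv tau) = (SUM tau:D. b tau *\<^sub>R pv tau)"
   using eq split[of "%tau. a tau *\<^sub>R pv tau"] split[of "%tau. b tau *\<^sub>R pv tau"] by simp
  have lw: "(SUM tau:D. a tau * l (pv tau)) = (SUM tau:D. b tau * l (pv tau))"
   if "linear l" for l :: "real \<times> (real ^ 'n) => real" using arg_cong[OF w, of l] that by (simp add: linear_sum linear_cmul)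
  have Dnn: "0 <= a tau" if "tau : D" for tau using nonneg D(2) that by blast
  show False
  proof (cases "sig : C")
   case False
   hence a_pos: "0 < a sig" using gt C(2)[OF sig(1)] by simp
   define B where "B = C Int D"
   have B: "flag P B" "finite B" "!!F. F : B ==> F face_of P" using chain_subset[OF C(1), of B] D by (auto simp: B_def intro: faces_face_of)
   note U = chain_Union_face[OF B, simplified]
   obtain l :: "real \<times> (real ^ 'n) => real" where l': "linear l" "ALL x:P. 0 <= l (1, x)"
    "ALL x:P. l (1, x) = 0 \<longleftrightarrow> x : \<Union>B" using face_functional[OF polytope_P U(1)] by blast
   note l = l'(1) l'(2,3)[rule_format]
   have "b tau * l (pv tau) = 0" if tau: "tau : D" for tau
   proof (cases "tau : C")
    case True
    hence "p tau : \<Union>B" using tau p_in D(2) by (auto simp: B_def)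
    thus ?thesis using l(3)[of "p tau"] p_in_P tau D(2) by (auto simp: pv_def)
   next
    case False
    thus ?thesis using C(2) tau D(2) by auto
   qed
   hence "(SUM tau:D. b tau * l (pv tau)) = 0" by (intro sum.neutral ballI)
   hence "(SUM tau:D. a tau * l (pv tau)) = 0" using lw[OF l(1)] by simp
   moreover have "0 <= a tau * l (pv tau)" if "tau : D" for tau using Dnn[OF that] l(2)[of "p tau"] p_in_P that D(2) by (auto simp: pv_def)
   ultimately have "a sig * l (pv sig) = 0" using sum_nonneg_eq_0_iff[OF D(1), of "%tau. a tau * l (pv tau)"] D(3) by blast
   hence "p sig : \<Union>B" using a_pos l(3)[of "p sig"] p_in_P[OF sig(1)] by (simp add: pv_def)
   hence sub: "sig <= \<Union>B" "B ~= {}" using p_in_face_iff[OF sig(1) U(1)] by auto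
   hence UB: "\<Union>B : C" "\<Union>B : D" using U(2) by (auto simp: B_def)
   hence "(sig, \<Union>B) : r" "(\<Union>B, sig) : r" using r_subset[OF sig(1) _ sub(1)] by (auto simp: D_def)
   hence "sig = \<Union>B" by (rule r_antisym)
   thus False using UB(1) False by simp
  next
   case True
   define B where "B = C Int D - {sig}"
   have B_sub: "tau <= sig" if "tau : B" for tau
   proof -
    have "tau : faces P" "tau <= sig | sig <= tau" "(tau, sig) : r" "tau ~= sig"
     using that True C(1) by (auto simp: B_def D_def subset.chain_def)
    thus ?thesis using r_subset[OF sig(1)] r_antisym by blast
   qed
   have B: "flag P B" "finite B" "!!F. F : B ==> F face_of sig"
   proof -
    show "flag P B" by (rule chain_subset[OF C(1)]) (auto simp: B_def)
    show "finite B" using D(1) by (simp add: B_def)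
    show "F face_of sig" if "F : B" for F using face_of_face[OF sig(1) _ B_sub[OF that]] that D(2) by (auto simp: B_def)
   qed
   note U = chain_Union_face[OF B, simplified]
   obtain l :: "real \<times> (real ^ 'n) => real" where l': "linear l" "ALL x:P. 0 <= l (1, x)"
    "ALL x:P. l (1, x) = 0 \<longleftrightarrow> x : sig" using face_functional[OF polytope_P faces_face_of[OF sig(1)]] by blast
   note l = l'(1) l'(2,3)[rule_format]
   obtain k :: "real \<times> (real ^ 'n) => real" where k': "linear k" "ALL x:sig. 0 <= k (1, x)"
    "ALL x:sig. k (1, x) = 0 \<longleftrightarrow> x : \<Union>B" using face_functional[OF polytope_face[OF sig(1)] U(1)] by blast
   note k = k'(1) k'(2,3)[rule_format]
   have in_sigma: "p tau : sig" if "tau : D" "tau : C" for tau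
    using B_sub[of tau] p_in[of tau] that D(2) by (cases "tau = sig") (auto simp: B_def)
   have "b tau * l (pv tau) = 0" if tau: "tau : D" for tau using in_sigma[OF tau] l(3)[of "p tau"] p_in_P[of tau] C(2)[of tau] tau D(2)
    by (cases "tau : C") (auto simp: pv_def)
   hence "(SUM tau:D. b tau * l (pv tau)) = 0" by (intro sum.neutral ballI)
   hence "(SUM tau:D. a tau * l (pv tau)) = 0" using lw[OF l(1)] by simp
   moreover have "0 <= a tau * l (pv tau)" if "tau : D" for tau using Dnn[OF that] l(2)[of "p tau"] p_in_P that D(2) by (auto simp: pv_def)
   ultimately have "a tau * l (pv tau) = 0" if "tau : D" for tau
    using sum_nonneg_eq_0_iff[OF D(1), of "%tau. a tau * l (pv tau)"] that by blast
   hence a_sigma: "a tau = 0 | p tau : sig" if "tau : D" for tau using l(3)[of "p tau"] p_in_P[of tau] that D(2) by (auto simp: pv_def)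
   have "b tau * k (pv tau) = 0" if tau: "tau : D" "tau ~= sig" for tau
   proof (cases "tau : C")
    case True
    hence "p tau : \<Union>B" using tau p_in D(2) by (auto simp: B_def)
    thus ?thesis using k(3)[of "p tau"] in_sigma[OF tau(1) True] by (auto simp: pv_def)
   next
    case False
    thus ?thesis using C(2) tau D(2) by auto
   qed
   hence "(SUM tau:D. b tau * k (pv tau)) = (SUM tau:D. if tau = sig then b sig * k (pv sig) else 0)" by (intro sum.cong refl) auto
   hence "(SUM tau:D. a tau * k (pv tau)) = b sig * k (pv sig)" using lw[OF k(1)] D by simp
   moreover have "0 <= a tau * k (pv tau)" if "tau : D" for tau using Dnn[OF that] a_sigma[OF that] k(2)[of "p tau"] by (auto simp: pv_def)
   hence "a sig * k (pv sig) <= (SUM tau:D. a tau * k (pv tau))" using D by (intro member_le_sum) auto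
   ultimately have le: "a sig * k (pv sig) <= b sig * k (pv sig)" by simp
   have "p sig ~: \<Union>B"
   proof
    assume "p sig : \<Union>B"
    then obtain tau where tau: "tau : B" "p sig : tau" by blast
    hence "tau : faces P" "tau ~= sig" using D(2) by (auto simp: B_def)
    hence "sig <= tau" using p_in_face_iff[OF sig(1) faces_face_of] tau(2) by blast
    thus False using B_sub[OF tau(1)] \<open>tau ~= sig\<close> by blast
   qed
   hence "0 < k (pv sig)" using k(2,3)[OF p_in[OF sig(1)]] by (simp add: pv_def less_le)
   thus False using le gt by simp
  qed
 qed
 thus ?thesis using sig(1) above by blast
qed

lemma flag_independent: assumes C: "flag P C" and eq: "(SUM sig:C. b sig *\<^sub>R pv sig) = 0" and sig: "sig : C" shows "b sig = 0"
proof (rule ccontr)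
 assume nz: "b sig ~= 0"
 define b' where "b' = (%tau. if tau : C then b tau else 0)"
 have "C <= faces P" using C by (auto simp: subset.chain_def)
 hence s: "(SUM tau:faces P. (c * b' tau) *\<^sub>R pv tau) = 0" for c :: real
 proof -
  have "(SUM tau:faces P. (c * b' tau) *\<^sub>R pv tau) = (SUM tau:C. (c * b' tau) *\<^sub>R pv tau)"
   using \<open>C <= faces P\<close> finite_faces by (intro sum.mono_neutral_right) (auto simp: b'_def)
  also have "... = c *\<^sub>R (SUM tau:C. b tau *\<^sub>R pv tau)" by (auto simp: scaleR_sum_right b'_def intro!: sum.cong)
  finally show ?thesis using eq by simp
 qed
 have *: "EX sig:faces P. 0 < c * b' sig & (ALL tau:faces P. (sig, tau) : r & tau ~= sig --> 0 = c * b' tau)"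
  if "c ~= 0" for c :: real by (rule lex_comparison[OF _ C])
   (use s[of c] nz sig \<open>C <= faces P\<close> that in "auto simp: b'_def intro!: bexI[of _ sig]")
 obtain s where s: "s : faces P" "0 < b' s" "!!tau. tau : faces P ==> (s, tau) : r ==> tau ~= s ==> b' tau = 0" using *[of 1] by auto
 obtain t where t: "t : faces P" "b' t < 0" "!!tau. tau : faces P ==> (t, tau) : r ==> tau ~= t ==> b' tau = 0" using *[of "- 1"] by auto
 have "s ~= t" using s(2) t(2) by auto
 moreover have "(s, t) : r | (t, s) : r" using r_total s(1) t(1) by blast
 ultimately show False using s t by force
qed

subsection \<open>The simplices cover the polytope\<close>

text \<open>A point \<open>x\<close> of a face \<open>sig\<close> other than \<open>p sig\<close> lies on the segment from \<open>p sig\<close> to the point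
  where the ray through \<open>x\<close> leaves \<open>sig\<close>, and that point lies on a smaller face.\<close>

lemma flag_simplices_cover: assumes "sig : faces P" "x : sig" shows "EX C. flag P C & (ALL tau:C. tau <= sig) & x : convex hull (p ` C)" using assms
proof (induction "nat (aff_dim sig + 1)" arbitrary: sig x rule: less_induct)
 case less
 show ?case
 proof (cases "x = p sig")
  case True
  thus ?thesis using less.prems by (intro exI[of _ "{sig}"]) (auto simp: subset.chain_def)
 next
  case False
  note pt = polytope_face[OF less.prems(1)]
  have px: "p sig + (x - p sig) : affine hull sig" using less.prems(2) by (simp add: hull_inc)
  obtain d where d: "0 < d" "p sig + d *\<^sub>R (x - p sig) : rel_frontier sig"
   using ray_to_rel_frontier[OF polytope_imp_bounded[OF pt] p_rel_interior[OF less.prems(1)] px] False by auto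
  define y where "y = p sig + d *\<^sub>R (x - p sig)"
  have "1 <= d"
  proof (rule ccontr)
   assume "~ 1 <= d"
   hence "x - (1 - d) *\<^sub>R (x - p sig) : rel_interior sig"
    using d(1) by (intro rel_interior_convex_shrink convex_face p_rel_interior less.prems) auto
   moreover have "x - (1 - d) *\<^sub>R (x - p sig) = y" by (simp add: y_def algebra_simps)
   ultimately show False using d(2) by (simp add: rel_frontier_def y_def)
  qed
  obtain F where F: "F face_of sig" "F ~= sig" "y : F"
   using d(2) rel_frontier_of_polyhedron_alt[OF polytope_imp_polyhedron[OF pt]] by (auto simp: y_def)
  have FP: "F : faces P" using F face_of_trans[OF F(1) faces_face_of[OF less.prems(1)]] by (auto simp: faces_def)
  have "aff_dim F < aff_dim sig" by (rule face_of_aff_dim_lt[OF convex_face[OF less.prems(1)] F(1,2)])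
  moreover have "0 <= aff_dim F" using F(3) aff_dim_geq[of F] aff_dim_empty[of F] by force
  ultimately have "nat (aff_dim F + 1) < nat (aff_dim sig + 1)" by simp
  from less.hyps[OF this FP F(3)] obtain C where C: "flag P C" "ALL tau:C. tau <= F"
   "y : convex hull (p ` C)" by blast
  have Fs: "F <= sig" using F(1) face_of_imp_subset by blast
  have "flag P (insert sig C)" using C(1,2) Fs less.prems(1) by (auto simp: subset.chain_def)
  moreover have "ALL tau:insert sig C. tau <= sig" using C(2) Fs by auto
  moreover have "x : convex hull (p ` insert sig C)"
  proof -
   have "x = (1 - 1 / d) *\<^sub>R p sig + (1 / d) *\<^sub>R y" using d(1) by (simp add: y_def algebra_simps)
   moreover have "p sig : convex hull (p ` insert sig C)" by (simp add: hull_inc)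
   moreover have "y : convex hull (p ` insert sig C)" using C(3) hull_mono[of "p ` C" "p ` insert sig C" convex] by auto
   ultimately show ?thesis using convexD[OF convex_convex_hull, of "p sig" "p ` insert sig C" y "1 - 1 / d" "1 / d"] \<open>1 <= d\<close>
    by simp
  qed
  ultimately show ?thesis by blast
 qed
qed

lemma in_cone_over_simplex: assumes "flag P C"
 shows "z : cone_over (convex hull (p ` C)) \<longleftrightarrow> (EX a. (ALL sig:C. 0 <= a sig) & z = (SUM sig:C. a sig *\<^sub>R pv sig))"
proof -
 note fin = flag_finite[OF assms]
 have inj: "inj_on p C" using inj_p assms inj_on_subset by (auto simp: subset.chain_def)
 show ?thesis
 proof
  assume "z : cone_over (convex hull (p ` C))"
  then consider "z = 0" | c q where "0 <= c" "q : convex hull (p ` C)" "z = (c, c *\<^sub>R q)" by (auto simp: cone_over_def)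
  thus "EX a. (ALL sig:C. 0 <= a sig) & z = (SUM sig:C. a sig *\<^sub>R pv sig)"
  proof cases
   case 1
   thus ?thesis by (intro exI[of _ "%_. 0"]) auto
  next
   case 2
   then obtain u where u: "ALL i:C. 0 <= u i" "sum u C = 1" "q = (SUM i:C. u i *\<^sub>R p i)"
    unfolding convex_hull_image_finite[OF fin inj] by blast
   have "z = (SUM sig:C. (c * u sig) *\<^sub>R pv sig)" using 2(3) u(2,3) by (simp add: prod_eq_iff fst_sum snd_sum pv_def scaleR_sum_right
      flip: sum_distrib_left)
   thus ?thesis using 2(1) u(1) by (intro exI[of _ "%sig. c * u sig"]) auto
  qed
 next
  assume "EX a. (ALL sig:C. 0 <= a sig) & z = (SUM sig:C. a sig *\<^sub>R pv sig)"
  then obtain a where a: "ALL sig:C. 0 <= a sig" "z = (SUM sig:C. a sig *\<^sub>R pv sig)" by blast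
  have z: "z = (sum a C, SUM sig:C. a sig *\<^sub>R p sig)" by (simp add: a(2) prod_eq_iff fst_sum snd_sum pv_def)
  show "z : cone_over (convex hull (p ` C))"
  proof (cases "sum a C = 0")
   case True
   hence "ALL sig:C. a sig = 0" using a(1) fin by (simp add: sum_nonneg_eq_0_iff)
   hence "z = 0" by (simp add: a(2))
   thus ?thesis by (simp add: cone_over_def)
  next
   case False
   hence pos: "0 < sum a C" using a(1) by (simp add: less_le sum_nonneg)
   have "(SUM sig:C. (a sig / sum a C) *\<^sub>R p sig) : convex hull (p ` C)" unfolding convex_hull_image_finite[OF fin inj]
    using a(1) pos by (intro exI[of _ "%sig. a sig / sum a C"]) (auto simp flip: sum_divide_distrib)
   moreover have "z = (sum a C, sum a C *\<^sub>R (SUM sig:C. (a sig / sum a C) *\<^sub>R p sig))"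
    using False by (simp add: z scaleR_sum_right)
   ultimately show ?thesis using pos by (auto simp: cone_over_def)
  qed
 qed
qed

subsection \<open>Maximal chains of faces\<close>

lemma chain_aff_dim_less: assumes "sig : faces P" "tau : faces P" "sig \<subset> tau" shows "aff_dim sig < aff_dim tau"
 using face_of_aff_dim_lt[OF convex_face[OF assms(2)] face_of_face[OF assms(2,1)]] assms(3) by blast

lemma aff_dim_faces_nonneg: "sig : faces P ==> 0 <= aff_dim sig" using p_in[of sig] aff_dim_geq[of sig] aff_dim_empty[of sig] by force

lemma max_chain_flag: "max_chain P C ==> flag P C" by (simp add: subset.maxchain_def)

lemma max_chain_insert: assumes "max_chain P C" "F : faces P" "!!tau. tau : C ==> F <= tau | tau <= F" shows "F : C"
proof (rule ccontr)
 assume "F ~: C"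
 moreover have "flag P (insert F C)" using max_chain_flag[OF assms(1)] assms(2,3) by (auto simp: subset.chain_def)
 ultimately show False using assms(1) by (auto simp: subset.maxchain_def)
qed

lemma flag_extends_to_max_chain: assumes "flag P C" obtains D where "max_chain P D" "C <= D"
proof -
 have fin: "finite {D. flag P D & C <= D}" using finite_subset[of "{D. flag P D & C <= D}" "Pow (faces P)"] finite_faces
  by (auto simp: subset.chain_def)
 moreover have "{D. flag P D & C <= D} ~= {}" using assms by blast
 ultimately have "EX D:{D. flag P D & C <= D}. ALL E:{D. flag P D & C <= D}. D <= E --> D = E" by (rule finite_has_maximal)
 then obtain D where D: "D : {D. flag P D & C <= D}"
  "ALL E:{D. flag P D & C <= D}. D <= E --> D = E" ..
 have "~ D \<subset> E" if "flag P E" for E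
 proof
  assume "D \<subset> E"
  hence "E : {D. flag P D & C <= D}" using that D(1) by auto
  thus False using D(2) \<open>D \<subset> E\<close> by blast
 qed
 hence "max_chain P D" using D(1) unfolding subset.maxchain_def by simp
 thus thesis by (rule that) (use D(1) in simp)
qed

lemma max_chain_has_facet: assumes C: "max_chain P C" and sig: "sig : C" and dim: "0 < aff_dim sig" shows "EX tau:C. aff_dim tau = aff_dim sig - 1"
proof -
 note flag = max_chain_flag[OF C]
 have sigP: "sig : faces P" using flag sig flag_faces by blast
 define B where "B = {tau : C. tau \<subset> sig}"
 have B: "flag P B" "finite B" "!!F. F : B ==> F face_of sig"
  proof -
  show "flag P B" by (rule chain_subset[OF flag]) (auto simp: B_def)
  show "finite B" using flag_finite[OF flag] by (simp add: B_def)
  show "F face_of sig" if "F : B" for F using face_of_face[OF sigP flag_faces[OF flag]] that by (auto simp: B_def)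
 qed
 note U = chain_Union_face[OF B, simplified]
 have ph: "polyhedron sig" using polytope_face[OF sigP] polytope_imp_polyhedron by blast
 obtain F where F: "F facet_of sig" "\<Union>B <= F"
 proof (cases "\<Union>B = {}")
  case True
  obtain F where "F facet_of sig" by (rule polytope_facet_exists[OF polytope_face[OF sigP] dim])
  thus thesis by (rule that) (use True in blast)
 next
  case False
  hence "\<Union>B : B" using U(2) by auto
  hence ne: "\<Union>B ~= sig" by (auto simp: B_def)
  obtain F where "F facet_of sig" "\<Union>B <= F" by (rule face_of_polyhedron_subset_facet[OF ph U(1) False ne])
  thus thesis by (rule that)
 qed
 have F': "F face_of sig" "F ~= {}" "aff_dim F = aff_dim sig - 1" using F(1) by (auto simp: facet_of_def)
 hence FP: "F : faces P" using face_of_trans[OF F'(1) faces_face_of[OF sigP]] by (simp add: faces_def)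
 have "F : C"
 proof (rule max_chain_insert[OF C FP])
  fix tau assume tau: "tau : C"
  hence "tau \<subset> sig | sig <= tau" using flag sig by (auto simp: subset.chain_def)
  thus "F <= tau | tau <= F" using F(2) face_of_imp_subset[OF F'(1)] tau by (auto simp: B_def)
 qed
 thus ?thesis using F'(3) by blast
qed

lemma max_chain_aff_dim: assumes C: "max_chain P C" and full: "aff_dim P = int CARD('n)" shows "bij_betw aff_dim C {0..int CARD('n)}"
proof -
 note flag = max_chain_flag[OF C]
 have "P ~= {}" using full by auto
 hence PP: "P : faces P" using polytope_imp_convex[OF polytope_P] by (simp add: faces_def face_of_refl)
 have PC: "P : C" by (rule max_chain_insert[OF C PP]) (use flag_faces[OF flag] faces_subset in blast)
 have "EX tau:C. aff_dim tau = int CARD('n) - int k" if "k <= CARD('n)" for k using that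
 proof (induction k)
  case 0
  thus ?case using PC full by auto
 next
  case (Suc k)
  then obtain tau where tau: "tau : C" "aff_dim tau = int CARD('n) - int k" by auto
  then obtain tau' where "tau' : C" "aff_dim tau' = aff_dim tau - 1" using max_chain_has_facet[OF C tau(1)] Suc.prems by auto
  thus ?case using tau(2) by (intro bexI[of _ tau']) auto
 qed
 hence surj: "EX tau:C. aff_dim tau = i" if "0 <= i" "i <= int CARD('n)" for i
 proof -
  have "nat (int CARD('n) - i) <= CARD('n)" using that by simp
  from \<open>!!k. k <= CARD('n) ==> EX tau:C. aff_dim tau = int CARD('n) - int k\<close>[OF this]
  show ?thesis using that by auto
 qed
 have "inj_on aff_dim C"
 proof (rule inj_onI, rule ccontr)
  fix sig tau assume *: "sig : C" "tau : C" "aff_dim sig = aff_dim tau" "sig ~= tau"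
  hence "sig \<subset> tau | tau \<subset> sig" using flag by (auto simp: subset.chain_def)
  thus False using chain_aff_dim_less flag_faces[OF flag] * by (metis less_irrefl)
 qed
 moreover have "aff_dim ` C = {0..int CARD('n)}"
 proof
  have "aff_dim sig <= int CARD('n)" if "sig : C" for sig using aff_dim_subset[OF faces_subset[OF flag_faces[OF flag that]]] full by simp
  thus "aff_dim ` C <= {0..int CARD('n)}" using aff_dim_faces_nonneg flag_faces[OF flag] by auto
  show "{0..int CARD('n)} <= aff_dim ` C"
  proof
   fix i assume "i : {0..int CARD('n)}"
   then obtain tau where "tau : C" "aff_dim tau = i" using surj[of i] by auto
   thus "i : aff_dim ` C" by blast
  qed
 qed
 ultimately show ?thesis by (simp add: bij_betw_def)
qed

lemma card_max_chain: assumes "max_chain P C" "aff_dim P = int CARD('n)" shows "card C = CARD('n) + 1"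
proof -
 have "card C = card {0..int CARD('n)}" by (rule bij_betw_same_card[OF max_chain_aff_dim[OF assms]])
 thus ?thesis by simp
qed

end

subsection \<open>Rational coordinates\<close>

text \<open>The lattice \<open>\<int> \<times> M\<close> inside a rational vector space of dimension \<open>n + 1\<close>.\<close>

definition rat_hvec :: "'n::finite hlat => rat ^ ('n option)" where
 "rat_hvec s = (\<chi> i. case i of None => of_int (fst s) | Some j => of_int (snd s $ j))"

lemma rat_hvec_eq_iff:
 "rat_hvec s = (SUM i:C. a i *s rat_hvec (g i)) \<longleftrightarrow> of_int (fst s) = (SUM i:C. a i * of_int (fst (g i))) &
   (ALL j. of_int (snd s $ j) = (SUM i:C. a i * of_int (snd (g i) $ j)))"
proof -
 have "rat_hvec s = (SUM i:C. a i *s rat_hvec (g i)) \<longleftrightarrow> (ALL k. rat_hvec s $ k = (SUM i:C. a i * rat_hvec (g i) $ k))"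
  by (simp add: vec_eq_iff)
 also have "... \<longleftrightarrow> rat_hvec s $ None = (SUM i:C. a i * rat_hvec (g i) $ None) &
   (ALL j. rat_hvec s $ Some j = (SUM i:C. a i * rat_hvec (g i) $ Some j))"
  by (metis option.exhaust)
 finally show ?thesis by (simp add: rat_hvec_def)
qed

lemma inj_rat_hvec: "inj rat_hvec"
proof (rule injI)
 fix s t :: "'n::finite hlat" assume "rat_hvec s = rat_hvec t"
 hence "rat_hvec s $ i = rat_hvec t $ i" for i by simp
 from this[of None] this[of "Some _"] show "s = t" by (simp add: rat_hvec_def prod_eq_iff vec_eq_iff)
qed

lemma real_hvec_sum_rat:
 assumes "rat_hvec s = (SUM i:C. a i *s rat_hvec (g i))" shows "real_hvec s = (SUM i:C. real_of_rat (a i) *\<^sub>R real_hvec (g i))"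
proof -
 have "real_of_rat (of_int (fst s)) = real_of_rat (SUM i:C. a i * of_int (fst (g i)))" using assms unfolding rat_hvec_eq_iff by simp
 moreover have "real_of_rat (of_int (snd s $ j)) = real_of_rat (SUM i:C. a i * of_int (snd (g i) $ j))" for j
  using assms unfolding rat_hvec_eq_iff by simp
 ultimately show ?thesis by (simp add: real_hvec_def real_vec_def prod_eq_iff vec_eq_iff fst_sum snd_sum of_rat_sum of_rat_mult)
qed

text \<open>Integer vectors that are independent over the reals form a rational basis as soon as their
  number is \<open>n + 1\<close>.\<close>

lemma rat_coordinates_exist: fixes g :: "'i => 'n::finite hlat" assumes "finite C" "card C = CARD('n) + 1"
  and indep: "!!b i. (SUM i:C. b i *\<^sub>R real_hvec (g i)) = 0 ==> i : C ==> b i = (0::real)"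
 obtains a where "rat_hvec s = (SUM i:C. a i *s rat_hvec (g i))"
proof -
 let ?B = "(%i. rat_hvec (g i)) ` C"
 have ind: "a i = 0" if "(SUM i:C. a i *s rat_hvec (g i)) = 0" "i : C" for a i
 proof -
  have "rat_hvec 0 = (SUM i:C. a i *s rat_hvec (g i))" using that(1) by (simp add: rat_hvec_def vec_eq_iff split: option.split)
  from real_hvec_sum_rat[OF this] have "(SUM i:C. real_of_rat (a i) *\<^sub>R real_hvec (g i)) = 0"
   by (simp add: real_hvec_def real_vec_def prod_eq_iff vec_eq_iff)
  thus ?thesis using indep[of "%i. real_of_rat (a i)"] that(2) by simp
 qed
 have inj: "inj_on (%i. rat_hvec (g i)) C"
 proof (rule inj_onI, rule ccontr)
  fix i j assume ij: "i : C" "j : C" "rat_hvec (g i) = rat_hvec (g j)" "i ~= j"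
  define a where "a k = (if k = i then 1 else if k = j then - 1 else (0::rat))" for k
  have "(SUM k:C. a k *s rat_hvec (g k)) = (SUM k:{i, j}. a k *s rat_hvec (g k))"
   using ij assms(1) by (intro sum.mono_neutral_right) (auto simp: a_def)
  also have "... = 0" using ij by (simp add: a_def)
  finally show False using ind[of a i] ij(1) by (simp add: a_def)
 qed
 have "vec.independent ?B"
 proof (rule vec.independent_if_scalars_zero)
  fix u x assume "(SUM x:?B. u x *s x) = 0" "x : ?B"
  thus "u x = 0" using ind[of "%i. u (rat_hvec (g i))"] by (auto simp: sum.reindex[OF inj])
 qed (use assms(1) in auto)
 moreover have "vec.dim (UNIV :: (rat ^ ('n option)) set) <= card ?B" unfolding vec_dim_card using assms(2) card_image[OF inj] by simp
 ultimately have "UNIV <= vec.span ?B" by (intro vec.card_ge_dim_independent) auto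
 hence "rat_hvec s : vec.span ?B" by blast
 then obtain u where "rat_hvec s = (SUM x:?B. u x *s x)" using vec.span_finite[of ?B] assms(1) by auto
 thus thesis using that[of "%i. u (rat_hvec (g i))"] by (simp add: sum.reindex[OF inj])
qed

section \<open>The lexicographic order\<close>

definition qvecs :: "(real ^ 'n::finite) set => 'n qvec set" where
 "qvecs P = {a. qsupp a <= faces P}"

lemma qvecs_eqI: assumes "a : qvecs P" "b : qvecs P" "!!sig. sig : faces P ==> a sig = b sig" shows "a = b"
proof
 fix sig
 show "a sig = b sig"
 proof (cases "sig : faces P")
  case False
  hence "a sig = 0" "b sig = 0" using assms(1,2) by (auto simp: qvecs_def qsupp_def)
  thus ?thesis by simp
 qed (rule assms(3))
qed

context face_points begin

lemma lex_less_irrefl: "~ lex_less P r a a" by (simp add: lex_less_def)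

lemma r_trans: "(x, y) : r ==> (y, z) : r ==> (x, z) : r"
 using lin by (auto simp: linearization_def linear_order_on_def partial_order_on_def preorder_on_def dest: transD)

lemma lex_less_trans: assumes "lex_less P r a b" "lex_less P r b c" shows "lex_less P r a c"
proof -
 obtain s where s: "s : faces P" "a s < b s"
  "ALL tau:faces P. (s, tau) : r & tau ~= s --> a tau = b tau" using assms(1) unfolding lex_less_def by blast
 obtain t where t: "t : faces P" "b t < c t"
  "ALL tau:faces P. (t, tau) : r & tau ~= t --> b tau = c tau" using assms(2) unfolding lex_less_def by blast
 consider "s = t" | "(s, t) : r" "s ~= t" | "(t, s) : r" "s ~= t" using r_total s(1) t(1) by blast
 thus ?thesis
 proof cases
  case 1
  thus ?thesis unfolding lex_less_def using s t by (intro bexI[of _ s]) auto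
 next
  case 2
  hence "a t < c t" using s(3) t by auto
  moreover have "a tau = c tau" if "tau : faces P" "(t, tau) : r" "tau ~= t" for tau
  proof -
   have "(s, tau) : r" by (rule r_trans[OF 2(1) that(2)])
   moreover have "tau ~= s" using 2 that(2) r_antisym by blast
   ultimately show ?thesis using s(3) t(3) that by auto
  qed
  ultimately show ?thesis unfolding lex_less_def using t(1) by blast
 next
  case 3
  hence "a s < c s" using s t(3) by auto
  moreover have "a tau = c tau" if "tau : faces P" "(s, tau) : r" "tau ~= s" for tau
  proof -
   have "(t, tau) : r" by (rule r_trans[OF 3(1) that(2)])
   moreover have "tau ~= t" using 3 that(2) r_antisym by blast
   ultimately show ?thesis using s(3) t(3) that by auto
  qed
  ultimately show ?thesis unfolding lex_less_def using s(1) by blast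
 qed
qed

lemma lex_less_total: assumes "a : qvecs P" "b : qvecs P" "a ~= b" shows "lex_less P r a b | lex_less P r b a"
proof -
 have "{sig : faces P. a sig ~= b sig} ~= {}" using qvecs_eqI[OF assms(1,2)] assms(3) by auto
 then obtain m where m: "m : faces P" "a m ~= b m"
  "!!x. x : faces P ==> a x ~= b x ==> (x, m) : r" using r_max[of "{sig : faces P. a sig ~= b sig}"] by auto
 have eq: "a tau = b tau" if "tau : faces P" "(m, tau) : r" "tau ~= m" for tau using m(3)[OF that(1)] r_antisym[OF that(2)] that(3) by auto
 show ?thesis
 proof (cases "a m < b m")
  case True
  thus ?thesis using m(1) eq unfolding lex_less_def by auto
 next
  case False
  hence "b m < a m" using m(2) by simp
  hence "lex_less P r b a" using m(1) eq unfolding lex_less_def by (intro bexI[of _ m]) auto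
  thus ?thesis ..
 qed
qed

lemma lex_le_refl: "lex_le P r a a" by (simp add: lex_le_def)

lemma lex_le_trans: "lex_le P r a b ==> lex_le P r b c ==> lex_le P r a c" by (auto simp: lex_le_def intro: lex_less_trans)

lemma lex_le_antisym: "lex_le P r a b ==> lex_le P r b a ==> a = b"
 using lex_less_trans[of a b a] lex_less_irrefl[of a] by (auto simp: lex_le_def)

lemma lex_less_le_trans: "lex_less P r a b ==> lex_le P r b c ==> lex_less P r a c" by (auto simp: lex_le_def intro: lex_less_trans)

lemma lex_min_eqI: assumes "a : B" "!!b. b : B ==> lex_le P r a b" shows "lex_min P r B = a" unfolding lex_min_def
proof (rule the_equality)
 show "a : B & (ALL b:B. lex_le P r a b)" using assms by simp
 fix c assume "c : B & (ALL b:B. lex_le P r c b)"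
 thus "c = a" using assms by (intro lex_le_antisym) simp_all
qed

lemma lex_min_exists: assumes "finite B" "B ~= {}" "B <= qvecs P" shows "EX a:B. ALL b:B. lex_le P r a b" using assms
proof (induction B rule: finite_ne_induct)
 case (singleton x)
 thus ?case by (simp add: lex_le_refl)
next
 case (insert x B)
 then obtain a where a: "a : B" "ALL b:B. lex_le P r a b" by auto
 have "lex_le P r a x | lex_le P r x a" using lex_less_total[of a x] insert.prems a(1) by (auto simp: lex_le_def)
 thus ?case
 proof
  assume "lex_le P r a x"
  thus ?thesis using a by blast
 next
  assume x: "lex_le P r x a"
  have "lex_le P r x b" if "b : insert x B" for b using that a(2) lex_le_trans[OF x] lex_le_refl by auto
  thus ?thesis by blast
 qed
qed

lemma lex_min_props: assumes "finite B" "B ~= {}" "B <= qvecs P" shows "lex_min P r B : B"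
proof -
 obtain a where a: "a : B" "ALL b:B. lex_le P r a b" using lex_min_exists[OF assms] by blast
 hence "lex_min P r B = a" by (intro lex_min_eqI) auto
 thus "lex_min P r B : B" using a by simp
qed

end

section \<open>The quasi-valuation\<close>

locale stratified =
 fixes P :: "(real ^ 'n::finite) set" and f :: "'n face => ('n, 'k::field_char_0) lfun" and r :: "('n face \<times> 'n face) set"
 assumes normal: "normal_lattice_polytope P" and full: "aff_dim P = int CARD('n)"
  and strat: "EX X. seshadri_stratification P X f" and linear: "linearization P r"
begin

abbreviation "S \<equiv> S_mon P"

definition vertex :: "'n face => real ^ 'n" where "vertex sig = snd (weight_point P (f sig))"

definition gen :: "'n face => 'n hlat" where "gen sig = - weight P (f sig)"

definition fdeg :: "'n face => nat" where "fdeg sig = fun_degree P (f sig)"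

lemma stratD: assumes "sig : faces P" shows "EX c. c ~= 0 & f sig = cone_fun P (single (gen sig) c)" "gen sig : S"
  "fst (gen sig) = int (fdeg sig)" "1 <= fdeg sig" "vertex sig : rel_interior sig"
  "real_hvec (gen sig) = real (fdeg sig) *\<^sub>R (1, vertex sig)"
proof -
 obtain w where w: "is_eigenfunction P (f sig) w" and d: "1 <= fdeg sig"
  and v: "weight_point P (f sig) : {1} \<times> rel_interior sig" using strat assms unfolding seshadri_stratification_def fdeg_def by blast
 obtain c where c: "- w : S" "c ~= 0" "f sig = cone_fun P (single (- w) c)" using w unfolding eigenfunction_iff by blast
 have g: "gen sig = - w" unfolding gen_def c(3) weight_single[OF c(1,2)] by simp
 show "gen sig : S" unfolding g by (rule c(1))
 show "EX c. c ~= 0 & f sig = cone_fun P (single (gen sig) c)" unfolding g using c(2,3) by (intro exI[of _ c] conjI)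
 have nz: "single (- w) c ~= 0" using c(2) by (metis lookup_single_eq lookup_zero)
 have "fun_degree P (f sig) = nat (fst (- w))" unfolding c(3) by (rule fun_degree_cone_fun[OF span_on_single[OF c(1)] nz])
   (use c(2) S_mon_fst_nonneg[OF c(1)] in auto)
 thus "fst (gen sig) = int (fdeg sig)" using S_mon_fst_nonneg[OF c(1)] by (simp add: g fdeg_def)
 show "1 <= fdeg sig" by (rule d)
 show "vertex sig : rel_interior sig" using v by (auto simp: vertex_def)
 have "real_hvec (gen sig) = - real_hvec (weight P (f sig))" by (simp add: gen_def real_hvec_def real_vec_def vec_eq_iff)
 hence wp: "weight_point P (f sig) = (1 / real (fdeg sig)) *\<^sub>R real_hvec (gen sig)" by (simp add: weight_point_def fdeg_def)
 have "fst (weight_point P (f sig)) = 1" using v by auto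
 hence "weight_point P (f sig) = (1, vertex sig)" by (simp add: vertex_def prod_eq_iff)
 hence "(1, vertex sig) = (1 / real (fdeg sig)) *\<^sub>R real_hvec (gen sig)" using wp by simp
 hence "real (fdeg sig) *\<^sub>R (1, vertex sig) = real (fdeg sig) *\<^sub>R ((1 / real (fdeg sig)) *\<^sub>R real_hvec (gen sig))"
  by (rule arg_cong)
 thus "real_hvec (gen sig) = real (fdeg sig) *\<^sub>R (1, vertex sig)" using d by simp
qed

lemma polytope: "polytope P"
proof -
 obtain F :: "'n lat set" where F: "finite F" "P = convex hull (real_vec ` F)"
  using normal by (auto simp: normal_lattice_polytope_def lattice_polytope_def)
 show ?thesis unfolding polytope_def using F by (intro exI[of _ "real_vec ` F"]) auto
qed

sublocale face_points P vertex r by unfold_locales (use polytope stratD(5) linear in auto)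

lemma real_gen: "sig : faces P ==> real_hvec (gen sig) = real (fdeg sig) *\<^sub>R pv sig" using stratD(6) by (simp add: pv_def)

lemma flag_simplex_eq: "flag_simplex P f C = convex hull (vertex ` C)" by (simp add: flag_simplex_def vertex_def[abs_def])

lemma real_hvec_add: "real_hvec (s + t) = real_hvec s + real_hvec t" by (simp add: real_hvec_def real_vec_def vec_eq_iff)

lemma real_hvec_0: "real_hvec 0 = 0" by (simp add: real_hvec_def real_vec_def prod_eq_iff vec_eq_iff)

subsection \<open>The semigroup as the lattice points of the cone over the polytope\<close>

lemma convex_P: "convex P" by (rule polytope_imp_convex[OF polytope])

lemma cone_over_add: assumes "x : cone_over P" "y : cone_over P" shows "x + y : cone_over P"
proof -
 consider "x = 0" | "y = 0" | c q d q' where "0 <= c" "0 <= d" "q : P" "q' : P" "x = (c, c *\<^sub>R q)" "y = (d, d *\<^sub>R q')"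
  using assms by (auto simp: cone_over_def)
 thus ?thesis
 proof cases
  case 3
  show ?thesis
  proof (cases "c + d = 0")
   case True
   hence "c = 0" "d = 0" using 3(1,2) by auto
   hence "x + y = 0" using 3(5,6) by (simp add: prod_eq_iff)
   thus ?thesis by (simp add: cone_over_def)
  next
   case False
   define q'' where "q'' = (c / (c + d)) *\<^sub>R q + (d / (c + d)) *\<^sub>R q'"
   have q: "q'' : P" unfolding q''_def by (rule convexD[OF convex_P]) (use 3 False in "auto simp flip: add_divide_distrib")
   have "x + y = (c + d, (c + d) *\<^sub>R q'')" using False 3(5,6) by (simp add: q''_def scaleR_right_distrib)
   thus ?thesis using 3(1,2) q unfolding cone_over_def by (intro insertI2 CollectI exI[of _ "c + d"] exI[of _ q'']) auto
  qed
 qed (use assms in auto)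
qed

lemma real_hvec_in_cone: "s : S ==> real_hvec s : cone_over P" unfolding S_mon_def
proof (induction rule: submonoid_gen.induct)
 case zero
 show ?case by (simp add: real_hvec_0 cone_over_def)
next
 case (gen b)
 then obtain xi where xi: "real_vec xi : P" "b = (1, xi)" by (auto simp: lattice_points_def)
 thus ?case unfolding cone_over_def by (intro insertI2 CollectI exI[of _ 1] exI[of _ "real_vec xi"]) (auto simp: real_hvec_def)
next
 case (add a b)
 thus ?case by (simp add: real_hvec_add cone_over_add)
qed

text \<open>Normality: a lattice point of the dilate \<open>k P\<close> is a sum of \<open>k\<close> lattice points of \<open>P\<close>.\<close>

lemma lattice_cone_subset_S: assumes "real_hvec s : cone_over P" shows "s : S"
proof -
 have *: "xi : lpts (dilate k P) ==> (int k, xi) : S" for k xi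
 proof (induction k arbitrary: xi)
  case 0
  hence "xi = 0" by (auto simp: lattice_points_def dilate_def real_vec_def vec_eq_iff)
  thus ?case using S_mon_0 by (simp add: zero_prod_def)
 next
  case (Suc k)
  have "lpts (dilate (k + 1) P) = {a + b | a b. a : lpts (dilate k P) & b : lpts (dilate 1 P)}"
   using normal by (simp add: normal_lattice_polytope_def)
  then obtain a b where ab: "xi = a + b" "a : lpts (dilate k P)" "b : lpts (dilate 1 P)" using Suc.prems by auto
  hence "(1, b) : S" unfolding S_mon_def by (intro submonoid_gen.gen) (auto simp: dilate_def)
  hence "(int k, a) + (1, b) : S" by (rule S_mon_add[OF Suc.IH[OF ab(2)]])
  thus ?case by (simp add: ab(1) add.commute)
 qed
 show ?thesis
 proof (cases "real_hvec s = 0")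
  case True
  hence "s = 0" by (auto simp: real_hvec_def real_vec_def prod_eq_iff vec_eq_iff)
  thus ?thesis by (simp add: S_mon_0)
 next
  case False
  then obtain c q where c: "0 <= c" "q : P" "real_hvec s = (c, c *\<^sub>R q)" using assms by (auto simp: cone_over_def)
  hence c1: "c = real_of_int (fst s)" "real_vec (snd s) = c *\<^sub>R q" by (auto simp: real_hvec_def)
  have "0 <= fst s" using c(1) c1(1) by simp
  then obtain k where k: "fst s = int k" by (rule nonneg_int_cases)
  hence "snd s : lpts (dilate k P)" using c1 c(2) by (auto simp: lattice_points_def dilate_def)
  from *[OF this] show ?thesis using k by (metis prod.collapse)
 qed
qed

lemma exists_flag_cone: assumes "s : S" shows "EX C. flag P C & real_hvec s : cone_over (convex hull (vertex ` C))"
proof -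
 consider "real_hvec s = 0" | c q where "0 <= c" "q : P" "real_hvec s = (c, c *\<^sub>R q)"
  using real_hvec_in_cone[OF assms] by (auto simp: cone_over_def)
 thus ?thesis
 proof cases
  case 1
  thus ?thesis by (intro exI[of _ "{}"]) (simp add: cone_over_def subset.chain_def)
 next
  case 2
  have "P ~= {}" using 2(2) by blast
  hence "P : faces P" using convex_P by (simp add: faces_def face_of_refl)
  from flag_simplices_cover[OF this 2(2)]
  obtain C where C: "flag P C & (ALL tau:C. tau <= P) & q : convex hull (vertex ` C)" ..
  hence "real_hvec s : cone_over (convex hull (vertex ` C))"
   using 2(1,3) unfolding cone_over_def by (intro insertI2 CollectI exI[of _ c] exI[of _ q]) auto
  thus ?thesis using C by (intro exI[of _ C]) simp
 qed
qed

subsection \<open>Coordinates with respect to the generators of a flag\<close>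

definition combo :: "'n qvec => rat ^ ('n option)" where
 "combo a = (SUM sig:faces P. a sig *s rat_hvec (gen sig))"

lemma combo_subset: assumes "qsupp a <= C" "C <= faces P" shows "combo a = (SUM sig:C. a sig *s rat_hvec (gen sig))"
 unfolding combo_def using assms finite_faces by (intro sum.mono_neutral_right) (auto simp: qsupp_def)

lemma combo_qadd: "combo (qadd a b) = combo a + combo b" by (simp add: combo_def qadd_def vec.scale_left_distrib sum.distrib)

lemma combo_diff: "combo (%sig. a sig - b sig) = combo a - combo b" by (simp add: combo_def vec.scale_left_diff_distrib sum_subtractf)

lemma combo_0: "combo (%_. 0) = 0" by (simp add: combo_def)

lemma rat_hvec_add: "rat_hvec (s + t) = rat_hvec s + rat_hvec t" by (simp add: rat_hvec_def vec_eq_iff split: option.split)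

lemma rat_hvec_0: "rat_hvec 0 = 0" by (simp add: rat_hvec_def vec_eq_iff split: option.split)

lemma flag_sub_faces: "flag P C ==> C <= faces P" by (simp add: subset_chain_def)

lemma combo_real: assumes "combo a = combo b" shows "(SUM sig:faces P. (real_of_rat (a sig) * real (fdeg sig)) *\<^sub>R pv sig) =
  (SUM sig:faces P. (real_of_rat (b sig) * real (fdeg sig)) *\<^sub>R pv sig)"
proof -
 have "rat_hvec 0 = combo (%sig. a sig - b sig)" using assms by (simp add: combo_diff rat_hvec_0)
 hence "rat_hvec 0 = (SUM sig:faces P. (a sig - b sig) *s rat_hvec (gen sig))" by (simp add: combo_def)
 from real_hvec_sum_rat[OF this]
 have "(SUM sig:faces P. real_of_rat (a sig - b sig) *\<^sub>R real_hvec (gen sig)) = 0" by (simp add: real_hvec_0)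
 moreover have "(SUM sig:faces P. real_of_rat (a sig - b sig) *\<^sub>R real_hvec (gen sig)) =
   (SUM sig:faces P. (real_of_rat (a sig) * real (fdeg sig)) *\<^sub>R pv sig - (real_of_rat (b sig) * real (fdeg sig)) *\<^sub>R pv sig)"
  by (intro sum.cong refl) (simp add: real_gen of_rat_diff algebra_simps)
 ultimately show ?thesis by (simp add: sum_subtractf)
qed

lemma nonneg_lex_le: assumes a: "!!sig. 0 <= a sig" "qsupp a <= faces P" and b: "flag P C" "qsupp b <= C"
  and eq: "combo a = combo b" shows "lex_le P r a b"
proof (cases "a = b")
 case False
 have Cf: "C <= faces P" by (rule flag_sub_faces[OF b(1)])
 have dif: "EX sig:faces P. a sig ~= b sig"
 proof (rule ccontr)
  assume "~ (EX sig:faces P. a sig ~= b sig)"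
  hence "a = b" by (intro qvecs_eqI[of a P b]) (use a(2) b(2) Cf in "auto simp: qvecs_def")
  thus False using False by simp
 qed
 have pos: "0 < fdeg sig" if "sig : faces P" for sig using stratD(4)[OF that] by simp
 have "EX sig:faces P. real_of_rat (a sig) * real (fdeg sig) < real_of_rat (b sig) * real (fdeg sig) &
   (ALL tau:faces P. (sig, tau) : r & tau ~= sig --> real_of_rat (a tau) * real (fdeg tau) = real_of_rat (b tau) * real (fdeg tau))"
 proof (rule lex_comparison[OF _ b(1) _ combo_real[OF eq]])
  show "0 <= real_of_rat (a sig) * real (fdeg sig)" for sig using a(1)[of sig] by simp
  show "real_of_rat (b sig) * real (fdeg sig) = 0" if "sig ~: C" for sig using b(2) that by (auto simp: qsupp_def)
  obtain sig where "sig : faces P" "a sig ~= b sig" using dif by blast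
  thus "EX sig:faces P. real_of_rat (a sig) * real (fdeg sig) ~= real_of_rat (b sig) * real (fdeg sig)"
   using pos[of sig] by (intro bexI[of _ sig]) auto
 qed
 then obtain sig where sig: "sig : faces P" "real_of_rat (a sig) * real (fdeg sig) < real_of_rat (b sig) * real (fdeg sig)"
  "ALL tau:faces P. (sig, tau) : r & tau ~= sig --> real_of_rat (a tau) * real (fdeg tau) = real_of_rat (b tau) * real (fdeg tau)" by blast
 have "a sig < b sig" using sig(2) pos[OF sig(1)] by (simp add: of_rat_less)
 moreover have "ALL tau:faces P. (sig, tau) : r & tau ~= sig --> a tau = b tau"
 proof (intro ballI impI)
  fix tau assume tau: "tau : faces P" "(sig, tau) : r & tau ~= sig"
  hence "real_of_rat (a tau) * real (fdeg tau) = real_of_rat (b tau) * real (fdeg tau)" using sig(3) by simp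
  thus "a tau = b tau" using pos[OF tau(1)] by simp
 qed
 ultimately show ?thesis using sig(1) unfolding lex_le_def lex_less_def by blast
qed (simp add: lex_le_refl)

lemma flag_coords_unique: assumes C: "flag P C" and ab: "qsupp a <= C" "qsupp b <= C" and eq: "combo a = combo b" shows "a = b"
proof -
 have le: "lex_le P r (%_. 0) (%sig. c sig - d sig)"
  if "qsupp c <= C" "qsupp d <= C" "combo c = combo d" for c d
 proof (rule nonneg_lex_le[OF _ _ C])
  show "qsupp (%sig. c sig - d sig) <= C"
  proof
   fix sig assume "sig : qsupp (%sig. c sig - d sig)"
   hence "c sig ~= 0 | d sig ~= 0" by (auto simp: qsupp_def)
   thus "sig : C" using that(1,2) by (auto simp: qsupp_def)
  qed
  show "combo (%_. 0) = combo (%sig. c sig - d sig)" using that(3) by (simp add: combo_diff combo_0)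
 qed (auto simp: qsupp_def)
 have neg: False if "lex_less P r (%_. 0) (%sig. a sig - b sig)" "lex_less P r (%_. 0) (%sig. b sig - a sig)"
 proof -
  have "lex_less P r (%sig. b sig - a sig) (%_. 0)" using that(1) unfolding lex_less_def by simp (metis (no_types))
  from lex_less_trans[OF that(2) this] show False using lex_less_irrefl by simp
 qed
 have "(%_. 0) = (%sig. a sig - b sig) | (%_. 0) = (%sig. b sig - a sig)"
  using le[OF ab eq] le[OF ab(2,1) eq[symmetric]] neg unfolding lex_le_def by blast
 thus ?thesis by (auto simp: fun_eq_iff)
qed

lemma max_chain_coords: assumes C: "max_chain P C" shows "EX a. qsupp a <= C & rat_hvec s = combo a"
proof -
 note flag = max_chain_flag[OF C]
 have Cf: "C <= faces P" by (rule flag_sub_faces[OF flag])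
 have ind: "b sig = 0" if "(SUM sig:C. b sig *\<^sub>R real_hvec (gen sig)) = 0" "sig : C" for b :: "'n face => real" and sig
 proof -
  have "(SUM sig:C. (b sig * real (fdeg sig)) *\<^sub>R pv sig) = (SUM sig:C. b sig *\<^sub>R real_hvec (gen sig))"
   using Cf by (intro sum.cong refl) (auto simp: real_gen)
  hence "b sig * real (fdeg sig) = 0" using flag_independent[OF flag _ that(2), of "%sig. b sig * real (fdeg sig)"] that(1) by simp
  thus ?thesis using stratD(4)[of sig] that(2) Cf by auto
 qed
 obtain a where a: "rat_hvec s = (SUM sig:C. a sig *s rat_hvec (gen sig))"
  by (rule rat_coordinates_exist[of C gen s]) (use flag_finite[OF flag] card_max_chain[OF C full] ind in auto)
 define a' where "a' = (%sig. if sig : C then a sig else 0)"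
 have supp: "qsupp a' <= C" by (auto simp: a'_def qsupp_def)
 moreover have "combo a' = (SUM sig:C. a sig *s rat_hvec (gen sig))"
  unfolding combo_subset[OF supp Cf] by (intro sum.cong refl) (simp add: a'_def)
 ultimately show ?thesis using a by (intro exI[of _ a']) simp
qed

lemma combo_real_gen: assumes "C <= faces P" "qsupp a <= C" "rat_hvec s = combo a"
 shows "real_hvec s = (SUM sig:C. (real_of_rat (a sig) * real (fdeg sig)) *\<^sub>R pv sig)"
proof -
 have "real_hvec s = (SUM sig:C. real_of_rat (a sig) *\<^sub>R real_hvec (gen sig))"
  by (rule real_hvec_sum_rat) (simp add: assms(3) combo_subset[OF assms(2,1)])
 also have "... = (SUM sig:C. (real_of_rat (a sig) * real (fdeg sig)) *\<^sub>R pv sig)"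
  using assms(1) by (intro sum.cong refl) (auto simp: real_gen)
 finally show ?thesis .
qed

lemma cone_coords: assumes C: "flag P C" shows "real_hvec s : cone_over (convex hull (vertex ` C)) \<longleftrightarrow>
  (EX a. (ALL sig. 0 <= a sig) & qsupp a <= C & rat_hvec s = combo a)"
proof
 have Cf: "C <= faces P" by (rule flag_sub_faces[OF C])
 assume "EX a. (ALL sig. 0 <= a sig) & qsupp a <= C & rat_hvec s = combo a"
 then obtain a where a: "ALL sig. 0 <= a sig" "qsupp a <= C" "rat_hvec s = combo a" by blast
 show "real_hvec s : cone_over (convex hull (vertex ` C))" unfolding in_cone_over_simplex[OF C] combo_real_gen[OF Cf a(2,3)] using a(1)
  by (intro exI[of _ "%sig. real_of_rat (a sig) * real (fdeg sig)"]) auto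
next
 assume "real_hvec s : cone_over (convex hull (vertex ` C))"
 then obtain b where b: "ALL sig:C. 0 <= b sig" "real_hvec s = (SUM sig:C. b sig *\<^sub>R pv sig)"
  unfolding in_cone_over_simplex[OF C] by blast
 obtain D where D: "max_chain P D" "C <= D" by (rule flag_extends_to_max_chain[OF C])
 note flag = max_chain_flag[OF D(1)]
 have Df: "D <= faces P" by (rule flag_sub_faces[OF flag])
 obtain a where a: "qsupp a <= D" "rat_hvec s = combo a" using max_chain_coords[OF D(1), of s] by blast
 have e1: "real_hvec s = (SUM sig:D. (real_of_rat (a sig) * real (fdeg sig)) *\<^sub>R pv sig)" by (rule combo_real_gen[OF Df a])
 define b' where "b' = (%sig. if sig : C then b sig else 0)"
 have "(SUM sig:C. b sig *\<^sub>R pv sig) = (SUM sig:D. b' sig *\<^sub>R pv sig)"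
  using D(2) flag_finite[OF flag] by (intro sum.mono_neutral_cong_left) (auto simp: b'_def)
 hence dif: "(SUM sig:D. (real_of_rat (a sig) * real (fdeg sig) - b' sig) *\<^sub>R pv sig) = 0"
  using e1 b(2) by (simp add: scaleR_left_diff_distrib sum_subtractf)
 have ab: "real_of_rat (a sig) * real (fdeg sig) = b' sig" if "sig : D" for sig using flag_independent[OF flag dif that] by simp
 have "qsupp a <= C"
 proof
  fix sig assume sig: "sig : qsupp a"
  hence "sig : D" using a(1) by blast
  hence "b' sig ~= 0" using ab[of sig] sig stratD(4)[of sig] Df by (auto simp: qsupp_def)
  thus "sig : C" by (simp add: b'_def split: if_splits)
 qed
 moreover have "0 <= a sig" for sig
 proof (cases "sig : D")
  case True
  hence "0 <= real_of_rat (a sig) * real (fdeg sig)" using ab b(1) by (simp add: b'_def)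
  moreover have "0 < real (fdeg sig)" using stratD(4)[of sig] Df True by auto
  ultimately show ?thesis by (simp add: zero_le_mult_iff)
 next
  case False
  hence "a sig = 0" using a(1) by (auto simp: qsupp_def)
  thus ?thesis by simp
 qed
 ultimately show "EX a. (ALL sig. 0 <= a sig) & qsupp a <= C & rat_hvec s = combo a" using a(2) by blast
qed

text \<open>The coordinates of a semigroup element on the simplex that contains it.\<close>

definition coords :: "'n hlat => 'n qvec" where
 "coords s = (THE a. (ALL sig. 0 <= a sig) & flag P (qsupp a) & rat_hvec s = combo a)"

lemma flag_subset: "flag P C ==> B <= C ==> flag P B" by (rule chain_subset)

lemma coords_eqI: assumes "!!sig. 0 <= a sig" "flag P (qsupp a)" "rat_hvec s = combo a" shows "coords s = a" unfolding coords_def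
proof (rule the_equality)
 show "(ALL sig. 0 <= a sig) & flag P (qsupp a) & rat_hvec s = combo a" using assms by simp
 fix b assume b: "(ALL sig. 0 <= b sig) & flag P (qsupp b) & rat_hvec s = combo b"
 have "lex_le P r a b" by (rule nonneg_lex_le[of a "qsupp b" b]) (use assms b flag_sub_faces in auto)
 moreover have "lex_le P r b a" by (rule nonneg_lex_le[of b "qsupp a" a]) (use assms b flag_sub_faces in auto)
 ultimately show "b = a" by (intro lex_le_antisym)
qed

lemma coords: assumes "s : S" shows "0 <= coords s sig" "flag P (qsupp (coords s))" "rat_hvec s = combo (coords s)"
  "qsupp (coords s) <= faces P"
proof -
 obtain C where C: "flag P C" "real_hvec s : cone_over (convex hull (vertex ` C))" using exists_flag_cone[OF assms] by blast
 then obtain a where a: "ALL sig. 0 <= a sig" "qsupp a <= C" "rat_hvec s = combo a" unfolding cone_coords[OF C(1)] by blast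
 have fl: "flag P (qsupp a)" using flag_subset[OF C(1) a(2)] .
 have eq: "coords s = a" by (rule coords_eqI) (use a fl in auto)
 show "0 <= coords s sig" "flag P (qsupp (coords s))" "rat_hvec s = combo (coords s)" unfolding eq using a fl by auto
 show "qsupp (coords s) <= faces P" unfolding eq by (rule flag_sub_faces[OF fl])
qed

lemma inj_coords: "inj_on coords S"
proof (rule inj_onI)
 fix s t assume st: "s : S" "t : S" "coords s = coords t"
 hence "rat_hvec s = rat_hvec t" using coords(3)[OF st(1)] coords(3)[OF st(2)] by simp
 thus "s = t" by (rule injD[OF inj_rat_hvec])
qed

abbreviation ssupp :: "'n hlat => 'n face set" where "ssupp s \<equiv> qsupp (coords s)"

lemma S_flag_iff: assumes "flag P C" shows "s : S_flag P f C \<longleftrightarrow> s : S & ssupp s <= C"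
proof -
 have "(EX a. (ALL sig. 0 <= a sig) & qsupp a <= C & rat_hvec s = combo a) \<longleftrightarrow> ssupp s <= C" if s: "s : S"
 proof
  assume "EX a. (ALL sig. 0 <= a sig) & qsupp a <= C & rat_hvec s = combo a"
  then obtain a where a: "ALL sig. 0 <= a sig" "qsupp a <= C" "rat_hvec s = combo a" by blast
  hence "coords s = a" using flag_subset[OF assms a(2)] by (intro coords_eqI) auto
  thus "ssupp s <= C" using a(2) by simp
 next
  assume "ssupp s <= C"
  thus "EX a. (ALL sig. 0 <= a sig) & qsupp a <= C & rat_hvec s = combo a" using coords(1,3)[OF s] by (intro exI[of _ "coords s"]) auto
 qed
 thus ?thesis by (auto simp: S_flag_def flag_simplex_eq cone_coords[OF assms])
qed

lemma qsupp_qadd_nonneg: assumes "!!sig. 0 <= a sig" "!!sig. 0 <= b sig" shows "qsupp (qadd a b) = qsupp a Un qsupp b"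
 using assms by (auto simp: qsupp_def qadd_def add_nonneg_eq_0_iff)

lemma coords_add: assumes "s : S" "t : S" "flag P (ssupp s Un ssupp t)" shows "coords (s + t) = qadd (coords s) (coords t)"
proof (rule coords_eqI)
 show "0 <= qadd (coords s) (coords t) sig" for sig using coords(1)[OF assms(1)] coords(1)[OF assms(2)] by (simp add: qadd_def)
 show "flag P (qsupp (qadd (coords s) (coords t)))" using assms by (simp add: qsupp_qadd_nonneg coords(1))
 show "rat_hvec (s + t) = combo (qadd (coords s) (coords t))"
  using coords(3)[OF assms(1)] coords(3)[OF assms(2)] by (simp add: rat_hvec_add combo_qadd)
qed

lemma ssupp_add: assumes "s : S" "t : S" "flag P (ssupp s Un ssupp t)" shows "ssupp (s + t) = ssupp s Un ssupp t"
 by (simp add: coords_add[OF assms] qsupp_qadd_nonneg coords(1) assms)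

lemma coords_superadditive: assumes "s : S" "t : S" shows "lex_le P r (qadd (coords s) (coords t)) (coords (s + t))"
proof (rule nonneg_lex_le)
 note st = S_mon_add[OF assms]
 show "0 <= qadd (coords s) (coords t) sig" for sig using coords(1)[OF assms(1)] coords(1)[OF assms(2)] by (simp add: qadd_def)
 show "qsupp (qadd (coords s) (coords t)) <= faces P"
  using coords(4)[OF assms(1)] coords(4)[OF assms(2)] by (simp add: qsupp_qadd_nonneg coords(1) assms)
 show "flag P (qsupp (coords (s + t)))" by (rule coords(2)[OF st])
 show "combo (qadd (coords s) (coords t)) = combo (coords (s + t))" using coords(3)[OF assms(1)] coords(3)[OF assms(2)] coords(3)[OF st]
  by (simp add: rat_hvec_add combo_qadd)
qed simp

lemma coords_0: "coords 0 = (%_. 0)" by (rule coords_eqI) (auto simp: qsupp_def combo_0 rat_hvec_0 subset.chain_def)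

lemma coords_gen: assumes "sig : faces P" shows "coords (gen sig) = (%tau. if tau = sig then 1 else 0)"
proof (rule coords_eqI)
 have supp: "qsupp (%tau. if tau = sig then 1 else 0) = {sig}" by (auto simp: qsupp_def)
 show "flag P (qsupp (%tau. if tau = sig then 1 else 0))" unfolding supp using assms by (simp add: subset.chain_def)
 show "rat_hvec (gen sig) = combo (%tau. if tau = sig then 1 else 0)" by (subst combo_subset[of _ "{sig}"]) (use supp assms in auto)
qed simp

lemma ssupp_gen: "sig : faces P ==> ssupp (gen sig) = {sig}" by (auto simp: coords_gen qsupp_def)

lemma qdegree_coords: assumes "s : S" shows "qdegree P f (coords s) = of_int (fst s)"
proof -
 have "of_int (fst s) = (SUM sig:faces P. coords s sig * of_int (fst (gen sig)))"
  using coords(3)[OF assms] unfolding combo_def rat_hvec_eq_iff by simp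
 also have "... = (SUM sig:faces P. coords s sig * of_nat (fdeg sig))" by (intro sum.cong refl) (simp add: stratD(3))
 finally show ?thesis by (simp add: qdegree_def fdeg_def)
qed

subsection \<open>The values of the quasi-valuation\<close>

lemma nu_eigen_eq: assumes C: "max_chain P C" and s: "s : S" and c: "c ~= 0" shows "qsupp (nu_eigen P f C (cone_fun P (single s c))) <= C &
  rat_hvec s = combo (nu_eigen P f C (cone_fun P (single s c)))"
proof -
 note flag = max_chain_flag[OF C]
 have Cf: "C <= faces P" by (rule flag_sub_faces[OF flag])
 let ?Q = "%a. qsupp a <= C & rat_hvec s = combo a"
 have w: "weight P (cone_fun P (single s c)) = - s" by (rule weight_single[OF s c])
 have g: "weight P (f sig) = - gen sig" for sig by (simp add: gen_def)
 have iff: "(qsupp a <= C & of_int (fst (- s)) = (SUM sig:C. a sig * of_int (fst (- gen sig))) &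
   (ALL i. of_int (snd (- s) $ i) = (SUM sig:C. a sig * of_int (snd (- gen sig) $ i)))) = ?Q a" for a
 proof (cases "qsupp a <= C")
  case True
  thus ?thesis unfolding combo_subset[OF True Cf] rat_hvec_eq_iff by (simp add: sum_negf)
 qed simp
 have eq: "nu_eigen P f C (cone_fun P (single s c)) = (THE a. ?Q a)" unfolding nu_eigen_def w g iff ..
 obtain a where a: "?Q a" using max_chain_coords[OF C, of s] ..
 have "(THE a. ?Q a) = a"
 proof (rule the_equality[where P = ?Q, OF a])
  fix b assume "?Q b"
  thus "b = a" using a by (intro flag_coords_unique[OF flag]) auto
 qed
 thus ?thesis unfolding eq using a by simp
qed

lemma nu_cone_fun: assumes F: "F : span_on S" "F ~= 0" shows "nu P f r (cone_fun P F) : coords ` keys F"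
  "s : keys F ==> lex_le P r (nu P f r (cone_fun P F)) (coords s)"
proof -
 let ?K = "keys F"
 have KS: "s : S" if "s : ?K" for s using span_onD[OF F(1) that] .
 have Kne: "?K ~= {}" using F(2) by simp
 have "coords ` ?K <= qvecs P" using coords(4) KS by (auto simp: qvecs_def)
 hence "EX a:coords ` ?K. ALL b:coords ` ?K. lex_le P r a b" by (intro lex_min_exists) (use Kne in auto)
 then obtain m where m: "m : coords ` ?K" "ALL b:coords ` ?K. lex_le P r m b" ..
 define e where "e = (%C s. nu_eigen P f C (cone_fun P (single s (lookup F s))))"
 have e: "qsupp (e C s) <= C & rat_hvec s = combo (e C s)" if "max_chain P C" "s : ?K" for C s
  unfolding e_def by (rule nu_eigen_eq[OF that(1) KS[OF that(2)]]) (use that(2) in "simp add: in_keys_iff")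
 have le: "lex_le P r (coords s) (e C s)" if Cs: "max_chain P C" "s : ?K" for C s
 proof (rule nonneg_lex_le[OF coords(1,4)[OF KS[OF Cs(2)]] max_chain_flag[OF Cs(1)]])
  show "qsupp (e C s) <= C" using e[OF Cs] by simp
  show "combo (coords s) = combo (e C s)" using e[OF Cs] coords(3)[OF KS[OF Cs(2)]] by simp
 qed
 have mle: "lex_le P r m (e C s)" if Cs: "max_chain P C" "s : ?K" for C s by (rule lex_le_trans[OF _ le[OF Cs]]) (use m(2) Cs(2) in simp)
 have chain: "nu_chain P f r C (cone_fun P F) = lex_min P r (e C ` ?K)" for C
  unfolding nu_chain_def weight_components_cone_fun[OF F(1)] image_image e_def ..
 have sub: "e C ` ?K <= qvecs P" if C: "max_chain P C" for C using e[OF C] flag_sub_faces[OF max_chain_flag[OF C]] by (auto simp: qvecs_def)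
 have nu: "nu P f r (cone_fun P F) = m" unfolding nu_def
 proof (rule lex_min_eqI)
  obtain s where s: "s : ?K" "m = coords s" using m(1) by blast
  obtain C where C: "max_chain P C" "ssupp s <= C" by (rule flag_extends_to_max_chain[OF coords(2)[OF KS[OF s(1)]]])
  have "e C s = coords s" by (rule flag_coords_unique[OF max_chain_flag[OF C(1)] _ C(2)])
    (use coords(3)[OF KS[OF s(1)]] e[OF C(1) s(1)] in auto)
  hence "m : e C ` ?K" using s by (intro image_eqI[of _ _ s]) auto
  hence "lex_min P r (e C ` ?K) = m" by (rule lex_min_eqI) (use mle[OF C(1)] in auto)
  hence "nu_chain P f r C (cone_fun P F) = m" unfolding chain .
  thus "m : {nu_chain P f r C (cone_fun P F) | C. max_chain P C}" using C(1) by auto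
 next
  fix b assume "b : {nu_chain P f r C (cone_fun P F) | C. max_chain P C}"
  then obtain C where C: "max_chain P C" "b = lex_min P r (e C ` ?K)" unfolding chain by auto
  hence "b : e C ` ?K" using lex_min_props[OF _ _ sub[OF C(1)]] Kne by simp
  thus "lex_le P r m b" using mle[OF C(1)] by auto
 qed
 show "nu P f r (cone_fun P F) : coords ` ?K" unfolding nu by (rule m(1))
 show "s : ?K ==> lex_le P r (nu P f r (cone_fun P F)) (coords s)" unfolding nu using m(2) by simp
qed

lemma single_nonzero: "c ~= 0 ==> single s c ~= 0" by (metis lookup_single_eq lookup_zero)

lemma nu_single: assumes "s : S" "c ~= 0" shows "nu P f r (cone_fun P (single s c)) = coords s"
 using nu_cone_fun(1)[OF span_on_single[OF assms(1)] single_nonzero[OF assms(2)]] assms(2) by simp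

lemma Gam_eq: "Gam P f r = coords ` S"
proof
 show "Gam P f r <= coords ` S"
 proof
  fix a assume "a : Gam P f r"
  then obtain F where F: "F : span_on S" "cone_fun P F ~= (%_. 0)" "a = nu P f r (cone_fun P F)"
   by (auto simp: Gam_def carrier_coord_ring coord_ring_simps)
  hence "F ~= 0" by auto
  from nu_cone_fun(1)[OF F(1) this] show "a : coords ` S" unfolding F(3) using F(1) by (auto simp: span_on_def)
 qed
 show "coords ` S <= Gam P f r"
 proof (rule image_subsetI)
  fix s assume s: "s : S"
  let ?F = "single s (1 :: 'k)"
  have nz: "?F ~= 0" by (rule single_nonzero) simp
  have "cone_fun P ?F ~= (%_. 0)" unfolding cone_fun_eq_0[OF span_on_single[OF s]] by (rule nz)
  moreover have "cone_fun P ?F : carrier (KX P)" unfolding carrier_coord_ring by (rule imageI[OF span_on_single[OF s]])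
  ultimately have "nu P f r (cone_fun P ?F) : Gam P f r" by (simp add: Gam_def coord_ring_simps)
  thus "coords s : Gam P f r" by (simp add: nu_single[OF s])
 qed
qed

subsection \<open>The image of the quasi-valuation is a fan of monoids\<close>

lemma sub_fan_eq:
 assumes "flag P C" shows "sub_fan (Gam P f r) C = coords ` S_flag P f C" unfolding sub_fan_def Gam_eq using S_flag_iff[OF assms] by auto

lemma flag_union_subset: "flag P C ==> A <= C ==> B <= C ==> flag P (A Un B)" by (rule flag_subset) auto

lemma S_flag_coords_add:
 assumes "flag P C" "s : S_flag P f C" "t : S_flag P f C" shows "coords (s + t) = qadd (coords s) (coords t)" "s + t : S_flag P f C"
proof -
 have st: "s : S" "t : S" "ssupp s <= C" "ssupp t <= C" using assms(2,3) unfolding S_flag_iff[OF assms(1)] by auto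
 have fl: "flag P (ssupp s Un ssupp t)" using flag_union_subset[OF assms(1) st(3,4)] .
 show "coords (s + t) = qadd (coords s) (coords t)" by (rule coords_add[OF st(1,2) fl])
 show "s + t : S_flag P f C" using ssupp_add[OF st(1,2) fl] st S_mon_add[OF st(1,2)] by (simp add: S_flag_iff[OF assms(1)])
qed

lemma S_flag_0: "flag P C ==> 0 : S_flag P f C" by (simp add: S_flag_iff S_mon_0 coords_0 qsupp_def)

lemma fan_of_monoids_Gam: "fan_of_monoids P (Gam P f r)" unfolding fan_of_monoids_def
proof (intro conjI allI impI)
 show "Gam P f r = (UN C:{C. flag P C}. sub_fan (Gam P f r) C)"
 proof
  show "Gam P f r <= (UN C:{C. flag P C}. sub_fan (Gam P f r) C)"
  proof
   fix a assume a: "a : Gam P f r"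
   hence "flag P (qsupp a)" using coords(2) by (auto simp: Gam_eq)
   moreover have "a : sub_fan (Gam P f r) (qsupp a)" using a by (simp add: sub_fan_def)
   ultimately show "a : (UN C:{C. flag P C}. sub_fan (Gam P f r) C)" by (intro UN_I[of "qsupp a"]) simp_all
  qed
 qed (auto simp: sub_fan_def)
next
 fix C assume C: "flag P C"
 have "coords 0 : coords ` S_flag P f C" by (rule imageI[OF S_flag_0[OF C]])
 thus "(%_. 0) : sub_fan (Gam P f r) C" by (simp add: sub_fan_eq[OF C] coords_0)
 show "ALL a:sub_fan (Gam P f r) C. ALL b:sub_fan (Gam P f r) C. qadd a b : sub_fan (Gam P f r) C" unfolding sub_fan_eq[OF C]
 proof (intro ballI)
  fix a b assume "a : coords ` S_flag P f C" "b : coords ` S_flag P f C"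
  then obtain s t where st: "s : S_flag P f C" "t : S_flag P f C" "a = coords s" "b = coords t" by blast
  show "qadd a b : coords ` S_flag P f C" unfolding st(3,4) S_flag_coords_add(1)[OF C st(1,2), symmetric]
   by (rule imageI[OF S_flag_coords_add(2)[OF C st(1,2)]])
 qed
next
 fix C C' assume C: "flag P C & flag P C'"
 show "sub_fan (Gam P f r) C <= sub_fan (Gam P f r) C' \<longleftrightarrow> C <= C'"
 proof
  assume sub: "sub_fan (Gam P f r) C <= sub_fan (Gam P f r) C'"
  show "C <= C'"
  proof
   fix sig assume sig: "sig : C"
   hence sigP: "sig : faces P" using C flag_faces by blast
   have "coords (gen sig) : Gam P f r" unfolding Gam_eq by (rule imageI[OF stratD(2)[OF sigP]])
   hence "coords (gen sig) : sub_fan (Gam P f r) C" using ssupp_gen[OF sigP] sig by (simp add: sub_fan_def)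
   hence "coords (gen sig) : sub_fan (Gam P f r) C'" using sub by blast
   thus "sig : C'" using ssupp_gen[OF sigP] by (simp add: sub_fan_def)
  qed
 qed (auto simp: sub_fan_def)
 show "sub_fan (Gam P f r) C Int sub_fan (Gam P f r) C' = sub_fan (Gam P f r) (C Int C')" by (auto simp: sub_fan_def)
qed

lemma S_flag_subset: "S_flag P f C <= S" by (auto simp: S_flag_def)

lemma S_fan_eq: "S_fan P f = S"
proof
 show "S_fan P f <= S" using S_flag_subset by (auto simp: S_fan_def)
 show "S <= S_fan P f"
 proof
  fix s assume s: "s : S"
  hence "s : S_flag P f (ssupp s)" by (simp add: S_flag_iff coords(2))
  thus "s : S_fan P f" unfolding S_fan_def using coords(2)[OF s] by (intro UN_I[of "ssupp s"]) simp_all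
 qed
qed

definition uncoords :: "'n qvec => 'n hlat" where "uncoords = inv_into S coords"

lemma uncoords [simp]: "s : S ==> uncoords (coords s) = s" by (simp add: uncoords_def inj_coords)

lemma bij_uncoords: "bij_betw uncoords (Gam P f r) S"
 unfolding Gam_eq uncoords_def using inj_coords by (simp add: bij_betw_inv_into inj_on_imp_bij_betw)

lemma bij_uncoords_flag: assumes "flag P C" shows "bij_betw uncoords (sub_fan (Gam P f r) C) (S_flag P f C)" unfolding sub_fan_eq[OF assms]
proof (rule bij_betw_byWitness[where f' = coords])
 have *: "uncoords (coords s) = s" if "s : S_flag P f C" for s by (rule uncoords[OF subsetD[OF S_flag_subset that]])
 thus "ALL a:coords ` S_flag P f C. coords (uncoords a) = a" by simp
 show "ALL a':S_flag P f C. uncoords (coords a') = a'" using * by simp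
 show "uncoords ` coords ` S_flag P f C <= S_flag P f C" using * by (auto simp only: image_image image_subset_iff)
qed simp

lemma uncoords_qadd: assumes "flag P C" "a : sub_fan (Gam P f r) C" "b : sub_fan (Gam P f r) C" shows "uncoords (qadd a b) = uncoords a + uncoords b"
proof -
 obtain s t where st: "s : S_flag P f C" "t : S_flag P f C" "a = coords s" "b = coords t"
  using assms(2,3) unfolding sub_fan_eq[OF assms(1)] by blast
 have S: "s : S" "t : S" using st S_flag_subset by auto
 show ?thesis unfolding st(3,4) S_flag_coords_add(1)[OF assms(1) st(1,2), symmetric] by (simp add: S S_mon_add)
qed

lemma uncoords_0: "uncoords (%_. 0) = 0" using uncoords[OF S_mon_0] by (simp add: coords_0)

lemma fan_iso_S_Gam: "fan_iso_S P (Gam P f r) f" unfolding fan_iso_S_def S_fan_eq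
 by (intro exI[of _ uncoords] conjI allI impI ballI bij_uncoords bij_uncoords_flag uncoords_0 uncoords_qadd)

end

lemma fan_iso_same_triangulation:
 assumes "stratified P f r" "stratified P f' r'" "same_triangulation P f f'" shows "fan_iso P (Gam P f r) (Gam P f' r')"
proof -
 interpret A: stratified P f r by fact
 interpret B: stratified P f' r' by fact
 have eq: "S_flag P f C = S_flag P f' C" if "flag P C" for C using assms(3) that by (simp add: same_triangulation_def S_flag_def)
 let ?h = "B.coords \<circ> A.uncoords"
 have "bij_betw B.coords (S_mon P) (Gam P f' r')" unfolding B.Gam_eq using B.inj_coords by (rule inj_on_imp_bij_betw)
 hence 1: "bij_betw ?h (Gam P f r) (Gam P f' r')" by (rule bij_betw_trans[OF A.bij_uncoords])
 have 2: "bij_betw ?h (sub_fan (Gam P f r) C) (sub_fan (Gam P f' r') C)" if C: "flag P C" for C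
 proof -
  have "inj_on B.coords (S_flag P f' C)" by (rule inj_on_subset[OF B.inj_coords B.S_flag_subset])
  hence "bij_betw B.coords (S_flag P f C) (sub_fan (Gam P f' r') C)" unfolding B.sub_fan_eq[OF C] eq[OF C] by (rule inj_on_imp_bij_betw)
  thus ?thesis by (rule bij_betw_trans[OF A.bij_uncoords_flag[OF C]])
 qed
 have 3: "?h (%_. 0) = (%_. 0)" by (simp add: A.uncoords_0 B.coords_0)
 have 4: "?h (qadd a b) = qadd (?h a) (?h b)"
  if C: "flag P C" "a : sub_fan (Gam P f r) C" "b : sub_fan (Gam P f r) C" for C a b
 proof -
  have ab: "A.uncoords a : S_flag P f' C" "A.uncoords b : S_flag P f' C"
   using bij_betw_apply[OF A.bij_uncoords_flag[OF C(1)]] C(2,3) eq[OF C(1)] by auto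
  show ?thesis using B.S_flag_coords_add(1)[OF C(1) ab] A.uncoords_qadd[OF C] by simp
 qed
 show ?thesis unfolding fan_iso_def by (intro exI[of _ ?h] conjI allI impI ballI 1 2 3 4)
qed

section \<open>The algebra of a fan of monoids\<close>

definition restr :: "'a set => ('a \<Rightarrow>\<^sub>0 'k::field) => ('a \<Rightarrow>\<^sub>0 'k)" where
 "restr A F = (SUM s:keys F. if s : A then single s (lookup F s) else 0)"

lemma lookup_restr [simp]:
 "lookup (restr A F) s = (if s : A then lookup F s else 0)"
proof -
 have "lookup (restr A F) s = (SUM t:keys F. if t = s then (if s : A then lookup F s else 0) else 0)"
  unfolding restr_def lookup_sum by (intro sum.cong refl) (auto simp: lookup_single when_def)
 also have "... = (if s : A then lookup F s else 0)" by (simp add: in_keys_iff)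
 finally show ?thesis .
qed

lemma keys_restr: "keys (restr A F) = keys F Int A" by (auto simp: in_keys_iff split: if_splits)

lemma restr_add: "restr A (F + G) = restr A F + restr A G" by (rule poly_mapping_eqI) (simp add: lookup_add)

lemma restr_0 [simp]: "restr A 0 = 0" by (rule poly_mapping_eqI) simp

lemma restr_sum: "restr A (sum F J) = (SUM i:J. restr A (F i))" by (induction J rule: infinite_finite_induct) (simp_all add: restr_add)

lemma restr_single:
 "restr A (single s c) = (if s : A then single s c else 0)" by (rule poly_mapping_eqI) (auto simp: lookup_single when_def)

lemma restr_smult: fixes F :: "'a::comm_monoid_add \<Rightarrow>\<^sub>0 'k::field" shows "restr A (single 0 c * F) = single 0 c * restr A F"
 by (rule poly_mapping_eqI) simp

lemma restr_supported: "restr A F : span_on A" by (auto simp: span_on_def keys_restr)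

lemma restr_id: "F : span_on A ==> restr A F = F" by (rule poly_mapping_eqI) (auto simp: span_on_def in_keys_iff)

lemma pm_mult_superset: fixes F G :: "'a::monoid_add \<Rightarrow>\<^sub>0 'k::field"
 assumes "finite A" "finite B" "keys F <= A" "keys G <= B" shows "F * G = (SUM s:A. SUM t:B. single (s + t) (lookup F s * lookup G t))"
proof -
 have "F * G = (SUM s:keys F. SUM t:B. single (s + t) (lookup F s * lookup G t))"
  unfolding pm_mult_expand using assms by (intro sum.cong refl sum.mono_neutral_left) (auto simp: in_keys_iff)
 also have "... = (SUM s:A. SUM t:B. single (s + t) (lookup F s * lookup G t))"
  using assms by (intro sum.mono_neutral_left) (auto simp: in_keys_iff)
 finally show ?thesis .
qed

text \<open>The algebra with basis the elements of a union of monoids, where a product is the sum in a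
  common monoid, or zero if there is none.\<close>

definition fan_comp :: "'i set => ('i => 'm set) => 'm => 'm => bool" where
 "fan_comp I M s t \<longleftrightarrow> (EX i:I. s : M i & t : M i)"

definition fan_mult ::
  "'i set => ('i => 'm::comm_monoid_add set) => ('m \<Rightarrow>\<^sub>0 'k::field) => ('m \<Rightarrow>\<^sub>0 'k) => ('m \<Rightarrow>\<^sub>0 'k)" where
 "fan_mult I M F G = (SUM s:keys F. SUM t:keys G. if fan_comp I M s t then single (s + t) (lookup F s * lookup G t) else 0)"

definition fan_algebra_on ::
  "'i set => ('i => 'n::finite hlat set) => ('k::field, ('n, 'k) lpoly) graded_algebra" where
 "fan_algebra_on I M = \<lparr> carrier = span_on (UN i:I. M i), mult = fan_mult I M, one = 1, zero = 0, add = (+), smult = (%c p. single 0 c * p),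
   homog = (%d. {p : span_on (UN i:I. M i). ALL s:keys p. fst s = int d}) \<rparr>"

lemma fan_simps:
 "carrier (fan_algebra_on I M) = span_on (UN i:I. M i)"
 "F \<otimes>\<^bsub>fan_algebra_on I M\<^esub> G = fan_mult I M F G" "\<one>\<^bsub>fan_algebra_on I M\<^esub> = 1"
 "\<zero>\<^bsub>fan_algebra_on I M\<^esub> = 0" "F \<oplus>\<^bsub>fan_algebra_on I M\<^esub> G = F + G"
 "c \<odot>\<^bsub>fan_algebra_on I M\<^esub> F = single 0 c * F"
 "homog (fan_algebra_on I M) d = {p : span_on (UN i:I. M i). ALL s:keys p. fst s = int d}"
 by (simp_all add: fan_algebra_on_def)

lemma sg_simps:
 "carrier (semigroup_algebra A) = span_on A"
 "F \<otimes>\<^bsub>semigroup_algebra A\<^esub> G = F * G" "\<one>\<^bsub>semigroup_algebra A\<^esub> = 1"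
 "\<zero>\<^bsub>semigroup_algebra A\<^esub> = 0" "F \<oplus>\<^bsub>semigroup_algebra A\<^esub> G = F + G"
 "c \<odot>\<^bsub>semigroup_algebra A\<^esub> F = single 0 c * F"
 "homog (semigroup_algebra A) d = {p : span_on A. ALL s:keys p. fst s = int d}" by (auto simp: semigroup_algebra_def span_on_def)

lemma lookup_fan_mult:
 "lookup (fan_mult I M F G) u = (SUM (s, t):{(s, t) : keys F \<times> keys G. fan_comp I M s t & s + t = u}. lookup F s * lookup G t)"
proof -
 have "lookup (fan_mult I M F G) u = (SUM s:keys F. SUM t:keys G. if fan_comp I M s t & s + t = u then lookup F s * lookup G t else 0)"
  unfolding fan_mult_def lookup_sum by (intro sum.cong refl) (simp add: lookup_single when_def)
 also have "... = (SUM z:keys F \<times> keys G. if fan_comp I M (fst z) (snd z) & fst z + snd z = u then lookup F (fst z) * lookup G (snd z) else 0)"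
  by (simp add: sum.cartesian_product split_def)
 also have "... = (SUM z:{z : keys F \<times> keys G. fan_comp I M (fst z) (snd z) & fst z + snd z = u}. lookup F (fst z) * lookup G (snd z))"
  by (subst sum.inter_filter) auto
 also have "{z : keys F \<times> keys G. fan_comp I M (fst z) (snd z) & fst z + snd z = u} =
   {(s, t) : keys F \<times> keys G. fan_comp I M s t & s + t = u}" by auto
 finally show ?thesis by (simp add: split_def)
qed

text \<open>Faces of the fan: a sum of two compatible elements lies in a monoid of the fan only if both
  summands do. Hence discarding the exponents outside one of the monoids is multiplicative.\<close>

locale monoid_fan =
 fixes I :: "'i set" and M :: "'i => 'n::finite hlat set" assumes I_ne: "I ~= {}" and M_0: "!!i. i : I ==> 0 : M i"
  and M_add: "!!i s t. i : I ==> s : M i ==> t : M i ==> s + t : M i"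
  and M_face: "!!i j s t. i : I ==> j : I ==> s : M j ==> t : M j ==> s + t : M i ==> s : M i & t : M i"
  and M_fst: "!!i s. i : I ==> s : M i ==> 0 <= fst s"
begin

abbreviation "U \<equiv> UN i:I. M i"

lemma restrict_fan_mult: fixes F G :: "('n, 'k::field) lpoly"
 assumes i: "i : I" shows "restr (M i) (fan_mult I M F G) = restr (M i) F * restr (M i) G"
proof -
 have "restr (M i) (if fan_comp I M s t then single (s + t) (lookup F s * lookup G t) else 0)
   = single (s + t) (lookup (restr (M i) F) s * lookup (restr (M i) G) t)" for s t
 proof (cases "s : M i & t : M i")
  case True
  hence "fan_comp I M s t" "s + t : M i" using i M_add[of i s t] unfolding fan_comp_def by blast+
  thus ?thesis using True by (simp add: restr_single)
 next
  case False
  have "s + t ~: M i" if c: "fan_comp I M s t"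
  proof
   obtain j where j: "j : I" "s : M j" "t : M j" using c unfolding fan_comp_def by blast
   assume "s + t : M i"
   thus False using M_face[OF i j] False by simp
  qed
  thus ?thesis using False by (auto simp: restr_single)
 qed
 thus ?thesis by (simp add: fan_mult_def restr_sum
    pm_mult_superset[of "keys F" "keys G"] keys_restr)
qed

lemma restrict_one: "i : I ==> restr (M i) 1 = 1" using M_0 by (simp add: restr_single flip: single_one)

lemma restrict_jointly_inj: assumes "F : span_on U" "G : span_on U" "!!i. i : I ==> restr (M i) F = restr (M i) G" shows "F = G"
proof (rule poly_mapping_eqI)
 fix s
 show "lookup F s = lookup G s"
 proof (cases "s : U")
  case True
  then obtain i where i: "i : I" "s : M i" by blast
  thus ?thesis using arg_cong[OF assms(3)[OF i(1)], of "%H. lookup H s"] by simp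
 next
  case False
  hence "s ~: keys F" "s ~: keys G" using assms(1,2) by (auto simp: span_on_def)
  thus ?thesis by (simp add: in_keys_iff)
 qed
qed

lemma fan_mult_closed: fixes F G :: "('n, 'k::field) lpoly" shows "fan_mult I M F G : span_on U" unfolding fan_mult_def
proof (intro span_on_sum)
 fix s t
 have "s + t : U" if c: "fan_comp I M s t"
 proof -
  obtain i where "i : I" "s : M i" "t : M i" using c unfolding fan_comp_def by blast
  thus ?thesis using M_add[of i s t] by blast
 qed
 thus "(if fan_comp I M s t then single (s + t) (lookup F s * lookup G t) else 0) : span_on U"
  by (simp add: span_on_0 span_on_single)
qed

lemma one_supported: "1 : span_on U" using I_ne M_0 by (auto simp: span_on_def)

lemma cring_fan_algebra: "cring (fan_algebra_on I M :: ('k::field, ('n, 'k) lpoly) graded_algebra)"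
  (is "cring ?T")
proof (rule cringI)
 show "abelian_group ?T"
 proof (rule abelian_groupI)
  fix x assume "x : carrier ?T"
  thus "EX y:carrier ?T. y \<oplus>\<^bsub>?T\<^esub> x = \<zero>\<^bsub>?T\<^esub>"
   by (intro bexI[of _ "- x"]) (auto simp: fan_simps span_on_uminus)
 qed (auto simp: fan_simps span_on_add span_on_0 add_ac)
 have eqI: "F = G" if "F : span_on U" "G : span_on U"
   "!!i. i : I ==> restr (M i) F = restr (M i) G" for F G :: "('n, 'k) lpoly" using restrict_jointly_inj that by blast
 show "Group.comm_monoid ?T"
 proof (rule comm_monoidI)
  fix x y z assume "x : carrier ?T" "y : carrier ?T" "z : carrier ?T"
  show "x \<otimes>\<^bsub>?T\<^esub> y \<otimes>\<^bsub>?T\<^esub> z = x \<otimes>\<^bsub>?T\<^esub> (y \<otimes>\<^bsub>?T\<^esub> z)"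
   unfolding fan_simps by (rule eqI) (simp_all add: fan_mult_closed restrict_fan_mult mult.assoc)
 next
  fix x y assume "x : carrier ?T" "y : carrier ?T"
  show "x \<otimes>\<^bsub>?T\<^esub> y = y \<otimes>\<^bsub>?T\<^esub> x" unfolding fan_simps
   by (rule eqI) (simp_all add: fan_mult_closed restrict_fan_mult mult.commute)
 next
  fix x assume x: "x : carrier ?T"
  show "\<one>\<^bsub>?T\<^esub> \<otimes>\<^bsub>?T\<^esub> x = x" unfolding fan_simps
   by (rule eqI) (use x in "simp_all add: fan_simps fan_mult_closed restrict_fan_mult restrict_one")
 qed (simp_all add: fan_simps fan_mult_closed one_supported)
 fix x y z assume "x : carrier ?T" "y : carrier ?T" "z : carrier ?T"
 show "(x \<oplus>\<^bsub>?T\<^esub> y) \<otimes>\<^bsub>?T\<^esub> z = x \<otimes>\<^bsub>?T\<^esub> z \<oplus>\<^bsub>?T\<^esub> y \<otimes>\<^bsub>?T\<^esub> z"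
  unfolding fan_simps by (rule eqI) (simp_all add: fan_mult_closed span_on_add restrict_fan_mult restr_add distrib_right)
qed

end

lemma fan_algebra_on_cong: assumes "!!i. i : I ==> M i = M' i" shows "fan_algebra_on I M = fan_algebra_on I M'"
proof -
 have "fan_comp I M = fan_comp I M'" using assms unfolding fan_comp_def by (intro ext bex_cong refl) simp
 hence "fan_mult I M = fan_mult I M'" unfolding fan_mult_def by simp
 moreover have "(UN i:I. M i) = (UN i:I. M' i)" using assms by auto
 ultimately show ?thesis by (simp add: fan_algebra_on_def)
qed

subsection \<open>Isomorphisms of graded algebras\<close>

lemma graded_isomorphic_span: assumes T: "ring T" "!!c x. x : carrier T ==> c \<odot>\<^bsub>T\<^esub> x : carrier T" "!!d. homog T d <= carrier T"
  and h: "graded_iso T A h" and g: "graded_iso T B g" shows "graded_isomorphic A B"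
proof -
 interpret ring T by fact
 define k where "k = inv_into (carrier T) h"
 have bij: "bij_betw h (carrier T) (carrier A)" "bij_betw g (carrier T) (carrier B)"
  and hom: "h : ring_hom T A" "g : ring_hom T B" using h g by (auto simp: graded_iso_def ring_iso_def)
 have kh: "k (h x) = x" if "x : carrier T" for x using that bij(1) by (simp add: k_def bij_betw_def)
 have surj: "EX x:carrier T. y = h x" if "y : carrier A" for y using that bij(1) by (auto simp: bij_betw_def)
 have "g \<circ> k : ring_hom A B"
 proof (rule ring_hom_memI)
  fix x y assume xy: "x : carrier A" "y : carrier A"
  obtain a where a: "a : carrier T" "x = h a" using surj[OF xy(1)] ..
  obtain b where b: "b : carrier T" "y = h b" using surj[OF xy(2)] ..
  note ab = a(1) b(1) a(2) b(2)
  show "(g \<circ> k) (x \<otimes>\<^bsub>A\<^esub> y) = (g \<circ> k) x \<otimes>\<^bsub>B\<^esub> (g \<circ> k) y"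
   using ab by (simp add: kh ring_hom_mult[OF hom(1), symmetric] ring_hom_mult[OF hom(2)])
  show "(g \<circ> k) (x \<oplus>\<^bsub>A\<^esub> y) = (g \<circ> k) x \<oplus>\<^bsub>B\<^esub> (g \<circ> k) y"
   using ab by (simp add: kh ring_hom_add[OF hom(1), symmetric] ring_hom_add[OF hom(2)])
 next
  fix x assume x: "x : carrier A"
  obtain a where a: "a : carrier T" "x = h a" using surj[OF x] ..
  show "(g \<circ> k) x : carrier B" using a bij_betw_apply[OF bij(2) a(1)] by (simp add: kh)
 next
  show "(g \<circ> k) \<one>\<^bsub>A\<^esub> = \<one>\<^bsub>B\<^esub>"
   using ring_hom_one[OF hom(1)] ring_hom_one[OF hom(2)] kh[OF one_closed] by simp
 qed
 moreover have "bij_betw (g \<circ> k) (carrier A) (carrier B)"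
  unfolding k_def by (rule bij_betw_trans[OF bij_betw_inv_into[OF bij(1)] bij(2)])
 moreover have "(g \<circ> k) (c \<odot>\<^bsub>A\<^esub> x) = c \<odot>\<^bsub>B\<^esub> (g \<circ> k) x" if x: "x : carrier A" for c x
 proof -
  obtain a where a: "a : carrier T" "x = h a" using surj[OF x] ..
  have "c \<odot>\<^bsub>A\<^esub> h a = h (c \<odot>\<^bsub>T\<^esub> a)" "g (c \<odot>\<^bsub>T\<^esub> a) = c \<odot>\<^bsub>B\<^esub> g a"
   using h g a(1) by (auto simp: graded_iso_def)
  thus ?thesis using a T(2)[OF a(1)] kh by simp
 qed
 moreover have "(g \<circ> k) ` homog A d = homog B d" for d
 proof -
  have "homog A d = h ` homog T d" "homog B d = g ` homog T d" using h g by (auto simp: graded_iso_def)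
  moreover have "k ` h ` homog T d = homog T d" using kh subsetD[OF T(3)[of d]] by (simp add: image_image)
  ultimately show ?thesis by (metis image_comp)
 qed
 ultimately have "graded_iso A B (g \<circ> k)" by (simp add: graded_iso_def ring_iso_def)
 thus ?thesis unfolding graded_isomorphic_def by blast
qed

section \<open>The associated graded algebra\<close>

lemma coord_ring_a_monoid:
 "abelian_monoid (KX P :: ('k::field_char_0, ('n::finite, 'k) lfun) graded_algebra)"
proof (rule abelian_monoidI)
 fix g h :: "('n, 'k) lfun"
 assume "g : carrier (KX P)" "h : carrier (KX P)"
 then obtain F G where "F : span_on (S_mon P)" "g = cone_fun P F"
  "G : span_on (S_mon P)" "h = cone_fun P G" by (auto simp: carrier_coord_ring)
 thus "g \<oplus>\<^bsub>KX P\<^esub> h : carrier (KX P)"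
  by (auto simp: coord_ring_simps carrier_coord_ring span_on_add simp flip: cone_fun_add)
next
 show "\<zero>\<^bsub>KX P\<^esub> : carrier (KX P :: ('k, ('n, 'k) lfun) graded_algebra)"
  unfolding carrier_coord_ring coord_ring_simps by (rule image_eqI[of _ _ 0]) (simp_all add: span_on_0)
qed (auto simp: coord_ring_simps add_ac)

lemma finsum_coord_ring: fixes H :: "'j => ('n::finite, 'k::field_char_0) lpoly" assumes "finite J" "!!j. j : J ==> H j : span_on (S_mon P)"
 shows "(\<Oplus>\<^bsub>KX P\<^esub>j\<in>J. cone_fun P (H j)) = cone_fun P (sum H J)" using assms
proof (induction J rule: finite_induct)
 case empty
 interpret abelian_monoid "KX P :: ('k, ('n, 'k) lfun) graded_algebra" by (rule coord_ring_a_monoid)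
 show ?case by (simp add: coord_ring_simps(1))
next
 case (insert j J)
 interpret abelian_monoid "KX P :: ('k, ('n, 'k) lfun) graded_algebra" by (rule coord_ring_a_monoid)
 have mem: "cone_fun P (H i) : carrier (KX P)" if "i : insert j J" for i using insert.prems[OF that] by (simp add: carrier_coord_ring)
 have "(\<Oplus>\<^bsub>KX P\<^esub>i\<in>insert j J. cone_fun P (H i)) =
   cone_fun P (H j) \<oplus>\<^bsub>KX P\<^esub> (\<Oplus>\<^bsub>KX P\<^esub>i\<in>J. cone_fun P (H i))"
  using insert.hyps mem by (intro finsum_insert) auto
 thus ?case using insert by (simp add: coord_ring_simps cone_fun_add)
qed

context stratified begin

abbreviation "mchains \<equiv> {C. max_chain P C}"

abbreviation "fan_alg \<equiv> (fan_algebra_on mchains (S_flag P f) :: ('k, ('n, 'k) lpoly) graded_algebra)"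

lemma exists_max_chain: "mchains ~= {}"
proof -
 obtain D where "max_chain P D" by (rule flag_extends_to_max_chain[of "{}"]) (simp add: subset_chain_def)
 thus ?thesis by blast
qed

lemma fan_comp_iff:
 "fan_comp mchains (S_flag P f) s t \<longleftrightarrow> s : S & t : S & flag P (ssupp s Un ssupp t)"
proof
 assume "fan_comp mchains (S_flag P f) s t"
 then obtain C where C: "max_chain P C" "s : S_flag P f C" "t : S_flag P f C" by (auto simp: fan_comp_def)
 note fl = max_chain_flag[OF C(1)]
 show "s : S & t : S & flag P (ssupp s Un ssupp t)" using C(2,3) flag_union_subset[OF fl] unfolding S_flag_iff[OF fl] by blast
next
 assume *: "s : S & t : S & flag P (ssupp s Un ssupp t)"
 obtain D where D: "max_chain P D" "ssupp s Un ssupp t <= D" by (rule flag_extends_to_max_chain) (use * in auto)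
 thus "fan_comp mchains (S_flag P f) s t" using * unfolding fan_comp_def by (intro bexI[of _ D]) (auto simp: S_flag_iff[OF max_chain_flag])
qed

lemma Union_S_flag: "(UN C:mchains. S_flag P f C) = S"
proof
 show "S <= (UN C:mchains. S_flag P f C)"
 proof
  fix s assume s: "s : S"
  have "fan_comp mchains (S_flag P f) s s" using s coords(2)[OF s] by (simp add: fan_comp_iff)
  thus "s : (UN C:mchains. S_flag P f C)" by (auto simp: fan_comp_def)
 qed
qed (use S_flag_subset in blast)

sublocale fan: monoid_fan mchains "S_flag P f"
proof
 show "mchains ~= {}" by (rule exists_max_chain)
 fix C assume "C : mchains"
 hence C: "flag P C" using max_chain_flag by auto
 show "0 : S_flag P f C" by (rule S_flag_0[OF C])
 show "s + t : S_flag P f C" if "s : S_flag P f C" "t : S_flag P f C" for s t by (rule S_flag_coords_add(2)[OF C that])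
 show "0 <= fst s" if "s : S_flag P f C" for s using that S_flag_subset S_mon_fst_nonneg by blast
 fix D s t assume D: "D : mchains" "s : S_flag P f D" "t : S_flag P f D" and st: "s + t : S_flag P f C"
 have "fan_comp mchains (S_flag P f) s t" unfolding fan_comp_def using D by blast
 hence c: "s : S" "t : S" "flag P (ssupp s Un ssupp t)" by (auto simp: fan_comp_iff)
 thus "s : S_flag P f C & t : S_flag P f C" using st ssupp_add[OF c] by (simp add: S_flag_iff[OF C])
qed

text \<open>The residue class of functions with leading exponent at least \<open>a\<close> is determined by the
  coefficient of the character with coordinates \<open>a\<close>.\<close>

definition leaf :: "'n qvec => 'k => ('n, 'k) lfun set" where
 "leaf a c = cone_fun P ` {H : span_on S. (ALL t:keys H. lex_le P r a (coords t)) & lookup H (uncoords a) = c}"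

lemma filt_ge_eq:
 "filt_ge P f r a = cone_fun P ` {H : span_on S. ALL t:keys H. lex_le P r a (coords t)}"
proof -
 have "(cone_fun P H = (%_. 0) | lex_le P r a (nu P f r (cone_fun P H))) \<longleftrightarrow>
   (ALL t:keys H. lex_le P r a (coords t))" if H: "H : span_on S" for H :: "('n, 'k) lpoly"
 proof (cases "H = 0")
  case False
  have "lex_le P r a (nu P f r (cone_fun P H)) \<longleftrightarrow> (ALL t:keys H. lex_le P r a (coords t))"
  proof
   assume "lex_le P r a (nu P f r (cone_fun P H))"
   thus "ALL t:keys H. lex_le P r a (coords t)" using lex_le_trans[OF _ nu_cone_fun(2)[OF H False]] by simp
  next
   obtain t where t: "t : keys H" "nu P f r (cone_fun P H) = coords t" using nu_cone_fun(1)[OF H False] by blast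
   assume "ALL t:keys H. lex_le P r a (coords t)"
   thus "lex_le P r a (nu P f r (cone_fun P H))" unfolding t(2) using t(1) by (rule bspec)
  qed
  thus ?thesis using cone_fun_eq_0[OF H] False by simp
 qed simp
 thus ?thesis by (auto simp: filt_ge_def carrier_coord_ring coord_ring_simps)
qed

lemma filt_gt_eq:
 "filt_gt P f r a = cone_fun P ` {H : span_on S. ALL t:keys H. lex_less P r a (coords t)}"
proof -
 have "(cone_fun P H = (%_. 0) | lex_less P r a (nu P f r (cone_fun P H))) \<longleftrightarrow>
   (ALL t:keys H. lex_less P r a (coords t))" if H: "H : span_on S" for H :: "('n, 'k) lpoly"
 proof (cases "H = 0")
  case False
  have "lex_less P r a (nu P f r (cone_fun P H)) \<longleftrightarrow> (ALL t:keys H. lex_less P r a (coords t))"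
  proof
   assume "lex_less P r a (nu P f r (cone_fun P H))"
   thus "ALL t:keys H. lex_less P r a (coords t)" using lex_less_le_trans[OF _ nu_cone_fun(2)[OF H False]] by simp
  next
   obtain t where t: "t : keys H" "nu P f r (cone_fun P H) = coords t" using nu_cone_fun(1)[OF H False] by blast
   assume "ALL t:keys H. lex_less P r a (coords t)"
   thus "lex_less P r a (nu P f r (cone_fun P H))" unfolding t(2) using t(1) by (rule bspec)
  qed
  thus ?thesis using cone_fun_eq_0[OF H] False by simp
 qed simp
 thus ?thesis by (auto simp: filt_gt_def carrier_coord_ring coord_ring_simps)
qed

lemma coords_le_iff: assumes "s : S" "t : S" shows "lex_le P r (coords s) (coords t) \<longleftrightarrow> lex_less P r (coords s) (coords t) | t = s"
 using inj_onD[OF inj_coords _ assms] by (auto simp: lex_le_def)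

lemma coset_eq_leaf: assumes s: "s : S" and G: "G : span_on S" "ALL t:keys G. lex_le P r (coords s) (coords t)"
 shows "filt_gt P f r (coords s) +>\<^bsub>KX P\<^esub> cone_fun P G = leaf (coords s) (lookup G s)"
proof -
 have "filt_gt P f r (coords s) +>\<^bsub>KX P\<^esub> cone_fun P G =
   (%H. cone_fun P (H + G)) ` {H : span_on S. ALL t:keys H. lex_less P r (coords s) (coords t)}"
  unfolding a_r_coset_def' filt_gt_eq by (auto simp: coord_ring_simps cone_fun_add)
 also have "... = leaf (coords s) (lookup G s)"
 proof (intro equalityI subsetI)
  fix x assume "x : (%H. cone_fun P (H + G)) ` {H : span_on S. ALL t:keys H. lex_less P r (coords s) (coords t)}"
  then obtain H where H: "H : span_on S" "ALL t:keys H. lex_less P r (coords s) (coords t)"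
   "x = cone_fun P (H + G)" by blast
  have "s ~: keys H" using bspec[OF H(2), of s] lex_less_irrefl[of "coords s"] by blast
  hence "lookup H s = 0" by (simp add: in_keys_iff)
  hence "lookup (H + G) (uncoords (coords s)) = lookup G s" using s by (simp add: lookup_add)
  moreover have "ALL t:keys (H + G). lex_le P r (coords s) (coords t)"
   using H(2) G(2) Poly_Mapping.keys_add[of H G] by (auto simp: lex_le_def)
  ultimately show "x : leaf (coords s) (lookup G s)" unfolding leaf_def H(3) using span_on_add[OF H(1) G(1)] by (intro imageI) simp
 next
  fix x assume "x : leaf (coords s) (lookup G s)"
  then obtain H where H: "H : span_on S" "ALL t:keys H. lex_le P r (coords s) (coords t)"
   "lookup H s = lookup G s" "x = cone_fun P H" using s by (auto simp: leaf_def)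
  have mem: "H - G : span_on S" by (rule span_on_diff[OF H(1) G(1)])
  have "lex_less P r (coords s) (coords t)" if t: "t : keys (H - G)" for t
  proof -
   have "t : keys H | t : keys G" "t ~= s" using t H(3) by (auto simp: in_keys_iff lookup_minus)
   hence "lex_le P r (coords s) (coords t)" using H(2) G(2) by auto
   thus ?thesis using coords_le_iff[OF s span_onD[OF mem t]] \<open>t ~= s\<close> by simp
  qed
  thus "x : (%H. cone_fun P (H + G)) ` {H : span_on S. ALL t:keys H. lex_less P r (coords s) (coords t)}"
   using mem H(4) by (intro image_eqI[of _ _ "H - G"]) simp_all
 qed
 finally show ?thesis .
qed

lemma filt_gt_leaf: "s : S ==> filt_gt P f r (coords s) = leaf (coords s) 0"
proof -
 assume s: "s : S"
 have "(ALL t:keys H. lex_less P r (coords s) (coords t)) \<longleftrightarrow> (ALL t:keys H. lex_le P r (coords s) (coords t)) & lookup H s = 0"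
  if H: "H : span_on S" for H :: "('n, 'k) lpoly"
 proof -
  have "lex_less P r (coords s) (coords t) \<longleftrightarrow> lex_le P r (coords s) (coords t) & t ~= s"
   if "t : keys H" for t using coords_le_iff[OF s span_onD[OF H that]] lex_less_irrefl[of "coords s"] by auto
  moreover have "lookup H s = 0 \<longleftrightarrow> s ~: keys H" by (simp add: in_keys_iff)
  ultimately show ?thesis by auto
 qed
 thus ?thesis using s by (auto simp: filt_gt_eq leaf_def)
qed

lemma single_in_leaf: "s : S ==> cone_fun P (single s c) : leaf (coords s) c"
 unfolding leaf_def by (rule imageI) (auto simp: span_on_single lex_le_refl)

lemma leaf_inj: "s : S ==> leaf (coords s) c = leaf (coords s) d \<longleftrightarrow> c = d"
proof
 assume s: "s : S" and eq: "leaf (coords s) c = leaf (coords s) d"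
 then obtain H where H: "H : span_on S" "lookup H s = d"
  "cone_fun P (single s c) = cone_fun P H" using single_in_leaf[OF s, of c] by (auto simp: leaf_def)
 hence "single s c = H" using cone_fun_inj[OF span_on_single[OF s] H(1)] by simp
 thus "c = d" using H(2) by auto
qed simp

lemma cosets_eq:
 assumes "s : S" shows "{filt_gt P f r (coords s) +>\<^bsub>KX P\<^esub> g | g. g : filt_ge P f r (coords s)} = range (leaf (coords s))"
proof (intro equalityI subsetI)
 fix x assume "x : {filt_gt P f r (coords s) +>\<^bsub>KX P\<^esub> g | g. g : filt_ge P f r (coords s)}"
 then obtain H where H: "H : span_on S" "ALL t:keys H. lex_le P r (coords s) (coords t)"
  "x = filt_gt P f r (coords s) +>\<^bsub>KX P\<^esub> cone_fun P H" by (auto simp: filt_ge_eq)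
 thus "x : range (leaf (coords s))" using coset_eq_leaf[OF assms H(1,2)] by auto
next
 fix x assume "x : range (leaf (coords s))"
 then obtain c where c: "x = leaf (coords s) c" by blast
 let ?H = "single s c"
 have H: "?H : span_on S" "ALL t:keys ?H. lex_le P r (coords s) (coords t)" using assms by (auto simp: span_on_single lex_le_refl)
 hence "x = filt_gt P f r (coords s) +>\<^bsub>KX P\<^esub> cone_fun P ?H" using coset_eq_leaf[OF assms H] c by simp
 moreover have "cone_fun P ?H : filt_ge P f r (coords s)" unfolding filt_ge_eq using H by blast
 ultimately show "x : {filt_gt P f r (coords s) +>\<^bsub>KX P\<^esub> g | g. g : filt_ge P f r (coords s)}" by blast
qed

end

context face_points begin

lemma lex_less_qadd: "lex_less P r a b ==> lex_less P r (qadd a c) (qadd b c)" unfolding lex_less_def qadd_def by simp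

lemma qadd_commute: "qadd a b = qadd b a" by (simp add: qadd_def add.commute)

lemma lex_le_qadd: "lex_le P r a b ==> lex_le P r (qadd a c) (qadd b c)" using lex_less_qadd by (auto simp: lex_le_def)

lemma lex_le_qadd_mono: assumes "lex_le P r a a'" "lex_le P r b b'" shows "lex_le P r (qadd a b) (qadd a' b')"
 using lex_le_trans[OF lex_le_qadd[OF assms(1), of b] lex_le_qadd[OF assms(2), of a', unfolded qadd_commute[of _ a']]] .

lemma lex_le_qadd_eq: assumes "lex_le P r a a'" "lex_le P r b b'" "qadd a b = qadd a' b'" shows "a = a' & b = b'"
proof (rule ccontr)
 assume ne: "~ (a = a' & b = b')"
 have 1: "lex_le P r (qadd a b) (qadd a' b)" by (rule lex_le_qadd[OF assms(1)])
 have 2: "lex_le P r (qadd a' b) (qadd a' b')" using lex_le_qadd[OF assms(2), of a'] by (simp add: qadd_commute[of _ a'])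
 have "lex_less P r (qadd a b) (qadd a' b')"
 proof (cases "a = a'")
  case True
  hence "lex_less P r b b'" using ne assms(2) by (simp add: lex_le_def)
  thus ?thesis using lex_less_qadd[of b b' a] True by (simp add: qadd_commute[of _ a'])
 next
  case False
  hence "lex_less P r a a'" using assms(1) by (simp add: lex_le_def)
  from lex_less_le_trans[OF lex_less_qadd[OF this] 2] show ?thesis .
 qed
 thus False using assms(3) lex_less_irrefl by simp
qed

end

context stratified begin

abbreviation "gr \<equiv> gr_algebra P f r"

abbreviation "\<Gamma> \<equiv> Gam P f r"

text \<open>Only products of characters from a common simplex have the sum of the coordinates as their
  coordinates; all other products fall into a smaller step of the filtration.\<close>

lemma leaf_mult: assumes s: "s : S" and t: "t : S" and w: "w : S" and eq: "qadd (coords s) (coords t) = coords w"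
  and g: "g : leaf (coords s) c" and h: "h : leaf (coords t) d" shows "EX H. H : span_on S & g \<otimes>\<^bsub>KX P\<^esub> h = cone_fun P H &
  (ALL u:keys H. lex_le P r (coords w) (coords u)) & lookup H w = c * d"
proof -
 obtain F where F: "F : span_on S" "ALL u:keys F. lex_le P r (coords s) (coords u)"
  "lookup F s = c" "g = cone_fun P F" using g s by (auto simp: leaf_def)
 obtain G where G: "G : span_on S" "ALL u:keys G. lex_le P r (coords t) (coords u)"
  "lookup G t = d" "h = cone_fun P G" using h t by (auto simp: leaf_def)
 let ?H = "F * G"
 have H: "?H : span_on S" by (rule span_on_mult[OF F(1) G(1) S_mon_add])
 have le: "lex_le P r (coords w) (qadd (coords x) (coords y))" "lex_le P r (qadd (coords x) (coords y)) (coords (x + y))"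
  if xy: "x : keys F" "y : keys G" for x y
 proof -
  show "lex_le P r (coords w) (qadd (coords x) (coords y))"
   unfolding eq[symmetric] by (rule lex_le_qadd_mono[OF bspec[OF F(2) xy(1)] bspec[OF G(2) xy(2)]])
  show "lex_le P r (qadd (coords x) (coords y)) (coords (x + y))"
   by (rule coords_superadditive[OF span_onD[OF F(1) xy(1)] span_onD[OF G(1) xy(2)]])
 qed
 have st: "s + t = w"
 proof -
  have "flag P (ssupp s Un ssupp t)" using coords(2)[OF w] qsupp_qadd_nonneg[of "coords s" "coords t"] coords(1)[OF s] coords(1)[OF t]
   by (simp add: eq)
  hence "coords (s + t) = coords w" using coords_add[OF s t] eq by simp
  thus ?thesis by (rule inj_onD[OF inj_coords _ S_mon_add[OF s t] w])
 qed
 have uniq: "x = s & y = t" if xy: "x : keys F" "y : keys G" "x + y = w" for x y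
 proof -
  have "coords w = qadd (coords x) (coords y)" by (rule lex_le_antisym[OF le(1)[OF xy(1,2)] le(2)[OF xy(1,2), unfolded xy(3)]])
  hence "coords s = coords x & coords t = coords y" by (intro lex_le_qadd_eq[OF bspec[OF F(2) xy(1)] bspec[OF G(2) xy(2)]]) (simp add: eq)
  thus ?thesis using inj_onD[OF inj_coords _ s span_onD[OF F(1) xy(1)]]
    inj_onD[OF inj_coords _ t span_onD[OF G(1) xy(2)]] by simp
 qed
 have "ALL u:keys ?H. lex_le P r (coords w) (coords u)"
 proof
  fix u assume "u : keys ?H"
  then obtain x y where xy: "x : keys F" "y : keys G" "u = x + y" using Poly_Mapping.keys_mult[of F G] by blast
  show "lex_le P r (coords w) (coords u)" unfolding xy(3) by (rule lex_le_trans[OF le[OF xy(1,2)]])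
 qed
 moreover have "lookup ?H w = c * d"
 proof -
  have "lookup ?H w = (SUM x:keys F. SUM y:keys G. if x + y = w then lookup F x * lookup G y else 0)"
   unfolding pm_mult_expand[of F G] lookup_sum by (intro sum.cong refl) (simp add: lookup_single when_def)
  also have "... = (SUM x:keys F. SUM y:keys G. if y = t then if x = s then lookup F x * lookup G y else 0 else 0)"
  proof (intro sum.cong refl)
   fix x y assume xy: "x : keys F" "y : keys G"
   have "x + y = w \<longleftrightarrow> x = s & y = t" using uniq[OF xy] st by auto
   thus "(if x + y = w then lookup F x * lookup G y else 0) = (if y = t then if x = s then lookup F x * lookup G y else 0 else 0)" by simp
  qed
  also have "... = c * d" using F(3) G(3) by (cases "d = 0") (simp_all add: in_keys_iff)
  finally show ?thesis .
 qed
 moreover have "g \<otimes>\<^bsub>KX P\<^esub> h = cone_fun P ?H" by (simp add: F(4) G(4) coord_ring_simps cone_fun_mult[OF F(1) G(1)])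
 ultimately show ?thesis using H by blast
qed

definition gr_map :: "(('n, 'k) lpoly) => 'n qvec => ('n, 'k) lfun set" where
 "gr_map p = (\<lambda>a\<in>\<Gamma>. leaf a (lookup p (uncoords a)))"

abbreviation gr_supp :: "('n qvec => ('n, 'k) lfun set) => 'n qvec set" where
 "gr_supp u \<equiv> {a : \<Gamma>. u a ~= filt_gt P f r a}"

lemma carrier_gr: "carrier gr = {u : (\<Pi>\<^sub>E a\<in>\<Gamma>. range (leaf a)). finite (gr_supp u)}"
proof -
 have "(\<Pi>\<^sub>E a\<in>\<Gamma>. {filt_gt P f r a +>\<^bsub>KX P\<^esub> g | g. g : filt_ge P f r a}) = (\<Pi>\<^sub>E a\<in>\<Gamma>. range (leaf a))"
 proof (rule PiE_cong)
  fix a assume "a : \<Gamma>"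
  then obtain s where "s : S" "a = coords s" unfolding Gam_eq by blast
  thus "{filt_gt P f r a +>\<^bsub>KX P\<^esub> g | g. g : filt_ge P f r a} = range (leaf a)" using cosets_eq by simp
 qed
 thus ?thesis by (simp add: gr_algebra_def Let_def)
qed

lemma gr_map_coords: "s : S ==> gr_map p (coords s) = leaf (coords s) (lookup p s)" by (simp add: gr_map_def Gam_eq)

lemma gr_supp_gr_map: "p : span_on S ==> gr_supp (gr_map p) = coords ` keys p"
proof -
 assume p: "p : span_on S"
 have "gr_map p (coords s) ~= filt_gt P f r (coords s) \<longleftrightarrow> s : keys p" if s: "s : S" for s
  by (simp add: gr_map_coords[OF s] filt_gt_leaf[OF s] leaf_inj[OF s] in_keys_iff)
 moreover have "keys p <= S" using p by (simp add: span_on_def)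
 ultimately show ?thesis unfolding Gam_eq by (auto simp: image_iff)
qed

lemma gr_map_closed: "p : span_on S ==> gr_map p : carrier gr" unfolding carrier_gr using gr_supp_gr_map by (auto simp: gr_map_def)

lemma gr_map_inj: assumes "p : span_on S" "q : span_on S" "gr_map p = gr_map q" shows "p = q"
proof (rule poly_mapping_eqI)
 fix s
 show "lookup p s = lookup q s"
 proof (cases "s : S")
  case True
  thus ?thesis using fun_cong[OF assms(3), of "coords s"] by (simp add: gr_map_coords leaf_inj)
 next
  case False
  hence "s ~: keys p" "s ~: keys q" using False span_onD[OF assms(1), of s] span_onD[OF assms(2), of s] by argo+
  thus ?thesis by (simp add: in_keys_iff)
 qed
qed

lemma gr_map_surj: assumes "u : carrier gr" shows "EX p:span_on S. gr_map p = u"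
proof -
 have u: "u : (\<Pi>\<^sub>E a\<in>\<Gamma>. range (leaf a))" "finite (gr_supp u)" using assms by (auto simp: carrier_gr)
 have "ALL a:\<Gamma>. EX c. u a = leaf a c" using u(1) by (auto simp: PiE_iff image_iff)
 then obtain c where c: "ALL a:\<Gamma>. u a = leaf a (c a)" by (rule bchoice[THEN exE])
 define J where "J = uncoords ` gr_supp u"
 define p where "p = (SUM s:J. single s (c (coords s)))"
 have JS: "J <= S" unfolding J_def Gam_eq by auto
 have finJ: "finite J" using u(2) by (simp add: J_def)
 have lk: "lookup p s = c (coords s)" if s: "s : S" for s
 proof -
  have "lookup p s = (SUM t:J. if t = s then c (coords s) else 0)"
   unfolding p_def lookup_sum by (intro sum.cong refl) (auto simp: lookup_single when_def)
  also have "... = (if s : J then c (coords s) else 0)" using finJ by simp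
  also have "... = c (coords s)"
  proof (cases "s : J")
   case False
   have "coords s : \<Gamma>" using s by (simp add: Gam_eq)
   moreover have "coords s ~: gr_supp u"
   proof
    assume "coords s : gr_supp u"
    hence "uncoords (coords s) : J" unfolding J_def by (rule imageI)
    thus False using s False by simp
   qed
   ultimately have "leaf (coords s) (c (coords s)) = leaf (coords s) 0" using c s by (auto simp: filt_gt_leaf)
   thus ?thesis using False leaf_inj[OF s] by simp
  qed simp
  finally show ?thesis .
 qed
 have "p : span_on S" unfolding p_def by (intro span_on_sum span_on_single) (use JS in auto)
 moreover have "gr_map p = u"
 proof (rule extensionalityI[of _ \<Gamma>])
  show "gr_map p : extensional \<Gamma>" by (simp add: gr_map_def)
  show "u : extensional \<Gamma>" using u(1) by (simp add: PiE_def)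
  fix a assume "a : \<Gamma>"
  then obtain s where s: "s : S" "a = coords s" by (auto simp: Gam_eq)
  thus "gr_map p a = u a" using c \<open>a : \<Gamma>\<close> lk by (simp add: gr_map_coords)
 qed
 ultimately show ?thesis by blast
qed

lemma gr_rep: assumes "s : S" shows "(SOME g. g : gr_map p (coords s)) : leaf (coords s) (lookup p s)" unfolding gr_map_coords[OF assms]
 by (rule someI[where P = "%g. g : leaf (coords s) (lookup p s)"]) (rule single_in_leaf[OF assms])

lemma gr_rep_obtain: assumes "s : S"
 obtains H where "H : span_on S" "ALL t:keys H. lex_le P r (coords s) (coords t)"
  "lookup H s = lookup p s" "(SOME g. g : gr_map p (coords s)) = cone_fun P H"
 using gr_rep[OF assms, of p] that assms by (auto simp: leaf_def)

lemma gr_map_eqI: assumes "!!s. s : S ==> h (coords s) = leaf (coords s) (lookup p s)" shows "(\<lambda>c\<in>\<Gamma>. h c) = gr_map p"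
 unfolding gr_map_def by (rule restrict_ext) (use assms in "auto simp: Gam_eq")

lemma gr_map_add: "gr_map p \<oplus>\<^bsub>gr\<^esub> gr_map q = gr_map (p + q)"
proof -
 have "gr_map p \<oplus>\<^bsub>gr\<^esub> gr_map q = (\<lambda>c\<in>\<Gamma>. filt_gt P f r c +>\<^bsub>KX P\<^esub>
   ((SOME g. g : gr_map p c) \<oplus>\<^bsub>KX P\<^esub> (SOME g. g : gr_map q c)))"
  by (simp add: gr_algebra_def Let_def)
 also have "... = gr_map (p + q)"
 proof (rule gr_map_eqI)
  fix s assume s: "s : S"
  obtain F where F: "F : span_on S" "ALL t:keys F. lex_le P r (coords s) (coords t)"
   "lookup F s = lookup p s" "(SOME g. g : gr_map p (coords s)) = cone_fun P F" by (rule gr_rep_obtain[OF s])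
  obtain G where G: "G : span_on S" "ALL t:keys G. lex_le P r (coords s) (coords t)"
   "lookup G s = lookup q s" "(SOME g. g : gr_map q (coords s)) = cone_fun P G" by (rule gr_rep_obtain[OF s])
  have "ALL t:keys (F + G). lex_le P r (coords s) (coords t)" using F(2) G(2) Poly_Mapping.keys_add[of F G] by blast
  from coset_eq_leaf[OF s span_on_add[OF F(1) G(1)] this]
  show "filt_gt P f r (coords s) +>\<^bsub>KX P\<^esub>
    ((SOME g. g : gr_map p (coords s)) \<oplus>\<^bsub>KX P\<^esub> (SOME g. g : gr_map q (coords s))) = leaf (coords s) (lookup (p + q) s)"
   by (simp add: F(3,4) G(3,4) coord_ring_simps lookup_add flip: cone_fun_add)
 qed
 finally show ?thesis .
qed

lemma gr_map_smult: "c \<odot>\<^bsub>gr\<^esub> gr_map p = gr_map (single 0 c * p)"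
proof -
 have "c \<odot>\<^bsub>gr\<^esub> gr_map p = (\<lambda>a\<in>\<Gamma>. filt_gt P f r a +>\<^bsub>KX P\<^esub>
   (c \<odot>\<^bsub>KX P\<^esub> (SOME g. g : gr_map p a)))"
  by (simp add: gr_algebra_def Let_def)
 also have "... = gr_map (single 0 c * p)"
 proof (rule gr_map_eqI)
  fix s assume s: "s : S"
  obtain F where F: "F : span_on S" "ALL t:keys F. lex_le P r (coords s) (coords t)"
   "lookup F s = lookup p s" "(SOME g. g : gr_map p (coords s)) = cone_fun P F" by (rule gr_rep_obtain[OF s])
  have "ALL t:keys (single 0 c * F). lex_le P r (coords s) (coords t)"
  proof
   fix t assume "t : keys (single 0 c * F)"
   hence "t : keys F" by (simp add: in_keys_iff)
   thus "lex_le P r (coords s) (coords t)" by (rule bspec[OF F(2)])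
  qed
  from coset_eq_leaf[OF s span_on_smult[OF F(1)] this]
  show "filt_gt P f r (coords s) +>\<^bsub>KX P\<^esub> (c \<odot>\<^bsub>KX P\<^esub> (SOME g. g : gr_map p (coords s))) =
    leaf (coords s) (lookup (single 0 c * p) s)"
   by (simp add: F(3,4) coord_ring_simps flip: cone_fun_smult)
 qed
 finally show ?thesis .
qed

lemma gr_map_one: "\<one>\<^bsub>gr\<^esub> = gr_map 1"
proof -
 have "\<one>\<^bsub>gr\<^esub> = (\<lambda>c\<in>\<Gamma>. if c = (%_. 0) then filt_gt P f r c +>\<^bsub>KX P\<^esub> \<one>\<^bsub>KX P\<^esub> else filt_gt P f r c)"
  by (simp add: gr_algebra_def Let_def)
 also have "... = gr_map 1"
 proof (rule gr_map_eqI)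
  fix s assume s: "s : S"
  show "(if coords s = (%_. 0) then filt_gt P f r (coords s) +>\<^bsub>KX P\<^esub> \<one>\<^bsub>KX P\<^esub>
    else filt_gt P f r (coords s)) = leaf (coords s) (lookup (1 :: ('n, 'k) lpoly) s)"
  proof (cases "s = 0")
   case True
   have "filt_gt P f r (coords 0) +>\<^bsub>KX P\<^esub> cone_fun P 1 = leaf (coords 0) (lookup (1 :: ('n, 'k) lpoly) 0)"
    by (rule coset_eq_leaf) (auto simp: S_mon_0 span_on_def lex_le_refl)
   thus ?thesis using True by (simp add: coords_0 coord_ring_simps cone_fun_1)
  next
   case False
   hence "coords s ~= coords 0" using inj_onD[OF inj_coords _ s S_mon_0] by blast
   thus ?thesis using False by (simp add: coords_0[symmetric] filt_gt_leaf[OF s] lookup_one)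
  qed
 qed
 finally show ?thesis .
qed

lemma gr_map_mult: assumes p: "p : span_on S" and q: "q : span_on S"
 shows "gr_map p \<otimes>\<^bsub>gr\<^esub> gr_map q = gr_map (fan_mult mchains (S_flag P f) p q)"
proof -
 let ?rep = "%u a. SOME g. g : u a"
 have "gr_map p \<otimes>\<^bsub>gr\<^esub> gr_map q = (\<lambda>c\<in>\<Gamma>. filt_gt P f r c +>\<^bsub>KX P\<^esub>
   (\<Oplus>\<^bsub>KX P\<^esub>ab\<in>{ab : gr_supp (gr_map p) \<times> gr_supp (gr_map q). qadd (fst ab) (snd ab) = c}.
    ?rep (gr_map p) (fst ab) \<otimes>\<^bsub>KX P\<^esub> ?rep (gr_map q) (snd ab)))"
  by (simp add: gr_algebra_def Let_def)
 also have "... = gr_map (fan_mult mchains (S_flag P f) p q)"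
 proof (rule gr_map_eqI)
  fix w assume w: "w : S"
  let ?J = "{ab : gr_supp (gr_map p) \<times> gr_supp (gr_map q). qadd (fst ab) (snd ab) = coords w}"
  let ?K = "{(s, t) : keys p \<times> keys q. fan_comp mchains (S_flag P f) s t & s + t = w}"
  have J: "?J = {ab : coords ` keys p \<times> coords ` keys q. qadd (fst ab) (snd ab) = coords w}"
   using gr_supp_gr_map[OF p] gr_supp_gr_map[OF q] by simp
  have fin: "finite ?J" unfolding J by simp
  define X where "X = (%ab. ?rep (gr_map p) (fst ab) \<otimes>\<^bsub>KX P\<^esub> ?rep (gr_map q) (snd ab))"
  have "ALL ab:?J. EX H. H : span_on S & X ab = cone_fun P H & (ALL u:keys H. lex_le P r (coords w) (coords u)) &
    lookup H w = lookup p (uncoords (fst ab)) * lookup q (uncoords (snd ab))"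
  proof
   fix ab assume "ab : ?J"
   hence "ab : coords ` keys p \<times> coords ` keys q" "qadd (fst ab) (snd ab) = coords w" unfolding J by simp_all
   then obtain s t where st: "s : keys p" "t : keys q" "ab = (coords s, coords t)"
    "qadd (coords s) (coords t) = coords w" by auto
   have S: "s : S" "t : S" using span_onD[OF p st(1)] span_onD[OF q st(2)] .
   from leaf_mult[OF S w st(4) gr_rep[OF S(1)] gr_rep[OF S(2)]]
   show "EX H. H : span_on S & X ab = cone_fun P H & (ALL u:keys H. lex_le P r (coords w) (coords u)) &
    lookup H w = lookup p (uncoords (fst ab)) * lookup q (uncoords (snd ab))"
    unfolding X_def st(3) fst_conv snd_conv uncoords[OF S(1)] uncoords[OF S(2)] .
  qed
  then obtain H where H: "ALL ab:?J. H ab : span_on S & X ab = cone_fun P (H ab) & (ALL u:keys (H ab). lex_le P r (coords w) (coords u)) &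
    lookup (H ab) w = lookup p (uncoords (fst ab)) * lookup q (uncoords (snd ab))"
   by (rule bchoice[THEN exE])
  have H1: "H ab : span_on S" and H2: "X ab = cone_fun P (H ab)"
   and H3: "u : keys (H ab) ==> lex_le P r (coords w) (coords u)"
   and H4: "lookup (H ab) w = lookup p (uncoords (fst ab)) * lookup q (uncoords (snd ab))"
   if "ab : ?J" for ab u using bspec[OF H that] by blast+
  interpret CR: abelian_monoid "KX P :: ('k, ('n, 'k) lfun) graded_algebra" by (rule coord_ring_a_monoid)
  have "(\<Oplus>\<^bsub>KX P\<^esub>ab\<in>?J. X ab) = (\<Oplus>\<^bsub>KX P\<^esub>ab\<in>?J. cone_fun P (H ab))"
  proof (rule CR.finsum_cong'[OF refl])
   show "(%ab. cone_fun P (H ab)) : ?J \<rightarrow> carrier (KX P)" unfolding carrier_coord_ring by (rule Pi_I) (rule imageI[OF H1])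
   show "X ab = cone_fun P (H ab)" if "ab : ?J" for ab by (rule H2[OF that])
  qed
  also have "... = cone_fun P (sum H ?J)" by (rule finsum_coord_ring[OF fin H1])
  finally have fs: "(\<Oplus>\<^bsub>KX P\<^esub>ab\<in>?J. X ab) = cone_fun P (sum H ?J)" .
  have mem: "sum H ?J : span_on S" by (rule span_on_sum[OF H1])
  have "lex_le P r (coords w) (coords u)" if u: "u : keys (sum H ?J)" for u
  proof -
   have "EX ab:?J. u : keys (H ab)"
   proof (rule ccontr)
    assume no: "~ (EX ab:?J. u : keys (H ab))"
    have "lookup (sum H ?J) u = 0" unfolding lookup_sum
    proof (rule sum.neutral[OF ballI])
     fix ab assume "ab : ?J"
     hence "u ~: keys (H ab)" using no by blast
     thus "lookup (H ab) u = 0" by (simp add: in_keys_iff)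
    qed
    thus False using u by (simp add: in_keys_iff)
   qed
   then obtain ab where "ab : ?J" "u : keys (H ab)" ..
   thus ?thesis by (rule H3)
  qed
  hence "filt_gt P f r (coords w) +>\<^bsub>KX P\<^esub> cone_fun P (sum H ?J) =
    leaf (coords w) (lookup (sum H ?J) w)" by (intro coset_eq_leaf[OF w mem] ballI)
  moreover have "lookup (sum H ?J) w = (SUM ab:?J. lookup p (uncoords (fst ab)) * lookup q (uncoords (snd ab)))"
   unfolding lookup_sum by (rule sum.cong[OF refl H4])
  moreover have "... = (SUM (s, t):?K. lookup p s * lookup q t)"
  proof (rule sum.reindex_bij_witness[where j = "%ab. (uncoords (fst ab), uncoords (snd ab))"
     and i = "%(s, t). (coords s, coords t)"])
   fix ab assume "ab : ?J"
   hence "ab : coords ` keys p \<times> coords ` keys q" "qadd (fst ab) (snd ab) = coords w" unfolding J by simp_all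
   then obtain s t where st: "s : keys p" "t : keys q" "ab = (coords s, coords t)"
    "qadd (coords s) (coords t) = coords w" by auto
   have S: "s : S" "t : S" using span_onD[OF p st(1)] span_onD[OF q st(2)] .
   have fl: "flag P (ssupp s Un ssupp t)"
    using coords(2)[OF w] qsupp_qadd_nonneg[of "coords s" "coords t"] coords(1)[OF S(1)] coords(1)[OF S(2)] by (simp add: st(4))
   have "coords (s + t) = coords w" using coords_add[OF S fl] st(4) by simp
   hence "s + t = w" by (rule inj_onD[OF inj_coords _ S_mon_add[OF S] w])
   thus "(uncoords (fst ab), uncoords (snd ab)) : ?K" using st S fl by (simp add: fan_comp_iff)
   show "(%(s, t). (coords s, coords t)) (uncoords (fst ab), uncoords (snd ab)) = ab" using st S by simp
   show "(%(s, t). lookup p s * lookup q t) (uncoords (fst ab), uncoords (snd ab)) =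
     lookup p (uncoords (fst ab)) * lookup q (uncoords (snd ab))" by simp
  next
   fix st assume "st : ?K"
   then obtain s t where st: "s : keys p" "t : keys q" "st = (s, t)"
    "fan_comp mchains (S_flag P f) s t" "s + t = w" by auto
   have c: "s : S" "t : S" "flag P (ssupp s Un ssupp t)" using st(4) by (auto simp: fan_comp_iff)
   show "(%(s, t). (coords s, coords t)) st : ?J" unfolding J using st coords_add[OF c] by simp
   show "(uncoords (fst ((%(s, t). (coords s, coords t)) st)), uncoords (snd ((%(s, t). (coords s, coords t)) st))) = st"
    using st(3) c by simp
  qed
  ultimately show "filt_gt P f r (coords w) +>\<^bsub>KX P\<^esub> (\<Oplus>\<^bsub>KX P\<^esub>ab\<in>?J.
    ?rep (gr_map p) (fst ab) \<otimes>\<^bsub>KX P\<^esub> ?rep (gr_map q) (snd ab)) = leaf (coords w) (lookup (fan_mult mchains (S_flag P f) p q) w)"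
   using fs unfolding X_def lookup_fan_mult by simp
 qed
 finally show ?thesis .
qed

lemma graded_iso_gr: "graded_iso fan_alg gr gr_map" unfolding graded_iso_def
proof (intro conjI allI ballI)
 have bij: "bij_betw gr_map (span_on S) (carrier gr)" unfolding bij_betw_def
 proof
  show "inj_on gr_map (span_on S)" by (rule inj_onI) (rule gr_map_inj)
  show "gr_map ` span_on S = carrier gr" using gr_map_closed gr_map_surj by blast
 qed
 have "gr_map : ring_hom fan_alg gr" by (rule ring_hom_memI)
   (auto simp: fan_simps Union_S_flag gr_map_closed gr_map_mult gr_map_add gr_map_one)
 thus "gr_map : ring_iso fan_alg gr" using bij by (simp add: ring_iso_def fan_simps Union_S_flag)
 show "gr_map (c \<odot>\<^bsub>fan_alg\<^esub> x) = c \<odot>\<^bsub>gr\<^esub> gr_map x" for c x by (simp add: fan_simps gr_map_smult)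
 fix d
 have hg: "homog gr d = {u : carrier gr. ALL a:gr_supp u. qdegree P f a = of_nat d}" by (simp add: gr_algebra_def Let_def)
 have deg: "(ALL a:gr_supp (gr_map p). qdegree P f a = of_nat d) \<longleftrightarrow> (ALL s:keys p. fst s = int d)"
  if p: "p : span_on S" for p
 proof -
  have "qdegree P f (coords s) = of_nat d \<longleftrightarrow> fst s = int d" if "s : keys p" for s
   unfolding qdegree_coords[OF span_onD[OF p that]] by (metis of_int_eq_iff of_int_of_nat_eq)
  thus ?thesis unfolding gr_supp_gr_map[OF p] by simp
 qed
 show "gr_map ` homog fan_alg d = homog gr d"
 proof (intro equalityI subsetI)
  fix u assume "u : gr_map ` homog fan_alg d"
  then obtain p where p: "p : span_on S" "ALL s:keys p. fst s = int d" "u = gr_map p"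
   by (auto simp only: fan_simps Union_S_flag image_iff mem_Collect_eq)
  thus "u : homog gr d" unfolding hg using gr_map_closed[OF p(1)] deg[OF p(1)] by simp
 next
  fix u assume u: "u : homog gr d"
  then obtain p where p: "p : span_on S" "gr_map p = u" using gr_map_surj unfolding hg by blast
  hence "ALL s:keys p. fst s = int d" using u deg[OF p(1)] unfolding hg by simp
  thus "u : gr_map ` homog fan_alg d" unfolding fan_simps Union_S_flag using p by blast
 qed
qed

end

section \<open>The fan algebra by generators and relations\<close>

lemma cring_span_on: fixes R :: "('a::comm_monoid_add \<Rightarrow>\<^sub>0 'k::field, 'x) ring_scheme"
 assumes R: "carrier R = span_on A" "!!x y. x \<otimes>\<^bsub>R\<^esub> y = x * y" "!!x y. x \<oplus>\<^bsub>R\<^esub> y = x + y"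
  "\<one>\<^bsub>R\<^esub> = 1" "\<zero>\<^bsub>R\<^esub> = 0"
  and A: "0 : A" "!!s t. s : A ==> t : A ==> s + t : A" shows "cring R"
proof (rule cringI)
 show "abelian_group R"
 proof (rule abelian_groupI)
  fix x assume "x : carrier R"
  thus "EX y:carrier R. y \<oplus>\<^bsub>R\<^esub> x = \<zero>\<^bsub>R\<^esub>" by (intro bexI[of _ "- x"]) (auto simp: R span_on_uminus)
 qed (auto simp: R span_on_add span_on_0 add_ac)
 have "1 : span_on A" using A(1) by (simp add: span_on_def)
 moreover have "x * y : span_on A" if "x : span_on A" "y : span_on A" for x y :: "'a \<Rightarrow>\<^sub>0 'k"
  using span_on_mult[OF that A(2)] .
 ultimately show "Group.comm_monoid R" by (intro comm_monoidI) (simp_all add: R mult_ac)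
qed (simp add: R distrib_right)

definition pm_subst :: "('i => ('b::comm_monoid_add \<Rightarrow>\<^sub>0 'k)) => ('i, 'k::field) mpoly => ('b \<Rightarrow>\<^sub>0 'k)" where
 "pm_subst g F = (SUM m:keys F. single 0 (lookup F m) * mono_val g m)"

lemma pm_subst_superset: assumes "finite A" "keys F <= A" shows "pm_subst g F = (SUM m:A. single 0 (lookup F m) * mono_val g m)"
 unfolding pm_subst_def using assms by (intro sum.mono_neutral_left) (auto simp: in_keys_iff)

lemma pm_subst_add: "pm_subst g (F + G) = pm_subst g F + pm_subst g G"
proof -
 let ?A = "keys F Un keys G"
 have "pm_subst g (F + G) = (SUM m:?A. single 0 (lookup (F + G) m) * mono_val g m)"
  by (intro pm_subst_superset) (auto dest: Poly_Mapping.keys_add[THEN subsetD])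
 thus ?thesis by (simp add: lookup_add single_add distrib_right sum.distrib pm_subst_superset[of ?A])
qed

lemma pm_subst_single [simp]: "pm_subst g (single m c) = single 0 c * mono_val g m" by (simp add: pm_subst_def)

lemma pm_subst_0 [simp]: "pm_subst g 0 = 0" by (simp add: pm_subst_def)

lemma pm_subst_sum: "pm_subst g (sum F A) = (SUM i:A. pm_subst g (F i))"
 by (induction A rule: infinite_finite_induct) (simp_all add: pm_subst_add)

lemma pm_subst_mult: fixes g :: "'i => ('b::comm_monoid_add \<Rightarrow>\<^sub>0 'k::field)" shows "pm_subst g (F * G) = pm_subst g F * pm_subst g G"
proof -
 have "pm_subst g (F * G) = (SUM s:keys F. SUM t:keys G. single 0 (lookup F s * lookup G t) * (mono_val g s * mono_val g t))"
  by (simp add: pm_mult_expand[of F G] pm_subst_sum mono_add)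
 also have "... = (SUM s:keys F. SUM t:keys G. (single 0 (lookup F s) * mono_val g s) * (single 0 (lookup G t) * mono_val g t))"
 proof (intro sum.cong refl)
  fix s t
  have "single 0 (lookup F s * lookup G t) = (single 0 (lookup F s) * single 0 (lookup G t) :: 'b \<Rightarrow>\<^sub>0 'k)"
   by (simp add: mult_single)
  thus "single 0 (lookup F s * lookup G t) * (mono_val g s * mono_val g t) = (single 0 (lookup F s) * mono_val g s) *
   (single 0 (lookup G t) * mono_val g t)" by (simp add: mult_ac)
 qed
 also have "... = pm_subst g F * pm_subst g G" by (simp add: pm_subst_def[of g F] pm_subst_def[of g G] sum_product)
 finally show ?thesis .
qed

lemma pm_subst_yvar [simp]: "pm_subst g (yvar a) = g a" by (simp add: yvar_def)

lemma pm_subst_1 [simp]: "pm_subst g 1 = 1" using pm_subst_single[of g 0 1] by simp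

lemma pm_subst_diff: "pm_subst g (F - G) = pm_subst g F - pm_subst g G" using pm_subst_add[of g "F - G" G] by simp

lemma polys_in_span_on: "polys_in I = span_on {m. keys m <= I}" by (auto simp: polys_in_def span_on_def)

lemma poly_ring_simps:
 "carrier (poly_ring I) = span_on {m. keys m <= I}" "x \<otimes>\<^bsub>poly_ring I\<^esub> y = x * y"
 "x \<oplus>\<^bsub>poly_ring I\<^esub> y = x + y" "\<one>\<^bsub>poly_ring I\<^esub> = 1" "\<zero>\<^bsub>poly_ring I\<^esub> = 0"
 by (simp_all add: poly_ring_def polys_in_span_on)

lemma UN_const: "x : A ==> (!!F. F : A ==> g F = K) ==> (UN F:A. g F) = K" by auto

lemma cring_poly_ring: "cring (poly_ring I :: ('i, 'k::field) mpoly ring)" by (rule cring_span_on[where A = "{m. keys m <= I}"])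
  (simp_all add: poly_ring_simps keys_add_nat)

lemma cring_semigroup_algebra: assumes "0 : A" "!!s t. s : A ==> t : A ==> s + t : A"
 shows "cring (semigroup_algebra A :: ('k::field, ('n::finite, 'k) lpoly) graded_algebra)"
 by (rule cring_span_on[where A = A]) (use assms in "simp_all add: sg_simps")

lemma mono_val_supported: fixes g :: "'i => ('b::comm_monoid_add \<Rightarrow>\<^sub>0 'k::field)"
 assumes "0 : A" "!!s t. s : A ==> t : A ==> s + t : A" "!!i. i : keys m ==> g i : span_on A" shows "mono_val g m : span_on A"
proof -
 have one: "1 : span_on A" using assms(1) by (simp add: span_on_def)
 have mul: "x * y : span_on A" if "x : span_on A" "y : span_on A" for x y :: "'b \<Rightarrow>\<^sub>0 'k"
  using span_on_mult[OF that assms(2)] .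
 have pow: "x ^ k : span_on A" if "x : span_on A" for x :: "'b \<Rightarrow>\<^sub>0 'k" and k by (induction k) (use that one mul in auto)
 have "(PROD i:J. g i ^ lookup m i) : span_on A" if "J <= keys m" for J using finite_subset[OF that finite_keys] that
  by (induction J rule: finite_induct) (use one pow assms(3) mul in auto)
 thus ?thesis unfolding mono_val_def by blast
qed

lemma (in ideal) coset_eq_iff: assumes "x : carrier R" "y : carrier R" shows "I +> x = I +> y \<longleftrightarrow> x \<ominus> y : I"
 using quotient_eq_iff_same_a_r_cos[OF is_ideal assms] by auto

context stratified begin

abbreviation "Yring \<equiv> (poly_ring \<Gamma> :: ('n qvec, 'k) mpoly ring)"

abbreviation "fan_gens \<equiv> (fan_ideal_gens P \<Gamma> :: ('n qvec, 'k) mpoly set)"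

definition fan_ideal :: "('n qvec, 'k) mpoly set" where
 "fan_ideal = Idl\<^bsub>Yring\<^esub> fan_gens"

definition to_poly :: "(('n, 'k) lpoly) => ('n qvec, 'k) mpoly" where
 "to_poly p = pm_map (%s. single (coords s) 1) p"

text \<open>The homomorphism to the semigroup algebra of one simplex that kills the variables outside
  that simplex.\<close>

definition yimage :: "'n face set => 'n qvec => (('n, 'k) lpoly)" where
 "yimage C a = (if uncoords a : S_flag P f C then single (uncoords a) 1 else 0)"

lemma yvar_in: "a : \<Gamma> ==> yvar a : carrier Yring" by (simp add: poly_ring_simps yvar_def span_on_def)

lemma Y_closed:
 "x : carrier Yring ==> y : carrier Yring ==> x + y : carrier Yring"
 "x : carrier Yring ==> y : carrier Yring ==> x - y : carrier Yring"
 "x : carrier Yring ==> y : carrier Yring ==> x * y : carrier Yring"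
 "1 : carrier Yring" "0 : carrier Yring" "single 0 c : carrier Yring"
proof -
 interpret cring Yring by (rule cring_poly_ring)
 show "x : carrier Yring ==> y : carrier Yring ==> x + y : carrier Yring"
  "x : carrier Yring ==> y : carrier Yring ==> x * y : carrier Yring"
  "1 : carrier Yring" "0 : carrier Yring"
  using a_closed[of x y] m_closed[of x y] one_closed zero_closed by (simp_all add: poly_ring_simps(2-5))
 show "x : carrier Yring ==> y : carrier Yring ==> x - y : carrier Yring"
  "single 0 c : carrier Yring" by (simp_all add: poly_ring_simps(1) span_on_diff span_on_single)
qed

lemma a_minus_Y: "x : carrier Yring ==> y : carrier Yring ==> x \<ominus>\<^bsub>Yring\<^esub> y = x - y"
proof -
 interpret cring Yring by (rule cring_poly_ring)
 assume x: "x : carrier Yring" and y: "y : carrier Yring"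
 have "x - y : carrier Yring" by (rule Y_closed(2)[OF x y])
 hence "(x - y) \<oplus>\<^bsub>Yring\<^esub> y \<ominus>\<^bsub>Yring\<^esub> y = x - y" using y by algebra
 thus ?thesis by (simp add: poly_ring_simps(3))
qed

lemma zero_in_Gam: "(%_. 0) : \<Gamma>" unfolding Gam_eq by (rule image_eqI[of _ _ 0]) (simp_all add: coords_0 S_mon_0)

lemma flag_pair_iff: "(EX C. flag P C & A <= C & B <= C) \<longleftrightarrow> flag P (A Un B)"
proof
 assume "EX C. flag P C & A <= C & B <= C"
 then obtain C where "flag P C" "A <= C" "B <= C" by blast
 thus "flag P (A Un B)" by (rule flag_union_subset)
qed (intro exI[of _ "A Un B"], auto)

lemma fan_gens_cases: assumes "x : fan_gens"
 obtains (comp) s t where "s : S" "t : S" "fan_comp mchains (S_flag P f) s t"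
   "x = yvar (coords s) * yvar (coords t) - yvar (coords (s + t))"
  | (incomp) s t where "s : S" "t : S" "~ fan_comp mchains (S_flag P f) s t"
   "x = yvar (coords s) * yvar (coords t)"
  | (one) "x = yvar (%_. 0) - 1"
proof -
 consider a b where "a : \<Gamma>" "b : \<Gamma>" "flag P (qsupp a Un qsupp b)" "x = yvar a * yvar b - yvar (qadd a b)"
  | a b where "a : \<Gamma>" "b : \<Gamma>" "~ flag P (qsupp a Un qsupp b)" "x = yvar a * yvar b"
  | "x = yvar (%_. 0) - 1" using assms unfolding fan_ideal_gens_def flag_pair_iff by auto
 thus thesis
 proof cases
  case 1
  then obtain s t where st: "s : S" "t : S" "a = coords s" "b = coords t" by (auto simp: Gam_eq)
  thus thesis using 1 coords_add[OF st(1,2)] by (intro comp[of s t]) (auto simp: fan_comp_iff)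
 next
  case 2
  then obtain s t where st: "s : S" "t : S" "a = coords s" "b = coords t" by (auto simp: Gam_eq)
  thus thesis using 2 by (intro incomp[of s t]) (auto simp: fan_comp_iff)
 next
  case 3
  thus thesis by (rule one)
 qed
qed

lemma fan_gens_intros:
 "s : S ==> t : S ==> fan_comp mchains (S_flag P f) s t ==> yvar (coords s) * yvar (coords t) - yvar (coords (s + t)) : fan_gens"
 "s : S ==> t : S ==> ~ fan_comp mchains (S_flag P f) s t ==> yvar (coords s) * yvar (coords t) : fan_gens"
 "yvar (%_. 0) - 1 : fan_gens"
proof -
 have G: "coords s : \<Gamma>" if "s : S" for s using that by (simp add: Gam_eq)
 show "yvar (coords s) * yvar (coords t) - yvar (coords (s + t)) : fan_gens"
  if st: "s : S" "t : S" and c: "fan_comp mchains (S_flag P f) s t"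
 proof -
  have fl: "flag P (ssupp s Un ssupp t)" using c by (simp add: fan_comp_iff)
  show ?thesis unfolding fan_ideal_gens_def flag_pair_iff coords_add[OF st fl] using G st fl by blast
 qed
 show "yvar (coords s) * yvar (coords t) : fan_gens"
  if st: "s : S" "t : S" and c: "~ fan_comp mchains (S_flag P f) s t"
 proof -
  have fl: "~ flag P (ssupp s Un ssupp t)" using c st by (simp add: fan_comp_iff)
  show ?thesis unfolding fan_ideal_gens_def flag_pair_iff using G st fl by blast
 qed
 show "yvar (%_. 0) - 1 : fan_gens" unfolding fan_ideal_gens_def by simp
qed

lemma fan_gens_carrier: "fan_gens <= carrier Yring"
proof
 have G: "coords s : \<Gamma>" if "s : S" for s using that by (simp add: Gam_eq)
 fix x assume "x : fan_gens"
 thus "x : carrier Yring"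
 proof (cases rule: fan_gens_cases)
  case (comp s t)
  thus ?thesis by (simp add: Y_closed(2,3) yvar_in G S_mon_add)
 next
  case (incomp s t)
  thus ?thesis by (simp add: Y_closed(3) yvar_in G)
 next
  case one
  thus ?thesis by (simp add: Y_closed(2,4) yvar_in zero_in_Gam)
 qed
qed

lemma fan_ideal_ideal: "ideal fan_ideal Yring"
proof -
 interpret cring Yring by (rule cring_poly_ring)
 show ?thesis unfolding fan_ideal_def by (rule genideal_ideal[OF fan_gens_carrier])
qed

lemma fan_ideal_closed:
 "x : fan_ideal ==> x : carrier Yring" "x : fan_gens ==> x : fan_ideal"
 "x : fan_ideal ==> y : fan_ideal ==> x + y : fan_ideal"
 "x : fan_ideal ==> y : carrier Yring ==> y * x : fan_ideal" "0 : fan_ideal"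
 "x : fan_ideal ==> - x : fan_ideal"
proof -
 interpret cring Yring by (rule cring_poly_ring)
 interpret ideal fan_ideal Yring by (rule fan_ideal_ideal)
 show "x : fan_ideal ==> x : carrier Yring" by (rule a_Hcarr)
 show "x : fan_gens ==> x : fan_ideal" using genideal_self[OF fan_gens_carrier] unfolding fan_ideal_def by blast
 show "x : fan_ideal ==> y : fan_ideal ==> x + y : fan_ideal" using a_closed[of x y] by (simp add: poly_ring_simps(3))
 show m: "x : fan_ideal ==> y : carrier Yring ==> y * x : fan_ideal" for x y using I_l_closed[of x y] by (simp add: poly_ring_simps(2))
 show "0 : fan_ideal" using zero_closed by (simp add: poly_ring_simps(5))
 show "x : fan_ideal ==> - x : fan_ideal" using m[of x "single 0 (- 1)"] Y_closed(6)[of "- 1"] by (simp add: single_uminus)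
qed

lemma fan_ideal_sum: "(!!i. i : J ==> F i : fan_ideal) ==> sum F J : fan_ideal"
 by (induction J rule: infinite_finite_induct) (auto intro: fan_ideal_closed)

lemma to_poly_single: "to_poly (single s c) = single 0 c * yvar (coords s)" by (simp add: to_poly_def yvar_def mult_single)

lemma to_poly_add: "to_poly (p + q) = to_poly p + to_poly q" by (simp add: to_poly_def pm_map_add)

lemma to_poly_sum: "to_poly (sum F J) = (SUM i:J. to_poly (F i))" by (simp add: to_poly_def pm_map_sum)

lemma to_poly_0 [simp]: "to_poly 0 = 0" by (simp add: to_poly_def)

lemma to_poly_diff: "to_poly (p - q) = to_poly p - to_poly q" using to_poly_add[of "p - q" q] by simp

lemma to_poly_expand: "to_poly p = (SUM s:keys p. single 0 (lookup p s) * yvar (coords s))"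
 by (subst pm_expand) (simp add: to_poly_sum to_poly_single)

lemma to_poly_smult: "to_poly (single 0 c * p) = single 0 c * to_poly p"
proof -
 have "single 0 c * p = (SUM s:keys p. single s (c * lookup p s))" by (subst (1) pm_expand[of p]) (simp add: sum_distrib_left mult_single)
 hence "to_poly (single 0 c * p) = (SUM s:keys p. single 0 (c * lookup p s) * yvar (coords s))"
  by (simp only: to_poly_sum to_poly_single)
 also have "... = single 0 c * to_poly p" unfolding to_poly_expand[of p] sum_distrib_left
  by (intro sum.cong refl) (simp add: mult_single flip: mult.assoc)
 finally show ?thesis .
qed

lemma to_poly_closed: "p : span_on S ==> to_poly p : carrier Yring"
proof -
 assume p: "p : span_on S"
 have "(SUM s:J. single 0 (lookup p s) * yvar (coords s)) : carrier Yring"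
  if "J <= keys p" for J using finite_subset[OF that finite_keys] that
 proof (induction J rule: finite_induct)
  case (insert s J)
  hence "coords s : \<Gamma>" using span_onD[OF p] by (auto simp: Gam_eq)
  thus ?case using insert by (simp add: Y_closed(1,3,6) yvar_in)
 qed (simp add: Y_closed(5))
 thus ?thesis unfolding to_poly_expand by blast
qed

lemma to_poly_mult:
 assumes p: "p : span_on S" and q: "q : span_on S" shows "to_poly p * to_poly q - to_poly (fan_mult mchains (S_flag P f) p q) : fan_ideal"
proof -
 let ?p = "lookup p" and ?q = "lookup q"
 have e1: "to_poly p * to_poly q = (SUM s:keys p. SUM t:keys q. single 0 (?p s * ?q t) * (yvar (coords s) * yvar (coords t)))"
  unfolding to_poly_expand[of p] to_poly_expand[of q] sum_product
 proof (intro sum.cong refl)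
  fix s t
  have "single 0 (?p s * ?q t) = (single 0 (?p s) * single 0 (?q t) :: ('n qvec, 'k) mpoly)" by (simp add: mult_single)
  thus "single 0 (?p s) * yvar (coords s) * (single 0 (?q t) * yvar (coords t)) =
    single 0 (?p s * ?q t) * (yvar (coords s) * yvar (coords t))" by (simp add: mult_ac)
 qed
 have e2: "to_poly (fan_mult mchains (S_flag P f) p q) = (SUM s:keys p. SUM t:keys q.
   single 0 (?p s * ?q t) * (if fan_comp mchains (S_flag P f) s t then yvar (coords (s + t)) else 0))"
  unfolding fan_mult_def to_poly_sum by (intro sum.cong refl) (simp add: to_poly_single)
 show ?thesis unfolding e1 e2 sum_subtractf[symmetric] right_diff_distrib[symmetric]
 proof (intro fan_ideal_sum fan_ideal_closed(4) Y_closed(6))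
  fix s t assume st: "s : keys p" "t : keys q"
  note S = span_onD[OF p st(1)] span_onD[OF q st(2)]
  show "yvar (coords s) * yvar (coords t) - (if fan_comp mchains (S_flag P f) s t then yvar (coords (s + t)) else 0) : fan_ideal"
   using fan_gens_intros(1,2)[OF S] by (auto intro: fan_ideal_closed(2))
 qed
qed

lemma to_poly_restrict: assumes "p : span_on S" shows "pm_subst (yimage C) (to_poly p) = restr (S_flag P f C) p"
proof -
 have "pm_subst (yimage C) (to_poly p) = (SUM s:keys p. single 0 (lookup p s) * yimage C (coords s))"
  by (simp add: to_poly_expand pm_subst_sum pm_subst_mult)
 also have "... = restr (S_flag P f C) p" unfolding restr_def
  by (intro sum.cong refl) (use span_onD[OF assms] in "simp add: yimage_def mult_single")
 finally show ?thesis .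
qed

lemma pm_subst_yimage_fan_ideal: assumes C: "C : mchains" and x: "x : fan_ideal" shows "pm_subst (yimage C) x = 0"
proof -
 interpret Y: cring Yring by (rule cring_poly_ring)
 let ?A = "semigroup_algebra (S_flag P f C) :: ('k, ('n, 'k) lpoly) graded_algebra"
 have A: "cring ?A" by (rule cring_semigroup_algebra) (use fan.M_0[OF C] fan.M_add[OF C] in auto)
 interpret A: cring ?A by (rule A)
 have yi: "yimage C a : span_on (S_flag P f C)" for a by (simp add: yimage_def span_on_0 span_on_single)
 have cl: "pm_subst (yimage C) F : span_on (S_flag P f C)" for F unfolding pm_subst_def
  by (intro span_on_sum span_on_smult mono_val_supported yi fan.M_0[OF C] fan.M_add[OF C])
 have "pm_subst (yimage C) : ring_hom Yring ?A" by (rule ring_hom_memI)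
   (simp_all add: sg_simps poly_ring_simps(2-5) cl pm_subst_mult pm_subst_add)
 then interpret h: ring_hom_ring Yring ?A "pm_subst (yimage C)" by (rule ring_hom_ringI2[OF Y.ring_axioms A.ring_axioms])
 have "fan_gens <= a_kernel Yring ?A (pm_subst (yimage C))"
 proof
  fix y assume y: "y : fan_gens"
  hence "pm_subst (yimage C) y = 0"
  proof (cases rule: fan_gens_cases)
   case (comp s t)
   have "s + t : S_flag P f C \<longleftrightarrow> s : S_flag P f C & t : S_flag P f C"
   proof -
    obtain D where "D : mchains" "s : S_flag P f D" "t : S_flag P f D" using comp(3) unfolding fan_comp_def by blast
    thus ?thesis using fan.M_face[OF C, of D s t] fan.M_add[OF C, of s t] by blast
   qed
   thus ?thesis using comp by (auto simp: pm_subst_diff pm_subst_mult yimage_def S_mon_add mult_single)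
  next
   case (incomp s t)
   have "~ (s : S_flag P f C & t : S_flag P f C)" using incomp(3) C unfolding fan_comp_def by blast
   thus ?thesis using incomp by (auto simp: pm_subst_mult yimage_def)
  next
   case one
   thus ?thesis using fan.M_0[OF C] by (simp add: pm_subst_diff yimage_def uncoords_0)
  qed
  thus "y : a_kernel Yring ?A (pm_subst (yimage C))"
   using subsetD[OF fan_gens_carrier y] by (simp only: a_kernel_def' mem_Collect_eq sg_simps)
 qed
 hence "fan_ideal <= a_kernel Yring ?A (pm_subst (yimage C))" unfolding fan_ideal_def by (rule Y.genideal_minimal[OF h.kernel_is_ideal])
 hence "x : a_kernel Yring ?A (pm_subst (yimage C))" using x by (rule subsetD)
 thus ?thesis by (simp only: a_kernel_def' mem_Collect_eq sg_simps)
qed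

lemma to_poly_fan_ideal: assumes p: "p : span_on S" and J: "to_poly p : fan_ideal" shows "p = 0"
proof (rule fan.restrict_jointly_inj)
 show "p : span_on (UN C:mchains. S_flag P f C)" unfolding Union_S_flag by (rule p)
 show "0 : span_on (UN C:mchains. S_flag P f C)" by (rule span_on_0)
 fix C assume "C : mchains"
 thus "restr (S_flag P f C) p = restr (S_flag P f C) 0" using pm_subst_yimage_fan_ideal[OF _ J] to_poly_restrict[OF p] by simp
qed

definition mono_qdeg :: "('n qvec \<Rightarrow>\<^sub>0 nat) => rat" where
 "mono_qdeg m = (SUM a:keys m. of_nat (lookup m a) * qdegree P f a)"

lemma mono_qdeg_superset:
 "finite A ==> keys m <= A ==> mono_qdeg m = (SUM a:A. of_nat (lookup m a) * qdegree P f a)"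
 unfolding mono_qdeg_def by (intro sum.mono_neutral_left) (auto simp: in_keys_iff)

lemma mono_qdeg_add: "mono_qdeg (m + m') = mono_qdeg m + mono_qdeg m'"
proof -
 let ?A = "keys m Un keys m'"
 show ?thesis by (simp add: mono_qdeg_superset[of ?A] keys_add_nat lookup_add distrib_right sum.distrib)
qed

lemma mono_qdeg_single: "mono_qdeg (single a (Suc 0)) = qdegree P f a" by (simp add: mono_qdeg_def)

text \<open>The relations rewrite every monomial to a single variable, or to zero.\<close>

lemma monomial_reduces: assumes "keys m <= \<Gamma>" shows "EX p:span_on S. single m 1 - to_poly p : fan_ideal &
  (ALL s:keys p. of_int (fst s) = mono_qdeg m)"
 using assms
proof (induction "mono_deg m" arbitrary: m)
 case 0
 hence m: "m = 0" using mono_deg_eq_0[of m] by simp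
 have "- (yvar (%_. 0) - 1) : fan_ideal" by (intro fan_ideal_closed(2,6) fan_gens_intros(3))
 hence "single m 1 - to_poly (single 0 1) : fan_ideal" using to_poly_single[of 0 1] by (simp add: m coords_0)
 thus ?case by (intro bexI[of _ "single 0 1"]) (simp_all add: span_on_single S_mon_0 m mono_qdeg_def del: single_one)
next
 case (Suc k)
 hence "m ~= 0" by auto
 then obtain a where a: "a : keys m" by (metis keys_eq_empty all_not_in_conv)
 define m' where "m' = m - single a 1"
 have m: "m = m' + single a 1"
  by (rule poly_mapping_eqI) (use a in "auto simp: m'_def lookup_add lookup_minus lookup_single when_def in_keys_iff")
 have "mono_deg m = mono_deg m' + 1" by (subst m) (simp add: mono_add(1))
 hence k: "k = mono_deg m'" using Suc.hyps(2) by simp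
 have km: "keys m' <= \<Gamma>" using Suc.prems keys_add_nat[of m' "single a 1"] m by auto
 obtain p where p: "p : span_on S" "single m' 1 - to_poly p : fan_ideal"
  "ALL s:keys p. of_int (fst s) = mono_qdeg m'" using Suc.hyps(1)[OF k km] by blast
 obtain t where t: "t : S" "a = coords t" using a Suc.prems by (auto simp: Gam_eq)
 have aG: "a : \<Gamma>" using a Suc.prems by blast
 let ?q = "single t (1 :: 'k)"
 let ?pq = "fan_mult mchains (S_flag P f) p ?q"
 have q: "?q : span_on S" using t(1) by (rule span_on_single)
 have tq: "to_poly ?q = yvar a" by (simp add: to_poly_single t(2))
 have "single m 1 = single m' 1 * (yvar a :: ('n qvec, 'k) mpoly)" by (subst m) (simp add: yvar_def mult_single)
 hence "single m 1 - to_poly ?pq = yvar a * (single m' 1 - to_poly p) + (to_poly p * to_poly ?q - to_poly ?pq)"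
  by (simp add: tq algebra_simps)
 also have "... : fan_ideal" by (intro fan_ideal_closed(3,4) p(2) yvar_in aG to_poly_mult p(1) q)
 finally have 1: "single m 1 - to_poly ?pq : fan_ideal" .
 have 2: "?pq : span_on S" using fan.fan_mult_closed[of p ?q] unfolding Union_S_flag .
 have "of_int (fst s) = mono_qdeg m" if s: "s : keys ?pq" for s
 proof -
  have "{(x, y) : keys p \<times> keys ?q. fan_comp mchains (S_flag P f) x y & x + y = s} ~= {}"
   using s unfolding in_keys_iff lookup_fan_mult by (metis (no_types, lifting) sum.empty)
  then obtain x where x: "x : keys p" "s = x + t" by auto
  have "mono_qdeg m = mono_qdeg m' + qdegree P f a" by (subst m) (simp add: mono_qdeg_add mono_qdeg_single)
  thus ?thesis using p(3) x qdegree_coords[OF t(1)] t(2) by simp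
 qed
 thus ?case using 1 2 by blast
qed

lemma poly_reduces: assumes F: "F : carrier Yring" shows "EX p:span_on S. F - to_poly p : fan_ideal &
  (ALL s:keys p. EX m:keys F. of_int (fst s) = mono_qdeg m)"
proof -
 let ?R = "%m p. p : span_on S & single m 1 - to_poly p : fan_ideal & (ALL s:keys p. of_int (fst s) = mono_qdeg m)"
 have "ALL m:keys F. EX p. ?R m p" using monomial_reduces F by (auto simp: poly_ring_simps(1) span_on_def)
 then obtain q where q: "ALL m:keys F. ?R m (q m)" by (rule bchoice[THEN exE])
 let ?t = "%m. single 0 (lookup F m) * q m"
 define p where "p = sum ?t (keys F)"
 have "p : span_on S" unfolding p_def by (intro span_on_sum span_on_smult) (use q in auto)
 moreover have "F - to_poly p : fan_ideal"
 proof -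
  have "F = (SUM m:keys F. single 0 (lookup F m) * single m 1)" by (subst pm_expand) (simp add: mult_single)
  hence "F - to_poly p = (SUM m:keys F. single 0 (lookup F m) * (single m 1 - to_poly (q m)))"
   unfolding p_def to_poly_sum to_poly_smult right_diff_distrib sum_subtractf by simp
  also have "... : fan_ideal" by (intro fan_ideal_sum fan_ideal_closed(4) Y_closed(6)) (use q in auto)
  finally show ?thesis .
 qed
 moreover have "EX m:keys F. of_int (fst s) = mono_qdeg m" if s: "s : keys p" for s
 proof (rule ccontr)
  assume no: "~ (EX m:keys F. of_int (fst s) = mono_qdeg m)"
  have "lookup (?t m) s = 0" if m: "m : keys F" for m
  proof -
   have "s ~: keys (q m)" using no q m by blast
   thus ?thesis by (simp add: in_keys_iff)
  qed
  hence "lookup p s = 0" unfolding p_def lookup_sum by (intro sum.neutral ballI)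
  thus False using s by (simp add: in_keys_iff)
 qed
 ultimately show ?thesis by blast
qed

definition fan_map :: "(('n, 'k) lpoly) => ('n qvec, 'k) mpoly set" where
 "fan_map p = fan_ideal +>\<^bsub>Yring\<^esub> to_poly p"

abbreviation "fan_quot \<equiv> (fan_algebra P f \<Gamma> :: ('k, ('n qvec, 'k) mpoly set) graded_algebra)"

lemma graded_iso_fan: "graded_iso fan_alg fan_quot fan_map" unfolding graded_iso_def
proof (intro conjI allI ballI)
 interpret Y: cring Yring by (rule cring_poly_ring)
 interpret J: ideal fan_ideal Yring by (rule fan_ideal_ideal)
 note cos = J.rcos_ring_hom
 have sim: "carrier fan_quot = carrier (Yring Quot fan_ideal)" "x \<otimes>\<^bsub>fan_quot\<^esub> y = x \<otimes>\<^bsub>Yring Quot fan_ideal\<^esub> y"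
  "x \<oplus>\<^bsub>fan_quot\<^esub> y = x \<oplus>\<^bsub>Yring Quot fan_ideal\<^esub> y" "\<one>\<^bsub>fan_quot\<^esub> = \<one>\<^bsub>Yring Quot fan_ideal\<^esub>"
  "c \<odot>\<^bsub>fan_quot\<^esub> x = (UN p:x. fan_ideal +>\<^bsub>Yring\<^esub> (single 0 c * p))"
  "homog fan_quot d = {fan_ideal +>\<^bsub>Yring\<^esub> p | p. p : carrier Yring & (ALL m:keys p. mono_qdeg m = of_nat d)}"
  for x y c d by (simp_all add: fan_algebra_def Let_def fan_ideal_def mono_qdeg_def)
 have eq: "fan_ideal +>\<^bsub>Yring\<^esub> x = fan_ideal +>\<^bsub>Yring\<^esub> y \<longleftrightarrow> x - y : fan_ideal"
  if "x : carrier Yring" "y : carrier Yring" for x y using J.coset_eq_iff[OF that] a_minus_Y[OF that] by simp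
 have car: "carrier (Yring Quot fan_ideal) = (%x. fan_ideal +>\<^bsub>Yring\<^esub> x) ` carrier Yring"
  by (auto simp: FactRing_def A_RCOSETS_def')
 have surj: "EX p:span_on S. fan_map p = fan_ideal +>\<^bsub>Yring\<^esub> F & (ALL s:keys p. EX m:keys F. of_int (fst s) = mono_qdeg m)"
  if F: "F : carrier Yring" for F
 proof -
  obtain p where p: "p : span_on S" "F - to_poly p : fan_ideal"
   "ALL s:keys p. EX m:keys F. of_int (fst s) = mono_qdeg m" using poly_reduces[OF F] by blast
  have "fan_map p = fan_ideal +>\<^bsub>Yring\<^esub> F" unfolding fan_map_def using eq[OF F to_poly_closed[OF p(1)]] p(2) by simp
  thus ?thesis using p by blast
 qed
 have "fan_map : ring_hom fan_alg fan_quot"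
 proof (rule ring_hom_memI)
  fix p assume "p : carrier fan_alg"
  hence p: "p : span_on S" by (simp add: fan_simps Union_S_flag)
  show "fan_map p : carrier fan_quot" unfolding sim car fan_map_def by (rule imageI[OF to_poly_closed[OF p]])
  fix q assume "q : carrier fan_alg"
  hence q: "q : span_on S" by (simp add: fan_simps Union_S_flag)
  have pq: "fan_mult mchains (S_flag P f) p q : span_on S" using fan.fan_mult_closed[of p q] unfolding Union_S_flag .
  have "fan_map p \<otimes>\<^bsub>fan_quot\<^esub> fan_map q = fan_ideal +>\<^bsub>Yring\<^esub> (to_poly p * to_poly q)"
   unfolding sim fan_map_def using ring_hom_mult[OF cos to_poly_closed[OF p] to_poly_closed[OF q]] by (simp add: poly_ring_simps(2))
  also have "... = fan_map (fan_mult mchains (S_flag P f) p q)" unfolding fan_map_def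
   by (subst eq) (use to_poly_mult[OF p q] to_poly_closed p q pq Y_closed(3) in auto)
  finally show "fan_map (p \<otimes>\<^bsub>fan_alg\<^esub> q) = fan_map p \<otimes>\<^bsub>fan_quot\<^esub> fan_map q"
   by (simp add: fan_simps)
  show "fan_map (p \<oplus>\<^bsub>fan_alg\<^esub> q) = fan_map p \<oplus>\<^bsub>fan_quot\<^esub> fan_map q"
   unfolding sim fan_map_def fan_simps
   using ring_hom_add[OF cos to_poly_closed[OF p] to_poly_closed[OF q]] by (simp add: poly_ring_simps(3) to_poly_add)
 next
  have "fan_map 1 = fan_ideal +>\<^bsub>Yring\<^esub> 1"
  proof -
   have t1: "to_poly 1 = yvar (%_. 0)" using to_poly_single[of 0 1] by (simp add: coords_0)
   show ?thesis unfolding fan_map_def t1 by (subst eq) (auto intro: yvar_in zero_in_Gam Y_closed(4) fan_ideal_closed(2) fan_gens_intros(3))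
  qed
  thus "fan_map \<one>\<^bsub>fan_alg\<^esub> = \<one>\<^bsub>fan_quot\<^esub>"
   unfolding sim using ring_hom_one[OF cos] by (simp add: fan_simps poly_ring_simps(4))
 qed
 moreover have "bij_betw fan_map (carrier fan_alg) (carrier fan_quot)" unfolding fan_simps Union_S_flag sim car bij_betw_def
 proof
  show "inj_on fan_map (span_on S)"
  proof (rule inj_onI)
   fix p q :: "('n, 'k) lpoly" assume pq: "p : span_on S" "q : span_on S" "fan_map p = fan_map q"
   hence "to_poly p - to_poly q : fan_ideal" using eq[OF to_poly_closed[OF pq(1)] to_poly_closed[OF pq(2)]] by (simp add: fan_map_def)
   hence "p - q = 0" by (intro to_poly_fan_ideal span_on_diff pq) (simp add: to_poly_diff)
   thus "p = q" by simp
  qed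
  show "fan_map ` span_on S = (%x. fan_ideal +>\<^bsub>Yring\<^esub> x) ` carrier Yring"
  proof (intro equalityI subsetI)
   fix x assume "x : fan_map ` span_on S"
   thus "x : (%x. fan_ideal +>\<^bsub>Yring\<^esub> x) ` carrier Yring" unfolding fan_map_def using to_poly_closed by auto
  next
   fix x assume "x : (%x. fan_ideal +>\<^bsub>Yring\<^esub> x) ` carrier Yring"
   then obtain F where F: "F : carrier Yring" "x = fan_ideal +>\<^bsub>Yring\<^esub> F" by blast
   thus "x : fan_map ` span_on S" using surj[OF F(1)] by auto
  qed
 qed
 ultimately show "fan_map : ring_iso fan_alg fan_quot" by (simp add: ring_iso_def)
 fix c and p assume "p : carrier fan_alg"
 hence p: "p : span_on S" by (simp add: fan_simps Union_S_flag)
 note tp = to_poly_closed[OF p]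
 have "fan_ideal +>\<^bsub>Yring\<^esub> (single 0 c * F) = fan_ideal +>\<^bsub>Yring\<^esub> (single 0 c * to_poly p)"
  if F: "F : fan_map p" for F
 proof -
  obtain h where h: "h : fan_ideal" "F = h + to_poly p" using F by (auto simp: fan_map_def a_r_coset_def' poly_ring_simps(3))
  hence FY: "F : carrier Yring" by (auto intro: Y_closed(1) fan_ideal_closed(1) tp)
  have "F - to_poly p : fan_ideal" using h by simp
  hence "single 0 c * (F - to_poly p) : fan_ideal" by (intro fan_ideal_closed(4) Y_closed(6))
  thus ?thesis by (subst eq) (auto simp: right_diff_distrib intro: Y_closed(3,6) FY tp)
 qed
 note all = this
 have "to_poly p : fan_map p" unfolding fan_map_def a_r_coset_def' using fan_ideal_closed(5)
  by (intro UN_I[of 0]) (simp_all add: poly_ring_simps(3))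
 hence "(UN F:fan_map p. fan_ideal +>\<^bsub>Yring\<^esub> (single 0 c * F)) =
   fan_ideal +>\<^bsub>Yring\<^esub> (single 0 c * to_poly p)" using all by (rule UN_const)
 thus "fan_map (c \<odot>\<^bsub>fan_alg\<^esub> p) = c \<odot>\<^bsub>fan_quot\<^esub> fan_map p"
  unfolding sim by (simp add: fan_simps fan_map_def to_poly_smult)
next
 fix d
 interpret Y: cring Yring by (rule cring_poly_ring)
 interpret J: ideal fan_ideal Yring by (rule fan_ideal_ideal)
 have hq: "homog fan_quot d = {fan_ideal +>\<^bsub>Yring\<^esub> p | p. p : carrier Yring & (ALL m:keys p. mono_qdeg m = of_nat d)}"
  by (simp add: fan_algebra_def Let_def fan_ideal_def mono_qdeg_def)
 have ha: "homog fan_alg d = {p : span_on S. ALL s:keys p. fst s = int d}" by (simp add: fan_simps Union_S_flag)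
 show "fan_map ` homog fan_alg d = homog fan_quot d"
 proof (intro equalityI subsetI)
  fix x assume "x : fan_map ` homog fan_alg d"
  then obtain p where p: "p : span_on S" "ALL s:keys p. fst s = int d" "x = fan_map p" unfolding ha by blast
  have "mono_qdeg m = of_nat d" if m: "m : keys (to_poly p)" for m
  proof -
   have "m : (%s. single (coords s) 1) ` keys p" by (rule subsetD[OF keys_pm_map]) (use m in "simp add: to_poly_def")
   then obtain s where s: "s : keys p" "m = single (coords s) 1" by blast
   thus ?thesis using p(2) qdegree_coords[OF span_onD[OF p(1) s(1)]] by (simp add: mono_qdeg_single)
  qed
  thus "x : homog fan_quot d" unfolding hq p(3) fan_map_def using to_poly_closed[OF p(1)] by blast
 next
  fix x assume "x : homog fan_quot d"
  then obtain F where F: "F : carrier Yring" "ALL m:keys F. mono_qdeg m = of_nat d"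
   "x = fan_ideal +>\<^bsub>Yring\<^esub> F" unfolding hq by blast
  obtain p where p: "p : span_on S" "F - to_poly p : fan_ideal"
   "ALL s:keys p. EX m:keys F. of_int (fst s) = mono_qdeg m" using poly_reduces[OF F(1)] by blast
  have "fst s = int d" if "s : keys p" for s
  proof -
   have "rat_of_int (fst s) = of_nat d" using p(3) F(2) that by auto
   thus ?thesis by (metis of_int_eq_iff of_int_of_nat_eq)
  qed
  moreover have "x = fan_map p" using J.coset_eq_iff[OF F(1) to_poly_closed[OF p(1)]] a_minus_Y[OF F(1) to_poly_closed[OF p(1)]] p(2) F(3)
   by (simp add: fan_map_def)
  ultimately show "x : fan_map ` homog fan_alg d" unfolding ha using p(1) by blast
 qed
qed

lemma fan_alg_ring: "ring fan_alg" "x : carrier fan_alg ==> c \<odot>\<^bsub>fan_alg\<^esub> x : carrier fan_alg"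
 "homog fan_alg d <= carrier fan_alg" using cring.axioms(1)[OF fan.cring_fan_algebra] by (auto simp: fan_simps span_on_smult)

lemma gr_isomorphic_fan: "graded_isomorphic gr fan_quot" by (rule graded_isomorphic_span[OF fan_alg_ring graded_iso_gr graded_iso_fan])

end

lemma gr_isomorphic_same_triangulation: assumes "stratified P f r" "stratified P f' r'" "same_triangulation P f f'"
 shows "graded_isomorphic (gr_algebra P f r) (gr_algebra P f' r')"
proof -
 interpret A: stratified P f r by fact
 interpret B: stratified P f' r' by fact
 have eq: "fan_algebra_on {C. max_chain P C} (S_flag P f) = fan_algebra_on {C. max_chain P C} (S_flag P f')" by (rule fan_algebra_on_cong)
   (use assms(3) A.max_chain_flag in "simp add: same_triangulation_def S_flag_def")
 show ?thesis by (rule graded_isomorphic_span[OF A.fan_alg_ring A.graded_iso_gr B.graded_iso_gr[folded eq]])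
qed

section \<open>Graded rings and the structure sheaf of Proj\<close>

text \<open>The maps \<open>pr d\<close> are the projections to the homogeneous components. With them an ideal is homogeneous
  iff it is stable under all \<open>pr d\<close>, which unlike generation by homogeneous elements can be checked
  elementwise.\<close>

locale graded_cring = cring R for R :: "('k, 'a) graded_algebra" (structure) +
 fixes pr :: "nat => 'a => 'a" assumes homog_carrier: "homog R d <= carrier R" and homog_zero: "\<zero> : homog R d"
  and homog_add: "x : homog R d ==> y : homog R d ==> x \<oplus> y : homog R d" and homog_minus: "x : homog R d ==> \<ominus> x : homog R d"
  and homog_mult: "x : homog R d ==> y : homog R e ==> x \<otimes> y : homog R (d + e)" and homog_one: "\<one> : homog R 0"
  and smult_homog: "x : homog R d ==> c \<odot> x : homog R d" and smult_closed: "x : carrier R ==> c \<odot> x : carrier R"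
  and smult_mult: "x : carrier R ==> y : carrier R ==> (c \<odot> x) \<otimes> y = c \<odot> (x \<otimes> y)"
  and pr_homog: "x : carrier R ==> pr d x : homog R d" and pr_id: "x : homog R d ==> pr e x = (if e = d then x else \<zero>)"
  and pr_add: "x : carrier R ==> y : carrier R ==> pr d (x \<oplus> y) = pr d x \<oplus> pr d y"
  and pr_finite: "x : carrier R ==> finite {d. pr d x ~= \<zero>}" and pr_sum: "x : carrier R ==> x = (\<Oplus>d\<in>{d. pr d x ~= \<zero>}. pr d x)"
begin

abbreviation "H \<equiv> homog_elems R"

lemma homog_in: "x : homog R d ==> x : carrier R" using homog_carrier by blast

lemma H_in: "x : H ==> x : carrier R" unfolding homog_elems_def using homog_in by blast

lemma homog_H: "x : homog R d ==> x : H" unfolding homog_elems_def by blast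

lemma H_mult: "x : H ==> y : H ==> x \<otimes> y : H" unfolding homog_elems_def using homog_mult by blast

lemma H_one: "\<one> : H" using homog_H[OF homog_one] .

lemma pr_in: "x : carrier R ==> pr d x : carrier R" using homog_in[OF pr_homog] .

lemma pr_finsum: assumes "finite J" "!!j. j : J ==> g j : carrier R" shows "pr d (\<Oplus>j\<in>J. g j) = (\<Oplus>j\<in>J. pr d (g j))" using assms
proof (induction J rule: finite_induct)
 case empty
 show ?case using pr_id[OF homog_zero[of d], of d] by simp
next
 case (insert j J)
 hence "pr d (\<Oplus>j\<in>insert j J. g j) = pr d (g j \<oplus> (\<Oplus>j\<in>J. g j))" by (subst finsum_insert) auto
 also have "... = pr d (g j) \<oplus> (\<Oplus>j\<in>J. pr d (g j))" using insert by (subst pr_add) auto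
 also have "... = (\<Oplus>j\<in>insert j J. pr d (g j))" using insert pr_in by (subst finsum_insert) auto
 finally show ?case .
qed

lemma ideal_finsum: assumes "ideal p R" "finite J" "!!j. j : J ==> g j : p" shows "(\<Oplus>j\<in>J. g j) : p"
proof -
 interpret p: ideal p R by fact
 show ?thesis using assms(2,3)
 proof (induction J rule: finite_induct)
  case (insert j J)
  hence "(\<Oplus>j\<in>insert j J. g j) = g j \<oplus> (\<Oplus>j\<in>J. g j)" by (subst finsum_insert) (auto intro: p.a_Hcarr)
  thus ?case using insert by simp
 qed simp
qed

lemma finsum_mult_left: assumes "finite J" "r : carrier R" "!!j. j : J ==> g j : carrier R"
 shows "r \<otimes> (\<Oplus>j\<in>J. g j) = (\<Oplus>j\<in>J. r \<otimes> g j)" using finsum_rdistr[OF assms(1,2), of g] assms(3) by auto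

lemma homog_ideal_iff: assumes p: "ideal p R" shows "p = Idl (p Int H) \<longleftrightarrow> (ALL x:p. ALL d. pr d x : p)"
proof -
 interpret p: ideal p R by fact
 have sub: "p Int H <= carrier R" using H_in by blast
 have pc: "x : carrier R" if "x : p" for x using p.a_Hcarr that .
 define L where "L = {x : carrier R. ALL d. pr d x : p}"
 have hom: "pr d (r \<otimes> y) : p" if r: "r : carrier R" and y: "y : homog R e" "y : p" for r y d e
 proof -
  let ?J = "{i. pr i r ~= \<zero>}"
  have "r \<otimes> y = (\<Oplus>i\<in>?J. y \<otimes> pr i r)"
   using finsum_mult_left[where g = "%i. pr i r", OF pr_finite[OF r] homog_in[OF y(1)] pr_in[OF r]]
    pr_sum[OF r] m_comm[OF r homog_in[OF y(1)]] by simp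
  hence "pr d (r \<otimes> y) = (\<Oplus>i\<in>?J. pr d (y \<otimes> pr i r))"
   using pr_finsum[where g = "%i. y \<otimes> pr i r", OF pr_finite[OF r]] homog_in[OF y(1)] pr_in[OF r] by simp
  also have "... : p"
  proof (rule ideal_finsum[OF p pr_finite[OF r]])
   fix i
   have "y \<otimes> pr i r : p" using p.I_r_closed[OF y(2) pr_in[OF r]] .
   moreover have "pr d (y \<otimes> pr i r) = (if d = e + i then y \<otimes> pr i r else \<zero>)"
    by (rule pr_id[OF homog_mult[OF y(1) pr_homog[OF r]]])
   ultimately show "pr d (y \<otimes> pr i r) : p" by simp
  qed
  finally show ?thesis .
 qed
 have L: "ideal L R"
 proof (rule idealI)
  show "ring R" by (rule ring_axioms)
  show "subgroup L (add_monoid R)"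
  proof (rule subgroup.intro)
   show "L <= carrier (add_monoid R)" by (auto simp: L_def)
   show "\<one>\<^bsub>add_monoid R\<^esub> : L" using pr_id[OF homog_zero] by (auto simp: L_def)
   fix x assume x: "x : L"
   hence xc: "x : carrier R" by (simp add: L_def)
   show "x \<otimes>\<^bsub>add_monoid R\<^esub> y : L" if "y : L" for y using x that by (auto simp: L_def pr_add)
   have "pr d (\<ominus> x) : p" for d
   proof -
    have "pr d x \<oplus> pr d (\<ominus> x) = \<zero>"
     using pr_add[OF xc a_inv_closed[OF xc], of d] pr_id[OF homog_zero, of d d] r_neg[OF xc] by simp
    hence "pr d (\<ominus> x) = \<ominus> (pr d x)" using pr_in[OF xc] pr_in[OF a_inv_closed[OF xc]] by (metis minus_equality a_comm)
    thus ?thesis using x by (simp add: L_def)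
   qed
   thus "inv\<^bsub>add_monoid R\<^esub> x : L" using xc by (simp add: L_def a_inv_def[symmetric])
  qed
  fix x r assume x: "x : L" and r: "r : carrier R"
  hence xc: "x : carrier R" by (simp add: L_def)
  have "pr d (r \<otimes> x) : p" for d
  proof -
   let ?J = "{i. pr i x ~= \<zero>}"
   have "r \<otimes> x = (\<Oplus>i\<in>?J. r \<otimes> pr i x)"
    using finsum_mult_left[where g = "%i. pr i x", OF pr_finite[OF xc] r pr_in[OF xc]] pr_sum[OF xc] by simp
   hence "pr d (r \<otimes> x) = (\<Oplus>i\<in>?J. pr d (r \<otimes> pr i x))"
    using pr_finsum[where g = "%i. r \<otimes> pr i x", OF pr_finite[OF xc]] r pr_in[OF xc] by simp
   also have "... : p" by (rule ideal_finsum[OF p pr_finite[OF xc]]) (rule hom[OF r pr_homog[OF xc]], use x in "simp add: L_def")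
   finally show ?thesis .
  qed
  thus "r \<otimes> x : L" using r xc by (simp add: L_def)
  thus "x \<otimes> r : L" using m_comm[OF r xc] by simp
 qed
 show ?thesis
 proof
  assume eq: "p = Idl (p Int H)"
  have "p Int H <= L"
  proof
   fix x assume x: "x : p Int H"
   then obtain d where d: "x : homog R d" unfolding homog_elems_def by blast
   have "pr e x : p" for e using pr_id[OF d, of e] x by simp
   thus "x : L" using homog_in[OF d] by (simp add: L_def)
  qed
  hence "Idl (p Int H) <= L" by (rule genideal_minimal[OF L])
  thus "ALL x:p. ALL d. pr d x : p" using eq unfolding L_def by blast
 next
  assume all: "ALL x:p. ALL d. pr d x : p"
  show "p = Idl (p Int H)"
  proof
   show "Idl (p Int H) <= p" by (rule genideal_minimal[OF p]) blast
   show "p <= Idl (p Int H)"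
   proof
    fix x assume x: "x : p"
    have "(\<Oplus>d\<in>{d. pr d x ~= \<zero>}. pr d x) : Idl (p Int H)"
    proof (rule ideal_finsum[OF genideal_ideal[OF sub] pr_finite[OF pc[OF x]]])
     fix d
     have "pr d x : p Int H" using all x homog_H[OF pr_homog[OF pc[OF x]]] by blast
     thus "pr d x : Idl (p Int H)" using genideal_self[OF sub] by blast
    qed
    thus "x : Idl (p Int H)" using pr_sum[OF pc[OF x]] by simp
   qed
  qed
 qed
qed

lemma proj_points_iff:
 "p : Pts R \<longleftrightarrow> primeideal p R & (ALL x:p. ALL d. pr d x : p) & (EX d>0. EX x:homog R d. x ~: p)"
 using homog_ideal_iff primeideal.axioms(1) by (auto simp: proj_points_def)

subsection \<open>The topology\<close>

definition basic :: "'a => 'a set set" where "basic a = {p : Pts R. a ~: p}"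

lemma point_prime: "p : Pts R ==> primeideal p R" by (simp add: proj_points_def)

lemma point_carrier: "p : Pts R ==> x : p ==> x : carrier R"
 using point_prime primeideal.axioms(1) ideal.axioms(1) additive_subgroup.a_Hcarr by metis

lemma point_zero: "p : Pts R ==> \<zero> : p" using point_prime primeideal.axioms(1) ideal.axioms(1) additive_subgroup.zero_closed by metis

lemma point_one: "p : Pts R ==> \<one> ~: p" using point_prime primeideal.axioms(1) ideal.one_imp_carrier primeideal.I_notcarr by metis

lemma point_mult: assumes "p : Pts R" "x : carrier R" "y : carrier R" shows "x \<otimes> y : p \<longleftrightarrow> x : p | y : p"
proof -
 interpret primeideal p R by (rule point_prime[OF assms(1)])
 show ?thesis using I_prime[OF assms(2,3)] I_l_closed[of y x] I_r_closed[of x y] assms by blast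
qed

lemma basic_Int: "a : carrier R ==> b : carrier R ==> basic a Int basic b = basic (a \<otimes> b)"
 using point_mult by (auto simp: basic_def)

lemma proj_top_eq: "proj_top R = topology_generated_by (basic ` H)"
proof -
 have "{{p : Pts R. a ~: p} | a. a : H} = basic ` H" by (auto simp: basic_def)
 thus ?thesis by (simp add: proj_top_def)
qed

lemma basis_Int: "A : basic ` H ==> B : basic ` H ==> A Int B : basic ` H" using basic_Int H_in H_mult by auto

lemma topspace_proj_top [simp]: "topspace (proj_top R) = Pts R"
proof -
 have "basic \<one> = Pts R" using point_one by (auto simp: basic_def)
 hence "\<Union>(basic ` H) = Pts R" using H_one by (auto simp: basic_def)
 thus ?thesis by (simp add: proj_top_eq topology_generated_by_topspace)
qed

lemma openin_proj_top: "openin (proj_top R) U \<longleftrightarrow> (ALL p:U. EX a:H. p : basic a & basic a <= U)"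
proof -
 have "openin (proj_top R) U \<longleftrightarrow> (ALL p:U. EX A:basic ` H. p : A & A <= U)"
  unfolding proj_top_eq by (rule openin_generated_base) (rule basis_Int)
 thus ?thesis by simp
qed

lemma openin_basic: "a : H ==> openin (proj_top R) (basic a)" unfolding openin_proj_top by blast

lemma openin_points: "openin (proj_top R) U ==> p : U ==> p : Pts R" using openin_subset by force

subsection \<open>Fractions\<close>

definition frac :: "'a set => 'a => 'a => bool" where
 "frac p a f \<longleftrightarrow> (EX d. a : homog R d & f : homog R d) & f ~: p"

lemma fracD: "frac p a f ==> a : carrier R & f : carrier R & f : H - p" unfolding frac_def using homog_in homog_H by blast

lemma frac_ops: assumes "p : Pts R" "frac p a f" "frac p b g"
 shows "frac p (a \<otimes> g \<oplus> b \<otimes> f) (f \<otimes> g)" "frac p (a \<otimes> b) (f \<otimes> g)" "frac p (\<ominus> a) f" "frac p (c \<odot> a) f"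
proof -
 obtain d where d: "a : homog R d" "f : homog R d" "f ~: p" using assms(2) unfolding frac_def by blast
 obtain e where e: "b : homog R e" "g : homog R e" "g ~: p" using assms(3) unfolding frac_def by blast
 have fg: "f \<otimes> g ~: p" using point_mult[OF assms(1) homog_in[OF d(2)] homog_in[OF e(2)]] d e by blast
 have "b \<otimes> f : homog R (d + e)" using homog_mult[OF e(1) d(2)] by (simp add: add.commute)
 thus "frac p (a \<otimes> g \<oplus> b \<otimes> f) (f \<otimes> g)"
  unfolding frac_def using homog_add[OF homog_mult[OF d(1) e(2)]] homog_mult[OF d(2) e(2)] fg by blast
 show "frac p (a \<otimes> b) (f \<otimes> g)" unfolding frac_def using homog_mult[OF d(1) e(1)] homog_mult[OF d(2) e(2)] fg by blast
 show "frac p (\<ominus> a) f" unfolding frac_def using homog_minus[OF d(1)] d by blast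
 show "frac p (c \<odot> a) f" unfolding frac_def using smult_homog[OF d(1)] d by blast
qed

lemma frac_consts: "p : Pts R ==> frac p \<zero> \<one>" "p : Pts R ==> frac p \<one> \<one>"
 unfolding frac_def using homog_zero homog_one point_one by blast+

lemma in_hfrac_iff:
 "(b, g) : hfrac R p a f \<longleftrightarrow> frac p b g & (EX h:H - p. h \<otimes> (a \<otimes> g) = h \<otimes> (b \<otimes> f))"
 by (auto simp: hfrac_def frac_def)

text \<open>If \<open>h\<close> witnesses \<open>a/f = b/g\<close> and \<open>k\<close> witnesses \<open>a/f = c/e\<close>, then \<open>h k f\<close> witnesses \<open>b/g = c/e\<close>.\<close>

lemma hfrac_eqI: assumes p: "p : Pts R" and v: "frac p a f" "frac p b g" and h: "h : H - p"
  and eq: "h \<otimes> (a \<otimes> g) = h \<otimes> (b \<otimes> f)" shows "hfrac R p a f = hfrac R p b g"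
proof -
 have sub: "hfrac R p a f <= hfrac R p b g"
  if v: "frac p a f" "frac p b g" and eq: "h \<otimes> (a \<otimes> g) = h \<otimes> (b \<otimes> f)" for a f b g
 proof (rule subrelI)
  fix c e assume "(c, e) : hfrac R p a f"
  then obtain k where k: "frac p c e" "k : H - p" "k \<otimes> (a \<otimes> e) = k \<otimes> (c \<otimes> f)"
   unfolding in_hfrac_iff by blast
  have car: "a : carrier R" "f : carrier R" "b : carrier R" "g : carrier R" "c : carrier R" "e : carrier R"
   "h : carrier R" "k : carrier R" using fracD v k h H_in by blast+
  have "(h \<otimes> k \<otimes> f) \<otimes> (b \<otimes> e) = (h \<otimes> (b \<otimes> f)) \<otimes> (k \<otimes> e)" using car by algebra
  also have "... = (h \<otimes> (a \<otimes> g)) \<otimes> (k \<otimes> e)" by (simp add: eq)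
  also have "... = (k \<otimes> (a \<otimes> e)) \<otimes> (h \<otimes> g)" using car by algebra
  also have "... = (k \<otimes> (c \<otimes> f)) \<otimes> (h \<otimes> g)" by (simp add: k(3))
  also have "... = (h \<otimes> k \<otimes> f) \<otimes> (c \<otimes> g)" using car by algebra
  finally have e: "(h \<otimes> k \<otimes> f) \<otimes> (b \<otimes> e) = (h \<otimes> k \<otimes> f) \<otimes> (c \<otimes> g)" .
  have "h \<otimes> k \<otimes> f : H" using h k(2) fracD[OF v(1)] by (intro H_mult) auto
  moreover have "h \<otimes> k \<otimes> f ~: p" using h k(2) fracD[OF v(1)] car by (simp add: point_mult[OF p])
  ultimately show "(c, e) : hfrac R p b g" unfolding in_hfrac_iff using k(1) e by blast
 qed
 show ?thesis using sub[OF v eq] sub[OF v(2,1) eq[symmetric]] by blast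
qed

lemma hfrac_eqI': assumes "p : Pts R" "frac p a f" "frac p b g" "a \<otimes> g = b \<otimes> f" shows "hfrac R p a f = hfrac R p b g"
 by (rule hfrac_eqI[OF assms(1-3), of \<one>]) (use H_one point_one[OF assms(1)] assms(4) in auto)

lemma hfrac_self: "p : Pts R ==> frac p a f ==> (a, f) : hfrac R p a f" unfolding in_hfrac_iff using H_one point_one by blast

lemma hfrac_eqD: assumes "p : Pts R" "frac p b g" "hfrac R p a f = hfrac R p b g"
 shows "EX h:H - p. h \<otimes> (a \<otimes> g) = h \<otimes> (b \<otimes> f)"
 using hfrac_self[OF assms(1,2)] unfolding assms(3)[symmetric] in_hfrac_iff by blast

lemma stalk_add_hfrac: assumes p: "p : Pts R" and v: "frac p a f" "frac p b g"
 shows "stalk_add R p (hfrac R p a f) (hfrac R p b g) = hfrac R p (a \<otimes> g \<oplus> b \<otimes> f) (f \<otimes> g)"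
proof -
 have "hfrac R p (a' \<otimes> g' \<oplus> b' \<otimes> f') (f' \<otimes> g') = hfrac R p (a \<otimes> g \<oplus> b \<otimes> f) (f \<otimes> g)"
  if m: "(a', f') : hfrac R p a f" "(b', g') : hfrac R p b g" for a' f' b' g'
 proof -
  obtain h where h: "frac p a' f'" "h : H - p" "h \<otimes> (a \<otimes> f') = h \<otimes> (a' \<otimes> f)"
   using m(1) unfolding in_hfrac_iff by blast
  obtain k where k: "frac p b' g'" "k : H - p" "k \<otimes> (b \<otimes> g') = k \<otimes> (b' \<otimes> g)"
   using m(2) unfolding in_hfrac_iff by blast
  have car: "a : carrier R" "f : carrier R" "b : carrier R" "g : carrier R" "a' : carrier R" "f' : carrier R"
   "b' : carrier R" "g' : carrier R" "h : carrier R" "k : carrier R" using fracD v h k H_in by blast+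
  have "(h \<otimes> k) \<otimes> ((a' \<otimes> g' \<oplus> b' \<otimes> f') \<otimes> (f \<otimes> g)) =
    (h \<otimes> (a' \<otimes> f)) \<otimes> (k \<otimes> g' \<otimes> g) \<oplus> (k \<otimes> (b' \<otimes> g)) \<otimes> (h \<otimes> f' \<otimes> f)" using car by algebra
  also have "... = (h \<otimes> (a \<otimes> f')) \<otimes> (k \<otimes> g' \<otimes> g) \<oplus> (k \<otimes> (b \<otimes> g')) \<otimes> (h \<otimes> f' \<otimes> f)"
   by (simp add: h(3) k(3))
  also have "... = (h \<otimes> k) \<otimes> ((a \<otimes> g \<oplus> b \<otimes> f) \<otimes> (f' \<otimes> g'))" using car by algebra
  finally have e: "(h \<otimes> k) \<otimes> ((a' \<otimes> g' \<oplus> b' \<otimes> f') \<otimes> (f \<otimes> g)) = (h \<otimes> k) \<otimes> ((a \<otimes> g \<oplus> b \<otimes> f) \<otimes> (f' \<otimes> g'))" .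
  have "h \<otimes> k : H - p" using h(2) k(2) H_mult point_mult[OF p] car by auto
  thus ?thesis by (rule hfrac_eqI[OF p frac_ops(1)[OF p h(1) k(1)] frac_ops(1)[OF p v] _ e])
 qed
 thus ?thesis unfolding stalk_add_def using hfrac_self[OF p v(1)] hfrac_self[OF p v(2)] by (intro Set.set_eqI) blast
qed

lemma stalk_mult_hfrac: assumes p: "p : Pts R" and v: "frac p a f" "frac p b g"
 shows "stalk_mult R p (hfrac R p a f) (hfrac R p b g) = hfrac R p (a \<otimes> b) (f \<otimes> g)"
proof -
 have "hfrac R p (a' \<otimes> b') (f' \<otimes> g') = hfrac R p (a \<otimes> b) (f \<otimes> g)"
  if m: "(a', f') : hfrac R p a f" "(b', g') : hfrac R p b g" for a' f' b' g'
 proof -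
  obtain h where h: "frac p a' f'" "h : H - p" "h \<otimes> (a \<otimes> f') = h \<otimes> (a' \<otimes> f)"
   using m(1) unfolding in_hfrac_iff by blast
  obtain k where k: "frac p b' g'" "k : H - p" "k \<otimes> (b \<otimes> g') = k \<otimes> (b' \<otimes> g)"
   using m(2) unfolding in_hfrac_iff by blast
  have car: "a : carrier R" "f : carrier R" "b : carrier R" "g : carrier R" "a' : carrier R" "f' : carrier R"
   "b' : carrier R" "g' : carrier R" "h : carrier R" "k : carrier R" using fracD v h k H_in by blast+
  have "(h \<otimes> k) \<otimes> ((a' \<otimes> b') \<otimes> (f \<otimes> g)) = (h \<otimes> (a' \<otimes> f)) \<otimes> (k \<otimes> (b' \<otimes> g))" using car by algebra
  also have "... = (h \<otimes> (a \<otimes> f')) \<otimes> (k \<otimes> (b \<otimes> g'))" by (simp add: h(3) k(3))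
  also have "... = (h \<otimes> k) \<otimes> ((a \<otimes> b) \<otimes> (f' \<otimes> g'))" using car by algebra
  finally have e: "(h \<otimes> k) \<otimes> ((a' \<otimes> b') \<otimes> (f \<otimes> g)) = (h \<otimes> k) \<otimes> ((a \<otimes> b) \<otimes> (f' \<otimes> g'))" .
  have "h \<otimes> k : H - p" using h(2) k(2) H_mult point_mult[OF p] car by auto
  thus ?thesis by (rule hfrac_eqI[OF p frac_ops(2)[OF p h(1) k(1)] frac_ops(2)[OF p v] _ e])
 qed
 thus ?thesis unfolding stalk_mult_def using hfrac_self[OF p v(1)] hfrac_self[OF p v(2)] by (intro Set.set_eqI) blast
qed

lemma stalk_smult_hfrac: assumes p: "p : Pts R" and v: "frac p a f" shows "stalk_smult R p c (hfrac R p a f) = hfrac R p (c \<odot> a) f"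
proof -
 have "hfrac R p (c \<odot> a') f' = hfrac R p (c \<odot> a) f" if m: "(a', f') : hfrac R p a f" for a' f'
 proof -
  obtain h where h: "frac p a' f'" "h : H - p" "h \<otimes> (a \<otimes> f') = h \<otimes> (a' \<otimes> f)"
   using m unfolding in_hfrac_iff by blast
  have car: "a : carrier R" "f : carrier R" "a' : carrier R" "f' : carrier R" "h : carrier R" using fracD v h H_in by blast+
  have sm: "h \<otimes> ((c \<odot> x) \<otimes> y) = c \<odot> (h \<otimes> (x \<otimes> y))" if "x : carrier R" "y : carrier R" for x y
  proof -
   have "h \<otimes> ((c \<odot> x) \<otimes> y) = (c \<odot> (x \<otimes> y)) \<otimes> h"
    using m_comm[of h "(c \<odot> x) \<otimes> y"] smult_mult[OF that] smult_closed[OF that(1)]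
     smult_closed[OF m_closed[OF that]] that car by simp
   also have "... = c \<odot> (h \<otimes> (x \<otimes> y))"
    using smult_mult[of "x \<otimes> y" h c] m_comm[of h "x \<otimes> y"] that car by simp
   finally show ?thesis .
  qed
  have "h \<otimes> ((c \<odot> a') \<otimes> f) = h \<otimes> ((c \<odot> a) \<otimes> f')" using car h(3) by (simp add: sm)
  thus ?thesis by (rule hfrac_eqI[OF p frac_ops(4)[OF p h(1) h(1)] frac_ops(4)[OF p v v] h(2)])
 qed
 thus ?thesis unfolding stalk_smult_def using hfrac_self[OF p v] by (intro Set.set_eqI) blast
qed

end

section \<open>Sections of the structure sheaf\<close>

context graded_cring
begin

definition stalk :: "'a set => ('a \<times> 'a) set set" where "stalk p = {hfrac R p a f | a f. frac p a f}"

lemma stalk_laws: assumes p: "p : Pts R" and xyz: "x : stalk p" "y : stalk p" "z : stalk p"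
 shows "stalk_add R p (stalk_add R p x y) z = stalk_add R p x (stalk_add R p y z)"
  "stalk_add R p x y = stalk_add R p y x"
  "stalk_add R p (hfrac R p \<zero> \<one>) x = x"
  "stalk_add R p (stalk_mult R p (hfrac R p (\<ominus> \<one>) \<one>) x) x = hfrac R p \<zero> \<one>"
  "stalk_mult R p (stalk_mult R p x y) z = stalk_mult R p x (stalk_mult R p y z)"
  "stalk_mult R p x y = stalk_mult R p y x"
  "stalk_mult R p (hfrac R p \<one> \<one>) x = x"
  "stalk_mult R p (stalk_add R p x y) z = stalk_add R p (stalk_mult R p x z) (stalk_mult R p y z)"
proof -
 obtain a f where x: "x = hfrac R p a f" "frac p a f" using xyz(1) unfolding stalk_def by blast
 obtain b g where y: "y = hfrac R p b g" "frac p b g" using xyz(2) unfolding stalk_def by blast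
 obtain c h where z: "z = hfrac R p c h" "frac p c h" using xyz(3) unfolding stalk_def by blast
 have car: "a : carrier R" "f : carrier R" "b : carrier R" "g : carrier R" "c : carrier R" "h : carrier R"
  using fracD[OF x(2)] fracD[OF y(2)] fracD[OF z(2)] by blast+
 note fo = frac_ops(1,2)[OF p] frac_consts[OF p] x(2) y(2) z(2) frac_ops(3)[OF p frac_consts(2)[OF p] frac_consts(2)[OF p]]
 note st = stalk_add_hfrac[OF p] stalk_mult_hfrac[OF p]
 note eq = hfrac_eqI'[OF p]
 show "stalk_add R p (stalk_add R p x y) z = stalk_add R p x (stalk_add R p y z)"
  unfolding x(1) y(1) z(1) using car by (simp only: st fo) (rule eq, (simp only: fo)+, algebra)
 show "stalk_add R p x y = stalk_add R p y x" unfolding x(1) y(1) z(1) using car by (simp only: st fo) (rule eq, (simp only: fo)+, algebra)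
 show "stalk_add R p (hfrac R p \<zero> \<one>) x = x"
  unfolding x(1) y(1) z(1) using car by (simp only: st fo) (rule eq, (simp only: fo)+, algebra)
 show "stalk_add R p (stalk_mult R p (hfrac R p (\<ominus> \<one>) \<one>) x) x = hfrac R p \<zero> \<one>"
  unfolding x(1) y(1) z(1) using car by (simp only: st fo) (rule eq, (simp only: fo)+, algebra)
 show "stalk_mult R p (stalk_mult R p x y) z = stalk_mult R p x (stalk_mult R p y z)"
  unfolding x(1) y(1) z(1) using car by (simp only: st fo) (rule eq, (simp only: fo)+, algebra)
 show "stalk_mult R p x y = stalk_mult R p y x"
  unfolding x(1) y(1) z(1) using car by (simp only: st fo) (rule eq, (simp only: fo)+, algebra)
 show "stalk_mult R p (hfrac R p \<one> \<one>) x = x"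
  unfolding x(1) y(1) z(1) using car by (simp only: st fo) (rule eq, (simp only: fo)+, algebra)
 show "stalk_mult R p (stalk_add R p x y) z = stalk_add R p (stalk_mult R p x z) (stalk_mult R p y z)"
  unfolding x(1) y(1) z(1) using car by (simp only: st fo) (rule eq, (simp only: fo)+, algebra)
qed

abbreviation "sec U \<equiv> proj_sections R U"

lemma sec_simps:
 "s \<otimes>\<^bsub>sec U\<^esub> t = (\<lambda>p\<in>U. stalk_mult R p (s p) (t p))" "s \<oplus>\<^bsub>sec U\<^esub> t = (\<lambda>p\<in>U. stalk_add R p (s p) (t p))"
 "\<one>\<^bsub>sec U\<^esub> = (\<lambda>p\<in>U. hfrac R p \<one> \<one>)" "\<zero>\<^bsub>sec U\<^esub> = (\<lambda>p\<in>U. hfrac R p \<zero> \<one>)"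
 "c \<odot>\<^bsub>sec U\<^esub> s = (\<lambda>p\<in>U. stalk_smult R p c (s p))" by (simp_all add: proj_sections_def)

lemma sec_ext: "s : carrier (sec U) ==> s : extensional U" by (simp add: proj_sections_def)

lemma sec_local: assumes "s : carrier (sec U)" "p : U"
 obtains W a f where "openin (proj_top R) W" "p : W" "W <= U"
  "!!q. q : W ==> frac q a f" "!!q. q : W ==> s q = hfrac R q a f"
proof -
 obtain W d a f where W: "openin (proj_top R) W" "p : W" "W <= U" "a : homog R d" "f : homog R d"
  "ALL q:W. f ~: q & s q = hfrac R q a f" using assms unfolding proj_sections_def by auto
 show thesis by (rule that[OF W(1-3), of a f]) (use W(4-6) in "auto simp: frac_def")
qed

lemma sec_stalk: assumes "s : carrier (sec U)" "p : U" shows "s p : stalk p"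
proof -
 obtain a f where "frac p a f" "s p = hfrac R p a f" using sec_local[OF assms] by metis
 thus ?thesis unfolding stalk_def by blast
qed

lemma sec_memI: assumes "s : extensional U" and loc: "!!p. p : U ==> EX W a f. openin (proj_top R) W & p : W & W <= U &
   (ALL q:W. frac q a f & s q = hfrac R q a f)"
 shows "s : carrier (sec U)"
proof -
 have "EX W. openin (proj_top R) W & p : W & W <= U &
    (EX d. EX a:homog R d. EX f:homog R d. ALL q:W. f ~: q & s q = hfrac R q a f)" if p: "p : U" for p
 proof -
  obtain W a f where W: "openin (proj_top R) W" "p : W" "W <= U" "ALL q:W. frac q a f & s q = hfrac R q a f" using loc[OF p] by blast
  obtain d where "a : homog R d" "f : homog R d" using W(2,4) unfolding frac_def by blast
  moreover have "ALL q:W. f ~: q & s q = hfrac R q a f" using W(4) unfolding frac_def by blast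
  ultimately show ?thesis using W(1-3) by blast
 qed
 thus ?thesis using assms(1) by (simp add: proj_sections_def)
qed

lemma sec_const: assumes "openin (proj_top R) U" "!!p. p : U ==> frac p a f" shows "(\<lambda>p\<in>U. hfrac R p a f) : carrier (sec U)"
proof (rule sec_memI)
 fix p assume "p : U"
 thus "EX W b g. openin (proj_top R) W & p : W & W <= U & (ALL q:W. frac q b g & (\<lambda>p\<in>U. hfrac R p a f) q = hfrac R q b g)"
  using assms by (intro exI[of _ U] exI[of _ a] exI[of _ f]) auto
qed simp

lemma sec_op_closed: assumes s: "s : carrier (sec U)" and t: "t : carrier (sec U)" and op: "!!p a f b g. p : U ==> frac p a f ==> frac p b g ==>
   frac p (A a f b g) (B a f b g) & op p (hfrac R p a f) (hfrac R p b g) = hfrac R p (A a f b g) (B a f b g)"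
 shows "(\<lambda>p\<in>U. op p (s p) (t p)) : carrier (sec U)"
proof (rule sec_memI)
 fix p assume p: "p : U"
 obtain W a f where W: "openin (proj_top R) W" "p : W" "W <= U"
  "!!q. q : W ==> frac q a f" "!!q. q : W ==> s q = hfrac R q a f" using sec_local[OF s p] by metis
 obtain V b g where V: "openin (proj_top R) V" "p : V" "V <= U"
  "!!q. q : V ==> frac q b g" "!!q. q : V ==> t q = hfrac R q b g" using sec_local[OF t p] by metis
 have "frac q (A a f b g) (B a f b g) & (\<lambda>p\<in>U. op p (s p) (t p)) q = hfrac R q (A a f b g) (B a f b g)"
  if q: "q : W Int V" for q
 proof -
  have q': "q : W" "q : V" "q : U" using q W(3) by auto
  show ?thesis using op[OF q'(3) W(4)[OF q'(1)] V(4)[OF q'(2)]] W(5)[OF q'(1)] V(5)[OF q'(2)] q'(3) by simp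
 qed
 thus "EX W c h. openin (proj_top R) W & p : W & W <= U & (ALL q:W. frac q c h & (\<lambda>p\<in>U. op p (s p) (t p)) q = hfrac R q c h)"
  using W V by (intro exI[of _ "W Int V"] exI[of _ "A a f b g"] exI[of _ "B a f b g"]) auto
qed simp

lemma sec_closed: assumes U: "openin (proj_top R) U"
 shows "s : carrier (sec U) ==> t : carrier (sec U) ==> s \<otimes>\<^bsub>sec U\<^esub> t : carrier (sec U)"
  "s : carrier (sec U) ==> t : carrier (sec U) ==> s \<oplus>\<^bsub>sec U\<^esub> t : carrier (sec U)"
  "\<one>\<^bsub>sec U\<^esub> : carrier (sec U)" "\<zero>\<^bsub>sec U\<^esub> : carrier (sec U)"
  "(\<lambda>p\<in>U. hfrac R p (\<ominus> \<one>) \<one>) : carrier (sec U)"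
proof -
 note P = openin_points[OF U]
 note fc = frac_consts[OF P]
 show "s \<otimes>\<^bsub>sec U\<^esub> t : carrier (sec U)" if "s : carrier (sec U)" "t : carrier (sec U)" unfolding sec_simps
  by (rule sec_op_closed[OF that, where A = "%a f b g. a \<otimes> b" and B = "%a f b g. f \<otimes> g"])
   (simp add: frac_ops[OF P] stalk_mult_hfrac[OF P])
 show "s \<oplus>\<^bsub>sec U\<^esub> t : carrier (sec U)" if "s : carrier (sec U)" "t : carrier (sec U)" unfolding sec_simps
  by (rule sec_op_closed[OF that, where A = "%a f b g. a \<otimes> g \<oplus> b \<otimes> f" and B = "%a f b g. f \<otimes> g"])
   (simp add: frac_ops[OF P] stalk_add_hfrac[OF P])
 show "\<one>\<^bsub>sec U\<^esub> : carrier (sec U)" unfolding sec_simps by (rule sec_const[OF U fc(2)])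
 show "\<zero>\<^bsub>sec U\<^esub> : carrier (sec U)" unfolding sec_simps by (rule sec_const[OF U fc(1)])
 show "(\<lambda>p\<in>U. hfrac R p (\<ominus> \<one>) \<one>) : carrier (sec U)"
  by (rule sec_const[OF U]) (rule frac_ops(3)[OF P fc(2) fc(2)])
qed

lemma cring_sections: assumes U: "openin (proj_top R) U" shows "cring (sec U)"
proof -
 note P = openin_points[OF U]
 note cl = sec_closed[OF U]
 note laws = stalk_laws[OF P]
 show ?thesis
 proof (rule cringI)
  show "abelian_group (sec U)"
  proof (rule abelian_groupI)
   fix s t r assume S: "s : carrier (sec U)" "t : carrier (sec U)" "r : carrier (sec U)"
   show "s \<oplus>\<^bsub>sec U\<^esub> t \<oplus>\<^bsub>sec U\<^esub> r = s \<oplus>\<^bsub>sec U\<^esub> (t \<oplus>\<^bsub>sec U\<^esub> r)"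
    unfolding sec_simps by (intro restrict_ext) (simp add: laws(1)[OF _ sec_stalk[OF S(1)] sec_stalk[OF S(2)] sec_stalk[OF S(3)]])
  next
   fix s t assume S: "s : carrier (sec U)" "t : carrier (sec U)"
   show "s \<oplus>\<^bsub>sec U\<^esub> t = t \<oplus>\<^bsub>sec U\<^esub> s" unfolding sec_simps
    by (intro restrict_ext) (rule laws(2)[OF _ sec_stalk[OF S(1)] sec_stalk[OF S(2)] sec_stalk[OF S(2)]])
  next
   fix s assume S: "s : carrier (sec U)"
   show "\<zero>\<^bsub>sec U\<^esub> \<oplus>\<^bsub>sec U\<^esub> s = s" by (rule extensionalityI[where A = U])
     (simp_all add: sec_simps sec_ext[OF S] laws(3)[OF _ sec_stalk[OF S] sec_stalk[OF S] sec_stalk[OF S]])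
   show "EX t:carrier (sec U). t \<oplus>\<^bsub>sec U\<^esub> s = \<zero>\<^bsub>sec U\<^esub>"
   proof (rule bexI[OF _ cl(1)[OF cl(5) S]])
    show "((\<lambda>p\<in>U. hfrac R p (\<ominus> \<one>) \<one>) \<otimes>\<^bsub>sec U\<^esub> s) \<oplus>\<^bsub>sec U\<^esub> s = \<zero>\<^bsub>sec U\<^esub>"
     unfolding sec_simps by (intro restrict_ext) (simp add: laws(4)[OF _ sec_stalk[OF S] sec_stalk[OF S] sec_stalk[OF S]])
   qed
  qed (rule cl; assumption)+
  show "Group.comm_monoid (sec U)"
  proof (rule comm_monoidI)
   fix s t r assume S: "s : carrier (sec U)" "t : carrier (sec U)" "r : carrier (sec U)"
   show "s \<otimes>\<^bsub>sec U\<^esub> t \<otimes>\<^bsub>sec U\<^esub> r = s \<otimes>\<^bsub>sec U\<^esub> (t \<otimes>\<^bsub>sec U\<^esub> r)"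
    unfolding sec_simps by (intro restrict_ext) (simp add: laws(5)[OF _ sec_stalk[OF S(1)] sec_stalk[OF S(2)] sec_stalk[OF S(3)]])
  next
   fix s t assume S: "s : carrier (sec U)" "t : carrier (sec U)"
   show "s \<otimes>\<^bsub>sec U\<^esub> t = t \<otimes>\<^bsub>sec U\<^esub> s" unfolding sec_simps
    by (intro restrict_ext) (rule laws(6)[OF _ sec_stalk[OF S(1)] sec_stalk[OF S(2)] sec_stalk[OF S(2)]])
  next
   fix s assume S: "s : carrier (sec U)"
   show "\<one>\<^bsub>sec U\<^esub> \<otimes>\<^bsub>sec U\<^esub> s = s" by (rule extensionalityI[where A = U])
     (simp_all add: sec_simps sec_ext[OF S] laws(7)[OF _ sec_stalk[OF S] sec_stalk[OF S] sec_stalk[OF S]])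
  qed (rule cl; assumption)+
  fix s t r assume S: "s : carrier (sec U)" "t : carrier (sec U)" "r : carrier (sec U)"
  show "(s \<oplus>\<^bsub>sec U\<^esub> t) \<otimes>\<^bsub>sec U\<^esub> r = s \<otimes>\<^bsub>sec U\<^esub> r \<oplus>\<^bsub>sec U\<^esub> t \<otimes>\<^bsub>sec U\<^esub> r"
   unfolding sec_simps by (intro restrict_ext) (simp add: laws(8)[OF _ sec_stalk[OF S(1)] sec_stalk[OF S(2)] sec_stalk[OF S(3)]])
 qed
qed

lemma hfrac_eq_zero_iff: assumes p: "p : Pts R" and v: "frac p a f"
 shows "hfrac R p a f = hfrac R p \<zero> \<one> \<longleftrightarrow> (EX h:H - p. h \<otimes> a = \<zero>)"
proof -
 have c: "h \<otimes> (a \<otimes> \<one>) = h \<otimes> (\<zero> \<otimes> f) \<longleftrightarrow> h \<otimes> a = \<zero>" if "h : H" for h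
  using fracD[OF v] H_in[OF that] by simp
 show ?thesis using hfrac_eqD[OF p frac_consts(1)[OF p], of a f] hfrac_eqI[OF p v frac_consts(1)[OF p]] c by blast
qed

lemma zero_section_eqI:
 assumes s: "s : carrier (sec U)" and z: "!!p. p : U ==> s p = hfrac R p \<zero> \<one>" shows "s = \<zero>\<^bsub>sec U\<^esub>"
 by (rule extensionalityI[OF sec_ext[OF s]]) (simp_all add: sec_simps z)

text \<open>If a power of the fraction \<open>a/f\<close> vanishes at \<open>p\<close>, then \<open>h a\<close> is nilpotent for some \<open>h\<close> outside \<open>p\<close>.\<close>

lemma reduced_Proj: assumes red: "!!x (m::nat). x : carrier R ==> x [^] m = \<zero> ==> x = \<zero>" shows "reduced_space (Proj R)"
proof -
 have "s = \<zero>\<^bsub>sec U\<^esub>"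
  if U: "openin (proj_top R) U" and s: "s : carrier (sec U)" and z: "s [^]\<^bsub>sec U\<^esub> m = \<zero>\<^bsub>sec U\<^esub>" for U s and m :: nat
 proof (rule zero_section_eqI[OF s])
  interpret U: cring "sec U" by (rule cring_sections[OF U])
  fix p assume p: "p : U"
  note P = openin_points[OF U p]
  obtain a f where a: "frac p a f" "s p = hfrac R p a f" using sec_local[OF s p] by metis
  have car: "a : carrier R" using fracD[OF a(1)] by blast
  have pow: "frac p (a [^] i) (f [^] i) & (s [^]\<^bsub>sec U\<^esub> i) p = hfrac R p (a [^] i) (f [^] i)" for i :: nat
  proof (induction i)
   case 0
   show ?case using frac_consts[OF P] p by (simp add: sec_simps)
  next
   case (Suc i)
   thus ?case using a p frac_ops(2)[OF P _ a(1)] by (simp add: sec_simps(1) stalk_mult_hfrac[OF P])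
  qed
  have "hfrac R p (a [^] m) (f [^] m) = hfrac R p \<zero> \<one>" using pow[of m] z p by (simp add: sec_simps)
  then obtain h where h: "h : H" "h ~: p" "h \<otimes> a [^] m = \<zero>" using hfrac_eq_zero_iff[OF P] pow[of m] by blast
  have hc: "h : carrier R" by (rule H_in[OF h(1)])
  have "(h \<otimes> a) [^] m = \<zero>"
  proof (cases m)
   case 0
   hence "h = \<zero>" using h(3) hc by simp
   thus ?thesis using h(2) point_zero[OF P] by simp
  next
   case (Suc i)
   have "(h \<otimes> a) [^] m = h [^] m \<otimes> a [^] m" by (rule nat_pow_distrib[OF hc car])
   also have "... = h [^] i \<otimes> (h \<otimes> a [^] m)" using hc car by (simp add: Suc m_assoc)
   finally show ?thesis using h(3) hc by simp
  qed
  hence "h \<otimes> a = \<zero>" using red hc car by blast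
  thus "s p = hfrac R p \<zero> \<one>" unfolding a(2) using hfrac_eq_zero_iff[OF P a(1)] h(1,2) by blast
 qed
 thus ?thesis by (simp add: reduced_space_def Proj_def)
qed

lemma zero_point: assumes "domain R" "x : homog R d" "d > 0" "x ~= \<zero>" shows "{\<zero>} : Pts R"
proof -
 have "primeideal {\<zero>} R" using domain_eq_zeroprimeideal assms(1) by blast
 thus ?thesis unfolding proj_points_iff using pr_id[OF homog_zero] assms(2-4) by auto
qed

lemma zero_point_generic: assumes "{\<zero>} : Pts R" "openin (proj_top R) U" "U ~= {}" shows "{\<zero>} : U"
proof -
 obtain p where p: "p : U" using assms(3) by blast
 obtain a where a: "a : H" "p : basic a" "basic a <= U" using assms(2) p unfolding openin_proj_top by blast
 have "a ~= \<zero>" using a(2) point_zero by (auto simp: basic_def)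
 thus ?thesis using a(3) assms(1) by (auto simp: basic_def)
qed

text \<open>The zero ideal is a generic point. A section vanishing there vanishes everywhere, because all
  its local numerators are zero.\<close>

lemma integral_Proj: assumes dom: "domain R" and x: "x : homog R d" "d > 0" "x ~= \<zero>" shows "integral_space (Proj R)"
proof -
 interpret D: domain R by (rule dom)
 note eta = zero_point[OF dom x]
 have "domain (sec U)" if U: "openin (proj_top R) U" "U ~= {}" for U
 proof -
  interpret U: cring "sec U" by (rule cring_sections[OF U(1)])
  note eU = zero_point_generic[OF eta U]
  have z: "s = \<zero>\<^bsub>sec U\<^esub>"
   if s: "s : carrier (sec U)" and a: "frac {\<zero>} \<zero> f" "s {\<zero>} = hfrac R {\<zero>} \<zero> f" for s f
  proof (rule zero_section_eqI[OF s])
   fix p assume p: "p : U"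
   obtain W b g where W: "openin (proj_top R) W" "p : W" "W <= U"
    "!!q. q : W ==> frac q b g" "!!q. q : W ==> s q = hfrac R q b g" using sec_local[OF s p] by metis
   have eW: "{\<zero>} : W" by (rule zero_point_generic[OF eta W(1)]) (use W(2) in blast)
   have "hfrac R {\<zero>} b g = hfrac R {\<zero>} \<zero> f" using a(2) W(5)[OF eW] by simp
   then obtain h where h: "h : H - {\<zero>}" "h \<otimes> (b \<otimes> f) = h \<otimes> (\<zero> \<otimes> g)"
    using hfrac_eqD[OF eta a(1)] by blast
   have car: "b : carrier R" "g : carrier R" "f : carrier R" "f ~= \<zero>" "h : carrier R" "h ~= \<zero>"
    using fracD[OF W(4)[OF eW]] fracD[OF a(1)] h(1) H_in by auto
   have "b = \<zero>" using h(2) car by (auto simp: D.integral_iff)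
   hence "\<one> : H - p & \<one> \<otimes> b = \<zero>" using H_one point_one[OF openin_points[OF U(1) p]] by simp
   thus "s p = hfrac R p \<zero> \<one>" using W(5)[OF W(2)] hfrac_eq_zero_iff[OF openin_points[OF U(1) p] W(4)[OF W(2)]] by metis
  qed
  show ?thesis
  proof (intro domain.intro domain_axioms.intro)
   show "cring (sec U)" by (rule U.is_cring)
   show "\<one>\<^bsub>sec U\<^esub> ~= \<zero>\<^bsub>sec U\<^esub>"
   proof
    assume "\<one>\<^bsub>sec U\<^esub> = \<zero>\<^bsub>sec U\<^esub>"
    hence "\<one>\<^bsub>sec U\<^esub> {\<zero>} = \<zero>\<^bsub>sec U\<^esub> {\<zero>}" by simp
    hence "hfrac R {\<zero>} \<one> \<one> = hfrac R {\<zero>} \<zero> \<one>" using eU by (simp add: sec_simps)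
    then obtain h where "h : H - {\<zero>}" "h \<otimes> \<one> = \<zero>" using hfrac_eq_zero_iff[OF eta frac_consts(2)[OF eta]] by blast
    thus False using H_in by auto
   qed
   fix s t assume st: "s \<otimes>\<^bsub>sec U\<^esub> t = \<zero>\<^bsub>sec U\<^esub>" "s : carrier (sec U)" "t : carrier (sec U)"
   obtain a f where a: "frac {\<zero>} a f" "s {\<zero>} = hfrac R {\<zero>} a f" using sec_local[OF st(2) eU] by metis
   obtain b g where b: "frac {\<zero>} b g" "t {\<zero>} = hfrac R {\<zero>} b g" using sec_local[OF st(3) eU] by metis
   have "(s \<otimes>\<^bsub>sec U\<^esub> t) {\<zero>} = \<zero>\<^bsub>sec U\<^esub> {\<zero>}" using st(1) by simp
   hence "hfrac R {\<zero>} (a \<otimes> b) (f \<otimes> g) = hfrac R {\<zero>} \<zero> \<one>"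
    using eU by (simp add: sec_simps a b stalk_mult_hfrac[OF eta a(1) b(1)])
   then obtain h where h: "h : H - {\<zero>}" "h \<otimes> (a \<otimes> b) = \<zero>"
    using hfrac_eq_zero_iff[OF eta frac_ops(2)[OF eta a(1) b(1)]] by blast
   have "a = \<zero> | b = \<zero>" using h fracD[OF a(1)] fracD[OF b(1)] H_in[of h] by (auto simp: D.integral_iff)
   thus "s = \<zero>\<^bsub>sec U\<^esub> | t = \<zero>\<^bsub>sec U\<^esub>" using z[OF st(2)] z[OF st(3)] a b by blast
  qed
 qed
 thus ?thesis using eta by (auto simp: integral_space_def Proj_def)
qed

end

section \<open>Closed immersions from surjective homomorphisms\<close>

text \<open>A surjection of graded rings identifies the points of \<open>Proj R'\<close> with the points of \<open>Proj R\<close> that contain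
  the kernel. Sections of the target lift locally, since numerators and denominators do.\<close>

locale graded_surjection = R: graded_cring R pr + R': graded_cring R' pr'
 for R :: "('k, 'a) graded_algebra" and pr and R' :: "('k, 'b) graded_algebra" and pr' + fixes phi :: "'a => 'b" assumes hom: "phi : ring_hom R R'"
  and homog_image: "phi ` homog R d = homog R' d" and surj: "phi ` carrier R = carrier R'"
  and map_smult: "x : carrier R ==> phi (c \<odot>\<^bsub>R\<^esub> x) = c \<odot>\<^bsub>R'\<^esub> phi x"
  and map_pr: "x : carrier R ==> phi (pr d x) = pr' d (phi x)"
begin

sublocale phi: ring_hom_cring R R' phi by unfold_locales (rule hom)

definition pull :: "'b set => 'a set" where "pull q = {x : carrier R. phi x : q}"

lemma map_homog: "x : homog R d ==> phi x : homog R' d" using homog_image by blast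

lemma map_H: "x : R.H ==> phi x : R'.H" unfolding homog_elems_def using map_homog by blast

lemma H_lift: "y : R'.H ==> EX x:R.H. y = phi x" unfolding homog_elems_def using homog_image by blast

lemma pull_point: assumes q: "q : Pts R'" shows "pull q : Pts R"
proof -
 have "primeideal (pull q) R" unfolding pull_def
  by (rule ring_hom_ring.primeideal_vimage[OF ring_hom_ringI2[OF R.ring_axioms R'.ring_axioms hom]
     R.is_cring R'.point_prime[OF q]])
 moreover have "ALL x:pull q. ALL d. pr d x : pull q" using q R.pr_in unfolding R'.proj_points_iff pull_def by (auto simp: map_pr)
 moreover have "EX d>0. EX x:homog R d. x ~: pull q"
 proof -
  obtain d y where d: "d > 0" "y : homog R' d" "y ~: q" using q unfolding R'.proj_points_iff by blast
  then obtain x where "x : homog R d" "y = phi x" using homog_image by blast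
  thus ?thesis using d by (intro exI[of _ d]) (auto simp: pull_def)
 qed
 ultimately show ?thesis unfolding R.proj_points_iff by blast
qed

lemma pull_iff: "x : carrier R ==> x : pull q \<longleftrightarrow> phi x : q" by (simp add: pull_def)

lemma pull_inj: "inj_on pull (Pts R')"
proof (rule inj_onI)
 have sub: "q <= q'" if q: "q : Pts R'" and eq: "pull q = pull q'" for q q'
 proof
  fix y assume y: "y : q"
  then obtain x where "x : carrier R" "y = phi x" using R'.point_carrier[OF q] surj by blast
  thus "y : q'" using y eq pull_iff by blast
 qed
 fix q q' assume "q : Pts R'" "q' : Pts R'" "pull q = pull q'"
 thus "q = q'" using sub[of q q'] sub[of q' q] by simp
qed

lemma image_of_pull:
 assumes p: "p : Pts R" and ker: "!!x. x : carrier R ==> phi x = \<zero>\<^bsub>R'\<^esub> ==> x : p" shows "EX q:Pts R'. pull q = p"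
proof (rule bexI)
 interpret p: primeideal p R by (rule R.point_prime[OF p])
 have pc: "p <= carrier R" using p.a_subset .
 have mem: "phi x : phi ` p \<longleftrightarrow> x : p" if x: "x : carrier R" for x
 proof
  assume "phi x : phi ` p"
  then obtain y where y: "y : p" "phi x = phi y" by blast
  have yc: "y : carrier R" using y(1) pc by blast
  have "phi (x \<ominus>\<^bsub>R\<^esub> y) = \<zero>\<^bsub>R'\<^esub>" using x yc y(2) by (simp add: R.minus_eq R'.r_neg)
  hence "x \<ominus>\<^bsub>R\<^esub> y : p" using ker x yc by simp
  hence "(x \<ominus>\<^bsub>R\<^esub> y) \<oplus>\<^bsub>R\<^esub> y : p" using y(1) by (rule p.a_closed)
  moreover have "(x \<ominus>\<^bsub>R\<^esub> y) \<oplus>\<^bsub>R\<^esub> y = x" using x yc by algebra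
  ultimately show "x : p" by simp
 qed blast
 have mem': "EX x:carrier R. y = phi x" if "y : carrier R'" for y using that unfolding surj[symmetric] by (rule imageE) blast
 have "primeideal (phi ` p) R'"
 proof (rule primeidealI)
  show "ideal (phi ` p) R'"
  proof (rule idealI)
   show "ring R'" by (rule R'.ring_axioms)
   show "subgroup (phi ` p) (add_monoid R')"
   proof (rule subgroup.intro)
    show "phi ` p <= carrier (add_monoid R')" using image_mono[OF pc, of phi] surj by simp
    show "\<one>\<^bsub>add_monoid R'\<^esub> : phi ` p" using imageI[OF p.zero_closed, of phi] by simp
    fix y assume y: "y : phi ` p"
    then obtain x where x: "x : p" "y = phi x" by blast
    have xc: "x : carrier R" using x(1) pc by blast
    show "y \<otimes>\<^bsub>add_monoid R'\<^esub> y' : phi ` p" if y': "y' : phi ` p" for y'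
    proof -
     obtain x' where x': "x' : p" "y' = phi x'" using y' by blast
     have "x' : carrier R" using x'(1) pc by blast
     hence "y \<oplus>\<^bsub>R'\<^esub> y' = phi (x \<oplus>\<^bsub>R\<^esub> x')" using x(2) x'(2) xc by simp
     thus ?thesis using p.a_closed[OF x(1) x'(1)] by simp
    qed
    have "\<ominus>\<^bsub>R'\<^esub> y = phi (\<ominus>\<^bsub>R\<^esub> x)" using x(2) xc by simp
    thus "inv\<^bsub>add_monoid R'\<^esub> y : phi ` p" using p.a_inv_closed[OF x(1)] by (simp add: a_inv_def[symmetric])
   qed
   fix y z assume "y : phi ` p" and z: "z : carrier R'"
   then obtain x where x: "x : p" "y = phi x" by blast
   obtain w where w: "w : carrier R" "z = phi w" using mem'[OF z] by blast
   have xc: "x : carrier R" using x(1) pc by blast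
   show "z \<otimes>\<^bsub>R'\<^esub> y : phi ` p" using imageI[OF p.I_l_closed[OF x(1) w(1)], of phi] w x(2) xc by simp
   show "y \<otimes>\<^bsub>R'\<^esub> z : phi ` p" using imageI[OF p.I_r_closed[OF x(1) w(1)], of phi] w x(2) xc by simp
  qed
  show "cring R'" by (rule R'.is_cring)
  show "carrier R' ~= phi ` p"
  proof
   assume "carrier R' = phi ` p"
   hence "phi \<one>\<^bsub>R\<^esub> : phi ` p" using phi.hom_closed[OF R.one_closed] by simp
   thus False using mem[OF R.one_closed] R.point_one[OF p] by simp
  qed
  fix y z assume yz: "y : carrier R'" "z : carrier R'" "y \<otimes>\<^bsub>R'\<^esub> z : phi ` p"
  obtain u w where u: "u : carrier R" "y = phi u" "w : carrier R" "z = phi w" using mem'[OF yz(1)] mem'[OF yz(2)] by blast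
  have "phi (u \<otimes>\<^bsub>R\<^esub> w) : phi ` p" using yz(3) u by simp
  hence "u \<otimes>\<^bsub>R\<^esub> w : p" using mem[of "u \<otimes>\<^bsub>R\<^esub> w"] u(1,3) by blast
  thus "y : phi ` p | z : phi ` p" using p.I_prime[OF u(1,3)] u(2,4) by blast
 qed
 moreover have "ALL y:phi ` p. ALL d. pr' d y : phi ` p"
 proof (intro ballI allI)
  fix y d assume "y : phi ` p"
  then obtain x where x: "x : p" "y = phi x" by blast
  have "pr d x : p" using p x(1) unfolding R.proj_points_iff by blast
  moreover have "pr' d y = phi (pr d x)" unfolding x(2) using map_pr x(1) pc by (simp add: subsetD)
  ultimately show "pr' d y : phi ` p" by blast
 qed
 moreover have "EX d>0. EX x:homog R' d. x ~: phi ` p"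
 proof -
  obtain d x where d: "d > 0" "x : homog R d" "x ~: p" using p unfolding R.proj_points_iff by blast
  thus ?thesis using mem[OF R.homog_in[OF d(2)]] map_homog[OF d(2)] by blast
 qed
 ultimately show "phi ` p : Pts R'" unfolding R'.proj_points_iff by blast
 show "pull (phi ` p) = p" unfolding pull_def using mem pc by blast
qed

lemma pull_image_iff:
 "p : pull ` Pts R' \<longleftrightarrow> p : Pts R & (ALL x:carrier R. phi x = \<zero>\<^bsub>R'\<^esub> --> x : p)"
 using image_of_pull[of p] pull_point R'.point_zero by (auto simp: pull_iff)

lemma pull_basic: "q : Pts R' ==> a : carrier R ==> pull q : R.basic a \<longleftrightarrow> q : R'.basic (phi a)"
 using pull_point by (auto simp: R.basic_def R'.basic_def pull_iff)

lemma openin_vimage_pull: assumes U: "openin (proj_top R) U" shows "openin (proj_top R') {q : Pts R'. pull q : U}" unfolding R'.openin_proj_top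
proof
 fix q assume "q : {q : Pts R'. pull q : U}"
 hence q: "q : Pts R'" "pull q : U" by auto
 obtain a where a: "a : R.H" "pull q : R.basic a" "R.basic a <= U" using U q(2) unfolding R.openin_proj_top by blast
 note ac = R.H_in[OF a(1)]
 have "R'.basic (phi a) <= {q : Pts R'. pull q : U}" using pull_basic[OF _ ac] a(3) by (auto simp: R'.basic_def)
 thus "EX b:R'.H. q : R'.basic b & R'.basic b <= {q : Pts R'. pull q : U}" using map_H[OF a(1)] pull_basic[OF q(1) ac] a(2) by blast
qed

lemma embedding_pull: "embedding_map (proj_top R') (proj_top R) pull"
proof -
 let ?Y = "subtopology (proj_top R) (pull ` Pts R')"
 have "homeomorphic_map (proj_top R') ?Y pull"
 proof (rule bijective_open_imp_homeomorphic_map)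
  show "continuous_map (proj_top R') ?Y pull"
  proof (rule continuous_map_into_subtopology)
   show "continuous_map (proj_top R') (proj_top R) pull" unfolding continuous_map_def using pull_point openin_vimage_pull by auto
  qed auto
  show "open_map (proj_top R') ?Y pull" unfolding open_map_def openin_subtopology
  proof (intro allI impI)
   fix U assume U: "openin (proj_top R') U"
   let ?T = "\<Union>{R.basic a | a. a : R.H & R'.basic (phi a) <= U}"
   have "openin (proj_top R) ?T" using R.openin_basic by blast
   moreover have "pull ` U = ?T Int pull ` Pts R'"
   proof (intro Set.equalityI subsetI)
    fix p assume "p : pull ` U"
    then obtain q where q: "q : U" "p = pull q" by blast
    note Q = R'.openin_points[OF U q(1)]
    obtain b where b: "b : R'.H" "q : R'.basic b" "R'.basic b <= U" using U q(1) unfolding R'.openin_proj_top by blast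
    obtain a where a: "a : R.H" "b = phi a" using H_lift[OF b(1)] by blast
    have "p : R.basic a" using pull_basic[OF Q R.H_in[OF a(1)]] b(2) a(2) q(2) by simp
    thus "p : ?T Int pull ` Pts R'" using a b(3) q(2) Q by blast
   next
    fix p assume "p : ?T Int pull ` Pts R'"
    then obtain a q where a: "a : R.H" "R'.basic (phi a) <= U" "p : R.basic a" "q : Pts R'" "p = pull q" by blast
    thus "p : pull ` U" using pull_basic[OF a(4) R.H_in[OF a(1)]] by blast
   qed
   ultimately show "EX T. openin (proj_top R) T & pull ` U = T Int pull ` Pts R'" by blast
  qed
  show "pull ` topspace (proj_top R') = topspace ?Y" using pull_point by auto
  show "inj_on pull (topspace (proj_top R'))" using pull_inj by simp
 qed
 thus ?thesis by (simp add: embedding_map_def)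
qed

lemma closedin_pull: "closedin (proj_top R) (pull ` Pts R')"
proof -
 have "openin (proj_top R) (Pts R - pull ` Pts R')" unfolding R.openin_proj_top
 proof
  fix p assume "p : Pts R - pull ` Pts R'"
  hence p: "p : Pts R" and "p ~: pull ` Pts R'" by auto
  then obtain x where x: "x : carrier R" "phi x = \<zero>\<^bsub>R'\<^esub>" "x ~: p" unfolding pull_image_iff by blast
  have "EX d. pr d x ~: p"
  proof (rule ccontr)
   assume "\<nexists>d. pr d x ~: p"
   hence "(\<Oplus>\<^bsub>R\<^esub>d\<in>{d. pr d x ~= \<zero>\<^bsub>R\<^esub>}. pr d x) : p"
    by (intro R.ideal_finsum[OF primeideal.axioms(1)[OF R.point_prime[OF p]] R.pr_finite[OF x(1)]]) simp
   thus False using R.pr_sum[OF x(1)] x(3) by simp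
  qed
  then obtain d where d: "pr d x ~: p" by blast
  note h = R.homog_H[OF R.pr_homog[OF x(1), of d]]
  have z: "phi (pr d x) = \<zero>\<^bsub>R'\<^esub>" using map_pr[OF x(1)] x(2) R'.pr_id[OF R'.homog_zero[of d], of d] by simp
  have "p : R.basic (pr d x)" using p d by (simp add: R.basic_def)
  moreover have "R.basic (pr d x) <= Pts R - pull ` Pts R'"
   unfolding pull_image_iff R.basic_def using z R.H_in[OF h] R'.point_zero by (auto simp: pull_iff)
  ultimately show "EX a:R.H. p : R.basic a & R.basic a <= Pts R - pull ` Pts R'" using h by blast
 qed
 thus ?thesis unfolding closedin_def using pull_point by auto
qed

subsection \<open>The homomorphism of sheaves\<close>

lemma frac_map: "R.frac (pull q) a f ==> R'.frac q (phi a) (phi f)"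
 unfolding R.frac_def R'.frac_def using map_homog R.homog_in by (auto simp: pull_iff)

definition germ_map :: "'b set => ('a \<times> 'a) set => ('b \<times> 'b) set" where
 "germ_map q x = (UN (a, f):x. hfrac R' q (phi a) (phi f))"

lemma germ_map_hfrac: assumes q: "q : Pts R'" and v: "R.frac (pull q) a f" shows "germ_map q (hfrac R (pull q) a f) = hfrac R' q (phi a) (phi f)"
proof -
 note p = pull_point[OF q]
 have "hfrac R' q (phi b) (phi g) = hfrac R' q (phi a) (phi f)" if m: "(b, g) : hfrac R (pull q) a f" for b g
 proof -
  obtain h where h: "R.frac (pull q) b g" "h : R.H - pull q" "h \<otimes>\<^bsub>R\<^esub> (a \<otimes>\<^bsub>R\<^esub> g) = h \<otimes>\<^bsub>R\<^esub> (b \<otimes>\<^bsub>R\<^esub> f)"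
   using m unfolding R.in_hfrac_iff by blast
  have car: "a : carrier R" "f : carrier R" "b : carrier R" "g : carrier R" "h : carrier R"
   using R.fracD[OF v] R.fracD[OF h(1)] R.H_in h(2) by blast+
  have "phi (h \<otimes>\<^bsub>R\<^esub> (a \<otimes>\<^bsub>R\<^esub> g)) = phi (h \<otimes>\<^bsub>R\<^esub> (b \<otimes>\<^bsub>R\<^esub> f))" by (simp add: h(3))
  hence "phi h \<otimes>\<^bsub>R'\<^esub> (phi b \<otimes>\<^bsub>R'\<^esub> phi f) = phi h \<otimes>\<^bsub>R'\<^esub> (phi a \<otimes>\<^bsub>R'\<^esub> phi g)" using car by simp
  moreover have "phi h : R'.H - q" using h(2) map_H car pull_iff by blast
  ultimately show ?thesis using R'.hfrac_eqI[OF q frac_map[OF h(1)] frac_map[OF v]] by blast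
 qed
 thus ?thesis unfolding germ_map_def using R.hfrac_self[OF p v] by (intro Set.set_eqI) blast
qed

definition sheaf_map :: "'a set set => ('a set => ('a \<times> 'a) set) => 'b set => ('b \<times> 'b) set" where
 "sheaf_map U s = (\<lambda>q\<in>{q : Pts R'. pull q : U}. germ_map q (s (pull q)))"

lemma closed_immersion_pull: "closed_immersion (Proj R') (Proj R) pull"
proof -
 define pre where "pre U = {q : Pts R'. pull q : U}" for U
 have preI: "openin (proj_top R) U ==> openin (proj_top R') (pre U)" for U unfolding pre_def by (rule openin_vimage_pull)
 have sm: "sheaf_map U s = (\<lambda>q\<in>pre U. germ_map q (s (pull q)))" for U s by (simp add: sheaf_map_def pre_def)
 have preD: "q : Pts R'" "pull q : U" if "q : pre U" for q U using that by (auto simp: pre_def)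
 have closed: "sheaf_map U s : carrier (R'.sec (pre U))"
  if U: "openin (proj_top R) U" and s: "s : carrier (R.sec U)" for U s
 proof (rule R'.sec_memI)
  show "sheaf_map U s : extensional (pre U)" by (simp add: sm)
  fix q assume q: "q : pre U"
  obtain W a f where W: "openin (proj_top R) W" "pull q : W" "W <= U"
   "!!q. q : W ==> R.frac q a f" "!!q. q : W ==> s q = hfrac R q a f" using R.sec_local[OF s preD(2)[OF q]] by metis
  have "R'.frac z (phi a) (phi f) & sheaf_map U s z = hfrac R' z (phi a) (phi f)" if z: "z : pre W" for z
  proof -
   note Z = preD[OF z]
   have "z : pre U" using Z W(3) by (auto simp: pre_def)
   thus ?thesis using frac_map[OF W(4)[OF Z(2)]] germ_map_hfrac[OF Z(1) W(4)[OF Z(2)]] W(5)[OF Z(2)] by (simp add: sm)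
  qed
  moreover have "q : pre W" "pre W <= pre U" using W(2,3) q by (auto simp: pre_def)
  ultimately show "EX W b g. openin (proj_top R') W & q : W & W <= pre U & (ALL z:W. R'.frac z b g & sheaf_map U s z = hfrac R' z b g)"
   using preI[OF W(1)] by (intro exI[of _ "pre W"] exI[of _ "phi a"] exI[of _ "phi f"] conjI ballI) simp_all
 qed
 have germ: "EX a f. R.frac (pull q) a f & s (pull q) = hfrac R (pull q) a f"
  if "s : carrier (R.sec U)" "q : pre U" for s U q using R.sec_stalk[OF that(1) preD(2)[OF that(2)]] unfolding R.stalk_def by blast
 have rh: "sheaf_map U : ring_hom (R.sec U) (R'.sec (pre U))" if U: "openin (proj_top R) U" for U
 proof (rule ring_hom_memI)
  show "sheaf_map U s : carrier (R'.sec (pre U))" if "s : carrier (R.sec U)" for s by (rule closed[OF U that])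
  show "sheaf_map U \<one>\<^bsub>R.sec U\<^esub> = \<one>\<^bsub>R'.sec (pre U)\<^esub>" unfolding sm R'.sec_simps
  proof (rule restrict_ext)
   fix q assume q: "q : pre U"
   show "germ_map q (\<one>\<^bsub>R.sec U\<^esub> (pull q)) = hfrac R' q \<one>\<^bsub>R'\<^esub> \<one>\<^bsub>R'\<^esub>"
    using germ_map_hfrac[OF preD(1)[OF q] R.frac_consts(2)[OF pull_point[OF preD(1)[OF q]]]] preD(2)[OF q] by (simp add: R.sec_simps)
  qed
  fix s t assume S: "s : carrier (R.sec U)" "t : carrier (R.sec U)"
  have both: "germ_map q (stalk_mult R (pull q) (s (pull q)) (t (pull q))) = stalk_mult R' q (germ_map q (s (pull q))) (germ_map q (t (pull q)))"
   "germ_map q (stalk_add R (pull q) (s (pull q)) (t (pull q))) =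
     stalk_add R' q (germ_map q (s (pull q))) (germ_map q (t (pull q)))" if q: "q : pre U" for q
  proof -
   note Q = preD(1)[OF q] note p = pull_point[OF Q]
   obtain a f where a: "R.frac (pull q) a f" "s (pull q) = hfrac R (pull q) a f" using germ[OF S(1) q] by blast
   obtain b g where b: "R.frac (pull q) b g" "t (pull q) = hfrac R (pull q) b g" using germ[OF S(2) q] by blast
   have car: "a : carrier R" "f : carrier R" "b : carrier R" "g : carrier R" using R.fracD[OF a(1)] R.fracD[OF b(1)] by blast+
   note rules = a(2) b(2) germ_map_hfrac[OF Q] a(1) b(1) R.stalk_mult_hfrac[OF p] R.stalk_add_hfrac[OF p]
    R.frac_ops(1,2)[OF p] R'.stalk_mult_hfrac[OF Q] R'.stalk_add_hfrac[OF Q] frac_map[OF a(1)] frac_map[OF b(1)]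
   have m: "phi (a \<otimes>\<^bsub>R\<^esub> b) = phi a \<otimes>\<^bsub>R'\<^esub> phi b" "phi (f \<otimes>\<^bsub>R\<^esub> g) = phi f \<otimes>\<^bsub>R'\<^esub> phi g"
    "phi (a \<otimes>\<^bsub>R\<^esub> g \<oplus>\<^bsub>R\<^esub> b \<otimes>\<^bsub>R\<^esub> f) = phi a \<otimes>\<^bsub>R'\<^esub> phi g \<oplus>\<^bsub>R'\<^esub> phi b \<otimes>\<^bsub>R'\<^esub> phi f"
    using car by simp_all
   show "germ_map q (stalk_mult R (pull q) (s (pull q)) (t (pull q))) =
     stalk_mult R' q (germ_map q (s (pull q))) (germ_map q (t (pull q)))" by (simp only: rules m)
   show "germ_map q (stalk_add R (pull q) (s (pull q)) (t (pull q))) =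
     stalk_add R' q (germ_map q (s (pull q))) (germ_map q (t (pull q)))" by (simp only: rules m)
  qed
  show "sheaf_map U (s \<otimes>\<^bsub>R.sec U\<^esub> t) = sheaf_map U s \<otimes>\<^bsub>R'.sec (pre U)\<^esub> sheaf_map U t"
   unfolding sm R'.sec_simps by (rule restrict_ext) (simp add: R.sec_simps both preD(2))
  show "sheaf_map U (s \<oplus>\<^bsub>R.sec U\<^esub> t) = sheaf_map U s \<oplus>\<^bsub>R'.sec (pre U)\<^esub> sheaf_map U t"
   unfolding sm R'.sec_simps by (rule restrict_ext) (simp add: R.sec_simps both preD(2))
 qed
 have scal: "sheaf_map U (c \<odot>\<^bsub>R.sec U\<^esub> s) = c \<odot>\<^bsub>R'.sec (pre U)\<^esub> sheaf_map U s"
  if U: "openin (proj_top R) U" and s: "s : carrier (R.sec U)" for U c s unfolding sm R'.sec_simps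
 proof (rule restrict_ext)
  fix q assume q: "q : pre U"
  note Q = preD(1)[OF q] note p = pull_point[OF Q]
  obtain a f where a: "R.frac (pull q) a f" "s (pull q) = hfrac R (pull q) a f" using germ[OF s q] by blast
  have "a : carrier R" using R.fracD[OF a(1)] by blast
  thus "germ_map q ((c \<odot>\<^bsub>R.sec U\<^esub> s) (pull q)) = stalk_smult R' q c ((\<lambda>q\<in>pre U. germ_map q (s (pull q))) q)"
   using q preD(2)[OF q] by (simp add: R.sec_simps a germ_map_hfrac[OF Q] R.stalk_smult_hfrac[OF p] R.frac_ops(4)[OF p a(1) a(1)]
     R'.stalk_smult_hfrac[OF Q frac_map[OF a(1)]] map_smult)
 qed
 have res: "sheaf_map W (restrict s W) = restrict (sheaf_map U s) (pre W)" if "W <= U" for W U s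
 proof -
  have "pre W <= pre U" using that by (auto simp: pre_def)
  thus ?thesis unfolding sm using preD(2) by (intro ext) (auto simp: restrict_def)
 qed
 have loc: "EX W. openin (proj_top R) W & pull z : W & W <= U & (EX s:carrier (R.sec W). sheaf_map W s = restrict t (pre W))"
  if U: "openin (proj_top R) U" and t: "t : carrier (R'.sec (pre U))" and z: "z : pre U" for U t z
 proof -
  obtain W' a' f' where W': "openin (proj_top R') W'" "z : W'" "W' <= pre U"
   "!!q. q : W' ==> R'.frac q a' f'" "!!q. q : W' ==> t q = hfrac R' q a' f'" using R'.sec_local[OF t z] by metis
  obtain d where d: "a' : homog R' d" "f' : homog R' d" using W'(4)[OF W'(2)] unfolding R'.frac_def by blast
  obtain a f where a: "a : homog R d" "a' = phi a" "f : homog R d" "f' = phi f" using d homog_image by blast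
  obtain b' where b': "b' : R'.H" "z : R'.basic b'" "R'.basic b' <= W'" using W'(1,2) unfolding R'.openin_proj_top by blast
  obtain b where b: "b : R.H" "b' = phi b" using H_lift[OF b'(1)] by blast
  define W where "W = U Int R.basic b Int R.basic f"
  have W: "openin (proj_top R) W" unfolding W_def using U R.openin_basic[OF b(1)] R.openin_basic[OF R.homog_H[OF a(3)]] by blast
  have fr: "R.frac q a f" if "q : W" for q using that a unfolding W_def R.basic_def R.frac_def by blast
  note Z = preD[OF z]
  have zW: "pull z : W" unfolding W_def using Z(2) pull_basic[OF Z(1) R.H_in[OF b(1)]] b'(2) b(2)
    pull_basic[OF Z(1) R.homog_in[OF a(3)]] W'(4)[OF W'(2)] a(4) Z(1) by (auto simp: R'.basic_def R'.frac_def)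
  have eq: "sheaf_map W (\<lambda>p\<in>W. hfrac R p a f) = restrict t (pre W)" unfolding sm
  proof (rule restrict_ext)
   fix q assume q: "q : pre W"
   note Q = preD[OF q]
   have "q : W'" using Q(2) pull_basic[OF Q(1) R.H_in[OF b(1)]] b'(3) b(2) unfolding W_def by blast
   thus "germ_map q ((\<lambda>p\<in>W. hfrac R p a f) (pull q)) = t q" using germ_map_hfrac[OF Q(1) fr[OF Q(2)]] Q(2) W'(5) a by simp
  qed
  have "(\<lambda>p\<in>W. hfrac R p a f) : carrier (R.sec W)" by (rule R.sec_const[OF W fr])
  thus ?thesis using W zW eq unfolding W_def by blast
 qed
 have pts: "points (Proj R') = Pts R'" "space_top (Proj R) = proj_top R" "space_top (Proj R') = proj_top R'"
  "sections (Proj R) = R.sec" "sections (Proj R') = R'.sec" by (simp_all add: Proj_def fun_eq_iff)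
 have pre: "pre U = {z : points (Proj R'). pull z : U}" for U by (simp add: pts pre_def)
 show ?thesis unfolding closed_immersion_def Let_def pre[symmetric] unfolding pts using embedding_pull closedin_pull
  by (intro conjI exI[of _ sheaf_map] allI impI ballI) (use rh scal res loc in "auto simp: pre_def")
qed

end

section \<open>Chains of prime ideals in a semigroup algebra\<close>

definition hbox :: "nat => 'n::finite hlat set" where
 "hbox b = {s. \<bar>fst s\<bar> <= int b & (ALL i. \<bar>snd s $ i\<bar> <= int b)}"

lemma hbox_add: "s : hbox b ==> t : hbox c ==> s + t : hbox (b + c)"
proof -
 have tri: "\<bar>x + y\<bar> <= int (b + c)" if "\<bar>x\<bar> <= int b" "\<bar>y\<bar> <= int c" for x y :: int using that by linarith
 show "s : hbox b ==> t : hbox c ==> s + t : hbox (b + c)"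
  unfolding hbox_def mem_Collect_eq fst_add snd_add vector_add_component by (intro conjI allI tri) blast+
qed

lemma hbox_mono: "b <= c ==> hbox b <= hbox c"
proof
 fix s assume b: "b <= c" and s: "s : hbox b"
 have le: "\<bar>x\<bar> <= int c" if "\<bar>x\<bar> <= int b" for x :: int using that b by linarith
 show "s : hbox c" using s unfolding hbox_def mem_Collect_eq by (intro conjI allI le) blast+
qed

lemma hbox_0: "0 : hbox b" by (simp add: hbox_def)

lemma in_some_hbox: fixes s :: "'n::finite hlat" shows "EX b. s : hbox b"
proof -
 let ?b = "nat (\<bar>fst s\<bar> + (SUM i:UNIV. \<bar>snd s $ i\<bar>))"
 have "0 <= (SUM i:UNIV. \<bar>snd s $ i\<bar>)" by (rule sum_nonneg) simp
 moreover have "\<bar>snd s $ i\<bar> <= (SUM i:UNIV. \<bar>snd s $ i\<bar>)" for i by (rule member_le_sum) auto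
 moreover have b: "int ?b = \<bar>fst s\<bar> + (SUM i:UNIV. \<bar>snd s $ i\<bar>)"
  using \<open>0 <= (SUM i:UNIV. \<bar>snd s $ i\<bar>)\<close> by simp
 ultimately have "\<bar>fst s\<bar> <= int ?b" "\<bar>snd s $ i\<bar> <= int ?b" for i unfolding b by (simp, simp add: add_increasing)
 thus ?thesis unfolding hbox_def by blast
qed

lemma finite_in_hbox: fixes B :: "'n::finite hlat set" assumes "finite B" shows "EX b. B <= hbox b" using assms
proof (induction B rule: finite_induct)
 case (insert s B)
 then obtain b where b: "B <= hbox b" by blast
 obtain c where c: "s : hbox c" using in_some_hbox by blast
 have "insert s B <= hbox (max b c)" using b c hbox_mono[of b "max b c"] hbox_mono[of c "max b c"] by auto
 thus ?case by blast
qed simp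

lemma card_hbox:
 "finite (hbox b :: 'n::finite hlat set)" "card (hbox b :: 'n hlat set) <= (2 * b + 1) ^ (CARD('n) + 1)"
proof -
 let ?J = "{- int b..int b}"
 let ?T = "?J \<times> ((UNIV :: 'n set) \<rightarrow>\<^sub>E ?J)"
 have sub: "(hbox b :: 'n hlat set) <= (%(x, g). (x, vec_lambda g)) ` ?T"
 proof
  fix s :: "'n hlat" assume s: "s : hbox b"
  have J: "x : ?J" if "\<bar>x\<bar> <= int b" for x using that by auto
  have "fst s : ?J" "!!i. snd s $ i : ?J" using s J unfolding hbox_def by blast+
  hence "(fst s, %i. snd s $ i) : ?T" by auto
  moreover have "s = (%(x, g). (x, vec_lambda g)) (fst s, %i. snd s $ i)" by (simp add: vec_eq_iff prod_eq_iff)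
  ultimately show "s : (%(x, g). (x, vec_lambda g)) ` ?T" by (rule rev_image_eqI)
 qed
 have fin: "finite ?T" by (intro finite_cartesian_product finite_PiE) auto
 thus "finite (hbox b :: 'n hlat set)" using finite_subset[OF sub] by blast
 have "card (hbox b :: 'n hlat set) <= card ((%(x, g). (x, vec_lambda g :: int ^ 'n)) ` ?T)"
  by (rule card_mono[OF finite_imageI[OF fin] sub])
 also have "... <= card ?T" by (rule card_image_le[OF fin])
 also have "... = (2 * b + 1) ^ (CARD('n) + 1)"
 proof -
  have J: "card ?J = 2 * b + 1" by simp
  show ?thesis by (simp only: card_cartesian_product card_PiE[OF finite] J prod_constant power_add power_one_right mult.commute)
 qed
 finally show "card (hbox b :: 'n hlat set) <= (2 * b + 1) ^ (CARD('n) + 1)" .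
qed

lemma keys_mult_hbox: assumes "keys F <= hbox b" "keys G <= hbox c" shows "keys (F * G) <= hbox (b + c)"
proof
 fix s assume "s : keys (F * G)"
 then obtain u v where "s = u + v" "u : keys F" "v : keys G" using keys_mult[of F G] by blast
 thus "s : hbox (b + c)" using assms hbox_add by blast
qed

lemma keys_power_hbox: fixes F :: "('n::finite, 'k::field) lpoly" assumes "keys F <= hbox b" shows "keys (F ^ e) <= hbox (b * e)"
proof (induction e)
 case 0
 thus ?case using hbox_0 by simp
next
 case (Suc e)
 thus ?case using keys_mult_hbox[OF assms Suc] by simp
qed

lemma keys_prod_hbox: fixes q :: "nat => (('n::finite, 'k::field) lpoly)"
 assumes "!!j. j <= i ==> keys (q j) <= hbox b" "!!j. j <= i ==> al j <= N" shows "keys (PROD j<=i. q j ^ al j) <= hbox (b * ((i + 1) * N))"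
 using assms
proof (induction i)
 case 0
 hence "keys (q 0 ^ al 0) <= hbox (b * al 0)" by (intro keys_power_hbox) simp
 thus ?case using hbox_mono[of "b * al 0" "b * N"] 0 by force
next
 case (Suc i)
 have "keys (q (Suc i) ^ al (Suc i)) <= hbox (b * al (Suc i))" using Suc.prems by (intro keys_power_hbox) simp
 moreover have "hbox (b * al (Suc i)) <= hbox (b * N)" using Suc.prems by (intro hbox_mono) simp
 ultimately have "keys ((PROD j<=i. q j ^ al j) * q (Suc i) ^ al (Suc i)) <= hbox (b * ((i + 1) * N) + b * N)"
  using Suc by (intro keys_mult_hbox) auto
 thus ?case by (simp add: algebra_simps)
qed

lemma card_le_card_support: fixes g :: "'e => ('a::comm_monoid_add \<Rightarrow>\<^sub>0 'k::field)" assumes fin: "finite E" "finite B"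
  and ind: "!!c E'. E' <= E ==> E' ~= {} ==> (ALL al:E'. c al ~= 0) ==> (SUM al:E'. single 0 (c al) * g al) ~= 0"
  and sup: "!!al. al : E ==> keys (g al) <= B" shows "card E <= card B"
proof -
 interpret V: vector_space "%(c::'k) (F :: 'a \<Rightarrow>\<^sub>0 'k). single 0 c * F" by unfold_locales
   (simp_all add: distrib_left distrib_right single_add mult_single flip: mult.assoc)
 have inj: "inj_on g E"
 proof (rule inj_onI, rule ccontr)
  fix al be assume ab: "al : E" "be : E" "g al = g be" "al ~= be"
  have "(SUM \<gamma>:{al, be}. single 0 (if \<gamma> = al then 1 else - 1 :: 'k) * g \<gamma>) ~= 0" by (rule ind) (use ab in auto)
  moreover have "single 0 (1 :: 'k) * g be + single 0 (- 1) * g be = 0" by (simp flip: distrib_right single_add)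
  ultimately show False using ab by simp
 qed
 have "V.independent (g ` E)"
 proof
  assume "V.dependent (g ` E)"
  then obtain u where u: "EX v:g ` E. u v ~= 0" "(SUM v:g ` E. single 0 (u v) * v) = 0"
   using V.dependent_finite[OF finite_imageI[OF fin(1)]] by blast
  let ?E = "{al : E. u (g al) ~= 0}"
  have "(SUM al:?E. single 0 (u (g al)) * g al) = (SUM al:E. single 0 (u (g al)) * g al)" by (rule sum.mono_neutral_left) (use fin in auto)
  also have "... = 0" using u(2) by (simp add: sum.reindex[OF inj])
  finally have "(SUM al:?E. single 0 (u (g al)) * g al) = 0" .
  moreover have "?E ~= {}" using u(1) by blast
  ultimately show False using ind[of ?E "%al. u (g al)"] by blast
 qed
 moreover have "g ` E <= V.span ((%s. single s 1) ` B)"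
 proof
  fix F assume "F : g ` E"
  hence FB: "keys F <= B" using sup by blast
  have "(SUM s:keys F. single 0 (lookup F s) * single s 1) : V.span ((%s. single s 1) ` B)"
   by (intro V.span_sum V.span_scale V.span_base) (use FB in blast)
  thus "F : V.span ((%s. single s 1) ` B)" using pm_expand[of F] by (simp add: mult_single)
 qed
 ultimately have "card (g ` E) <= card ((%s. single s (1::'k)) ` B)" using V.independent_span_bound[OF finite_imageI[OF fin(2)]] by blast
 also have "... <= card B" by (rule card_image_le[OF fin(2)])
 finally show ?thesis by (simp add: card_image[OF inj])
qed

text \<open>A chain of primes \<open>J 0 \<supset> \<dots> \<supset> J m\<close>, with elements \<open>q (i + 1)\<close> that lie in \<open>J i\<close> but not in \<open>J (i + 1)\<close>
 and an element \<open>q 0\<close> that is transcendental modulo \<open>J 0\<close>.\<close>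

locale prime_chain =
 fixes A :: "'n::finite hlat set" and J :: "nat => (('n, 'k::field) lpoly) set" and q :: "nat => (('n, 'k) lpoly)" and m :: nat
 assumes A_0: "0 : A" and A_add: "!!s t. s : A ==> t : A ==> s + t : A" and J_sub: "!!i. i <= m ==> J i <= span_on A"
  and J_0: "!!i. i <= m ==> 0 : J i" and J_add: "!!i F G. i <= m ==> F : J i ==> G : J i ==> F + G : J i"
  and J_mult: "!!i F G. i <= m ==> F : span_on A ==> G : J i ==> F * G : J i"
  and J_prime: "!!i F G. i <= m ==> F : span_on A ==> G : span_on A ==> F * G : J i ==> F : J i | G : J i"
  and J_dec: "!!i. i < m ==> J (Suc i) <= J i" and q_in: "!!i. i <= m ==> q i : span_on A" and q_prev: "!!i. i < m ==> q (Suc i) : J i"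
  and q_notin: "!!i. i <= m ==> q i ~: J i" and q_0_free: "!!E c. finite E ==> E ~= {} ==> (ALL e:E. c e ~= 0) ==>
   (SUM e:E. single 0 (c e) * q 0 ^ e) ~: J 0"
begin

abbreviation "qmon al i \<equiv> (PROD j<=i. q j ^ al j)"

lemma supported_power: "F : span_on A ==> F ^ e : span_on A" by (induction e) (simp_all add: span_on_mult A_add, simp add: span_on_def A_0)

lemma qmon_supported: "i <= m ==> qmon al i : span_on A" by (induction i) (simp_all add: span_on_mult A_add supported_power q_in)

lemma J_uminus: "i <= m ==> F : J i ==> - F : J i"
proof -
 assume i: "i <= m" and F: "F : J i"
 have "single 0 (- 1) * F : J i" by (rule J_mult[OF i _ F]) (simp add: span_on_def A_0)
 moreover have "single 0 (- 1) = (- 1 :: ('n, 'k) lpoly)" by (simp add: single_uminus)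
 ultimately show ?thesis by simp
qed

lemma power_notin: "i <= m ==> 1 ~: J i & q i ^ e ~: J i"
proof (induction e)
 case 0
 have "1 ~: J i" using J_mult[OF 0 q_in[OF 0], of 1] q_notin[OF 0] by auto
 thus ?case by simp
next
 case (Suc e)
 thus ?case using J_prime[OF Suc.prems q_in[OF Suc.prems] supported_power[OF q_in[OF Suc.prems]], of e] q_notin by auto
qed

text \<open>Look at the lowest power \<open>e\<close> of \<open>q i\<close> in a combination lying in \<open>J i\<close>: cancelling \<open>q i ^ e\<close>,
  which is not in \<open>J i\<close>, and reducing modulo \<open>q i \<in> J (i - 1)\<close> leaves a combination of
  monomials in the previous \<open>q j\<close> that lies in \<open>J (i - 1)\<close>.\<close>

lemma combination_notin: assumes "i <= m" "finite E" "E ~= {}" "ALL al:E. c al ~= 0"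
  "!!al be. al : E ==> be : E ==> (ALL j<=i. al j = be j) ==> al = be" shows "(SUM al:E. single 0 (c al) * qmon al i) ~: J i" using assms
proof (induction i arbitrary: E)
 case 0
 have inj: "inj_on (%al. al 0) E" using 0(5) by (intro inj_onI) auto
 let ?inv = "inv_into E (%al. al 0)"
 have "(SUM al:E. single 0 (c al) * qmon al 0) = (SUM e:(%al. al 0) ` E. single 0 (c (?inv e)) * q 0 ^ e)"
  unfolding sum.reindex[OF inj] o_def by (rule sum.cong) (simp_all add: inv_into_f_f[OF inj])
 moreover have "... ~: J 0" by (rule q_0_free) (use 0 inv_into_f_f[OF inj] in auto)
 ultimately show ?case by simp
next
 case (Suc i)
 let ?x = "q (Suc i)" and ?t = "%al. single 0 (c al) * qmon al i"
 have i: "i <= m" "i < m" using Suc.prems(1) by auto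
 have t: "?t al : span_on A" for al by (intro span_on_smult qmon_supported i)
 define e where "e = Min ((%al. al (Suc i)) ` E)"
 have e_le: "e <= al (Suc i)" if "al : E" for al unfolding e_def using that Suc.prems(2) by simp
 have "e : (%al. al (Suc i)) ` E" unfolding e_def using Suc.prems(2,3) by (intro Min_in) auto
 then obtain al0 where a0: "al0 : E" "al0 (Suc i) = e" by blast
 define E0 where "E0 = {al : E. al (Suc i) = e}"
 define R where "R = (SUM al:E - E0. ?t al * ?x ^ (al (Suc i) - e - 1))"
 have R: "R : span_on A" unfolding R_def by (intro span_on_sum span_on_mult A_add t supported_power q_in Suc.prems(1))
 have split: "(SUM al:E. single 0 (c al) * qmon al (Suc i)) = ?x ^ e * (sum ?t E0 + ?x * R)"
 proof -
  have "(SUM al:E. ?t al * ?x ^ al (Suc i)) = (SUM al:E - E0. ?t al * ?x ^ al (Suc i)) + (SUM al:E0. ?t al * ?x ^ al (Suc i))"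
   by (rule sum.subset_diff) (auto simp: E0_def Suc.prems(2))
  also have "(SUM al:E0. ?t al * ?x ^ al (Suc i)) = ?x ^ e * sum ?t E0"
   unfolding sum_distrib_left by (rule sum.cong) (auto simp: E0_def mult.commute)
  also have "(SUM al:E - E0. ?t al * ?x ^ al (Suc i)) = ?x ^ e * (?x * R)" unfolding R_def sum_distrib_left
  proof (rule sum.cong[OF refl])
   fix al assume a: "al : E - E0"
   hence "e < al (Suc i)" using e_le[of al] by (auto simp: E0_def le_less)
   hence "al (Suc i) = e + Suc (al (Suc i) - e - 1)" by simp
   hence "?x ^ al (Suc i) = ?x ^ e * (?x * ?x ^ (al (Suc i) - e - 1))" by (metis power_Suc power_add)
   thus "?t al * ?x ^ al (Suc i) = ?x ^ e * (?x * (?t al * ?x ^ (al (Suc i) - e - 1)))" by (simp add: algebra_simps)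
  qed
  finally show ?thesis by (simp add: algebra_simps)
 qed
 have E0: "sum ?t E0 : span_on A" by (intro span_on_sum t)
 have "sum ?t E0 ~: J i"
 proof (rule Suc.IH[OF i(1)])
  show "finite E0" "E0 ~= {}" "ALL al:E0. c al ~= 0" using Suc.prems(2,4) a0 by (auto simp: E0_def)
  fix al be assume ab: "al : E0" "be : E0" "ALL j<=i. al j = be j"
  hence "ALL j<=Suc i. al j = be j" by (auto simp: E0_def le_Suc_eq)
  thus "al = be" using Suc.prems(5) ab by (auto simp: E0_def)
 qed
 moreover have "sum ?t E0 : J i" if "sum ?t E0 + ?x * R : J (Suc i)"
 proof -
  have "sum ?t E0 + ?x * R : J i" using that J_dec[OF i(2)] by blast
  moreover have "- (R * ?x) : J i" by (rule J_uminus[OF i(1) J_mult[OF i(1) R q_prev[OF i(2)]]])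
  ultimately have "(sum ?t E0 + ?x * R) + - (R * ?x) : J i" by (rule J_add[OF i(1)])
  moreover have "(sum ?t E0 + ?x * R) + - (R * ?x) = sum ?t E0" by (simp add: mult.commute)
  ultimately show ?thesis by simp
 qed
 ultimately have "sum ?t E0 + ?x * R ~: J (Suc i)" by blast
 moreover have "?x ^ e ~: J (Suc i)" using power_notin[OF Suc.prems(1)] by blast
 moreover have "?x ^ e : span_on A" "sum ?t E0 + ?x * R : span_on A"
  by (intro span_on_add span_on_mult A_add supported_power q_in Suc.prems(1) E0 R; assumption?)+
 ultimately show ?case unfolding split using J_prime[OF Suc.prems(1)] by blast
qed

text \<open>There are \<open>(N + 1)\<^sup>m\<^sup>+\<^sup>1\<close> monomials in the \<open>q i\<close> with exponents up to \<open>N\<close>. They are independent and supported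
  on a box with \<open>O(N\<^sup>n\<^sup>+\<^sup>1)\<close> lattice points.\<close>

lemma length_le: "m <= CARD('n)"
proof (rule ccontr)
 let ?n = "CARD('n)"
 assume "~ m <= ?n"
 hence mn: "?n + 2 <= m + 1" by simp
 have "finite (UN j<=m. keys (q j))" by simp
 then obtain b where b: "(UN j<=m. keys (q j)) <= hbox b" using finite_in_hbox by blast
 \<comment> \<open>\<open>K (N + 1)\<close> bounds the side of the box; \<open>N\<close> is large enough for \<open>(N + 1)\<^sup>n\<^sup>+\<^sup>2\<close> to exceed its volume.\<close>
 define K where "K = 2 * (b * (m + 1)) + 1"
 define N where "N = K ^ (?n + 1)"
 define E where "E = {..m} \<rightarrow>\<^sub>E {..N}"
 have fE: "finite E" unfolding E_def by (intro finite_PiE) auto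
 let ?B = "hbox (b * ((m + 1) * N)) :: 'n hlat set"
 have "card E <= card ?B"
 proof (rule card_le_card_support[OF fE card_hbox(1), where g = "%al. qmon al m"])
  fix c E' assume E': "E' <= E" "E' ~= {}" "ALL al:E'. c al ~= (0 :: 'k)"
  have "(SUM al:E'. single 0 (c al) * qmon al m) ~: J m"
  proof (rule combination_notin[OF order_refl finite_subset[OF E'(1) fE] E'(2,3)])
   fix al be assume "al : E'" "be : E'" "ALL j<=m. al j = be j"
   thus "al = be" using E'(1) unfolding E_def by (intro PiE_ext[of al "{..m}" "%_. {..N}" be]) auto
  qed
  thus "(SUM al:E'. single 0 (c al) * qmon al m) ~= 0" using J_0[of m] by auto
 next
  fix al assume "al : E"
  thus "keys (qmon al m) <= ?B" using b by (intro keys_prod_hbox) (auto simp: E_def)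
 qed
 also have "... <= (2 * (b * ((m + 1) * N)) + 1) ^ (?n + 1)" by (rule card_hbox(2))
 also have "... <= (K * (N + 1)) ^ (?n + 1)" by (rule power_mono) (simp_all add: K_def algebra_simps)
 also have "... = N * (N + 1) ^ (?n + 1)" unfolding power_mult_distrib N_def[symmetric] ..
 finally have "(N + 1) ^ (m + 1) <= N * (N + 1) ^ (?n + 1)" by (simp add: E_def card_PiE)
 moreover have "(N + 1) ^ (?n + 2) <= (N + 1) ^ (m + 1)" by (rule power_increasing[OF mn]) simp
 moreover have "(N + 1) ^ (?n + 2) = (N + 1) * (N + 1) ^ (?n + 1)" by simp
 ultimately have "(N + 1) * (N + 1) ^ (?n + 1) <= N * (N + 1) ^ (?n + 1)" by linarith
 moreover have "N * (N + 1) ^ (?n + 1) < (N + 1) * (N + 1) ^ (?n + 1)" by (rule mult_strict_right_mono) simp_all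
 ultimately show False by linarith
qed

end

section \<open>Dimension of spaces of homogeneous primes\<close>

lemma homog_decomp: fixes F :: "('n::finite, 'k::field) lpoly"
 assumes "!!s. s : keys F ==> 0 <= fst s" shows "F = (SUM d:(%s. nat (fst s)) ` keys F. restr {s. fst s = int d} F)"
proof (rule poly_mapping_eqI)
 fix s
 let ?D = "(%s. nat (fst s)) ` keys F"
 have "lookup (SUM d:?D. restr {s. fst s = int d} F) s = (SUM d:?D. if fst s = int d then lookup F s else 0)"
  by (simp add: lookup_sum)
 also have "... = lookup F s"
 proof (cases "s : keys F")
  case True
  hence eq: "fst s = int d \<longleftrightarrow> d = nat (fst s)" for d using assms[of s] by auto
  have "(SUM d:?D. if fst s = int d then lookup F s else 0) = (SUM d:?D. if d = nat (fst s) then lookup F s else 0)" by (simp only: eq)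
  thus ?thesis using True by simp
 next
  case False
  hence z: "lookup F s = 0" by (simp add: in_keys_iff)
  show ?thesis unfolding z if_cancel by simp
 qed
 finally show "lookup F s = lookup (SUM d:?D. restr {s. fst s = int d} F) s" ..
qed

definition homogeneous :: "'n::finite hlat set => nat => (('n, 'k::field) lpoly) set" where
 "homogeneous A d = {F : span_on A. ALL s:keys F. fst s = int d}"

lemma homogeneous_mult: fixes F G :: "('n::finite, 'k::field) lpoly"
 assumes "!!s t. s : A ==> t : A ==> s + t : A" "F : homogeneous A d" "G : homogeneous A e" shows "F * G : homogeneous A (d + e)"
proof -
 have "fst s = int (d + e)" if s: "s : keys (F * G)" for s
 proof -
  obtain u v where "s = u + v" "u : keys F" "v : keys G" using keys_mult[of F G] s by blast
  thus ?thesis using assms(2,3) unfolding homogeneous_def by simp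
 qed
 moreover have "F * G : span_on A" using assms unfolding homogeneous_def by (intro span_on_mult) auto
 ultimately show ?thesis unfolding homogeneous_def by blast
qed

lemma homogeneous_power: fixes F :: "('n::finite, 'k::field) lpoly"
 assumes "0 : A" "!!s t. s : A ==> t : A ==> s + t : A" "F : homogeneous A d" shows "F ^ e : homogeneous A (d * e)"
proof (induction e)
 case 0
 show ?case using assms(1) by (simp add: homogeneous_def span_on_def)
next
 case (Suc e)
 thus ?case using homogeneous_mult[OF assms(2,3) Suc] by simp
qed

text \<open>A space whose points define homogeneous primes of \<open>k[A]\<close> and whose topology is the Zariski topology
  of these primes. The points need not be all primes: this covers \<open>Proj k[A]\<close> as well as the closed
  points of the toric variety, where \<open>P x\<close> consists of the functions vanishing on the line \<open>x\<close>.\<close>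

locale homog_spectrum =
 fixes X :: "'p topology" and A :: "'n::finite hlat set" and P :: "'p => (('n, 'k::field) lpoly) set"
 assumes A_0: "0 : A" and A_add: "!!s t. s : A ==> t : A ==> s + t : A" and A_fst: "!!s. s : A ==> 0 <= fst s"
  and P_sub: "!!x. x : topspace X ==> P x <= span_on A" and P_0: "!!x. x : topspace X ==> 0 : P x"
  and P_add: "!!x F G. x : topspace X ==> F : P x ==> G : P x ==> F + G : P x"
  and P_mult: "!!x F G. x : topspace X ==> F : span_on A ==> G : P x ==> F * G : P x"
  and P_prime: "!!x F G. x : topspace X ==> F : span_on A ==> G : span_on A ==> F * G : P x ==> F : P x | G : P x"
  and P_homog: "!!x F d. x : topspace X ==> F : P x ==> restr {s. fst s = int d} F : P x"
  and P_relevant: "!!x. x : topspace X ==> EX d>0. EX F:homogeneous A d. F ~: P x"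
  and openin_iff: "!!U. openin X U \<longleftrightarrow> U <= topspace X &
   (ALL x:U. EX d. EX F:homogeneous A d. F ~: P x & {y : topspace X. F ~: P y} <= U)"
begin

definition vanishing :: "'p set => (('n, 'k) lpoly) set" where
 "vanishing B = {F : span_on A. ALL x:B. F : P x}"

lemma P_sum: "x : topspace X ==> (!!i. i : E ==> g i : P x) ==> sum g E : P x"
 by (induction E rule: infinite_finite_induct) (simp_all add: P_0 P_add)

lemma closedin_zeros: assumes F: "F : span_on A" shows "closedin X {x : topspace X. F : P x}"
proof -
 have "openin X {x : topspace X. F ~: P x}" unfolding openin_iff
 proof (intro conjI ballI)
  fix x assume "x : {x : topspace X. F ~: P x}"
  hence x: "x : topspace X" "F ~: P x" by auto
  have nn: "0 <= fst s" if "s : keys F" for s using A_fst span_onD[OF F that] .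
  have "EX d. restr {s. fst s = int d} F ~: P x"
  proof (rule ccontr)
   assume "\<nexists>d. restr {s. fst s = int d} F ~: P x"
   hence "(SUM d:(%s. nat (fst s)) ` keys F. restr {s. fst s = int d} F) : P x" by (intro P_sum[OF x(1)]) blast
   thus False using homog_decomp[of F, OF nn] x(2) by simp
  qed
  then obtain d where d: "restr {s. fst s = int d} F ~: P x" by blast
  have "restr {s. fst s = int d} F : homogeneous A d" using F by (auto simp: homogeneous_def span_on_def keys_restr)
  moreover have "{y : topspace X. restr {s. fst s = int d} F ~: P y} <= {x : topspace X. F ~: P x}" using P_homog by blast
  ultimately show "EX d. EX G:homogeneous A d. G ~: P x & {y : topspace X. G ~: P y} <= {x : topspace X. F ~: P x}" using d by blast
 qed blast
 moreover have "topspace X - {x : topspace X. F : P x} = {x : topspace X. F ~: P x}" by blast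
 ultimately show ?thesis by (simp add: closedin_def)
qed

lemma vanishing_prime:
 assumes Z: "irreducible_in X Z" and F: "F : span_on A" "G : span_on A" "F * G : vanishing Z" shows "F : vanishing Z | G : vanishing Z"
proof -
 have sub: "Z <= topspace X" using Z by (simp add: irreducible_in_def)
 have "Z <= {x : topspace X. F : P x} Un {x : topspace X. G : P x}" using F sub P_prime unfolding vanishing_def by blast
 hence "Z <= {x : topspace X. F : P x} | Z <= {x : topspace X. G : P x}" using Z closedin_zeros F unfolding irreducible_in_def by blast
 thus ?thesis using F unfolding vanishing_def by blast
qed

lemma closed_separated: assumes "closedin X Z" "x : topspace X" "x ~: Z" shows "EX d. EX F:homogeneous A d. F ~: P x & F : vanishing Z"
proof -
 have "openin X (topspace X - Z)" "x : topspace X - Z" using assms by (auto simp: closedin_def)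
 then obtain d F where F: "F : homogeneous A d" "F ~: P x" "{y : topspace X. F ~: P y} <= topspace X - Z" unfolding openin_iff by blast
 have "F : P y" if "y : Z" for y using F(3) that closedin_subset[OF assms(1)] by blast
 hence "F : vanishing Z" using F(1) unfolding vanishing_def homogeneous_def by blast
 thus ?thesis using F by blast
qed

text \<open>The ideals of a chain of irreducible closed sets form a chain of primes. A homogeneous element of
  positive degree not vanishing at a point of the smallest set serves as \<open>q 0\<close>: its powers lie in
  different degrees.\<close>

lemma chain_length_le: assumes Z: "!!i. i <= m ==> closedin X (Z i) & irreducible_in X (Z i)" and inc: "!!i. i < m ==> Z i \<subset> Z (Suc i)"
 shows "m <= CARD('n)"
proof -
 have sub: "Z i <= topspace X" if "i <= m" for i using Z[OF that] by (simp add: irreducible_in_def)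
 obtain x where x: "x : Z 0" using Z[of 0] by (auto simp: irreducible_in_def)
 have xX: "x : topspace X" using x sub[of 0] by blast
 obtain d t where t: "d > 0" "t : homogeneous A d" "t ~: P x" using P_relevant[OF xX] by blast
 have tA: "t : span_on A" using t(2) by (simp add: homogeneous_def)
 have "EX F. F : vanishing (Z i) & F ~: vanishing (Z (Suc i))" if i: "i < m" for i
 proof -
  obtain y where y: "y : Z (Suc i)" "y ~: Z i" using inc[OF i] by blast
  have "y : topspace X" using y(1) sub[of "Suc i"] i by auto
  then obtain F where "F ~: P y" "F : vanishing (Z i)" using closed_separated[of "Z i" y] Z[of i] i y(2) by auto
  thus ?thesis using y(1) unfolding vanishing_def by blast
 qed
 then obtain g where g: "!!i. i < m ==> g i : vanishing (Z i) & g i ~: vanishing (Z (Suc i))" by metis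
 define q where "q i = (case i of 0 => t | Suc j => g j)" for i
 have free: "(SUM e:E. single 0 (c e) * t ^ e) ~: vanishing (Z 0)"
  if E: "finite E" "E ~= {}" "ALL e:E. c e ~= 0" for E :: "nat set" and c :: "nat => 'k"
 proof
  assume "(SUM e:E. single 0 (c e) * t ^ e) : vanishing (Z 0)"
  hence inP: "(SUM e:E. single 0 (c e) * t ^ e) : P x" using x unfolding vanishing_def by blast
  obtain e where e: "e : E" using E(2) by blast
  have tp: "t ^ e' : homogeneous A (d * e')" for e' by (rule homogeneous_power[OF A_0 A_add t(2)])
  have "restr {s. fst s = int (d * e)} (t ^ e') = (if e' = e then t ^ e else 0)" for e'
  proof (cases "e' = e")
   case True
   have "t ^ e : span_on {s. fst s = int (d * e)}" using tp[of e] unfolding homogeneous_def span_on_def by blast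
   thus ?thesis using True restr_id by simp
  next
   case False
   hence "keys (restr {s. fst s = int (d * e)} (t ^ e')) = {}" using tp[of e'] t(1) by (auto simp: homogeneous_def keys_restr)
   thus ?thesis using False by simp
  qed
  hence "restr {s. fst s = int (d * e)} (SUM e:E. single 0 (c e) * t ^ e) = (SUM e':E. if e' = e then single 0 (c e) * t ^ e else 0)"
   unfolding restr_sum restr_smult by (intro sum.cong) auto
  also have "... = single 0 (c e) * t ^ e" using E(1) e by simp
  finally have eq: "restr {s. fst s = int (d * e)} (SUM e:E. single 0 (c e) * t ^ e) = single 0 (c e) * t ^ e" .
  have "single 0 (c e) * t ^ e : P x" using P_homog[OF xX inP, of "d * e"] unfolding eq .
  hence "single 0 (inverse (c e)) * (single 0 (c e) * t ^ e) : P x" by (rule P_mult[OF xX, rotated]) (simp add: span_on_def A_0)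
  hence te: "t ^ e : P x" using E(3) e by (simp add: mult_single flip: mult.assoc)
  have "t : P x" if "t ^ i : P x" for i using that
  proof (induction i)
   case 0
   thus ?case using P_mult[OF xX tA, of 1] by simp
  next
   case (Suc i)
   have "t ^ i : span_on A" using homogeneous_power[OF A_0 A_add t(2), of i] by (simp add: homogeneous_def)
   thus ?case using Suc P_prime[OF xX tA, of "t ^ i"] by auto
  qed
  thus False using te t(3) by blast
 qed
 have "prime_chain A (%i. vanishing (Z i)) q m"
 proof
  show "0 : A" "!!s t. s : A ==> t : A ==> s + t : A" by (rule A_0, rule A_add)
  fix i assume i: "i <= m"
  show "vanishing (Z i) <= span_on A" unfolding vanishing_def by blast
  show "0 : vanishing (Z i)" unfolding vanishing_def using P_0 sub[OF i] span_on_0 by blast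
  show "q i : span_on A" using tA g i by (auto simp: q_def vanishing_def split: nat.split)
  show "q i ~: vanishing (Z i)" using t(3) x g i by (auto simp: q_def vanishing_def split: nat.split)
  fix F G
  show "F + G : vanishing (Z i)" if "F : vanishing (Z i)" "G : vanishing (Z i)"
   using that P_add sub[OF i] span_on_add unfolding vanishing_def by blast
  show "F * G : vanishing (Z i)" if F: "F : span_on A" and G: "G : vanishing (Z i)"
  proof -
   have "F * G : span_on A" using G unfolding vanishing_def by (intro span_on_mult A_add F) blast+
   thus ?thesis using P_mult F G sub[OF i] unfolding vanishing_def by blast
  qed
  show "F : vanishing (Z i) | G : vanishing (Z i)"
   if "F : span_on A" "G : span_on A" "F * G : vanishing (Z i)" using vanishing_prime that Z[OF i] by blast
 next
  fix i assume i: "i < m"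
  show "vanishing (Z (Suc i)) <= vanishing (Z i)" using inc[OF i] unfolding vanishing_def by blast
  show "q (Suc i) : vanishing (Z i)" using g[OF i] by (simp add: q_def)
 next
  fix E :: "nat set" and c :: "nat => 'k" assume "finite E" "E ~= {}" "ALL e:E. c e ~= 0"
  thus "(SUM e:E. single 0 (c e) * q 0 ^ e) ~: vanishing (Z 0)" using free by (simp add: q_def)
 qed
 thus ?thesis by (rule prime_chain.length_le)
qed

lemma krull_dim_le: "krull_dim X <= enat CARD('n)" unfolding krull_dim_def
proof (rule Sup_least)
 fix d assume "d : {enat m | m. EX Z. (ALL i<=m. closedin X (Z i) & irreducible_in X (Z i)) & (ALL i<m. Z i \<subset> Z (Suc i))}"
 then obtain m Z where "d = enat m" "!!i. i <= m ==> closedin X (Z i) & irreducible_in X (Z i)"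
  "!!i. i < m ==> Z i \<subset> Z (Suc i)" by blast
 thus "d <= enat CARD('n)" using chain_length_le[of m Z] by simp
qed

definition closure :: "'p set => 'p set" where
 "closure B = {x : topspace X. vanishing B <= P x}"

lemma closedin_closure: "closedin X (closure B)"
proof -
 have "closure B = topspace X Int (INT F:vanishing B. {x : topspace X. F : P x})" unfolding closure_def by blast
 also have "closedin X ..."
 proof (cases "vanishing B = {}")
  case False
  hence "closedin X (INT F:vanishing B. {x : topspace X. F : P x})" by (intro closedin_INT closedin_zeros) (auto simp: vanishing_def)
  thus ?thesis by (intro closedin_Int closedin_topspace)
 qed simp
 finally show ?thesis .
qed

lemma subset_closure: "B <= topspace X ==> B <= closure B" unfolding closure_def vanishing_def by blast

lemma irreducible_closure: assumes B: "B <= topspace X" "B ~= {}" and prime: "!!F G. F : span_on A ==> G : span_on A ==> F * G : vanishing B ==>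
   F : vanishing B | G : vanishing B"
 shows "irreducible_in X (closure B)" unfolding irreducible_in_def
proof (intro conjI allI impI)
 show "closure B <= topspace X" by (auto simp: closure_def)
 show "closure B ~= {}" using subset_closure[OF B(1)] B(2) by blast
 fix Y Z assume YZ: "closedin X Y & closedin X Z & closure B <= Y Un Z"
 show "closure B <= Y | closure B <= Z"
 proof (rule ccontr)
  assume "~ (closure B <= Y | closure B <= Z)"
  then obtain y z where yz: "y : closure B" "y ~: Y" "z : closure B" "z ~: Z" by blast
  have top: "y : topspace X" "z : topspace X" using yz unfolding closure_def by blast+
  obtain F where F: "F ~: P y" "F : vanishing Y" using closed_separated[OF _ top(1) yz(2)] YZ by blast
  obtain G where G: "G ~: P z" "G : vanishing Z" using closed_separated[OF _ top(2) yz(4)] YZ by blast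
  have FG: "F : span_on A" "G : span_on A" using F(2) G(2) unfolding vanishing_def by blast+
  have "F ~: vanishing B" "G ~: vanishing B" using yz F(1) G(1) unfolding closure_def by blast+
  hence "F * G ~: vanishing B" using prime FG by blast
  moreover have "F * G : P x" if x: "x : B" for x
  proof -
   have xX: "x : topspace X" using x B(1) by blast
   have "x : Y | x : Z" using x subset_closure[OF B(1)] YZ by blast
   thus ?thesis
   proof
    assume "x : Y"
    hence "F : P x" using F(2) unfolding vanishing_def by blast
    hence "G * F : P x" by (rule P_mult[OF xX FG(2)])
    thus ?thesis by (simp add: mult.commute)
   next
    assume "x : Z"
    thus ?thesis using P_mult[OF xX FG(1)] G(2) unfolding vanishing_def by blast
   qed
  qed
  moreover have "F * G : span_on A" by (rule span_on_mult[OF FG A_add])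
  ultimately show False unfolding vanishing_def by blast
 qed
qed

text \<open>Sets whose vanishing ideals are prime have irreducible closures. There may be no generic points.\<close>

lemma krull_dim_ge: assumes B: "!!i. i <= m ==> B i <= topspace X & B i ~= {}"
  and prime: "!!i F G. i <= m ==> F : span_on A ==> G : span_on A ==> F * G : vanishing (B i) ==> F : vanishing (B i) | G : vanishing (B i)"
  and dec: "!!i. i < m ==> vanishing (B (Suc i)) \<subset> vanishing (B i)" shows "enat m <= krull_dim X" unfolding krull_dim_def
proof (rule Sup_upper, rule CollectI, intro exI conjI allI impI)
 show "enat m = enat m" ..
 show "closedin X (closure (B i))" for i by (rule closedin_closure)
 show "irreducible_in X (closure (B i))" if "i <= m" for i by (rule irreducible_closure) (use B[OF that] prime[OF that] in auto)
 fix i assume i: "i < m"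
 have "closure (B i) <= closure (B (Suc i))" using dec[OF i] unfolding closure_def by blast
 moreover obtain F where F: "F : vanishing (B i)" "F ~: vanishing (B (Suc i))" using dec[OF i] by blast
 then obtain x where "x : B (Suc i)" "F ~: P x" unfolding vanishing_def by blast
 hence "x : closure (B (Suc i))" "x ~: closure (B i)" using subset_closure B[of "Suc i"] i F(1) unfolding closure_def by auto
 ultimately show "closure (B i) \<subset> closure (B (Suc i))" by blast
qed

end

subsection \<open>Monomial primes\<close>

lemma restr_mult_face: fixes F G :: "('n::finite, 'k::field) lpoly" assumes F: "F : span_on A" and G: "G : span_on A"
  and face: "!!s t. s : A ==> t : A ==> s + t : N \<longleftrightarrow> s : N & t : N" shows "restr N (F * G) = restr N F * restr N G"
proof -
 let ?m = "%F s. single s (lookup F s)"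
 have "F * G = (SUM s:keys F. SUM t:keys G. ?m F s * ?m G t)" by (subst pm_expand[of F], subst pm_expand[of G], rule sum_product)
 hence "restr N (F * G) = (SUM s:keys F. SUM t:keys G. restr N (?m F s * ?m G t))"
  by (simp add: restr_sum)
 also have "... = (SUM s:keys F. SUM t:keys G. (if s : N then ?m F s else 0) * (if t : N then ?m G t else 0))"
 proof (intro sum.cong refl)
  fix s t assume "s : keys F" "t : keys G"
  thus "restr N (?m F s * ?m G t) = (if s : N then ?m F s else 0) * (if t : N then ?m G t else 0)"
   using face[OF span_onD[OF F] span_onD[OF G]] by (simp add: mult_single restr_single)
 qed
 also have "... = restr N F * restr N G" by (simp add: restr_def sum_product)
 finally show ?thesis .
qed

definition monomial_prime :: "'n::finite hlat set => 'n hlat set => (('n, 'k::field) lpoly) set" where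
 "monomial_prime A N = {F : span_on A. restr N F = 0}"

text \<open>Restriction to the exponents in a face is multiplicative, with values in the domain of Laurent
  polynomials.\<close>

lemma monomial_prime_prime: assumes face: "!!s t. s : A ==> t : A ==> s + t : N \<longleftrightarrow> s : N & t : N"
  and FG: "F : span_on A" "G : span_on A" "F * G : monomial_prime A N" shows "F : monomial_prime A N | G : monomial_prime A N"
 using FG restr_mult_face[OF FG(1,2) face] laurent_mult_nonzero[of "restr N F" "restr N G"] unfolding monomial_prime_def by auto

lemma monomial_prime_strict: assumes "N <= N'" "s : N'" "s ~: N" "s : A"
 shows "monomial_prime A N' \<subset> (monomial_prime A N :: (('n::finite, 'k::field) lpoly) set)"
proof
 have eq: "restr N F = 0" if "restr N' F = 0" for F :: "('n, 'k) lpoly"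
 proof -
  have "keys F Int N' = {}" using that keys_restr[of N' F] by simp
  hence "keys (restr N F) = {}" using assms(1) keys_restr[of N F] by blast
  thus ?thesis by simp
 qed
 thus "monomial_prime A N' <= (monomial_prime A N :: (('n, 'k) lpoly) set)" unfolding monomial_prime_def by blast
 have "single s (1 :: 'k) : monomial_prime A N - monomial_prime A N'"
  using assms by (simp add: monomial_prime_def restr_single span_on_single)
   (metis lookup_single_eq lookup_zero zero_neq_one)
 thus "monomial_prime A N' ~= (monomial_prime A N :: (('n, 'k) lpoly) set)" by blast
qed

section \<open>The special fibre\<close>

abbreviation pdeg :: "nat => (('n::finite, 'k::field) lpoly) => (('n, 'k) lpoly)" where
 "pdeg d \<equiv> restr {s. fst s = int d}"

lemma homogeneous_supported: "F : homogeneous U d ==> F : span_on U" by (simp add: homogeneous_def)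

text \<open>Rings with a basis of monomials are graded by the first coordinate. The basis is given by a linear
  bijection \<open>h\<close> with inverse \<open>k\<close>, which leaves the multiplication arbitrary.\<close>

lemma graded_cring_monomial: fixes R :: "('k::field, 'b) graded_algebra" and h :: "(('n::finite, 'k) lpoly) => 'b"
 assumes cr: "cring R" and h: "!!x. x : span_on U ==> h x : carrier R & k (h x) = x" and surj: "!!y. y : carrier R ==> EX x:span_on U. y = h x"
  and add: "!!x y. x : span_on U ==> y : span_on U ==> h (x + y) = h x \<oplus>\<^bsub>R\<^esub> h y"
  and zero: "h 0 = \<zero>\<^bsub>R\<^esub>" and one: "h 1 = \<one>\<^bsub>R\<^esub>" and U0: "0 : U" and nn: "!!s. s : U ==> 0 <= fst s"
  and smult: "!!c x. x : span_on U ==> h (single 0 c * x) = c \<odot>\<^bsub>R\<^esub> h x" and homog: "!!d. homog R d = h ` homogeneous U d"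
  and mult_homog: "!!x y d e. x : homogeneous U d ==> y : homogeneous U e ==> h x \<otimes>\<^bsub>R\<^esub> h y : h ` homogeneous U (d + e)"
  and smult_mult: "!!c x y. x : span_on U ==> y : span_on U ==>
   h (single 0 c * x) \<otimes>\<^bsub>R\<^esub> h y = c \<odot>\<^bsub>R\<^esub> (h x \<otimes>\<^bsub>R\<^esub> h y)"
 shows "graded_cring R (%d y. h (pdeg d (k y)))"
proof -
 interpret cring R by (rule cr)
 have hc: "h x : carrier R" and kh: "k (h x) = x" if "x : span_on U" for x using h[OF that] by auto
 have fs: "finsum R (%j. h (g j)) J = h (sum g J)" if "finite J" "!!j. j : J ==> g j : span_on U"
  for J :: "nat set" and g :: "nat => ('n, 'k) lpoly" using that
 proof (induction J rule: finite_induct)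
  case (insert j J)
  hence "finsum R (%j. h (g j)) (insert j J) = h (g j) \<oplus>\<^bsub>R\<^esub> finsum R (%j. h (g j)) J"
   by (intro finsum_insert) (auto simp: hc)
  thus ?case using insert by (simp add: add span_on_sum)
 qed (simp add: zero)
 have hm: "x : homogeneous U d \<longleftrightarrow> x : span_on U & x : span_on {s. fst s = int d}" for x :: "('n, 'k) lpoly" and d
  unfolding homogeneous_def span_on_def by blast
 have pdU: "pdeg d x : span_on U" if "x : span_on U" for d x using that unfolding span_on_def mem_Collect_eq keys_restr by blast
 have h0: "h x = \<zero>\<^bsub>R\<^esub> \<longleftrightarrow> x = 0" if "x : span_on U" for x
  using kh[OF that] kh[OF span_on_0] zero by metis
 have sub: "{d. pdeg d x ~= 0} <= (%s. nat (fst s)) ` keys x" for x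
 proof
  fix d assume "d : {d. pdeg d x ~= 0}"
  hence "keys x Int {s. fst s = int d} ~= {}" using keys_restr[of "{s. fst s = int d}" x] by auto
  then obtain s where "s : keys x" "fst s = int d" by blast
  thus "d : (%s. nat (fst s)) ` keys x" by (intro image_eqI[of _ _ s]) auto
 qed
 have fin: "finite {d. pdeg d x ~= 0}" for x by (rule finite_subset[OF sub]) simp
 show ?thesis
 proof (intro graded_cring.intro graded_cring_axioms.intro cr)
  fix d
  show "homog R d <= carrier R" unfolding homog using hc homogeneous_supported by blast
  show "\<zero>\<^bsub>R\<^esub> : homog R d" unfolding homog zero[symmetric] by (rule imageI) (simp add: hm span_on_0)
  fix x y assume "x : homog R d"
  then obtain a where a: "a : homogeneous U d" "x = h a" unfolding homog by blast
  have as: "a : span_on U" "a : span_on {s. fst s = int d}" using a(1) unfolding hm by blast+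
  show "x \<oplus>\<^bsub>R\<^esub> y : homog R d" if y: "y : homog R d"
  proof -
   obtain b where b: "b : homogeneous U d" "y = h b" using y unfolding homog by blast
   hence bs: "b : span_on U" "b : span_on {s. fst s = int d}" unfolding hm by blast+
   show ?thesis unfolding homog a(2) b(2) add[OF as(1) bs(1), symmetric] by (rule imageI) (simp add: hm as bs span_on_add)
  qed
  have "\<ominus>\<^bsub>R\<^esub> x = h (- a)" by (rule minus_equality)
    (use as add[of "- a" a] in "simp_all add: a(2) zero hc span_on_uminus")
  thus "\<ominus>\<^bsub>R\<^esub> x : homog R d" unfolding homog using as by (simp add: hm span_on_uminus)
  show "x \<otimes>\<^bsub>R\<^esub> y : homog R (d + e)" if "y : homog R e" for e
   using mult_homog[OF a(1)] a(2) that unfolding homog by blast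
  show "c \<odot>\<^bsub>R\<^esub> x : homog R d" for c
   unfolding homog a(2) smult[OF as(1), symmetric] by (rule imageI) (simp add: hm as span_on_smult)
  show "h (pdeg e (k x)) = (if e = d then x else \<zero>\<^bsub>R\<^esub>)" for e
  proof (cases "e = d")
   case True
   thus ?thesis using restr_id[OF as(2)] kh[OF as(1)] a(2) by simp
  next
   case False
   hence "keys (pdeg e a) = {}" using as(2) unfolding keys_restr span_on_def by auto
   thus ?thesis using False zero kh[OF as(1)] a(2) by simp
  qed
 next
  show "\<one>\<^bsub>R\<^esub> : homog R 0" unfolding homog one[symmetric]
   by (rule imageI) (use U0 in "simp add: homogeneous_def span_on_def")
  fix x y c d assume x: "x : carrier R" and y: "y : carrier R"
  obtain a where a: "a : span_on U" "x = h a" using surj[OF x] by blast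
  obtain b where b: "b : span_on U" "y = h b" using surj[OF y] by blast
  show "(c \<odot>\<^bsub>R\<^esub> x) \<otimes>\<^bsub>R\<^esub> y = c \<odot>\<^bsub>R\<^esub> (x \<otimes>\<^bsub>R\<^esub> y)"
   using smult_mult[OF a(1) b(1)] by (simp add: a(2) b(2) smult[OF a(1)])
  show "h (pdeg d (k (x \<oplus>\<^bsub>R\<^esub> y))) = h (pdeg d (k x)) \<oplus>\<^bsub>R\<^esub> h (pdeg d (k y))"
   unfolding a(2) b(2) add[OF a(1) b(1), symmetric] kh[OF span_on_add[OF a(1) b(1)]] kh[OF a(1)] kh[OF b(1)]
    restr_add by (rule add[OF pdU[OF a(1)] pdU[OF b(1)]])
 next
  fix x d assume x: "x : carrier R"
  obtain a where a: "a : span_on U" "x = h a" using surj[OF x] by blast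
  show "c \<odot>\<^bsub>R\<^esub> x : carrier R" for c unfolding a(2) smult[OF a(1), symmetric] by (rule hc[OF span_on_smult[OF a(1)]])
  show "h (pdeg d (k x)) : homog R d" unfolding homog a(2) kh[OF a(1)] by (rule imageI) (simp add: hm pdU[OF a(1)] restr_supported)
  have nz: "{d. h (pdeg d (k x)) ~= \<zero>\<^bsub>R\<^esub>} = {d. pdeg d a ~= 0}" unfolding a(2) kh[OF a(1)] h0[OF pdU[OF a(1)]] ..
  show "finite {d. h (pdeg d (k x)) ~= \<zero>\<^bsub>R\<^esub>}" unfolding nz by (rule fin)
  have "a = (SUM d:(%s. nat (fst s)) ` keys a. pdeg d a)" by (rule homog_decomp) (rule nn[OF span_onD[OF a(1)]])
  also have "... = (SUM d:{d. pdeg d a ~= 0}. pdeg d a)" by (rule sum.mono_neutral_right) (use sub in auto)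
  finally have "x = h (SUM d:{d. pdeg d a ~= 0}. pdeg d a)" using a(2) by simp
  also have "... = (\<Oplus>\<^bsub>R\<^esub>d\<in>{d. h (pdeg d (k x)) ~= \<zero>\<^bsub>R\<^esub>}. h (pdeg d (k x)))"
   unfolding nz unfolding a(2) kh[OF a(1)] by (rule fs[symmetric]) (use fin pdU[OF a(1)] in auto)
  finally show "x = (\<Oplus>\<^bsub>R\<^esub>d\<in>{d. h (pdeg d (k x)) ~= \<zero>\<^bsub>R\<^esub>}. h (pdeg d (k x)))" .
 qed
qed

lemma graded_cring_semigroup_algebra: assumes A: "0 : A" "!!s t. s : A ==> t : A ==> s + t : A" "!!s. s : A ==> 0 <= fst s"
 shows "graded_cring (semigroup_algebra A :: ('k::field, ('n::finite, 'k) lpoly) graded_algebra) pdeg"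
proof (rule graded_cring_monomial[where U = A and h = "%x. x" and k = "%x. x"])
 show "cring (semigroup_algebra A :: ('k, ('n, 'k) lpoly) graded_algebra)" by (rule cring_semigroup_algebra[OF A(1,2)])
 show "x \<otimes>\<^bsub>semigroup_algebra A\<^esub> y : (%x. x) ` homogeneous A (d + e)"
  if "x : homogeneous A d" "y : homogeneous A e" for x y :: "('n, 'k) lpoly" and d e
  unfolding sg_simps image_ident by (rule homogeneous_mult[OF A(2) that])
qed (use A in "simp_all add: sg_simps homogeneous_def mult.assoc")

lemma (in monoid_fan) graded_cring_fan:
 "graded_cring (fan_algebra_on I M :: ('k::field, ('n, 'k) lpoly) graded_algebra) pdeg"
proof (rule graded_cring_monomial[where U = U and h = "%x. x" and k = "%x. x"])
 let ?T = "fan_algebra_on I M :: ('k, ('n, 'k) lpoly) graded_algebra"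
 show "cring ?T" by (rule cring_fan_algebra)
 show "0 : U" using I_ne M_0 by blast
 show "0 <= fst s" if "s : U" for s using that M_fst by blast
 show "x \<otimes>\<^bsub>?T\<^esub> y : (%x. x) ` homogeneous U (d + e)" if x: "x : homogeneous U d" and y: "y : homogeneous U e" for x y d e
 proof -
  have "fst s = int (d + e)" if s: "s : keys (fan_mult I M x y)" for s
  proof -
   have "s : U" using span_onD[OF fan_mult_closed s] .
   then obtain i where i: "i : I" "s : M i" by blast
   hence "s : keys (restr (M i) (fan_mult I M x y))" by (simp only: keys_restr Int_iff s i(2) simp_thms)
   hence "s : keys (restr (M i) x * restr (M i) y)" by (simp only: restrict_fan_mult[OF i(1)])
   then obtain u v where "s = u + v" "u : keys (restr (M i) x)" "v : keys (restr (M i) y)"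
    using keys_mult[of "restr (M i) x" "restr (M i) y"] by blast
   hence "s = u + v" "fst u = int d" "fst v = int e" using x y unfolding keys_restr homogeneous_def by blast+
   thus ?thesis by simp
  qed
  thus ?thesis unfolding homogeneous_def fan_simps image_ident using fan_mult_closed by blast
 qed
 show "(single 0 c * x) \<otimes>\<^bsub>?T\<^esub> y = c \<odot>\<^bsub>?T\<^esub> (x \<otimes>\<^bsub>?T\<^esub> y)" for c x y
  unfolding fan_simps by (rule restrict_jointly_inj[OF fan_mult_closed span_on_smult[OF fan_mult_closed]])
   (simp only: restrict_fan_mult restr_smult mult.assoc)
qed (simp_all add: fan_simps homogeneous_def)

lemma (in graded_cring) ideal_smult: assumes "ideal p R" "x : p" shows "c \<odot> x : p"
proof -
 interpret p: ideal p R by fact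
 have "x : carrier R" using p.a_Hcarr assms(2) .
 hence "c \<odot> x = (c \<odot> \<one>) \<otimes> x" using smult_mult[of \<one> x c] by simp
 thus ?thesis using p.I_l_closed[OF assms(2) smult_closed[OF one_closed]] by simp
qed

lemma graded_surjection_iso: fixes R :: "('k, 'a) graded_algebra" and R' :: "('k, 'b) graded_algebra"
 assumes R: "graded_cring R pr" and iso: "graded_iso R R' h" and R': "graded_cring R' (%d y. h (pr d (inv_into (carrier R) h y)))"
 shows "graded_surjection R pr R' (%d y. h (pr d (inv_into (carrier R) h y))) h"
proof (intro graded_surjection.intro graded_surjection_axioms.intro R R')
 have bij: "bij_betw h (carrier R) (carrier R')" using iso by (auto simp: graded_iso_def ring_iso_def)
 show "h : ring_hom R R'" "!!d. h ` homog R d = homog R' d" "!!x c. x : carrier R ==> h (c \<odot>\<^bsub>R\<^esub> x) = c \<odot>\<^bsub>R'\<^esub> h x"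
  using iso by (auto simp: graded_iso_def ring_iso_def)
 show "h ` carrier R = carrier R'" using bij by (simp add: bij_betw_def)
 show "h (pr d x) = h (pr d (inv_into (carrier R) h (h x)))" if "x : carrier R" for x d using that bij by (simp add: bij_betw_def)
qed

lemma graded_surjection_inv: fixes R :: "('k, 'a) graded_algebra" and R' :: "('k, 'b) graded_algebra"
 assumes iso: "graded_iso R R' h" and R': "graded_cring R' (%d y. h (pr d (inv_into (carrier R) h y)))" and psi: "graded_surjection R pr Q pr' psi"
 shows "graded_surjection R' (%d y. h (pr d (inv_into (carrier R) h y))) Q pr' (%y. psi (inv_into (carrier R) h y))"
proof -
 interpret p: graded_surjection R pr Q pr' psi by (rule psi)
 let ?k = "inv_into (carrier R) h"
 have bij: "bij_betw h (carrier R) (carrier R')" and ri: "h : ring_iso R R'" using iso by (auto simp: graded_iso_def ring_iso_def)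
 have hH: "homog R' d = h ` homog R d" for d using iso by (auto simp: graded_iso_def)
 have kh: "?k (h x) = x" if "x : carrier R" for x using that bij by (simp add: bij_betw_def)
 have car: "carrier R' = h ` carrier R" using bij by (simp add: bij_betw_def)
 have khom: "?k : ring_hom R' R" using ring_iso_set_sym[OF p.R.ring_axioms ri] by (simp add: ring_iso_def)
 show ?thesis
 proof (intro graded_surjection.intro graded_surjection_axioms.intro p.R'.graded_cring_axioms R')
  show "(%y. psi (?k y)) : ring_hom R' Q" using ring_hom_trans[OF khom p.hom] by (simp add: o_def)
  have im: "(%y. psi (?k y)) ` h ` B = psi ` B" if "B <= carrier R" for B using kh subsetD[OF that] by (simp add: image_image)
  show "(%y. psi (?k y)) ` homog R' d = homog Q d" for d unfolding hH im[OF p.R.homog_carrier] by (rule p.homog_image)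
  show "(%y. psi (?k y)) ` carrier R' = carrier Q" unfolding car im[OF order_refl] by (rule p.surj)
  fix y assume "y : carrier R'"
  then obtain x where x: "x : carrier R" "y = h x" unfolding car by blast
  show "psi (?k (c \<odot>\<^bsub>R'\<^esub> y)) = c \<odot>\<^bsub>Q\<^esub> psi (?k y)" for c
  proof -
   have "c \<odot>\<^bsub>R'\<^esub> y = h (c \<odot>\<^bsub>R\<^esub> x)" using iso x by (auto simp: graded_iso_def)
   thus ?thesis using x by (simp add: kh p.R.smult_closed p.map_smult)
  qed
  show "psi (?k (h (pr d (?k y)))) = pr' d (psi (?k y))" for d using x by (simp add: kh p.R.pr_in p.map_pr)
 qed
qed

subsection \<open>The components\<close>

context stratified
begin

abbreviation "rst C \<equiv> restr (S_flag P f C)"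

abbreviation tor :: "'n face set => ('k, ('n, 'k) lpoly) graded_algebra" where
 "tor C \<equiv> semigroup_algebra (S_flag P f C)"

abbreviation "gr_coord \<equiv> inv_into (carrier fan_alg) gr_map"

abbreviation "gr_pr d y \<equiv> gr_map (pdeg d (gr_coord y))"

lemma gr_map_zero: "gr_map \<zero>\<^bsub>fan_alg\<^esub> = \<zero>\<^bsub>gr\<^esub>"
proof -
 have "\<zero>\<^bsub>gr\<^esub> = (\<lambda>c\<in>\<Gamma>. filt_gt P f r c)" by (simp add: gr_algebra_def Let_def)
 also have "... = gr_map 0" by (rule gr_map_eqI) (simp add: filt_gt_leaf)
 finally show ?thesis by (simp add: fan_simps)
qed

lemma graded_cring_tor: "C : mchains ==> graded_cring (tor C) pdeg"
 by (rule graded_cring_semigroup_algebra) (use fan.M_0 fan.M_add fan.M_fst in blast)+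

lemma fan_surjection: assumes C: "C : mchains" shows "graded_surjection fan_alg pdeg (tor C) pdeg (rst C)"
proof (intro graded_surjection.intro graded_surjection_axioms.intro fan.graded_cring_fan graded_cring_tor[OF C])
 have sub: "S_flag P f C <= S" using Union_S_flag C by blast
 have up: "F : span_on S" if "F : span_on (S_flag P f C)" for F :: "('n, 'k) lpoly" using that sub unfolding span_on_def by blast
 show "rst C : ring_hom fan_alg (tor C)" by (rule ring_hom_memI)
   (simp_all add: fan_simps sg_simps restr_supported restr_add
    fan.restrict_fan_mult[OF C] fan.restrict_one[OF C])
 show "rst C ` carrier fan_alg = carrier (tor C)" unfolding fan_simps sg_simps Union_S_flag
 proof (intro Set.equalityI image_subsetI subsetI)
  fix F :: "('n, 'k) lpoly" assume F: "F : span_on (S_flag P f C)"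
  show "F : rst C ` span_on S" by (rule image_eqI[of F "rst C" F, OF restr_id[OF F, symmetric] up[OF F]])
 qed (rule restr_supported)
 show "rst C ` homog fan_alg d = homog (tor C) d" for d unfolding fan_simps sg_simps Union_S_flag
 proof (intro Set.equalityI image_subsetI subsetI)
  fix F :: "('n, 'k) lpoly"
  assume F: "F : {p : span_on (S_flag P f C). ALL s:keys p. fst s = int d}"
  hence F1: "F : span_on (S_flag P f C)" by blast
  show "F : rst C ` {p : span_on S. ALL s:keys p. fst s = int d}"
   by (rule image_eqI[of F "rst C" F, OF restr_id[OF F1, symmetric]]) (use up[OF F1] F in blast)
 next
  fix F :: "('n, 'k) lpoly"
  assume "F : {p : span_on S. ALL s:keys p. fst s = int d}"
  thus "rst C F : {p : span_on (S_flag P f C). ALL s:keys p. fst s = int d}"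
   using restr_supported unfolding mem_Collect_eq keys_restr by blast
 qed
 show "rst C (c \<odot>\<^bsub>fan_alg\<^esub> x) = c \<odot>\<^bsub>tor C\<^esub> rst C x" for c x
  by (simp add: fan_simps sg_simps restr_smult)
 show "rst C (pdeg d x) = pdeg d (rst C x)" for d x by (rule poly_mapping_eqI) simp
qed

lemma gr_coord_map: "F : span_on S ==> gr_coord (gr_map F) = F"
 using graded_iso_gr by (simp add: graded_iso_def ring_iso_def bij_betw_def fan_simps Union_S_flag)

lemma gr_elem: "y : carrier gr ==> EX F:span_on S. y = gr_map F" using gr_map_surj by blast

lemma graded_cring_gr: "graded_cring gr gr_pr"
proof (rule graded_cring_monomial[where U = S and h = gr_map and k = gr_coord])
 interpret T: graded_cring fan_alg pdeg by (rule fan.graded_cring_fan)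
 have ri: "gr_map : ring_iso fan_alg gr" and hH: "homog gr d = gr_map ` homog fan_alg d" for d
  using graded_iso_gr by (auto simp: graded_iso_def)
 have H: "homog fan_alg d = homogeneous S d" for d by (simp add: fan_simps Union_S_flag homogeneous_def)
 show "cring gr" using T.ring_iso_imp_img_cring[OF ri] by (simp add: gr_map_zero)
 show "homog gr d = gr_map ` homogeneous S d" for d by (simp only: hH H)
 show "0 : S" by (rule S_mon_0)
 show "0 <= fst s" if "s : S" for s by (rule S_mon_fst_nonneg[OF that])
 show "gr_map 0 = \<zero>\<^bsub>gr\<^esub>" using gr_map_zero by (simp add: fan_simps)
 fix x y :: "('n, 'k) lpoly"
 show "gr_map x \<otimes>\<^bsub>gr\<^esub> gr_map y : gr_map ` homogeneous S (d + e)"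
  if x: "x : homogeneous S d" and y: "y : homogeneous S e" for d e
  unfolding gr_map_mult[OF homogeneous_supported[OF x] homogeneous_supported[OF y]]
  using T.homog_mult[of x d y e] x y unfolding H fan_simps(2) by (intro imageI)
 show "gr_map (single 0 c * x) \<otimes>\<^bsub>gr\<^esub> gr_map y = c \<odot>\<^bsub>gr\<^esub> (gr_map x \<otimes>\<^bsub>gr\<^esub> gr_map y)"
  if x: "x : span_on S" and y: "y : span_on S" for c using T.smult_mult[of x y c] x y
  by (simp add: gr_map_mult span_on_smult gr_map_smult fan_simps Union_S_flag)
qed (use gr_map_closed gr_coord_map gr_elem in "auto simp: gr_map_add gr_map_one gr_map_smult")

lemma gr_surjection: "graded_surjection fan_alg pdeg gr gr_pr gr_map"
 by (rule graded_surjection_iso[OF fan.graded_cring_fan graded_iso_gr graded_cring_gr])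

lemma tor_surjection:
 "C : mchains ==> graded_surjection gr gr_pr (tor C) pdeg (%y. rst C (gr_coord y))"
 by (rule graded_surjection_inv[OF graded_iso_gr graded_cring_gr fan_surjection])

lemma domain_tor: assumes C: "C : mchains" shows "domain (tor C)"
proof -
 interpret graded_cring "tor C" pdeg by (rule graded_cring_tor[OF C])
 show ?thesis by (intro domain.intro domain_axioms.intro is_cring)
   (use laurent_mult_nonzero in "auto simp: sg_simps")
qed

lemma gen_in_S_flag: "C : mchains ==> sig : C ==> gen sig : S_flag P f C"
 using S_flag_iff[of C "gen sig"] max_chain_flag[of C] ssupp_gen[of sig] stratD(2)[of sig] flag_sub_faces[of C] by auto

lemma gen_notin_S_flag: "C : mchains ==> sig : faces P ==> sig ~: C ==> gen sig ~: S_flag P f C"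
 using S_flag_iff[of C "gen sig"] max_chain_flag[of C] ssupp_gen[of sig] by auto

lemma max_chain_nonempty: "C : mchains ==> C ~= {}" using card_max_chain[OF _ full, of C] by auto

lemma tor_relevant: assumes C: "C : mchains" shows "EX d>0. EX x:homog (tor C) d. x ~= \<zero>\<^bsub>tor C\<^esub>"
proof -
 obtain sig where s: "sig : C" using max_chain_nonempty[OF C] by blast
 have F: "sig : faces P" using s flag_sub_faces max_chain_flag[of C] C by blast
 show ?thesis
 proof (intro exI[of _ "fdeg sig"] conjI bexI)
  show "0 < fdeg sig" using stratD(4)[OF F] by simp
  show "single (gen sig) 1 : homog (tor C) (fdeg sig)" using gen_in_S_flag[OF C s] stratD(3)[OF F] by (simp add: sg_simps span_on_single)
  show "single (gen sig) 1 ~= \<zero>\<^bsub>tor C\<^esub>" by (simp add: sg_simps single_nonzero)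
 qed
qed

lemma integral_tor: assumes C: "C : mchains" shows "integral_space (Proj (tor C))"
proof -
 interpret graded_cring "tor C" pdeg by (rule graded_cring_tor[OF C])
 show ?thesis using tor_relevant[OF C] integral_Proj[OF domain_tor[OF C]] by blast
qed

lemma reduced_gr: "reduced_space (Proj gr)"
proof -
 interpret h: graded_surjection fan_alg pdeg gr gr_pr gr_map by (rule gr_surjection)
 show ?thesis
 proof (rule h.R'.reduced_Proj)
  fix y and m :: nat assume y: "y : carrier gr" "y [^]\<^bsub>gr\<^esub> m = \<zero>\<^bsub>gr\<^esub>"
  obtain F where F: "F : span_on S" "y = gr_map F" using gr_elem[OF y(1)] by blast
  have "rst C F = rst C 0" if C: "C : mchains" for C
  proof -
   interpret t: graded_surjection gr gr_pr "tor C" pdeg "%y. rst C (gr_coord y)" by (rule tor_surjection[OF C])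
   interpret D: domain "tor C" by (rule domain_tor[OF C])
   have m: "rst C (gr_coord (y [^]\<^bsub>gr\<^esub> i)) = (rst C (gr_coord y)) [^]\<^bsub>tor C\<^esub> i" for i :: nat
   proof (induction i)
    case 0
    show ?case using t.phi.hom_one by simp
   next
    case (Suc i)
    show ?case using t.phi.hom_mult[OF h.R'.nat_pow_closed[OF y(1), of i] y(1)] Suc by simp
   qed
   have "(rst C (gr_coord y)) [^]\<^bsub>tor C\<^esub> m = \<zero>\<^bsub>tor C\<^esub>" using m[of m] y(2) t.phi.hom_zero by simp
   hence "rst C (gr_coord y) = \<zero>\<^bsub>tor C\<^esub>"
   proof (induction m)
    case (Suc i)
    thus ?case using t.phi.hom_closed[OF y(1)] by (auto simp: D.integral_iff)
   qed simp
   thus ?thesis using F by (simp add: gr_coord_map sg_simps)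
  qed
  note r0 = this
  have "F = 0"
  proof (rule fan.restrict_jointly_inj)
   show "F : span_on (UN C:mchains. S_flag P f C)" using F(1) by (simp only: Union_S_flag)
   show "rst C F = rst C 0" if "C : mchains" for C by (rule r0[OF that])
  qed (rule span_on_0)
  thus "y = \<zero>\<^bsub>gr\<^esub>" using F(2) gr_map_zero by (simp add: fan_simps)
 qed
qed

text \<open>The exponents of the monomials outside a homogeneous prime have pairwise compatible supports,
  because the product of two of the monomials is not zero. The union of the supports is
  therefore a flag, and all monomials outside the corresponding \<open>S\<^sub>C\<close> lie in the prime.\<close>

lemma prime_contains_kernel: assumes p: "p : Pts fan_alg" shows "EX C:mchains. ALL F:span_on S. rst C F = 0 --> F : p"
proof -
 interpret T: graded_cring fan_alg pdeg by (rule fan.graded_cring_fan)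
 interpret p: primeideal p fan_alg by (rule T.point_prime[OF p])
 define E where "E = {s : S. single s (1::'k) ~: p}"
 define D where "D = \<Union>(ssupp ` E)"
 have sing: "single s (1::'k) : carrier fan_alg" if "s : S" for s using that by (simp add: fan_simps Union_S_flag span_on_single)
 have comp: "flag P (ssupp s Un ssupp t)" if st: "s : E" "t : E" for s t
 proof (rule ccontr)
  assume "~ ?thesis"
  hence "~ fan_comp mchains (S_flag P f) s t" unfolding fan_comp_iff by blast
  hence "fan_mult mchains (S_flag P f) (single s (1::'k)) (single t 1) = 0" by (simp add: fan_mult_def)
  hence "single s (1::'k) \<otimes>\<^bsub>fan_alg\<^esub> single t 1 : p" using T.point_zero[OF p] by (simp add: fan_simps)
  thus False using T.point_mult[OF p sing sing] st unfolding E_def by blast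
 qed
 have "flag P D" unfolding subset_chain_def
 proof (intro conjI ballI)
  show "D <= faces P" unfolding D_def E_def using coords(4) by blast
  fix sig tau assume "sig : D" "tau : D"
  then obtain s t where "s : E" "t : E" "sig : ssupp s" "tau : ssupp t" unfolding D_def by blast
  thus "sig <= tau | tau <= sig" using comp[of s t] unfolding subset_chain_def by blast
 qed
 then obtain C where C: "max_chain P C" "D <= C" by (rule flag_extends_to_max_chain)
 have "F : p" if F: "F : span_on S" "rst C F = 0" for F
 proof -
  have sum: "sum g K : p" if "!!s. s : K ==> g s : p" for g :: "'n hlat => ('n, 'k) lpoly" and K using that
  proof (induction K rule: infinite_finite_induct)
   case (insert s K)
   hence "g s \<oplus>\<^bsub>fan_alg\<^esub> sum g K : p" by (intro p.a_closed) blast+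
   thus ?case using insert by (simp add: fan_simps)
  qed (use T.point_zero[OF p] in "simp_all add: fan_simps")
  have "single s (lookup F s) : p" if s: "s : keys F" for s
  proof -
   have sS: "s : S" by (rule span_onD[OF F(1) s])
   have "s ~: S_flag P f C" using F(2) s keys_restr[of "S_flag P f C" F] by auto
   hence "~ ssupp s <= C" using S_flag_iff[OF max_chain_flag[OF C(1)]] sS by blast
   hence "s ~: E" using C(2) unfolding D_def by blast
   hence "single s (1::'k) : p" using sS unfolding E_def by blast
   hence "lookup F s \<odot>\<^bsub>fan_alg\<^esub> single s (1::'k) : p" by (rule T.ideal_smult[OF p.ideal_axioms])
   thus ?thesis by (simp add: fan_simps mult_single)
  qed
  hence "(SUM s:keys F. single s (lookup F s)) : p" by (rule sum)
  thus ?thesis using pm_expand[of F] by simp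
 qed
 thus ?thesis using C(1) by blast
qed

text \<open>A prime of \<open>k[S\<^sub>C]\<close> goes to its preimage in the associated graded ring.\<close>

definition comp_map :: "'n face set => (('n, 'k) lpoly) set => ('n qvec => ('n, 'k) lfun set) set" where
 "comp_map C q = {y : carrier gr. rst C (gr_coord y) : q}"

lemma comp_map_pull: "C : mchains ==> comp_map C = graded_surjection.pull gr (%y. rst C (gr_coord y))"
 by (rule ext) (simp add: comp_map_def graded_surjection.pull_def[OF tor_surjection])

lemma comp_map_closed_immersion: "C : mchains ==> closed_immersion (Proj (tor C)) (Proj gr) (comp_map C)"
 using graded_surjection.closed_immersion_pull[OF tor_surjection] by (simp add: comp_map_pull)

lemma comp_map_image_iff: assumes "C : mchains" shows "p : comp_map C ` Pts (tor C) \<longleftrightarrow>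
  p : Pts gr & (ALL F:span_on S. rst C F = 0 --> gr_map F : p)"
proof -
 have "(ALL y:carrier gr. rst C (gr_coord y) = \<zero>\<^bsub>tor C\<^esub> --> y : p) \<longleftrightarrow> (ALL F:span_on S. rst C F = 0 --> gr_map F : p)"
  (is "?l \<longleftrightarrow> ?r")
 proof
  show ?r if l: ?l
  proof (intro ballI impI)
   fix F :: "('n, 'k) lpoly" assume F: "F : span_on S" "rst C F = 0"
   show "gr_map F : p" using bspec[OF l gr_map_closed[OF F(1)]] F by (simp add: gr_coord_map sg_simps)
  qed
  show ?l if r: ?r
  proof (intro ballI impI)
   fix y assume y: "y : carrier gr" "rst C (gr_coord y) = \<zero>\<^bsub>tor C\<^esub>"
   obtain F where F: "F : span_on S" "y = gr_map F" using gr_elem[OF y(1)] by blast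
   show "y : p" using bspec[OF r F(1)] y(2) F by (simp add: gr_coord_map sg_simps)
  qed
 qed
 thus ?thesis using graded_surjection.pull_image_iff[OF tor_surjection[OF assms], of p] by (simp add: comp_map_pull[OF assms])
qed

lemma comp_map_cover: "Pts gr = (UN C:mchains. comp_map C ` Pts (tor C))"
proof (intro Set.equalityI subsetI)
 fix p assume p: "p : Pts gr"
 interpret h: graded_surjection fan_alg pdeg gr gr_pr gr_map by (rule gr_surjection)
 obtain C where C: "C : mchains" "ALL F:span_on S. rst C F = 0 --> F : h.pull p" using prime_contains_kernel[OF h.pull_point[OF p]] by blast
 hence "ALL F:span_on S. rst C F = 0 --> gr_map F : p" unfolding h.pull_def by blast
 hence "p : comp_map C ` Pts (tor C)" using p by (simp only: comp_map_image_iff[OF C(1)] simp_thms)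
 with C(1) show "p : (UN C:mchains. comp_map C ` Pts (tor C))" by (rule UN_I)
next
 fix p assume "p : (UN C:mchains. comp_map C ` Pts (tor C))"
 then obtain C where "C : mchains" "p : comp_map C ` Pts (tor C)" by (rule UN_E)
 thus "p : Pts gr" by (simp only: comp_map_image_iff simp_thms)
qed

lemma zero_point_tor: assumes C: "C : mchains" shows "{0} : Pts (tor C)"
proof -
 interpret graded_cring "tor C" pdeg by (rule graded_cring_tor[OF C])
 show ?thesis using tor_relevant[OF C] zero_point[OF domain_tor[OF C]] by (auto simp: sg_simps)
qed

lemma max_chains_incomparable: assumes "C : mchains" "D : mchains" "C ~= D" shows "~ C <= D"
proof
 assume "C <= D"
 moreover have "card C = card D" "finite D" using card_max_chain[OF _ full] assms flag_finite[OF max_chain_flag] by auto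
 ultimately show False using card_subset_eq assms(3) by blast
qed

text \<open>The monomial of a face in \<open>C\<close> but not in \<open>D\<close> vanishes on the component of \<open>D\<close>, but not at the generic
  point of the component of \<open>C\<close>.\<close>

lemma generic_point_component: assumes C: "C : mchains" and D: "D : mchains" and "comp_map C {0} : comp_map D ` Pts (tor D)" shows "C = D"
proof (rule ccontr)
 assume "C ~= D"
 then obtain sig where s: "sig : C" "sig ~: D" using max_chains_incomparable[OF C D] by blast
 have F: "sig : faces P" using s flag_sub_faces max_chain_flag[of C] C by blast
 let ?F = "single (gen sig) (1::'k)"
 have FS: "?F : span_on S" using stratD(2)[OF F] by (rule span_on_single)
 have "rst D ?F = 0" using gen_notin_S_flag[OF D F s(2)] by (simp add: restr_single)
 hence "gr_map ?F : comp_map C {0}" using assms(3) FS comp_map_image_iff[OF D] by blast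
 hence "rst C ?F = 0" using gr_coord_map[OF FS] by (simp add: comp_map_def)
 thus False using gen_in_S_flag[OF C s(1)] single_nonzero[of "1::'k" "gen sig"] by (simp add: restr_single)
qed

lemma irredundant_gr: "irredundant_union (Proj gr) mchains (%C. Proj (tor C))"
proof -
 have pts: "points (Proj gr) = Pts gr" "points (Proj (tor C)) = Pts (tor C)" if "C : mchains" for C
  using graded_cring.topspace_proj_top[OF graded_cring_tor[OF that]]
   graded_cring.topspace_proj_top[OF graded_surjection.axioms(1)[OF tor_surjection[OF that]]] by (simp_all add: Proj_def)
 obtain C0 where C0: "C0 : mchains" using exists_max_chain by blast
 show ?thesis unfolding irredundant_union_def
 proof (intro exI[of _ comp_map] conjI ballI)
  show "closed_immersion (Proj (tor C)) (Proj gr) (comp_map C)" if "C : mchains" for C by (rule comp_map_closed_immersion[OF that])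
  show "points (Proj gr) = (UN C:mchains. comp_map C ` points (Proj (tor C)))"
   unfolding pts(1)[OF C0] comp_map_cover using pts(2) by (intro SUP_cong refl) simp
  fix C assume C: "C : mchains"
  show "points (Proj gr) ~= (UN D:mchains - {C}. comp_map D ` points (Proj (tor D)))"
  proof
   assume eq: "points (Proj gr) = (UN D:mchains - {C}. comp_map D ` points (Proj (tor D)))"
   have "comp_map C {0} : comp_map C ` Pts (tor C)" using zero_point_tor[OF C] by (rule imageI)
   hence "comp_map C {0} : Pts gr" using comp_map_image_iff[OF C] by blast
   hence "comp_map C {0} : points (Proj gr)" by (simp only: pts(1)[OF C])
   then obtain D where D: "D : mchains - {C}" "comp_map C {0} : comp_map D ` points (Proj (tor D))" unfolding eq by (rule UN_E)
   hence D': "D : mchains" "D ~= C" by auto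
   show False using generic_point_component[OF C D'(1)] D(2) D'(2) pts(2)[OF D'(1)] by simp
  qed
 qed
qed

end

section \<open>Irreducible components and dimension\<close>

lemma irreducible_image: assumes g: "continuous_map X Y g" and Z: "irreducible_in X Z" shows "irreducible_in Y (g ` Z)" unfolding irreducible_in_def
proof (intro conjI allI impI)
 have sub: "Z <= topspace X" using Z by (simp add: irreducible_in_def)
 show "g ` Z <= topspace Y" using continuous_map_image_subset_topspace[OF g] sub by blast
 show "g ` Z ~= {}" using Z by (simp add: irreducible_in_def)
 fix F G assume FG: "closedin Y F & closedin Y G & g ` Z <= F Un G"
 have "Z <= {x : topspace X. g x : F} Un {x : topspace X. g x : G}" using FG sub by blast
 hence "Z <= {x : topspace X. g x : F} | Z <= {x : topspace X. g x : G}"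
  using Z closedin_continuous_map_preimage[OF g] FG unfolding irreducible_in_def by blast
 thus "g ` Z <= F | g ` Z <= G" by blast
qed

lemma krull_dim_homeomorphic_le: assumes g: "homeomorphic_map X Y g" shows "krull_dim X <= krull_dim Y" unfolding krull_dim_def
proof (rule Sup_subset_mono, rule subsetI)
 fix d assume "d : {enat m | m. EX Z. (ALL i<=m. closedin X (Z i) & irreducible_in X (Z i)) & (ALL i<m. Z i \<subset> Z (Suc i))}"
 then obtain m Z where d: "d = enat m" and Z: "!!i. i <= m ==> closedin X (Z i) & irreducible_in X (Z i)"
  "!!i. i < m ==> Z i \<subset> Z (Suc i)" by blast
 have cm: "continuous_map X Y g" and cl: "closed_map X Y g" and inj: "inj_on g (topspace X)"
  using g by (auto simp: homeomorphic_eq_everything_map)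
 have "closedin Y (g ` Z i) & irreducible_in Y (g ` Z i)" if "i <= m" for i
  using Z(1)[OF that] cl irreducible_image[OF cm] unfolding closed_map_def by blast
 moreover have "g ` Z i \<subset> g ` Z (Suc i)" if i: "i < m" for i
 proof -
  have "Z (Suc i) <= topspace X" using Z(1)[of "Suc i"] i closedin_subset[of X "Z (Suc i)"] by simp
  thus ?thesis using image_strict_mono[OF inj_on_subset[OF inj] Z(2)[OF i]] by blast
 qed
 ultimately show "d : {enat m | m. EX Z. (ALL i<=m. closedin Y (Z i) & irreducible_in Y (Z i)) & (ALL i<m. Z i \<subset> Z (Suc i))}"
  unfolding d by (intro CollectI exI[of _ m] conjI exI[of _ "%i. g ` Z i"]) blast+
qed

lemma krull_dim_homeomorphic: assumes "homeomorphic_map X Y g" shows "krull_dim X = krull_dim Y"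
proof (rule antisym)
 obtain h where "homeomorphic_maps X Y g h" using assms unfolding homeomorphic_map_maps by blast
 hence "homeomorphic_map Y X h" using homeomorphic_maps_map homeomorphic_maps_sym by blast
 thus "krull_dim Y <= krull_dim X" by (rule krull_dim_homeomorphic_le)
qed (rule krull_dim_homeomorphic_le[OF assms])

lemma irreducible_finite_union:
 assumes Z: "irreducible_in X Z" and "finite I" "!!i. i : I ==> closedin X (K i)" "Z <= (UN i:I. K i)" shows "EX i:I. Z <= K i"
 using assms(2-)
proof (induction I rule: finite_induct)
 case empty
 thus ?case using Z by (simp add: irreducible_in_def)
next
 case (insert i I)
 have "closedin X (K i)" "closedin X (UN i:I. K i)" "Z <= K i Un (UN i:I. K i)" using insert by (auto intro: closedin_Union)
 hence "Z <= K i | Z <= (UN i:I. K i)" using Z unfolding irreducible_in_def by blast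
 thus ?case using insert by blast
qed

lemma irreducible_components_finite_union: assumes "finite I" and K: "!!i. i : I ==> closedin X (K i)" "!!i. i : I ==> irreducible_in X (K i)"
  and cover: "topspace X = (UN i:I. K i)" and Z: "Z : irreducible_components X" shows "EX i:I. Z = K i"
proof -
 have irr: "irreducible_in X Z" and max: "!!Z'. irreducible_in X Z' ==> Z <= Z' ==> Z' = Z"
  using Z by (auto simp: irreducible_components_def)
 have "Z <= (UN i:I. K i)" using irr cover by (simp add: irreducible_in_def)
 hence "EX i:I. Z <= K i" by (rule irreducible_finite_union[OF irr assms(1) K(1), rotated])
 then obtain i where i: "i : I" "Z <= K i" ..
 have "K i = Z" by (rule max[OF K(2)[OF i(1)] i(2)])
 thus ?thesis using i(1) by (intro bexI[of _ i]) simp_all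
qed

lemma (in graded_cring) irreducible_points: assumes eta: "{\<zero>} : Pts R" shows "irreducible_in (proj_top R) (Pts R)" unfolding irreducible_in_def
proof (intro conjI allI impI)
 fix F G assume FG: "closedin (proj_top R) F & closedin (proj_top R) G & Pts R <= F Un G"
 have all: "Pts R <= K" if K: "closedin (proj_top R) K" "{\<zero>} : K" for K
 proof -
  have "openin (proj_top R) (Pts R - K)" using K(1) by (simp add: closedin_def)
  hence "Pts R - K = {}" using zero_point_generic[OF eta] K(2) by blast
  thus ?thesis by blast
 qed
 thus "Pts R <= F | Pts R <= G" using eta FG by blast
qed (use eta in auto)

lemma monomial_prime_point: assumes A: "0 : A" "!!s t. s : A ==> t : A ==> s + t : A" "!!s. s : A ==> 0 <= fst s"
  and face: "!!s t. s : A ==> t : A ==> s + t : N \<longleftrightarrow> s : N & t : N" and g: "g : N" "g : A" "0 < fst g"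
 shows "monomial_prime A N : Pts (semigroup_algebra A :: ('k::field, ('n::finite, 'k) lpoly) graded_algebra)"
proof -
 let ?R = "semigroup_algebra A :: ('k, ('n, 'k) lpoly) graded_algebra"
 let ?p = "monomial_prime A N :: (('n, 'k) lpoly) set"
 interpret graded_cring ?R pdeg by (rule graded_cring_semigroup_algebra[OF A])
 have "0 + g : N" using g(1) by simp
 hence N0: "0 : N" using face[OF A(1) g(2)] by blast
 have mult: "F * G : ?p" if "F : span_on A" "G : ?p" for F G
 proof -
  have G: "G : span_on A" "restr N G = 0" using that(2) by (auto simp: monomial_prime_def)
  have "restr N (F * G) = 0" using restr_mult_face[OF that(1) G(1) face] G(2) by simp
  moreover have "F * G : span_on A" by (rule span_on_mult[OF that(1) G(1) A(2)])
  ultimately show ?thesis by (simp add: monomial_prime_def)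
 qed
 have "primeideal ?p ?R"
 proof (rule primeidealI)
  show "ideal ?p ?R"
  proof (rule idealI)
   show "ring ?R" by (rule ring_axioms)
   show "subgroup ?p (add_monoid ?R)"
   proof (rule subgroup.intro)
    show "?p <= carrier (add_monoid ?R)" by (auto simp: monomial_prime_def sg_simps)
    show "\<one>\<^bsub>add_monoid ?R\<^esub> : ?p" by (simp add: monomial_prime_def sg_simps span_on_0)
    fix F assume F: "F : ?p"
    show "F \<otimes>\<^bsub>add_monoid ?R\<^esub> G : ?p" if "G : ?p" for G
     using F that by (simp add: monomial_prime_def sg_simps span_on_add restr_add)
    have "single 0 (- 1) * F : ?p" by (rule mult[OF span_on_single[OF A(1)] F])
    hence m: "- F : ?p" by (simp add: single_uminus)
    have "\<ominus>\<^bsub>?R\<^esub> F = - F" by (rule minus_equality) (use F m in "simp_all add: sg_simps monomial_prime_def")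
    thus "inv\<^bsub>add_monoid ?R\<^esub> F : ?p" using m by (simp add: a_inv_def)
   qed
   fix F G assume FG: "F : ?p" "G : carrier ?R"
   hence G: "G : span_on A" by (simp add: sg_simps)
   show "G \<otimes>\<^bsub>?R\<^esub> F : ?p" using mult[OF G FG(1)] by (simp add: sg_simps)
   show "F \<otimes>\<^bsub>?R\<^esub> G : ?p" using mult[OF G FG(1)] by (simp add: sg_simps mult.commute)
  qed
  show "cring ?R" by (rule is_cring)
  show "carrier ?R ~= ?p"
  proof
   assume "carrier ?R = ?p"
   hence "1 : ?p" using one_closed by (simp add: sg_simps)
   hence "restr N (1 :: ('n, 'k) lpoly) = 0" by (simp add: monomial_prime_def)
   moreover have "restr N (1 :: ('n, 'k) lpoly) = 1" using N0 restr_single[of N "0 :: 'n hlat" "1::'k"] by simp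
   ultimately show False by simp
  qed
  fix F G assume "F : carrier ?R" "G : carrier ?R" "F \<otimes>\<^bsub>?R\<^esub> G : ?p"
  thus "F : ?p | G : ?p" using monomial_prime_prime[OF face] by (simp add: sg_simps)
 qed
 moreover have "ALL F:?p. ALL d. pdeg d F : ?p"
 proof (intro ballI allI)
  fix F d assume F: "F : ?p"
  have "restr N (pdeg d F) = pdeg d (restr N F)" by (rule poly_mapping_eqI) simp
  moreover have "pdeg d F : span_on A" using F unfolding monomial_prime_def span_on_def mem_Collect_eq keys_restr by blast
  ultimately show "pdeg d F : ?p" using F by (simp add: monomial_prime_def)
 qed
 moreover have "EX d>0. EX x:homog ?R d. x ~: ?p"
 proof (intro exI[of _ "nat (fst g)"] conjI bexI)
  show "0 < nat (fst g)" using g(3) by simp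
  show "single g 1 : homog ?R (nat (fst g))" using g(2,3) by (simp add: sg_simps span_on_single)
  have "single g (1::'k) ~= 0" by (metis lookup_single_eq lookup_zero zero_neq_one)
  thus "single g 1 ~: ?p" using g(1) by (simp add: monomial_prime_def restr_single)
 qed
 ultimately show ?thesis unfolding proj_points_iff by blast
qed

lemma homog_spectrum_Proj: assumes A: "0 : A" "!!s t. s : A ==> t : A ==> s + t : A" "!!s. s : A ==> 0 <= fst s"
 shows "homog_spectrum (proj_top (semigroup_algebra A :: ('k::field, ('n::finite, 'k) lpoly) graded_algebra)) A (%p. p)"
proof -
 let ?R = "semigroup_algebra A :: ('k, ('n, 'k) lpoly) graded_algebra"
 interpret graded_cring ?R pdeg by (rule graded_cring_semigroup_algebra[OF A])
 have hom: "homog ?R d = homogeneous A d" for d by (simp add: sg_simps homogeneous_def)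
 show ?thesis
 proof (rule homog_spectrum.intro)
  show "0 : A" "!!s t. s : A ==> t : A ==> s + t : A" "!!s. s : A ==> 0 <= fst s" by (rule A; assumption)+
  fix p assume "p : topspace (proj_top ?R)"
  hence p: "p : Pts ?R" by simp
  interpret I: ideal p ?R using point_prime[OF p] by (rule primeideal.axioms)
  show "p <= span_on A" using point_carrier[OF p] by (auto simp: sg_simps)
  show "0 : p" using point_zero[OF p] by (simp add: sg_simps)
  fix F G
  show "F + G : p" if "F : p" "G : p" using I.a_closed[OF that] by (simp add: sg_simps)
  show "F * G : p" if "F : span_on A" "G : p" using I.I_l_closed[OF that(2), of F] that(1) by (simp add: sg_simps)
  show "F : p | G : p" if "F : span_on A" "G : span_on A" "F * G : p" using point_mult[OF p, of F G] that by (simp add: sg_simps)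
  show "pdeg d F : p" if "F : p" for d using p that unfolding proj_points_iff by blast
  show "EX d>0. EX F:homogeneous A d. F ~: p" using p unfolding proj_points_iff hom by blast
 next
  fix U
  have basic: "basic F = {q : topspace (proj_top ?R). F ~: q}" for F by (simp add: basic_def)
  have bex: "(EX a:H. Q a) \<longleftrightarrow> (EX d. EX F:homogeneous A d. Q F)" for Q unfolding homog_elems_def hom by blast
  have "openin (proj_top ?R) U \<longleftrightarrow> U <= topspace (proj_top ?R) & openin (proj_top ?R) U" using openin_subset by blast
  also have "... \<longleftrightarrow> U <= topspace (proj_top ?R) & (ALL p:U. EX d. EX F:homogeneous A d. p : basic F & basic F <= U)"
   by (simp only: openin_proj_top[of U] bex)
  also have "... \<longleftrightarrow> U <= topspace (proj_top ?R) &
    (ALL p:U. EX d. EX F:homogeneous A d. F ~: p & {y : topspace (proj_top ?R). F ~: y} <= U)"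
   unfolding basic by blast
  finally show "openin (proj_top ?R) U \<longleftrightarrow> U <= topspace (proj_top ?R) &
    (ALL p:U. EX d. EX F:homogeneous A d. F ~: p & {y : topspace (proj_top ?R). F ~: y} <= U)" .
 qed
qed

context stratified
begin

lemma finite_mchains: "finite mchains"
proof (rule finite_subset)
 show "mchains <= Pow (faces P)" using flag_sub_faces[OF max_chain_flag] by blast
qed (use finite_faces in simp)

text \<open>Finitely many irreducible closed sets covering a space contain all its components.\<close>

lemma irreducible_component_gr: assumes Z: "Z : irreducible_components (proj_top gr)" shows "EX C:mchains. Z = comp_map C ` Pts (tor C)"
proof (rule irreducible_components_finite_union[OF finite_mchains _ _ _ Z])
 fix C assume C: "C : mchains"
 interpret t: graded_surjection gr gr_pr "tor C" pdeg "%y. rst C (gr_coord y)" by (rule tor_surjection[OF C])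
 show "closedin (proj_top gr) (comp_map C ` Pts (tor C))" unfolding comp_map_pull[OF C] by (rule t.closedin_pull)
 have "continuous_map (proj_top (tor C)) (proj_top gr) t.pull" using t.embedding_pull unfolding embedding_map_def
  by (rule continuous_map_into_fulltopology[OF homeomorphic_imp_continuous_map])
 moreover have "irreducible_in (proj_top (tor C)) (Pts (tor C))"
  by (rule t.R'.irreducible_points) (use zero_point_tor[OF C] in "simp add: sg_simps")
 ultimately show "irreducible_in (proj_top gr) (comp_map C ` Pts (tor C))" unfolding comp_map_pull[OF C] by (rule irreducible_image)
next
 obtain C where C: "C : mchains" using exists_max_chain by blast
 show "topspace (proj_top gr) = (UN C:mchains. comp_map C ` Pts (tor C))" unfolding comp_map_cover[symmetric]
  by (rule graded_cring.topspace_proj_top[OF graded_surjection.axioms(1)[OF tor_surjection[OF C]]])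
qed

lemma krull_dim_component:
 assumes C: "C : mchains" shows "krull_dim (subtopology (proj_top gr) (comp_map C ` Pts (tor C))) = krull_dim (proj_top (tor C))"
proof -
 interpret t: graded_surjection gr gr_pr "tor C" pdeg "%y. rst C (gr_coord y)" by (rule tor_surjection[OF C])
 have "homeomorphic_map (proj_top (tor C)) (subtopology (proj_top gr) (t.pull ` Pts (tor C))) t.pull"
  using t.embedding_pull by (simp add: embedding_map_def)
 thus ?thesis unfolding comp_map_pull[OF C] by (rule krull_dim_homeomorphic[symmetric])
qed

lemma chain_face: assumes C: "C : mchains" and i: "i <= CARD('n)"
 obtains sig where "sig : C" "aff_dim sig = int i"
proof -
 have "aff_dim ` C = {0..int CARD('n)}" using max_chain_aff_dim[OF _ full, of C] C by (auto simp: bij_betw_def)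
 hence "int i : aff_dim ` C" using i by simp
 thus thesis using that by (metis imageE)
qed

text \<open>The primes spanned by the monomials that involve a face of dimension above \<open>i\<close> form a
  chain of maximal length.\<close>

lemma krull_dim_tor: assumes C: "C : mchains" shows "krull_dim (proj_top (tor C)) = enat CARD('n)"
proof -
 have fl: "flag P C" using C max_chain_flag by blast
 note A = fan.M_0[OF C] fan.M_add[OF C] fan.M_fst[OF C]
 interpret sp: homog_spectrum "proj_top (tor C)" "S_flag P f C" "%p. p" by (rule homog_spectrum_Proj[OF A])
 interpret R: graded_cring "tor C" pdeg by (rule graded_cring_tor[OF C])
 define N where "N i = {s : S_flag P f C. ssupp s <= {sig : C. aff_dim sig <= int i}}" for i :: nat
 have face: "s + t : N i \<longleftrightarrow> s : N i & t : N i" if st: "s : S_flag P f C" "t : S_flag P f C" for s t i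
 proof -
  have s: "s : S" "ssupp s <= C" and t: "t : S" "ssupp t <= C" using st S_flag_iff[OF fl] by blast+
  have "flag P (ssupp s Un ssupp t)" by (rule flag_subset[OF fl]) (use s t in blast)
  hence "ssupp (s + t) = ssupp s Un ssupp t" by (rule ssupp_add[OF s(1) t(1)])
  thus ?thesis using st A(2)[OF st] unfolding N_def by blast
 qed
 have genN: "gen sig : N i \<longleftrightarrow> aff_dim sig <= int i" "gen sig : S_flag P f C" "0 < fst (gen sig)" if s: "sig : C" for sig i
 proof -
  have F: "sig : faces P" using s flag_sub_faces[OF fl] by blast
  show m: "gen sig : S_flag P f C" by (rule gen_in_S_flag[OF C s])
  show "gen sig : N i \<longleftrightarrow> aff_dim sig <= int i" using m s ssupp_gen[OF F] unfolding N_def by simp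
  show "0 < fst (gen sig)" using stratD(3,4)[OF F] by simp
 qed
 have pt: "monomial_prime (S_flag P f C) (N i) : Pts (tor C)" if i: "i <= CARD('n)" for i
 proof -
  obtain sig where s: "sig : C" "aff_dim sig = int i" by (rule chain_face[OF C i])
  show ?thesis by (rule monomial_prime_point[OF A face, where g = "gen sig"]) (use genN[OF s(1)] s(2) in auto)
 qed
 have van: "sp.vanishing {monomial_prime (S_flag P f C) (N i)} = monomial_prime (S_flag P f C) (N i)" for i
  by (auto simp: sp.vanishing_def monomial_prime_def)
 have "enat CARD('n) <= krull_dim (proj_top (tor C))"
 proof (rule sp.krull_dim_ge[where B = "%i. {monomial_prime (S_flag P f C) (N i)}"], unfold van)
  fix i assume i: "i <= CARD('n)"
  show "{monomial_prime (S_flag P f C) (N i)} <= topspace (proj_top (tor C)) & {monomial_prime (S_flag P f C) (N i)} ~= {}"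
   using pt[OF i] by simp
  fix F G :: "('n, 'k) lpoly"
  assume FG: "F : span_on (S_flag P f C)" "G : span_on (S_flag P f C)" "F * G : monomial_prime (S_flag P f C) (N i)"
  show "F : monomial_prime (S_flag P f C) (N i) | G : monomial_prime (S_flag P f C) (N i)"
   by (rule monomial_prime_prime[OF _ FG]) (rule face)
 next
  fix i assume i: "i < CARD('n)"
  hence "Suc i <= CARD('n)" by simp
  then obtain sig where s: "sig : C" "aff_dim sig = int (Suc i)" by (rule chain_face[OF C])
  have sub: "N i <= N (Suc i)"
  proof
   fix s assume "s : N i"
   hence "s : S_flag P f C" "!!sig. sig : ssupp s ==> sig : C & aff_dim sig <= int i" unfolding N_def by blast+
   thus "s : N (Suc i)" unfolding N_def by force
  qed
  show "monomial_prime (S_flag P f C) (N (Suc i)) \<subset> monomial_prime (S_flag P f C) (N i)"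
   by (rule monomial_prime_strict[OF sub, of "gen sig"]) (use genN[OF s(1)] s(2) in auto)
 qed
 thus ?thesis using sp.krull_dim_le by (rule antisym[rotated])
qed

subsection \<open>Gordan's lemma\<close>

text \<open>Subtracting generators of the flag leaves an element with coordinates below \<open>1\<close>; there are
  finitely many of these.\<close>

lemma affine_semigroup_S_flag: assumes C: "C : mchains" shows "affine_semigroup (S_flag P f C)"
proof -
 have fl: "flag P C" using C max_chain_flag by blast
 have Cf: "C <= faces P" by (rule flag_sub_faces[OF fl])
 have fin: "finite C" by (rule flag_finite[OF fl])
 define B0 where "B0 = {s : S_flag P f C. ALL sig:C. coords s sig < 1}"
 have "finite (gen ` C)" using fin by simp
 then obtain b where b: "gen ` C <= hbox b" using finite_in_hbox by blast
 have bound: "\<bar>x\<bar> <= int (card C * b)"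
  if x: "rat_of_int x = (SUM sig:C. a sig * of_int (g sig))" and a: "!!sig. sig : C ==> 0 <= a sig & a sig < 1"
   and g: "!!sig. sig : C ==> \<bar>g sig\<bar> <= int b" for x a and g :: "'n face => int"
 proof -
  have "\<bar>rat_of_int x\<bar> <= (SUM sig:C. \<bar>a sig * of_int (g sig)\<bar>)" unfolding x by (rule sum_abs)
  also have "... <= (SUM sig:C. of_int (int b))"
  proof (rule sum_mono)
   fix sig assume s: "sig : C"
   have "\<bar>a sig\<bar> * \<bar>rat_of_int (g sig)\<bar> <= 1 * of_int (int b)"
   proof (rule mult_mono)
    show "\<bar>a sig\<bar> <= 1" using a[OF s] by simp
    have "rat_of_int \<bar>g sig\<bar> <= of_int (int b)" using g[OF s] unfolding of_int_le_iff .
    thus "\<bar>rat_of_int (g sig)\<bar> <= of_int (int b)" by simp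
   qed simp_all
   thus "\<bar>a sig * of_int (g sig)\<bar> <= of_int (int b)" by (simp add: abs_mult)
  qed
  also have "... = rat_of_int (int (card C * b))" by simp
  finally have "rat_of_int \<bar>x\<bar> <= rat_of_int (int (card C * b))" by simp
  thus ?thesis unfolding of_int_le_iff .
 qed
 have "B0 <= hbox (card C * b)"
 proof
  fix s assume s: "s : B0"
  hence S: "s : S" "ssupp s <= C" using S_flag_iff[OF fl] unfolding B0_def by blast+
  have eq: "rat_hvec s = (SUM sig:C. coords s sig *s rat_hvec (gen sig))" using coords(3)[OF S(1)] combo_subset[OF S(2) Cf] by simp
  have a: "0 <= coords s sig & coords s sig < 1" if "sig : C" for sig using coords(1)[OF S(1)] s that unfolding B0_def by blast
  have g: "\<bar>fst (gen sig)\<bar> <= int b" "\<bar>snd (gen sig) $ j\<bar> <= int b" if "sig : C" for sig j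
   using b that unfolding hbox_def by blast+
  have e: "of_int (fst s) = (SUM sig:C. coords s sig * of_int (fst (gen sig)))"
   "of_int (snd s $ j) = (SUM sig:C. coords s sig * of_int (snd (gen sig) $ j))" for j using eq unfolding rat_hvec_eq_iff by blast+
  have "\<bar>fst s\<bar> <= int (card C * b)" by (rule bound[OF e(1) a g(1)])
  moreover have "\<bar>snd s $ j\<bar> <= int (card C * b)" for j by (rule bound[OF e(2) a g(2)])
  ultimately show "s : hbox (card C * b)" unfolding hbox_def by blast
 qed
 hence finB: "finite (gen ` C Un B0)" using card_hbox(1) fin finite_subset by blast
 have "s : submonoid_gen (gen ` C Un B0)" if "s : S_flag P f C" for s using that
 proof (induction "nat (fst s)" arbitrary: s rule: less_induct)
  case less
  show ?case
  proof (cases "ALL sig:C. coords s sig < 1")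
   case True
   hence "s : gen ` C Un B0" using less.prems unfolding B0_def by blast
   thus ?thesis by (rule submonoid_gen.gen)
  next
   case False
   then obtain sig where s: "sig : C" "1 <= coords s sig" by (meson not_le)
   have F: "sig : faces P" using s(1) Cf by blast
   have S: "s : S" "ssupp s <= C" using less.prems S_flag_iff[OF fl] by blast+
   define a where "a = (%tau. coords s tau - coords (gen sig) tau)"
   let ?t = "s - gen sig"
   have "rat_hvec s = rat_hvec ?t + rat_hvec (gen sig)" using rat_hvec_add[of ?t "gen sig"] by simp
   moreover have "combo a = rat_hvec s - rat_hvec (gen sig)"
    unfolding a_def combo_diff using coords(3)[OF S(1)] coords(3)[OF stratD(2)[OF F]] by simp
   ultimately have "rat_hvec ?t = combo a" by simp
   moreover have "ALL tau. 0 <= a tau" using s(2) coords(1)[OF S(1)] by (simp add: a_def coords_gen[OF F])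
   moreover have "qsupp a <= C"
   proof
    fix tau assume "tau : qsupp a"
    thus "tau : C" using S(2) s(1) by (cases "tau = sig") (auto simp: a_def coords_gen[OF F] qsupp_def)
   qed
   ultimately have cone: "real_hvec ?t : cone_over (convex hull (vertex ` C))" using cone_coords[OF fl] by blast
   have "convex hull (vertex ` C) <= P" by (rule hull_minimal) (use p_in faces_subset Cf convex_P in blast)+
   hence "cone_over (convex hull (vertex ` C)) <= cone_over P" unfolding cone_over_def by blast
   hence tS: "?t : S" using lattice_cone_subset_S cone by blast
   hence t: "?t : S_flag P f C" using cone by (simp add: S_flag_def flag_simplex_eq)
   have "fst ?t = fst s - int (fdeg sig)" using stratD(3)[OF F] by simp
   moreover have "0 <= fst ?t" by (rule S_mon_fst_nonneg[OF tS])
   ultimately have "nat (fst ?t) < nat (fst s)" using stratD(4)[OF F] by linarith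
   hence "?t : submonoid_gen (gen ` C Un B0)" using less.hyps t by blast
   moreover have "gen sig : submonoid_gen (gen ` C Un B0)" by (rule submonoid_gen.gen) (use s(1) in blast)
   ultimately have "gen sig + ?t : submonoid_gen (gen ` C Un B0)" by (rule submonoid_gen.add[rotated])
   thus ?thesis by simp
  qed
 qed
 moreover have "s : S_flag P f C" if "s : submonoid_gen (gen ` C Un B0)" for s using that
 proof (induction rule: submonoid_gen.induct)
  case zero
  show ?case by (rule fan.M_0[OF C])
 next
  case (gen s)
  thus ?case using gen_in_S_flag[OF C] unfolding B0_def by blast
 next
  case (add s t)
  show ?case by (rule fan.M_add[OF C add.IH])
 qed
 ultimately have "S_flag P f C = submonoid_gen (gen ` C Un B0)" by blast
 thus ?thesis unfolding affine_semigroup_def using finB by blast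
qed

end

section \<open>The dimension of the toric variety\<close>

text \<open>If \<open>w\<close> is the family of values of the monomials at a point \<open>v\<close> of the cone, this is the restriction
  of \<open>F\<close> to the line through \<open>v\<close>, as a polynomial in the parameter. So the functions vanishing on the line are the kernel
  of a homomorphism to a domain.\<close>

definition ray :: "('n::finite hlat => 'k::field) => (('n, 'k) lpoly) => (('n, 'k) lpoly)" where
 "ray w F = (SUM s:keys F. single (fst s, 0) (lookup F s * w s))"

lemma ray_superset: assumes "finite A" "keys F <= A" shows "ray w F = (SUM s:A. single (fst s, 0) (lookup F s * w s))"
 unfolding ray_def using assms by (intro sum.mono_neutral_left) (auto simp: in_keys_iff)

lemma ray_single: "ray w (single s c) = single (fst s, 0) (c * w s)" by (subst ray_superset[of "{s}"]) auto

lemma ray_0: "ray w 0 = 0" by (simp add: ray_def)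

lemma ray_add: "ray w (F + G) = ray w F + ray w G"
proof -
 let ?A = "keys F Un keys G"
 have "ray w (F + G) = (SUM s:?A. single (fst s, 0) (lookup (F + G) s * w s))"
  by (rule ray_superset) (use Poly_Mapping.keys_add[of F G] in auto)
 thus ?thesis by (simp add: lookup_add distrib_right single_add sum.distrib ray_superset[of ?A])
qed

lemma ray_sum: "ray w (sum g A) = (SUM i:A. ray w (g i))" by (induction A rule: infinite_finite_induct) (simp_all add: ray_0 ray_add)

lemma ray_mult: fixes F G :: "('n::finite, 'k::field) lpoly" assumes F: "F : span_on A" and G: "G : span_on A"
  and w: "!!s t. s : A ==> t : A ==> w (s + t) = w s * w t" shows "ray w (F * G) = ray w F * ray w G"
proof -
 let ?m = "%F s. single s (lookup F s)"
 have "F * G = (SUM s:keys F. SUM t:keys G. ?m F s * ?m G t)" by (subst pm_expand[of F], subst pm_expand[of G], rule sum_product)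
 hence "ray w (F * G) = (SUM s:keys F. SUM t:keys G. ray w (?m F s * ?m G t))" by (simp add: ray_sum)
 also have "... = (SUM s:keys F. SUM t:keys G. single (fst s, 0) (lookup F s * w s) * single (fst t, 0) (lookup G t * w t))"
 proof (intro sum.cong refl)
  fix s t assume "s : keys F" "t : keys G"
  hence "w (s + t) = w s * w t" using w span_onD[OF F] span_onD[OF G] by blast
  thus "ray w (?m F s * ?m G t) = single (fst s, 0) (lookup F s * w s) * single (fst t, 0) (lookup G t * w t)"
   by (simp add: mult_single ray_single mult_ac)
 qed
 also have "... = ray w F * ray w G" by (simp add: ray_def sum_product)
 finally show ?thesis .
qed

lemma ray_pdeg: "ray w (pdeg d F) = pdeg d (ray w F)"
proof -
 have "ray w (pdeg d F) = (SUM s:keys F. single (fst s, 0) (lookup (pdeg d F) s * w s))" by (rule ray_superset) (simp_all add: keys_restr)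
 also have "... = (SUM s:keys F. pdeg d (single (fst s, 0) (lookup F s * w s)))" by (intro sum.cong refl) (simp add: restr_single)
 finally show ?thesis by (simp add: ray_def restr_sum)
qed

lemma ray_homogeneous: assumes "F : homogeneous A d" shows "ray w F = single (int d, 0) (pm_eval F w)"
proof -
 have sing: "(SUM s:B. single k (g s)) = single k (sum g B)"
  for B :: "'a hlat set" and k :: "'a hlat" and g :: "'a hlat => 'b"
  by (induction B rule: infinite_finite_induct) (simp_all add: single_add)
 have "ray w F = (SUM s:keys F. single (int d, 0) (lookup F s * w s))"
  unfolding ray_def using assms by (intro sum.cong refl) (simp add: homogeneous_def)
 thus ?thesis by (simp add: sing pm_eval_def)
qed

lemma ray_eval: "ray w F = 0 ==> pm_eval F w = 0"
proof -
 assume z: "ray w F = 0"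
 have "pm_eval (ray w F) (%_. 1) = pm_eval F w" by (simp add: ray_def pm_eval_sum pm_eval_def[of F])
 thus ?thesis using z by simp
qed

context stratified
begin

definition PX :: "('n, 'k) lvec set => (('n, 'k) lpoly) set" where
 "PX x = {F : span_on S. ALL v:x. ray (cone_val P v) F = 0}"

lemma toric_points:
 "(x :: ('n, 'k) lvec set) : toric_variety P \<longleftrightarrow> (EX v:affine_cone P. v ~= (%_. 0) & x = proj_point v)"
proof
 have sub: "toric_variety P <= (proj_space P :: ('n, 'k) lvec set set)"
  using closure_of_subset_topspace[of "proj_space_top P" "torus_orbit P P"] by (simp add: toric_variety_def stratum_def)
 {
  assume x: "x : toric_variety P"
  hence "x : proj_space P" using sub by blast
  then obtain v where v: "v ~= (%_. 0)" "x = proj_point v" unfolding proj_space_def by blast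
  have "v : affine_cone P" using x in_proj_point[of v] v(2) unfolding affine_cone_def by blast
  thus "EX v:affine_cone P. v ~= (%_. 0) & x = proj_point v" using v by blast
 }
 assume "EX v:affine_cone P. v ~= (%_. 0) & x = proj_point v"
 then obtain v where v: "v : affine_cone P" "v ~= (%_. 0)" "x = proj_point v" by blast
 then obtain y where y: "y : toric_variety P" "v : y" unfolding affine_cone_def by blast
 then obtain w where "y = proj_point w" using sub unfolding proj_space_def by blast
 hence "x = y" using v(3) y(2) proj_point_eq by blast
 thus "x : toric_variety P" using y(1) by simp
qed

lemma toric_subset: "toric_variety P <= (proj_space P :: ('n, 'k) lvec set set)"
 using closure_of_subset_topspace[of "proj_space_top P" "torus_orbit P P"] by (simp add: toric_variety_def stratum_def)

lemma ray_scale: fixes v :: "('n, 'k) lvec" assumes v: "v : affine_cone P" and c: "c ~= 0" and F: "F : span_on S" and z: "ray (cone_val P v) F = 0"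
 shows "ray (cone_val P (%xi. c * v xi)) F = 0"
proof -
 let ?u = "(c, \<chi> i. 1) :: 'k \<times> ('k ^ 'n)"
 have u: "?u : big_torus" using c by (simp add: torus_def)
 have "torus_act ?u v = (%xi. c * v xi)" by (simp add: torus_act_eq char_val_def)
 hence cv: "cone_val P (%xi. c * v xi) s = c powi fst s * cone_val P v s" if "s : S" for s
  using cone_val_torus_act[OF v that u] by (simp add: hchar_val_def char_val_def)
 have deg: "ray (cone_val P (%xi. c * v xi)) (pdeg d F) = 0" for d
 proof -
  have pF: "pdeg d F : homogeneous S d" using F unfolding homogeneous_def span_on_def mem_Collect_eq keys_restr by blast
  have "ray (cone_val P v) (pdeg d F) = 0" unfolding ray_pdeg z by simp
  hence e: "pm_eval (pdeg d F) (cone_val P v) = 0" by (rule ray_eval)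
  have "pm_eval (pdeg d F) (cone_val P (%xi. c * v xi)) = pm_eval (pdeg d F) (%s. c ^ d * cone_val P v s)"
  proof (rule pm_eval_cong)
   fix s assume s: "s : keys (pdeg d F)"
   hence "s : S" "fst s = int d" using pF unfolding homogeneous_def span_on_def by blast+
   thus "cone_val P (%xi. c * v xi) s = c ^ d * cone_val P v s" by (simp add: cv)
  qed
  also have "... = c ^ d * pm_eval (pdeg d F) (cone_val P v)" by (simp add: pm_eval_def sum_distrib_left mult_ac)
  finally show ?thesis using e by (simp add: ray_homogeneous[OF pF])
 qed
 have "ray (cone_val P (%xi. c * v xi)) F = ray (cone_val P (%xi. c * v xi)) (SUM d:(%s. nat (fst s)) ` keys F. pdeg d F)"
  using homog_decomp[of F, OF S_mon_fst_nonneg[OF span_onD[OF F]]] by simp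
 thus ?thesis by (simp add: ray_sum deg)
qed

lemma PX_point: fixes v :: "('n, 'k) lvec" assumes "v : affine_cone P" shows "PX (proj_point v) = {F : span_on S. ray (cone_val P v) F = 0}"
 unfolding PX_def using ray_scale[OF assms] in_proj_point[of v] by (auto simp: proj_point_def)

lemma homogeneous_in_PX: fixes v :: "('n, 'k) lvec"
 assumes "v : affine_cone P" "F : homogeneous S d" shows "F : PX (proj_point v) \<longleftrightarrow> pm_eval F (cone_val P v) = 0"
 using assms(2) single_nonzero[of "pm_eval F (cone_val P v)" "(int d, 0)"]
 by (auto simp: PX_point[OF assms(1)] ray_homogeneous[OF assms(2)] homogeneous_def)

lemma homog_poly_map: fixes p :: "('n lat, 'k) mpoly" assumes p: "p : hpolys P d" shows "pm_map mono_wt p : homogeneous S d"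
  "v : affine_cone P ==> poly_eval p v = pm_eval (pm_map mono_wt p) (cone_val P v)"
proof -
 have P: "p : polys_in (lpts P)" by (rule homog_polys_polys_in[OF p])
 have "s : S & fst s = int d" if s: "s : keys (pm_map mono_wt p)" for s
 proof -
  obtain m where m: "m : keys p" "s = mono_wt m" using keys_pm_map[of mono_wt p] s by blast
  have "keys m <= lpts P" using P m(1) unfolding polys_in_def by blast
  hence "s : S" unfolding S_mon_eq m(2) by blast
  moreover have "mono_deg m = d" using p m(1) by (simp add: homog_polys_def mono_deg_def)
  ultimately show ?thesis by (simp add: m(2) fst_mono_wt)
 qed
 thus "pm_map mono_wt p : homogeneous S d" unfolding homogeneous_def span_on_def by blast
 show "poly_eval p v = pm_eval (pm_map mono_wt p) (cone_val P v)" if "v : affine_cone P"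
  using fun_cong[OF poly_fun_eq_cone_fun[OF P], of v] that by (simp add: poly_fun_def cone_fun_def)
qed

lemma homog_poly_surj: fixes F :: "('n, 'k) lpoly" assumes F: "F : homogeneous S d" shows "EX p:hpolys P d. pm_map mono_wt p = F"
proof -
 obtain p :: "('n lat, 'k) mpoly" where p: "p : polys_in (lpts P)" "pm_map mono_wt p = F"
  "mono_wt ` keys p <= keys F" by (rule pm_map_mono_wt_surj[OF homogeneous_supported[OF F]])
 have "mono_deg m = d" if "m : keys p" for m
 proof -
  have "fst (mono_wt m) = int d" using p(3) that F unfolding homogeneous_def by blast
  thus ?thesis by (simp add: fst_mono_wt)
 qed
 hence "p : hpolys P d" using p(1) by (simp add: homog_polys_def mono_deg_def)
 thus ?thesis using p(2) by blast
qed

lemma basic_toric: fixes p :: "('n lat, 'k) mpoly"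
 assumes p: "p : hpolys P d" shows "proj_basic P p Int toric_variety P = {y : toric_variety P. pm_map mono_wt p ~: PX y}"
proof -
 have "y : proj_basic P p \<longleftrightarrow> pm_map mono_wt p ~: PX y" if y: "y : toric_variety P" for y
 proof -
  obtain v where v: "v : affine_cone P" "y = proj_point v" using y toric_points by blast
  have "proj_point v : proj_space P" using y v(2) toric_subset by blast
  hence "y : proj_basic P p \<longleftrightarrow> poly_eval p v ~= 0" unfolding v(2) by (simp add: proj_point_in_basic[OF p])
  thus ?thesis unfolding v(2) homogeneous_in_PX[OF v(1) homog_poly_map(1)[OF p]] homog_poly_map(2)[OF p v(1)] .
 qed
 thus ?thesis by blast
qed

abbreviation toric_top :: "('n, 'k) lvec set topology" where
 "toric_top \<equiv> subtopology (proj_space_top P) (toric_variety P)"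

lemma topspace_toric: "topspace toric_top = toric_variety P" using toric_subset by auto

lemma openin_toric:
 "openin toric_top U \<longleftrightarrow> U <= toric_variety P &
  (ALL x:U. EX d. EX F:homogeneous S d. F ~: PX x & {y : toric_variety P. F ~: PX y} <= U)"
proof
 assume "openin toric_top U"
 then obtain V where V: "openin (proj_space_top P) V" "U = V Int toric_variety P" unfolding openin_subtopology by blast
 show "U <= toric_variety P & (ALL x:U. EX d. EX F:homogeneous S d. F ~: PX x & {y : toric_variety P. F ~: PX y} <= U)"
 proof (intro conjI ballI)
  show "U <= toric_variety P" using V(2) by blast
  fix x assume x: "x : U"
  then obtain p d where p: "p : hpolys P d" "x : proj_basic P p" "proj_basic P p <= V" using V unfolding openin_proj_space_top by blast
  show "EX d. EX F:homogeneous S d. F ~: PX x & {y : toric_variety P. F ~: PX y} <= U"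
  proof (intro exI[of _ d] bexI[OF _ homog_poly_map(1)[OF p(1)]] conjI)
   show "pm_map mono_wt p ~: PX x" using basic_toric[OF p(1)] p(2) x V(2) by blast
   show "{y : toric_variety P. pm_map mono_wt p ~: PX y} <= U" unfolding basic_toric[OF p(1), symmetric] V(2) using p(3) by blast
  qed
 qed
next
 assume U: "U <= toric_variety P & (ALL x:U. EX d. EX F:homogeneous S d. F ~: PX x & {y : toric_variety P. F ~: PX y} <= U)"
 let ?V = "\<Union>{proj_basic P p | p. (EX d. p : hpolys P d) & proj_basic P p Int toric_variety P <= U}"
 have "openin (proj_space_top P) ?V" unfolding openin_proj_space_top by blast
 moreover have "U = ?V Int toric_variety P"
 proof (intro Set.equalityI subsetI)
  fix x assume x: "x : U"
  then obtain d F where F: "F : homogeneous S d" "F ~: PX x" "{y : toric_variety P. F ~: PX y} <= U" using U by blast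
  obtain p where p: "p : hpolys P d" "pm_map mono_wt p = F" using homog_poly_surj[OF F(1)] by blast
  note b = basic_toric[OF p(1), unfolded p(2)]
  have "x : proj_basic P p" "x : toric_variety P" using b F(2) x U by blast+
  moreover have "proj_basic P p Int toric_variety P <= U" unfolding b by (rule F(3))
  ultimately show "x : ?V Int toric_variety P" using p(1) by blast
 qed blast
 ultimately show "openin toric_top U" unfolding openin_subtopology by blast
qed

lemma homog_spectrum_toric: "homog_spectrum toric_top S PX"
proof (rule homog_spectrum.intro)
 show "0 : S" by (rule S_mon_0)
 show "s + t : S" if "s : S" "t : S" for s t by (rule S_mon_add[OF that])
 show "0 <= fst s" if "s : S" for s by (rule S_mon_fst_nonneg[OF that])
 show "openin toric_top U \<longleftrightarrow> U <= topspace toric_top &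
  (ALL x:U. EX d. EX F:homogeneous S d. F ~: PX x & {y : topspace toric_top. F ~: PX y} <= U)" for U
  unfolding topspace_toric by (rule openin_toric)
 fix x assume "x : topspace toric_top"
 then obtain v where v: "v : affine_cone P" "v ~= (%_. 0)" "x = proj_point v" unfolding topspace_toric toric_points by blast
 have x: "PX x = {F : span_on S. ray (cone_val P v) F = 0}" unfolding v(3) by (rule PX_point[OF v(1)])
 have mult: "ray (cone_val P v) (F * G) = ray (cone_val P v) F * ray (cone_val P v) G"
  if "F : span_on S" "G : span_on S" for F G by (rule ray_mult[OF that]) (rule cone_val_add[OF v(1)])
 show "PX x <= span_on S" unfolding x by blast
 show "0 : PX x" unfolding x by (simp add: ray_0 span_on_0)
 fix F G :: "('n, 'k) lpoly"
 show "F + G : PX x" if "F : PX x" "G : PX x" using that unfolding x by (simp add: ray_add span_on_add)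
 show "F * G : PX x" if "F : span_on S" "G : PX x" using that span_on_mult[OF that(1) _ S_mon_add] unfolding x by (simp add: mult)
 show "F : PX x | G : PX x" if "F : span_on S" "G : span_on S" "F * G : PX x"
  using that laurent_mult_nonzero[of "ray (cone_val P v) F" "ray (cone_val P v) G"] unfolding x by (auto simp: mult)
 show "pdeg d F : PX x" if F: "F : PX x" for d
 proof -
  have "pdeg d F : span_on S" using F unfolding x span_on_def mem_Collect_eq keys_restr by blast
  thus ?thesis using F unfolding x by (simp add: ray_pdeg)
 qed
next
 fix x assume "x : topspace toric_top"
 then obtain v where v: "v : affine_cone P" "v ~= (%_. 0)" "x = proj_point v" unfolding topspace_toric toric_points by blast
 then obtain xi where xi: "v xi ~= 0" by blast
 have "v : vspace P" using v(1) unfolding affine_cone_iff by blast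
 hence L: "xi : lpts P" using xi unfolding vspace_def by blast
 let ?m = "single xi (Suc 0)"
 have k: "keys ?m <= lpts P" using L by simp
 have wt: "mono_wt ?m = (1, xi)" "mono_val v ?m = v xi" by simp_all
 have "(1, xi) : S" unfolding S_mon_eq wt(1)[symmetric] using k by blast
 hence F: "single (1, xi) (1::'k) : homogeneous S 1" by (simp add: homogeneous_def span_on_single)
 have "cone_val P v (1, xi) = v xi" using cone_val_mono_wt[OF v(1) k] wt by simp
 hence "single (1, xi) (1::'k) ~: PX x" unfolding v(3) homogeneous_in_PX[OF v(1) F] using xi by simp
 thus "EX d>0. EX F:homogeneous S d. F ~: PX x" using F by (intro exI[of _ 1]) auto
qed

subsection \<open>Orbits\<close>

text \<open>The exponents of the monomials that do not vanish on the orbit of a face.\<close>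

definition face_monoid :: "'n face => 'n hlat set" where
 "face_monoid sig = mono_wt ` {m. keys m <= lpts P Int lpts sig}"

lemma real_mono_wt: fixes m :: "'n lat \<Rightarrow>\<^sub>0 nat"
 shows "real_hvec (mono_wt m) = (SUM xi:keys m. real (lookup m xi) *\<^sub>R (1, real_vec xi))"
proof -
 have sum: "real_hvec (sum g A) = (SUM xi:A. real_hvec (g xi))" for g :: "'n lat => 'n hlat" and A
  by (induction A rule: infinite_finite_induct) (simp_all add: real_hvec_0 real_hvec_add)
 have "real_hvec (nscale k xi) = real k *\<^sub>R (1, real_vec xi)" for k and xi :: "'n lat"
  by (simp add: nscale_def real_hvec_def real_vec_def vec_eq_iff)
 thus ?thesis by (simp add: mono_wt_def sum)
qed

text \<open>A functional that is nonnegative on \<open>P\<close> and vanishes exactly on the face decides membership in its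
  monoid, whatever way the exponent is written as a sum of lattice points.\<close>

lemma face_weight: assumes "sig : faces P"
 obtains l :: "real \<times> (real ^ 'n) => real" where "linear l" "!!s. s : S ==> 0 <= l (real_hvec s)"
  "!!x. x : P ==> l (1, x) = 0 \<longleftrightarrow> x : sig"
  "!!m. keys m <= lpts P ==> l (real_hvec (mono_wt m)) = 0 \<longleftrightarrow> keys m <= lpts sig"
  "!!s. s : S ==> s : face_monoid sig \<longleftrightarrow> l (real_hvec s) = 0"
proof -
 obtain l :: "real \<times> (real ^ 'n) => real" where l: "linear l" "ALL x:P. 0 <= l (1, x)" "ALL x:P. l (1, x) = 0 \<longleftrightarrow> x : sig"
  using face_functional[OF polytope, of sig] assms by (auto simp: faces_def)
 have val: "l (real_hvec (mono_wt m)) = (SUM xi:keys m. real (lookup m xi) * l (1, real_vec xi))" for m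
  unfolding real_mono_wt by (simp only: linear_sum[OF l(1)] linear_scale[OF l(1)] real_scaleR_def)
 have nn: "0 <= real (lookup m xi) * l (1, real_vec xi)"
  if "keys m <= lpts P" "xi : keys m" for m :: "'n lat \<Rightarrow>\<^sub>0 nat" and xi using that l(2) by (auto simp: lattice_points_def)
 have nonneg: "0 <= l (real_hvec s)" if s: "s : S" for s
 proof -
  obtain m where m: "keys m <= lpts P" "s = mono_wt m" using s unfolding S_mon_eq by blast
  show ?thesis unfolding m(2) val by (rule sum_nonneg) (rule nn[OF m(1)])
 qed
 have zero: "l (real_hvec (mono_wt m)) = 0 \<longleftrightarrow> keys m <= lpts sig"
  if m: "keys m <= lpts P" for m
 proof -
  have "l (real_hvec (mono_wt m)) = 0 \<longleftrightarrow> (ALL xi:keys m. real (lookup m xi) * l (1, real_vec xi) = 0)"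
   unfolding val by (rule sum_nonneg_eq_0_iff) (simp_all add: nn[OF m])
  also have "... \<longleftrightarrow> (ALL xi:keys m. xi : lpts sig)"
  proof (rule ball_cong[OF refl])
   fix xi assume xi: "xi : keys m"
   hence "real_vec xi : P" using m by (auto simp: lattice_points_def)
   thus "real (lookup m xi) * l (1, real_vec xi) = 0 \<longleftrightarrow> xi : lpts sig"
    using xi l(3) by (simp add: in_keys_iff lattice_points_def)
  qed
  finally show ?thesis by blast
 qed
 have mem: "s : face_monoid sig \<longleftrightarrow> l (real_hvec s) = 0" if s: "s : S" for s
 proof
  assume "s : face_monoid sig"
  then obtain m where m: "keys m <= lpts P Int lpts sig" "s = mono_wt m" unfolding face_monoid_def by blast
  thus "l (real_hvec s) = 0" using zero[of m] by simp
 next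
  assume z: "l (real_hvec s) = 0"
  obtain m where m: "keys m <= lpts P" "s = mono_wt m" using s unfolding S_mon_eq by blast
  thus "s : face_monoid sig" using zero[OF m(1)] z unfolding face_monoid_def by blast
 qed
 show thesis by (rule that[OF l(1) nonneg _ zero mem]) (use l(3) in blast)+
qed

lemma face_monoid_face:
 assumes "sig : faces P" "s : S" "t : S" shows "s + t : face_monoid sig \<longleftrightarrow> s : face_monoid sig & t : face_monoid sig"
proof -
 obtain l :: "real \<times> (real ^ 'n) => real" where l: "linear l" "!!s. s : S ==> 0 <= l (real_hvec s)"
  "!!s. s : S ==> s : face_monoid sig \<longleftrightarrow> l (real_hvec s) = 0" by (rule face_weight[OF assms(1)]) blast
 have "l (real_hvec (s + t)) = l (real_hvec s) + l (real_hvec t)" unfolding real_hvec_add by (rule linear_add[OF l(1)])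
 thus ?thesis using l(2)[OF assms(2)] l(2)[OF assms(3)] l(3)[OF assms(2)] l(3)[OF assms(3)] l(3)[OF S_mon_add[OF assms(2,3)]]
  by (simp add: add_nonneg_eq_0_iff)
qed

lemma gen_in_face_monoid: assumes sig: "sig : faces P" and tau: "tau : faces P" shows "gen sig : face_monoid tau \<longleftrightarrow> sig <= tau"
proof -
 obtain l :: "real \<times> (real ^ 'n) => real" where l: "linear l" "!!x. x : P ==> l (1, x) = 0 \<longleftrightarrow> x : tau"
  "!!s. s : S ==> s : face_monoid tau \<longleftrightarrow> l (real_hvec s) = 0" by (rule face_weight[OF tau]) blast
 have "l (real_hvec (gen sig)) = real (fdeg sig) * l (1, vertex sig)"
  unfolding stratD(6)[OF sig] using linear_scale[OF l(1), of "real (fdeg sig)" "(1, vertex sig)"] by simp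
 moreover have "vertex sig : P" using p_in[OF sig] faces_subset[OF sig] by blast
 moreover have "tau face_of P" using tau by (simp add: faces_def)
 ultimately show ?thesis using l(3)[OF stratD(2)[OF sig]] l(2)[of "vertex sig"] stratD(4)[OF sig] p_in_face_iff[OF sig, of tau] by simp
qed

lemma keys_face_monoid: assumes "sig : faces P" "keys m <= lpts P" shows "keys m <= lpts sig \<longleftrightarrow> mono_wt m : face_monoid sig"
proof -
 have "mono_wt m : S" unfolding S_mon_eq using assms(2) by blast
 thus ?thesis using assms by (elim face_weight) blast
qed

lemma torus_pt_in_cone:
 assumes sig: "sig : faces P" and u: "u : big_torus" shows "(torus_pt P sig u :: ('n, 'k) lvec) : affine_cone P" unfolding affine_cone_iff
proof (intro conjI allI impI)
 show "torus_pt P sig u : vspace P" by (rule torus_pt_in_vspace)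
 fix m m' assume m: "keys m <= lpts P" "keys m' <= lpts P" "mono_wt m = mono_wt m'"
 show "mono_val (torus_pt P sig u) m = mono_val (torus_pt P sig u) m'"
  by (simp add: mono_val_torus_pt[OF u m(1)] mono_val_torus_pt[OF u m(2)] keys_face_monoid[OF sig m(1)]
    keys_face_monoid[OF sig m(2)] m(3))
qed

lemma cone_val_orbit: assumes sig: "sig : faces P" and u: "u : big_torus" and s: "s : S"
 shows "cone_val P (torus_pt P sig u :: ('n, 'k) lvec) s = (if s : face_monoid sig then hchar_val s u else 0)"
proof -
 obtain m where m: "keys m <= lpts P" "s = mono_wt m" using s unfolding S_mon_eq by blast
 show ?thesis unfolding m(2) cone_val_mono_wt[OF torus_pt_in_cone[OF sig u] m(1)] mono_val_torus_pt[OF u m(1)]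
   keys_face_monoid[OF sig m(1)] ..
qed

lemma torus_pt_nonzero: assumes sig: "sig : faces P" and u: "u : big_torus" shows "(torus_pt P sig u :: ('n, 'k) lvec) ~= (%_. 0)"
proof -
 have "gen sig : face_monoid sig" using gen_in_face_monoid[OF sig sig] by simp
 then obtain m where m: "keys m <= lpts P Int lpts sig" "gen sig = mono_wt m" unfolding face_monoid_def by blast
 have "m ~= 0" using stratD(3,4)[OF sig] m(2) by auto
 then obtain xi where "xi : keys m" by (metis all_not_in_conv keys_eq_empty)
 hence xi: "xi : lpts P Int lpts sig" using m(1) by blast
 have "char_val xi (snd u) ~= 0" "fst u ~= 0" using u by (auto simp: char_val_def torus_def)
 hence "torus_pt P sig u xi ~= 0" using xi by (simp add: torus_pt_def)
 thus ?thesis by (metis (mono_tags))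
qed

lemma torus_orbit_point: assumes u: "u : big_torus" shows "proj_point (torus_pt P sig u :: ('n, 'k) lvec) : torus_orbit P sig"
proof -
 have c: "fst u ~= 0" and t: "snd u : torus" using u by auto
 have "torus_pt P sig u = (%xi. fst u * torus_pt P sig (1, snd u) xi)" using torus_pt_scale[of P sig "fst u" "snd u"] by simp
 hence "torus_pt P sig u : proj_point (torus_pt P sig (1, snd u))" unfolding proj_point_def using c by blast
 hence "proj_point (torus_pt P sig u) = proj_point (torus_pt P sig (1, snd u))" by (rule proj_point_eq)
 thus ?thesis unfolding torus_orbit_eq using t by blast
qed

interpretation tv: homog_spectrum toric_top S PX by (rule homog_spectrum_toric)

text \<open>On the orbit the monomials of the face are distinct characters, hence linearly independent.\<close>

lemma vanishing_orbit: assumes sig: "sig : faces P" shows "tv.vanishing (torus_orbit P sig) = monomial_prime S (face_monoid sig)"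
proof (intro Set.equalityI subsetI)
 fix F assume "F : tv.vanishing (torus_orbit P sig)"
 hence F: "F : span_on S" "!!x. x : torus_orbit P sig ==> F : PX x" unfolding tv.vanishing_def by blast+
 have "restr (face_monoid sig) F = 0"
 proof (rule characters_independent)
  fix u :: "'k \<times> ('k ^ 'n)" assume u: "u : big_torus"
  have "F : PX (proj_point (torus_pt P sig u))" by (rule F(2)[OF torus_orbit_point[OF u]])
  hence "ray (cone_val P (torus_pt P sig u)) F = 0" using PX_point[OF torus_pt_in_cone[OF sig u]] by blast
  hence e: "pm_eval F (cone_val P (torus_pt P sig u)) = 0" by (rule ray_eval)
  have "pm_eval (restr (face_monoid sig) F) (%s. hchar_val s u) = (SUM s:keys F. lookup (restr (face_monoid sig) F) s * hchar_val s u)"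
   by (rule pm_eval_superset) (simp_all add: keys_restr)
  also have "... = pm_eval F (cone_val P (torus_pt P sig u))" unfolding pm_eval_def
   by (intro sum.cong refl) (simp add: cone_val_orbit[OF sig u span_onD[OF F(1)]])
  finally show "pm_eval (restr (face_monoid sig) F) (%s. hchar_val s u) = 0" using e by simp
 qed
 thus "F : monomial_prime S (face_monoid sig)" using F(1) by (simp add: monomial_prime_def)
next
 fix F :: "('n, 'k) lpoly" assume "F : monomial_prime S (face_monoid sig)"
 hence F: "F : span_on S" "restr (face_monoid sig) F = 0" by (auto simp: monomial_prime_def)
 have "F : PX x" if x: "x : torus_orbit P sig" for x
 proof -
  obtain t where t: "t : torus" "x = proj_point (torus_pt P sig (1, t))" using x unfolding torus_orbit_eq by blast
  have u: "(1, t) : big_torus" using t(1) by simp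
  have "ray (cone_val P (torus_pt P sig (1, t))) F = 0" unfolding ray_def
  proof (rule sum.neutral, rule ballI)
   fix s assume s: "s : keys F"
   have "s ~: face_monoid sig" using F(2) s keys_restr[of "face_monoid sig" F] by auto
   thus "single (fst s, 0) (lookup F s * cone_val P (torus_pt P sig (1, t)) s) = 0"
    using cone_val_orbit[OF sig u span_onD[OF F(1) s]] by simp
  qed
  thus ?thesis unfolding t(2) PX_point[OF torus_pt_in_cone[OF sig u]] using F(1) by blast
 qed
 thus "F : tv.vanishing (torus_orbit P sig)" unfolding tv.vanishing_def using F(1) by blast
qed

text \<open>The closures of the orbits of the faces in a maximal chain.\<close>

lemma krull_dim_toric: "krull_dim toric_top = enat CARD('n)"
proof -
 obtain C where C: "C : mchains" using exists_max_chain by blast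
 have fl: "flag P C" using C max_chain_flag by blast
 have "ALL i. EX sig. i <= CARD('n) --> sig : C & aff_dim sig = int i" using chain_face[OF C] by metis
 then obtain sig where "ALL i. i <= CARD('n) --> sig i : C & aff_dim (sig i) = int i" unfolding choice_iff ..
 hence sig: "sig i : C" "aff_dim (sig i) = int i" "sig i : faces P" if "i <= CARD('n)" for i using that flag_sub_faces[OF fl] by blast+
 have "enat CARD('n) <= krull_dim toric_top"
 proof (rule tv.krull_dim_ge[where B = "%i. torus_orbit P (sig i)"])
  fix i assume i: "i <= CARD('n)"
  have "x : toric_variety P" if x: "x : torus_orbit P (sig i)" for x :: "('n, 'k) lvec set"
  proof -
   obtain t where t: "t : torus" "x = proj_point (torus_pt P (sig i) (1, t))" using x unfolding torus_orbit_eq by blast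
   hence u: "(1, t) : big_torus" by simp
   show ?thesis unfolding toric_points t(2) using torus_pt_in_cone[OF sig(3)[OF i] u] torus_pt_nonzero[OF sig(3)[OF i] u] by blast
  qed
  hence sub: "torus_orbit P (sig i) <= (toric_variety P :: ('n, 'k) lvec set set)" by (rule subsetI)
  have "(1, \<chi> i. 1) : (UNIV - {0::'k}) \<times> (torus :: ('k ^ 'n) set)" by (simp add: torus_def)
  hence "proj_point (torus_pt P (sig i) (1, \<chi> i. 1) :: ('n, 'k) lvec) : torus_orbit P (sig i)" by (rule torus_orbit_point)
  thus "torus_orbit P (sig i) <= topspace toric_top & (torus_orbit P (sig i) :: ('n, 'k) lvec set set) ~= {}"
   unfolding topspace_toric using sub by (intro conjI) auto
  fix F G :: "('n, 'k) lpoly"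
  assume FG: "F : span_on S" "G : span_on S" "F * G : tv.vanishing (torus_orbit P (sig i))"
  have FG3: "F * G : monomial_prime S (face_monoid (sig i))" using FG(3) unfolding vanishing_orbit[OF sig(3)[OF i]] .
  show "F : tv.vanishing (torus_orbit P (sig i)) | G : tv.vanishing (torus_orbit P (sig i))" unfolding vanishing_orbit[OF sig(3)[OF i]]
   by (rule monomial_prime_prime[OF _ FG(1,2) FG3]) (rule face_monoid_face[OF sig(3)[OF i]])
 next
  fix i assume i: "i < CARD('n)"
  hence le: "i <= CARD('n)" "Suc i <= CARD('n)" by simp_all
  have nsub: "~ sig (Suc i) <= sig i" using aff_dim_subset[of "sig (Suc i)" "sig i"] sig(2)[OF le(1)] sig(2)[OF le(2)] by auto
  hence "sig i <= sig (Suc i)" using fl sig(1)[OF le(1)] sig(1)[OF le(2)] unfolding subset_chain_def by blast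
  hence sub: "face_monoid (sig i) <= face_monoid (sig (Suc i))" unfolding face_monoid_def lattice_points_def by blast
  have g: "gen (sig (Suc i)) : face_monoid (sig (Suc i))" "gen (sig (Suc i)) ~: face_monoid (sig i)"
   using gen_in_face_monoid[OF sig(3)[OF le(2)] sig(3)[OF le(2)]]
    gen_in_face_monoid[OF sig(3)[OF le(2)] sig(3)[OF le(1)]] nsub by simp_all
  show "tv.vanishing (torus_orbit P (sig (Suc i))) \<subset> tv.vanishing (torus_orbit P (sig i))"
   unfolding vanishing_orbit[OF sig(3)[OF le(1)]] vanishing_orbit[OF sig(3)[OF le(2)]]
   by (rule monomial_prime_strict[OF sub g stratD(2)[OF sig(3)[OF le(2)]]])
 qed
 thus ?thesis using tv.krull_dim_le by (rule antisym[rotated])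
qed

end

section \<open>The theorem\<close>

theorem theorem2:
  fixes P :: "(real ^ 'n::finite) set"
    and X :: "'n face \<Rightarrow> ('n, 'k::{alg_closed_field, field_char_0}) lvec set set"
    and f :: "'n face \<Rightarrow> ('n, 'k) lfun"
    and r :: "('n face \<times> 'n face) set"
  assumes "normal_lattice_polytope P" and "aff_dim P = int CARD('n)"
    and "seshadri_stratification P X f"
    and "linearization P r"
  shows
    "(fan_of_monoids P (Gam P f r) \<and> fan_iso_S P (Gam P f r) f \<and>
      (\<forall>X' f' r'. seshadri_stratification P X' f' \<and> linearization P r' \<and>
         same_triangulation P f f' \<longrightarrow> fan_iso P (Gam P f r) (Gam P f' r')))
     \<and>
     (graded_isomorphic (gr_algebra P f r) (fan_algebra P f (Gam P f r)) \<and>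
      (\<forall>X' f' r'. seshadri_stratification P X' f' \<and> linearization P r' \<and>
         same_triangulation P f f' \<longrightarrow>
         graded_isomorphic (gr_algebra P f r) (gr_algebra P f' r')))
     \<and>
     (let X0 = Proj (gr_algebra P f r);
          toric = (\<lambda>C. Proj (semigroup_algebra (S_flag P f C) :: ('k, _) graded_algebra))
      in reduced_space X0 \<and>
         (\<forall>C. max_chain P C \<longrightarrow> affine_semigroup (S_flag P f C) \<and> integral_space (toric C)) \<and>
         irredundant_union X0 {C. max_chain P C} toric \<and>
         (\<forall>Z \<in> irreducible_components (space_top X0).
            krull_dim (subtopology (space_top X0) Z) =
            krull_dim (subtopology (proj_space_top P)
              (toric_variety P :: ('n, 'k) lvec set set))))"
proof -
 have str: "stratified P f' r'" if "seshadri_stratification P X' f'" "linearization P r'"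
  for X' and f' :: "'n face => ('n, 'k) lfun" and r' by (rule stratified.intro) (use assms(1,2) that in blast)+
 note this_str = str[OF assms(3,4)]
 interpret stratified P f r by (rule this_str)
 have sp: "space_top (Proj gr) = proj_top gr" by (simp add: Proj_def)
 show ?thesis unfolding Let_def sp
 proof (intro conjI allI impI ballI)
  show "fan_of_monoids P (Gam P f r)" by (rule fan_of_monoids_Gam)
  show "fan_iso_S P (Gam P f r) f" by (rule fan_iso_S_Gam)
  show "graded_isomorphic gr (fan_algebra P f (Gam P f r))" by (rule gr_isomorphic_fan)
  show "reduced_space (Proj gr)" by (rule reduced_gr)
  show "irredundant_union (Proj gr) {C. max_chain P C} (%C. Proj (tor C))" by (rule irredundant_gr)
 next
  fix X' and f' :: "'n face => ('n, 'k) lfun" and r'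
  assume a: "seshadri_stratification P X' f' & linearization P r' & same_triangulation P f f'"
  hence "stratified P f' r'" "same_triangulation P f f'" using str by blast+
  thus "fan_iso P (Gam P f r) (Gam P f' r')" "graded_isomorphic gr (gr_algebra P f' r')"
   by (rule fan_iso_same_triangulation[OF this_str], rule gr_isomorphic_same_triangulation[OF this_str])
 next
  fix C assume "max_chain P C"
  hence "C : mchains" by simp
  thus "affine_semigroup (S_flag P f C)" "integral_space (Proj (tor C))" by (rule affine_semigroup_S_flag, rule integral_tor)
 next
  fix Z assume "Z : irreducible_components (proj_top gr)"
  then obtain C where "C : mchains" "Z = comp_map C ` Pts (tor C)" using irreducible_component_gr by blast
  thus "krull_dim (subtopology (proj_top gr) Z) = krull_dim toric_top" using krull_dim_component krull_dim_tor krull_dim_toric by simp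
 qed
qed

end
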